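(* Let $h$ be a boundary function, and suppose that either (1) (Poly-$R_1$) and $\mathbf{HK}^h_B$ hold, or (2) (Poly-$\infty$) and $\mathbf{HK}^h_U$ hold. Let $G_D(x,y):=\int_0^\infty q(t,x,y)\,dt$ be the Green function of $X$. Suppose that $C_0=1$, $\beta_1=\beta_2$, $h$ is regular, (H2* ) holds with $\gamma_*=\gamma=\beta_1+1$, and (H2** ) holds. Suppose also that one of the following holds: (1) $d_1>\alpha_2(\beta_2\wedge1)$, or (2) $d_1=d_2=\alpha_1\beta_1=\alpha_2\beta_2$, or (3) $d_2<\alpha_1\beta_1$. Then for $x,y\in D$, $x\neq y$, $$G_D(x,y)\simeq h(\Phi(\rho(x,y)),x,y)\left[\frac{\Phi(\rho(x,y))}{\Psi(\rho(x,y))}\,\frac{\Phi(\rho(x,y))^{\gamma-1}}{V(x,\rho(x,y))}\log\Big(e+\frac{\Phi(\rho(x,y))}{\Phi(\delta_\vee(x,y))}\Big)+g_0(x,y)\right].$$ In particular, if $\Psi\simeq\Phi$, then $$G_D(x,y)\simeq h(\Phi(\rho(x,y)),x,y)\,g_0(x,y)\log\Big(e+\frac{\Phi(\rho(x,y))}{\Phi(\delta_\vee(x,y))}\Big).$$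
   Context: Notation: $a\wedge b=\min$, $a\vee b=\max$; $f\simeq g$ means $c_1g\le f\le c_2g$ on the specified range for some constants $c_1,c_2>0$. Quotients $c/0$ with $c>0$ are $+\infty$. Subordinator: $S=(S_t)_{t\ge0}$ is a driftless subordinator (non-decreasing pure-jump Lévy process, $S_0=0$) with Laplace exponent $\phi(\lambda)=-\log\mathbb{E}e^{-\lambda S_1}=\int_0^\infty(1-e^{-\lambda s})\nu(ds)$ and $w(r):=\nu(r,\infty)$. Condition (Poly-$R_1$), $R_1\in(0,\infty]$: there are constants $c_1,c_2>0$, $\beta_2\ge\beta_1>0$ with $c_1(R/r)^{\beta_1}\le w(r)/w(R)\le c_2(R/r)^{\beta_2}$ for all $0<r\le R<R_1$. (Poly-$\infty$) is the case $R_1=\infty$. Space and process: $(E,\rho)$ is a locally compact separable metric space in which all bounded closed sets are compact, $m$ is a positive Radon measure on $E$ with full support, $B(x,r)$ is the open ball, $V(x,r)=m(B(x,r))$. There are $R_E\in(0,\infty]$ and $d_2\ge d_1>0$ such that for every $a\ge1$ there is $C_V\ge1$ with $C_V^{-1}(R/r)^{d_1}\le V(x,R)/V(x,r)\le C_V(R/r)^{d_2}$ for all $x\in E$, $0<r\le R<aR_E$. $D\subset E$ is a proper open subset, $\delta_D(x)=\rho(x,E\setminus D)$, $\delta_\wedge(x,y)=\delta_D(x)\wedge\delta_D(y)$, $\delta_\vee(x,y)=\delta_D(x)\vee\delta_D(y)$. $Y^D$ is a Hunt process in $D$ independent of $S$ whose semigroup has a density (heat kernel) $p_D(t,x,y)$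 with respect to $m$; $X_t=Y^D_{S_t}$ has heat kernel $q(t,x,y)=\int_0^\infty p_D(s,x,y)\mathbb{P}(S_t\in ds)$. Scale functions: $\Phi,\Psi:[0,\infty)\to[0,\infty)$ are strictly increasing, $\Psi\ge\Phi$, and for some constants $\alpha_1,\dots,\alpha_4,c_1,\dots,c_4>0$ and all $R\ge r>0$: $c_1(R/r)^{\alpha_1}\le\Phi(R)/\Phi(r)\le c_2(R/r)^{\alpha_2}$ and $c_3(R/r)^{\alpha_3}\le\Psi(R)/\Psi(r)\le c_4(R/r)^{\alpha_4}$. Set $\psi(r)=1/\phi(1/\Phi(r))$. If $D$ is unbounded, $\Phi(\mathrm{diam}(D))$ is read as $\infty$. Boundary function: $h:(0,\infty)\times D\times D\to[0,1]$ such that (H1) $s\mapsto h(s,x,y)$ is non-increasing for all $x,y\in D$; (H2) there are $c_1>0$, $\gamma\ge0$ with $s^\gamma h(s,x,y)\le c_1t^\gamma h(t,x,y)$ for $0<s\le t<4\Phi(\mathrm{diam}(D))+1$, $x,y\in D$. $h$ is regular if there is $c_2>0$ with $h(t,x,y)\ge c_2$ whenever $0<t<4\Phi(\mathrm{diam}(D))+1$ and $\delta_\wedge(x,y)\ge\Phi^{-1}(t)$. (H2* ): there are $c_1,\gamma_*>0$ such that $s^{\gamma_*}h(s,x,y)\ge c_1t^{\gamma_*}h(t,x,y)$ for all $x,y\in D$ and $\Phi(\delta_\vee(x,y))\le s\le t<2\Phi(\mathrm{diam}(D))$. (H2** ): there are $c_1>0$ and $\gamma_{**}\in(0,1+\beta_1)$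 such that $s^{\gamma_{**}}h(s,x,y)\le c_1t^{\gamma_{**}}h(t,x,y)$ for all $x,y\in D$ and $\Phi(\delta_\wedge(x,y))\le s\le t<\Phi(\delta_\vee(x,y))$. Heat kernel conditions: for $C_0\in\{0,1\}$ and $c>0$ put $$I_{c}(t,x,y)=\frac1{V(x,\Phi^{-1}(t))}\wedge\Big(\frac{C_0t}{V(x,\rho(x,y))\Psi(\rho(x,y))}+\frac1{V(x,\Phi^{-1}(t))}\exp\Big(-\frac{c\,\rho(x,y)^2}{\Phi^{-1}(t)^2}\Big)\Big)$$ (the first summand is absent if $C_0=0$). $\mathbf{HK}^h_B$: $D$ is bounded; (i) there are $C_0\in\{0,1\}$ and $c_1,c_2,c_3,c_4>0$ with $c_1h(t,x,y)I_{c_2}(t,x,y)\le p_D(t,x,y)\le c_3h(t,x,y)I_{c_4}(t,x,y)$ for all $(t,x,y)\in(0,1]\times D\times D$; (ii) there is $\lambda_D>0$ with $p_D(t,x,y)\simeq e^{-\lambda_Dt}h(1,x,y)$ for $(t,x,y)\in[1,\infty)\times D\times D$. $\mathbf{HK}^h_U$: $R_E=\infty$ and the two-sided estimate in (i) holds for all $(t,x,y)\in(0,\infty)\times D\times D$. In the claim, $C_0,d_1,d_2,\beta_1,\beta_2,\alpha_1,\alpha_2,\gamma,\gamma_*$ are the constants in these conditions. Standing convention: when (Poly-$R_1$) and $\mathbf{HK}^h_B$ hold, $\Phi$ is normalized (by multiplication by a constant) so that $\Phi(\mathrm{diam}(D))<R_1/8$. The function $g_0$: $$g_0(x,y)=\begin{cases}\dfrac{\psi(\rho(x,y))}{V(x,\rho(x,y))},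 & d_1>\alpha_2(\beta_2\wedge1),\\[6pt] \log\Big(e+\dfrac{\delta_\vee(x,y)}{\rho(x,y)}\Big), & d_1=d_2=\alpha_1\beta_1=\alpha_2\beta_2,\\[6pt] \dfrac{\psi(\rho(x,y)\vee\delta_\vee(x,y))}{V(x,\rho(x,y)\vee\delta_\vee(x,y))}, & d_2<\alpha_1\beta_1.\end{cases}$$ *)

theory Defs
  imports "HOL-Probability.Probability"
begin

section \<open>Subordinators\<close>

definition levy_measure :: "real measure \<Rightarrow> bool" where
  "levy_measure \<nu> \<longleftrightarrow> sets \<nu> = sets borel \<and> emeasure \<nu> {..0} = 0 \<and>
     (\<integral>\<^sup>+ s. ennreal (min 1 s) \<partial>\<nu>) < \<infinity>"

definition levy_tail :: "real measure \<Rightarrow> real \<Rightarrow> real" where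
  "levy_tail \<nu> r = measure \<nu> {r<..}"

definition laplace_exponent :: "real measure \<Rightarrow> real \<Rightarrow> real" where
  "laplace_exponent \<nu> u = (\<integral>s. (1 - exp (- u * s)) \<partial>\<nu>)"

text \<open>
  A Levy process (indexed by \<open>t \<ge> 0\<close>) with non-decreasing paths whose Laplace exponent is
  \<open>laplace_exponent \<nu>\<close>; the absence of a linear term in that formula says that there is no drift.
  Left limits exist automatically, because the paths are monotone.
\<close>

definition driftless_subordinator ::
    "'w measure \<Rightarrow> (real \<Rightarrow> 'w \<Rightarrow> real) \<Rightarrow> real measure \<Rightarrow> bool" where
  "driftless_subordinator M S \<nu> \<longleftrightarrow>
     prob_space M \<and> levy_measure \<nu> \<and>
     (\<forall>t\<ge>0. S t \<in> borel_measurable M) \<and>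
     (AE \<omega> in M. S 0 \<omega> = 0 \<and> mono_on {0..} (\<lambda>t. S t \<omega>) \<and>
        (\<forall>t\<ge>0. continuous (at_right t) (\<lambda>t. S t \<omega>))) \<and>
     (\<forall>n. \<forall>t :: nat \<Rightarrow> real. 0 \<le> t 0 \<longrightarrow> mono t \<longrightarrow>
        prob_space.indep_vars M (\<lambda>_. borel) (\<lambda>i \<omega>. S (t (Suc i)) \<omega> - S (t i) \<omega>) {..<n}) \<and>
     (\<forall>s\<ge>0. \<forall>t\<ge>0. distr M borel (\<lambda>\<omega>. S (s + t) \<omega> - S s \<omega>) = distr M borel (S t)) \<and>
     (\<forall>u>0. - ln (prob_space.expectation M (\<lambda>\<omega>. exp (- u * S 1 \<omega>))) = laplace_exponent \<nu> u)"

text \<open>A vanishing tail makes a quotient \<open>0\<close> here, so the lower bound forces \<open>w > 0\<close> on \<open>(0, R\<^sub>1)\<close>.\<close>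

definition poly_tail :: "real measure \<Rightarrow> ereal \<Rightarrow> real \<Rightarrow> real \<Rightarrow> bool" where
  "poly_tail \<nu> R1 \<beta>1 \<beta>2 \<longleftrightarrow> 0 < R1 \<and> 0 < \<beta>1 \<and> \<beta>1 \<le> \<beta>2 \<and>
     (\<exists>c1>0. \<exists>c2>0. \<forall>r R. 0 < r \<and> r \<le> R \<and> ereal R < R1 \<longrightarrow>
        c1 * (R / r) powr \<beta>1 \<le> levy_tail \<nu> r / levy_tail \<nu> R \<and>
        levy_tail \<nu> r / levy_tail \<nu> R \<le> c2 * (R / r) powr \<beta>2)"


section \<open>Hunt processes and heat kernels\<close>

text \<open>
  The state space of a process in \<open>D\<close> is \<open>D\<close> together with a cemetery \<open>\<partial> = None\<close>, with the topology
  of the one-point compactification (\<open>\<partial>\<close> is isolated if \<open>D\<close> is compact).  Time runs through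
  \<open>[0, \<infinity>]\<close>, i.e. through \<open>ennreal\<close>, with \<open>Y \<infinity> = \<partial>\<close>.
\<close>

abbreviation cemetery_top :: "'a::topological_space set \<Rightarrow> 'a option topology" where
  "cemetery_top D \<equiv> Alexandroff_compactification (top_of_set D)"

definition borel_of_top :: "'b topology \<Rightarrow> 'b measure" where
  "borel_of_top T = sigma (topspace T) {U. openin T U}"

text \<open>
  \<open>strong_markov_qlc\<close>: the process is strong Markov and quasi-left-continuous relative to the
  filtration \<open>F\<close>.  Constant times are stopping times, so this contains the simple Markov property.
\<close>

definition strong_markov_qlc ::
    "'a::topological_space set \<Rightarrow> (ennreal \<Rightarrow> 'w \<Rightarrow> 'a option) \<Rightarrow> ('a option \<Rightarrow> 'w measure)
      \<Rightarrow> (ennreal \<Rightarrow> 'w measure) \<Rightarrow> bool" where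
  "strong_markov_qlc D Y P F \<longleftrightarrow>
     (\<forall>z \<in> topspace (cemetery_top D).
        (\<forall>\<sigma>. stopping_time F \<sigma> \<longrightarrow>
           (\<forall>s. \<forall>B \<in> sets (borel_of_top (cemetery_top D)).
              AE \<omega> in P z.
                real_cond_exp (P z) (filtration.pre_sigma (space (P None)) F \<sigma>)
                    (indicator {\<omega> \<in> space (P z). Y (\<sigma> \<omega> + s) \<omega> \<in> B}) \<omega>
                = measure (P (Y (\<sigma> \<omega>) \<omega>)) {\<omega>' \<in> space (P None). Y s \<omega>' \<in> B})) \<and>
        (\<forall>\<sigma> :: nat \<Rightarrow> 'w \<Rightarrow> ennreal.
           (\<forall>n. stopping_time F (\<sigma> n)) \<longrightarrow> (\<forall>\<omega> \<in> space (P None). incseq (\<lambda>n. \<sigma> n \<omega>)) \<longrightarrow>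
           (AE \<omega> in P z. (SUP n. \<sigma> n \<omega>) < \<infinity> \<longrightarrow>
              limitin (cemetery_top D) (\<lambda>n. Y (\<sigma> n \<omega>) \<omega>) (Y (SUP n. \<sigma> n \<omega>) \<omega>) sequentially)))"

definition hunt_process ::
    "'a::topological_space set \<Rightarrow> (ennreal \<Rightarrow> 'w \<Rightarrow> 'a option) \<Rightarrow> ('a option \<Rightarrow> 'w measure) \<Rightarrow> bool" where
  "hunt_process D Y P \<longleftrightarrow>
     (let T = cemetery_top D; N = borel_of_top T; \<Omega> = space (P None) in
       (\<forall>z \<in> topspace T. prob_space (P z) \<and> sets (P z) = sets (P None)) \<and>
       (\<forall>t. Y t \<in> measurable (P None) N) \<and>
       (\<forall>t. \<forall>B \<in> sets N. (\<lambda>z. measure (P z) {\<omega> \<in> \<Omega>. Y t \<omega> \<in> B}) \<in> borel_measurable N) \<and>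
       (\<forall>z \<in> topspace T. AE \<omega> in P z. Y 0 \<omega> = z) \<and>
       (\<forall>t. AE \<omega> in P None. Y t \<omega> = None) \<and>
       (\<forall>\<omega> \<in> \<Omega>. Y \<infinity> \<omega> = None \<and>
          (\<forall>t \<ge> Inf {s. Y s \<omega> = None}. Y t \<omega> = None) \<and>
          (\<forall>t < \<infinity>. limitin T (\<lambda>s. Y s \<omega>) (Y t \<omega>) (at_right t)) \<and>
          (\<forall>t. 0 < t \<and> t < \<infinity> \<longrightarrow> (\<exists>l. limitin T (\<lambda>s. Y s \<omega>) l (at_left t)))) \<and>
       (\<forall>t. \<exists>\<theta>. \<forall>\<omega> \<in> \<Omega>. \<theta> \<omega> \<in> \<Omega> \<and> (\<forall>s. Y s (\<theta> \<omega>) = Y (s + t) \<omega>)) \<and>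
       (\<exists>F. filtration \<Omega> F \<and>
          (\<forall>t. sets (F t) \<subseteq> sets (P None)) \<and>
          (\<forall>t. Y t \<in> measurable (F t) N) \<and>
          (\<forall>t < \<infinity>. sets (F t) = (\<Inter>s \<in> {t<..}. sets (F s))) \<and>
          strong_markov_qlc D Y P F))"

text \<open>Density, with respect to \<open>m\<close>, of the transition semigroup of \<open>Y\<close>; as usual a heat kernel is
  jointly measurable and satisfies the Chapman-Kolmogorov equations at all points.\<close>

definition heat_kernel ::
    "'a::topological_space measure \<Rightarrow> 'a set \<Rightarrow> (ennreal \<Rightarrow> 'w \<Rightarrow> 'a option) \<Rightarrow> ('a option \<Rightarrow> 'w measure)
      \<Rightarrow> (real \<Rightarrow> 'a \<Rightarrow> 'a \<Rightarrow> real) \<Rightarrow> bool" where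
  "heat_kernel m D Y P p \<longleftrightarrow>
     (\<forall>t>0. \<forall>x\<in>D. \<forall>y\<in>D. 0 \<le> p t x y) \<and>
     (\<lambda>(t, x, y). p t x y) \<in>
        borel_measurable (restrict_space (borel \<Otimes>\<^sub>M borel \<Otimes>\<^sub>M borel) ({0<..} \<times> D \<times> D)) \<and>
     (\<forall>s>0. \<forall>t>0. \<forall>x\<in>D. \<forall>y\<in>D.
        ennreal (p (s + t) x y) = (\<integral>\<^sup>+ z\<in>D. ennreal (p s x z * p t z y) \<partial>m)) \<and>
     (\<forall>t>0. \<forall>x\<in>D. \<forall>A \<in> sets borel. A \<subseteq> D \<longrightarrow>
        emeasure (P (Some x)) {\<omega> \<in> space (P (Some x)). Y (ennreal t) \<omega> \<in> Some ` A} =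
          (\<integral>\<^sup>+ y\<in>A. ennreal (p t x y) \<partial>m))"

definition process_events :: "'w measure \<Rightarrow> 'b measure \<Rightarrow> 't set \<Rightarrow> ('t \<Rightarrow> 'w \<Rightarrow> 'b) \<Rightarrow> 'w set set" where
  "process_events M N I Z =
     sigma_sets (space M) (\<Union>t\<in>I. {Z t -` B \<inter> space M | B. B \<in> sets N})"

definition independent_subordinator ::
    "'a::topological_space set \<Rightarrow> (ennreal \<Rightarrow> 'w \<Rightarrow> 'a option) \<Rightarrow> ('a option \<Rightarrow> 'w measure)
      \<Rightarrow> (real \<Rightarrow> 'w \<Rightarrow> real) \<Rightarrow> real measure \<Rightarrow> bool" where
  "independent_subordinator D Y P S \<nu> \<longleftrightarrow>
     (\<forall>x\<in>D. driftless_subordinator (P (Some x)) S \<nu> \<and>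
        prob_space.indep_set (P (Some x))
          (process_events (P (Some x)) (borel_of_top (cemetery_top D)) UNIV Y)
          (process_events (P (Some x)) borel {0..} S))"

text \<open>
  The heat kernel \<open>q\<close> of the subordinate process \<open>X\<^sub>t = Y\<^bsub>S\<^sub>t\<^esub>\<close>, and its Green function.  The law of
  \<open>S\<^sub>t\<close> is taken under \<open>P\<^sup>x\<close>; it is determined by \<open>\<nu>\<close> and does not depend on \<open>x\<close>.
\<close>

definition subordinate_kernel ::
    "('a option \<Rightarrow> 'w measure) \<Rightarrow> (real \<Rightarrow> 'w \<Rightarrow> real) \<Rightarrow> (real \<Rightarrow> 'a \<Rightarrow> 'a \<Rightarrow> real)
      \<Rightarrow> real \<Rightarrow> 'a \<Rightarrow> 'a \<Rightarrow> ennreal" where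
  "subordinate_kernel P S p t x y =
     (\<integral>\<^sup>+ s\<in>{0<..}. ennreal (p s x y) \<partial>(distr (P (Some x)) borel (S t)))"

definition green_function ::
    "('a option \<Rightarrow> 'w measure) \<Rightarrow> (real \<Rightarrow> 'w \<Rightarrow> real) \<Rightarrow> (real \<Rightarrow> 'a \<Rightarrow> 'a \<Rightarrow> real)
      \<Rightarrow> 'a \<Rightarrow> 'a \<Rightarrow> ennreal" where
  "green_function P S p x y = (\<integral>\<^sup>+ t\<in>{0<..}. subordinate_kernel P S p t x y \<partial>lborel)"


section \<open>Geometry of the state space\<close>

text \<open>On a metric space with compact bounded closed sets, finiteness on compact sets makes a Borel
  measure Radon (regularity is automatic).\<close>

definition radon_full_support :: "'a::metric_space measure \<Rightarrow> bool" where
  "radon_full_support m \<longleftrightarrow> sets m = sets borel \<and>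
     (\<forall>K. compact K \<longrightarrow> emeasure m K < \<infinity>) \<and>
     (\<forall>U. open U \<and> U \<noteq> {} \<longrightarrow> 0 < emeasure m U)"

definition vol :: "'a::metric_space measure \<Rightarrow> 'a \<Rightarrow> real \<Rightarrow> real" where
  "vol m x r = measure m (ball x r)"

definition volume_scaling :: "'a::metric_space measure \<Rightarrow> ereal \<Rightarrow> real \<Rightarrow> real \<Rightarrow> bool" where
  "volume_scaling m R_E d1 d2 \<longleftrightarrow> 0 < R_E \<and> 0 < d1 \<and> d1 \<le> d2 \<and>
     (\<forall>a\<ge>1. \<exists>C\<ge>1. \<forall>x r R. 0 < r \<and> r \<le> R \<and> ereal R < ereal a * R_E \<longrightarrow>
        inverse C * (R / r) powr d1 \<le> vol m x R / vol m x r \<and>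
        vol m x R / vol m x r \<le> C * (R / r) powr d2)"

definition bdist :: "'a::metric_space set \<Rightarrow> 'a \<Rightarrow> real" where
  "bdist D x = infdist x (- D)"

definition bdist_min :: "'a::metric_space set \<Rightarrow> 'a \<Rightarrow> 'a \<Rightarrow> real" where
  "bdist_min D x y = min (bdist D x) (bdist D y)"

definition bdist_max :: "'a::metric_space set \<Rightarrow> 'a \<Rightarrow> 'a \<Rightarrow> real" where
  "bdist_max D x y = max (bdist D x) (bdist D y)"


section \<open>Scale functions\<close>

definition weak_scaling :: "(real \<Rightarrow> real) \<Rightarrow> real \<Rightarrow> real \<Rightarrow> bool" where
  "weak_scaling f a b \<longleftrightarrow> 0 < a \<and> 0 < b \<and>
     (\<exists>c1>0. \<exists>c2>0. \<forall>r R. 0 < r \<and> r \<le> R \<longrightarrow>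
        c1 * (R / r) powr a \<le> f R / f r \<and> f R / f r \<le> c2 * (R / r) powr b)"

definition scale_functions ::
    "(real \<Rightarrow> real) \<Rightarrow> (real \<Rightarrow> real) \<Rightarrow> real \<Rightarrow> real \<Rightarrow> real \<Rightarrow> real \<Rightarrow> bool" where
  "scale_functions \<Phi> \<Psi> \<alpha>1 \<alpha>2 \<alpha>3 \<alpha>4 \<longleftrightarrow>
     (\<forall>r\<ge>0. 0 \<le> \<Phi> r \<and> \<Phi> r \<le> \<Psi> r) \<and>
     strict_mono_on {0..} \<Phi> \<and> strict_mono_on {0..} \<Psi> \<and>
     weak_scaling \<Phi> \<alpha>1 \<alpha>2 \<and> weak_scaling \<Psi> \<alpha>3 \<alpha>4"

text \<open>\<open>\<Phi>\<close> need not be continuous, so its inverse is the generalized one (the usual variants agree,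
  since \<open>\<Phi>\<close> is strictly increasing).\<close>

definition scale_inv :: "(real \<Rightarrow> real) \<Rightarrow> real \<Rightarrow> real" where
  "scale_inv \<Phi> t = Inf {r. 0 \<le> r \<and> t < \<Phi> r}"

definition scale_diam :: "(real \<Rightarrow> real) \<Rightarrow> 'a::metric_space set \<Rightarrow> ereal" where
  "scale_diam \<Phi> D = (if bounded D then ereal (\<Phi> (diameter D)) else \<infinity>)"

definition psi :: "real measure \<Rightarrow> (real \<Rightarrow> real) \<Rightarrow> real \<Rightarrow> real" where
  "psi \<nu> \<Phi> r = 1 / laplace_exponent \<nu> (1 / \<Phi> r)"


section \<open>Boundary functions\<close>

definition boundary_function ::
    "'a::metric_space set \<Rightarrow> (real \<Rightarrow> real) \<Rightarrow> real \<Rightarrow> (real \<Rightarrow> 'a \<Rightarrow> 'a \<Rightarrow> real) \<Rightarrow> bool" where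
  "boundary_function D \<Phi> \<gamma> h \<longleftrightarrow>
     (\<forall>t>0. \<forall>x\<in>D. \<forall>y\<in>D. 0 \<le> h t x y \<and> h t x y \<le> 1) \<and>
     (\<forall>x\<in>D. \<forall>y\<in>D. antimono_on {0<..} (\<lambda>s. h s x y)) \<and>
     0 \<le> \<gamma> \<and>
     (\<exists>c1>0. \<forall>s t. 0 < s \<and> s \<le> t \<and> ereal t < 4 * scale_diam \<Phi> D + 1 \<longrightarrow>
        (\<forall>x\<in>D. \<forall>y\<in>D. s powr \<gamma> * h s x y \<le> c1 * t powr \<gamma> * h t x y))"

definition regular_boundary_function ::
    "'a::metric_space set \<Rightarrow> (real \<Rightarrow> real) \<Rightarrow> (real \<Rightarrow> 'a \<Rightarrow> 'a \<Rightarrow> real) \<Rightarrow> bool" where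
  "regular_boundary_function D \<Phi> h \<longleftrightarrow>
     (\<exists>c2>0. \<forall>t. \<forall>x\<in>D. \<forall>y\<in>D.
        0 < t \<and> ereal t < 4 * scale_diam \<Phi> D + 1 \<and> scale_inv \<Phi> t \<le> bdist_min D x y \<longrightarrow>
        c2 \<le> h t x y)"

definition H2_star ::
    "'a::metric_space set \<Rightarrow> (real \<Rightarrow> real) \<Rightarrow> real \<Rightarrow> (real \<Rightarrow> 'a \<Rightarrow> 'a \<Rightarrow> real) \<Rightarrow> bool" where
  "H2_star D \<Phi> \<gamma>s h \<longleftrightarrow> 0 < \<gamma>s \<and>
     (\<exists>c1>0. \<forall>x\<in>D. \<forall>y\<in>D. \<forall>s t.
        \<Phi> (bdist_max D x y) \<le> s \<and> s \<le> t \<and> ereal t < 2 * scale_diam \<Phi> D \<longrightarrow>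
        c1 * t powr \<gamma>s * h t x y \<le> s powr \<gamma>s * h s x y)"

definition H2_star_star ::
    "'a::metric_space set \<Rightarrow> (real \<Rightarrow> real) \<Rightarrow> real \<Rightarrow> (real \<Rightarrow> 'a \<Rightarrow> 'a \<Rightarrow> real) \<Rightarrow> bool" where
  "H2_star_star D \<Phi> \<beta>1 h \<longleftrightarrow>
     (\<exists>c1>0. \<exists>\<gamma>ss. 0 < \<gamma>ss \<and> \<gamma>ss < 1 + \<beta>1 \<and>
       (\<forall>x\<in>D. \<forall>y\<in>D. \<forall>s t.
         \<Phi> (bdist_min D x y) \<le> s \<and> s \<le> t \<and> t < \<Phi> (bdist_max D x y) \<longrightarrow>
         s powr \<gamma>ss * h s x y \<le> c1 * t powr \<gamma>ss * h t x y))"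


section \<open>Heat kernel estimates\<close>

text \<open>
  At \<open>x = y\<close> the jump term is \<open>C\<^sub>0 t / 0\<close>, which is to be read as \<open>\<infinity>\<close> if \<open>C\<^sub>0 = 1\<close>, so that
  \<open>hk_bound = 1 / V\<close>; with \<open>u / 0 = 0\<close> one gets \<open>min (1 / V) (0 + 1 / V * exp 0)\<close>, the same value.
\<close>

definition hk_bound ::
    "'a::metric_space measure \<Rightarrow> (real \<Rightarrow> real) \<Rightarrow> (real \<Rightarrow> real) \<Rightarrow> real \<Rightarrow> real
      \<Rightarrow> real \<Rightarrow> 'a \<Rightarrow> 'a \<Rightarrow> real" where
  "hk_bound m \<Phi> \<Psi> C0 c t x y =
     min (1 / vol m x (scale_inv \<Phi> t))
         (C0 * t / (vol m x (dist x y) * \<Psi> (dist x y)) +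
          1 / vol m x (scale_inv \<Phi> t) * exp (- (c * (dist x y)\<^sup>2 / (scale_inv \<Phi> t)\<^sup>2)))"

definition two_sided_hk ::
    "'a::metric_space measure \<Rightarrow> 'a set \<Rightarrow> (real \<Rightarrow> real) \<Rightarrow> (real \<Rightarrow> real)
      \<Rightarrow> (real \<Rightarrow> 'a \<Rightarrow> 'a \<Rightarrow> real) \<Rightarrow> (real \<Rightarrow> 'a \<Rightarrow> 'a \<Rightarrow> real) \<Rightarrow> real \<Rightarrow> real set \<Rightarrow> bool" where
  "two_sided_hk m D \<Phi> \<Psi> h p C0 I \<longleftrightarrow> C0 \<in> {0, 1} \<and>
     (\<exists>c1>0. \<exists>c2>0. \<exists>c3>0. \<exists>c4>0. \<forall>t\<in>I. \<forall>x\<in>D. \<forall>y\<in>D.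
        c1 * h t x y * hk_bound m \<Phi> \<Psi> C0 c2 t x y \<le> p t x y \<and>
        p t x y \<le> c3 * h t x y * hk_bound m \<Phi> \<Psi> C0 c4 t x y)"

definition HK_B ::
    "'a::metric_space measure \<Rightarrow> 'a set \<Rightarrow> (real \<Rightarrow> real) \<Rightarrow> (real \<Rightarrow> real)
      \<Rightarrow> (real \<Rightarrow> 'a \<Rightarrow> 'a \<Rightarrow> real) \<Rightarrow> (real \<Rightarrow> 'a \<Rightarrow> 'a \<Rightarrow> real) \<Rightarrow> real \<Rightarrow> bool" where
  "HK_B m D \<Phi> \<Psi> h p C0 \<longleftrightarrow> bounded D \<and>
     two_sided_hk m D \<Phi> \<Psi> h p C0 {0<..1} \<and>
     (\<exists>l\<^sub>D>0. \<exists>c1>0. \<exists>c2>0. \<forall>t\<ge>1. \<forall>x\<in>D. \<forall>y\<in>D.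
        c1 * (exp (- l\<^sub>D * t) * h 1 x y) \<le> p t x y \<and>
        p t x y \<le> c2 * (exp (- l\<^sub>D * t) * h 1 x y))"

definition HK_U ::
    "'a::metric_space measure \<Rightarrow> ereal \<Rightarrow> 'a set \<Rightarrow> (real \<Rightarrow> real) \<Rightarrow> (real \<Rightarrow> real)
      \<Rightarrow> (real \<Rightarrow> 'a \<Rightarrow> 'a \<Rightarrow> real) \<Rightarrow> (real \<Rightarrow> 'a \<Rightarrow> 'a \<Rightarrow> real) \<Rightarrow> real \<Rightarrow> bool" where
  "HK_U m R_E D \<Phi> \<Psi> h p C0 \<longleftrightarrow> R_E = \<infinity> \<and> two_sided_hk m D \<Phi> \<Psi> h p C0 {0<..}"


section \<open>The function \<open>g\<^sub>0\<close>\<close>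

text \<open>The third formula is meant for \<open>d\<^sub>2 < \<alpha>\<^sub>1 \<beta>\<^sub>1\<close>; outside the three regimes \<open>g\<^sub>0\<close> is not used.\<close>

definition g0 ::
    "'a::metric_space measure \<Rightarrow> 'a set \<Rightarrow> (real \<Rightarrow> real) \<Rightarrow> real measure
      \<Rightarrow> real \<Rightarrow> real \<Rightarrow> real \<Rightarrow> real \<Rightarrow> real \<Rightarrow> real \<Rightarrow> 'a \<Rightarrow> 'a \<Rightarrow> real" where
  "g0 m D \<Phi> \<nu> d1 d2 \<alpha>1 \<alpha>2 \<beta>1 \<beta>2 x y =
     (if d1 > \<alpha>2 * min \<beta>2 1 then psi \<nu> \<Phi> (dist x y) / vol m x (dist x y)
      else if d1 = d2 \<and> d2 = \<alpha>1 * \<beta>1 \<and> \<alpha>1 * \<beta>1 = \<alpha>2 * \<beta>2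
        then ln (exp 1 + bdist_max D x y / dist x y)
      else psi \<nu> \<Phi> (max (dist x y) (bdist_max D x y)) / vol m x (max (dist x y) (bdist_max D x y)))"

end

theory Submission
  imports Defs
begin

text \<open>
By Tonelli's theorem the Green function is an integral over a single time variable,
\<open>G_D(x,y) = \<integral> p_D(s,x,y) U(ds)\<close>, where \<open>U\<close> is the potential measure of the subordinator.  So two
things have to be understood: how \<open>U\<close> distributes its mass over the time scales, and how large
\<open>p_D(s,x,y)\<close> is at each scale.

\<open>The measure U.\<close>  Let \<open>\<beta> = \<beta>\<^sub>1 = \<beta>\<^sub>2\<close>, so that the Levy tail is comparable with \<open>r^(-\<beta>)\<close>.  Integrability
of \<open>min 1 s\<close> forces \<open>\<beta> < 1\<close> (\<open>poly_tail_index_less_one\<close>), hence \<open>\<phi>(u)\<close> is comparable with \<open>u^\<beta>\<close>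
(\<open>laplace_exponent_bounds\<close>).  The Laplace transform of \<open>U\<close> is \<open>1/\<phi>\<close>, and a Tauberian argument
(\<open>potential_measure_regular\<close>) shows that \<open>U\<close> charges the time scales like \<open>s^(\<beta>-1) ds\<close>: the interval
\<open>(0,r]\<close> has mass at most of order \<open>r^\<beta>\<close>, and a block \<open>(\<kappa>r,r]\<close> has mass at least of order \<open>r^\<beta>\<close> once \<open>\<kappa>\<close> is
small.  These masses of whole blocks are the only information on \<open>U\<close> that enters, and all integrals are
estimated by summing over blocks.

\<open>The kernel.\<close>  Write \<open>\<rho>\<close> for the distance of the two points, \<open>\<tau> = \<Phi>(\<rho>)\<close>, \<open>\<Delta> = \<Phi>(\<delta>\<^sub>\<or>)\<close>, \<open>\<sigma> = min \<tau> \<Delta>\<close>,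
\<open>\<omega> = max \<tau> \<Delta>\<close> and \<open>v(s) = 1/V(x,\<Phi>\<^sup>-\<^sup>1(s))\<close>.

  \<^item> For \<open>s \<le> \<tau>\<close> the kernel is at most of order \<open>h(s) s / (V(x,\<rho>)\<Psi>(\<rho>)) + h(\<tau>) v(\<tau>)\<close>: the Gaussian factor
    decays faster than any power of \<open>\<tau>/s\<close>, which absorbs the growth of \<open>h\<close> and \<open>v\<close> as \<open>s\<close> decreases
    (\<open>p_upper_near\<close>).  Since \<open>\<gamma> = \<gamma>\<^sub>* = 1+\<beta>\<close>, the product \<open>h(s) s^(1+\<beta>)\<close> is comparable with
    \<open>h(\<tau>) \<tau>^(1+\<beta>)\<close> for \<open>\<Delta> \<le> s \<le> \<tau>\<close>.  The jump term is then comparable with a constant times \<open>s^(-\<beta>)\<close>, to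
    whose integral against \<open>U\<close> every scale contributes the same amount; this is the origin of the
    logarithm.  Below \<open>\<sigma>\<close> regularity and (H2**), whose exponent is smaller than \<open>1+\<beta>\<close>, make the integral
    of the order of the contribution of times near \<open>\<sigma>\<close> (\<open>h_small_times\<close>).
  \<^item> For \<open>\<tau> \<le> s \<le> \<omega>\<close> the boundary is far away on the spatial scale \<open>\<Phi>\<^sup>-\<^sup>1(s)\<close>, so \<open>h(s)\<close> is comparable with
    \<open>h(\<tau>)\<close> (\<open>h_upper_time\<close>) and the kernel with \<open>h(\<tau>) v(s)\<close>.  The integral of \<open>v\<close> against \<open>U\<close> over this
    range, extended to the left by the factor \<open>\<kappa>\<close>, is comparable with \<open>g\<^sub>0\<close>; it is dominated by the left end,
    by the right end, or spread evenly over all scales, according to the three regimes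
    (\<open>volume_integral_g0\<close>).
  \<^item> For \<open>s \<ge> \<omega>\<close> (H2*) gives \<open>h(s) \<le> C h(\<tau>) (\<omega>/s)^(1+\<beta>)\<close>, so that this range contributes at most
    \<open>C h(\<tau>) v(\<omega>) \<omega>^\<beta>\<close>, which is again controlled by \<open>g\<^sub>0\<close> (\<open>p_far\<close>, \<open>green_estimate\<close>).

If \<open>D\<close> is bounded, (H2), (H2*) and regularity only concern times below \<open>4\<Phi>(diam D) + 1\<close>.  Later times
are harmless because the kernel decays exponentially: for \<open>HK_B\<close> by assumption, and for \<open>HK_U\<close> on a bounded
domain because the volume growth makes the kernel drop by the factor 2 after a fixed time, a drop which
the Chapman-Kolmogorov equation iterates (\<open>HK_U_large_time\<close>).

The second estimate follows from the first.  If \<open>\<Psi>\<close> is comparable with \<open>\<Phi>\<close>, the first summand is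
\<open>V(x,\<rho>)\<^sup>-\<^sup>1 \<Phi>(\<rho>)^\<beta>\<close> times the logarithm.  For \<open>\<delta>\<^sub>\<or> \<le> \<rho>\<close> the function \<open>g\<^sub>0\<close> is comparable with
\<open>V(x,\<rho>)\<^sup>-\<^sup>1 \<Phi>(\<rho>)^\<beta>\<close>; for \<open>\<delta>\<^sub>\<or> > \<rho>\<close> the logarithm is bounded and \<open>g\<^sub>0\<close> dominates (\<open>comparable_scales\<close>).
\<close>

section \<open>Comparison up to constants and logarithms\<close>

abbreviation (input) within_factor :: "real \<Rightarrow> real \<Rightarrow> real \<Rightarrow> bool" where
  "within_factor C w z \<equiv> z / C \<le> w \<and> w \<le> C * z"

abbreviation (input) between_powers :: "real \<Rightarrow> real \<Rightarrow> real \<Rightarrow> real \<Rightarrow> real \<Rightarrow> bool" where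
  "between_powers C a b z w \<equiv> z powr a / C \<le> w \<and> w \<le> C * z powr b"

lemma ereal_le_below: "s \<le> t \<Longrightarrow> ereal t \<le> T \<Longrightarrow> ereal s \<le> T"
  by (rule order_trans[of "ereal s" "ereal t"]) simp_all

lemma one_le_ln_exp_plus: "0 \<le> z \<Longrightarrow> 1 \<le> ln (exp 1 + z :: real)"
  by (subst ln_ge_iff) (auto intro: add_pos_nonneg)

lemma ln_exp_plus_mono: "0 \<le> y \<Longrightarrow> y \<le> z \<Longrightarrow> ln (exp 1 + y) \<le> ln (exp 1 + z :: real)"
  by (subst ln_le_cancel_iff) (auto intro: add_pos_nonneg)

lemma ln_exp_plus_one_le: "ln (exp 1 + 1) \<le> (2::real)"
proof -
  have two: "2 \<le> exp (1::real)" using exp_ge_add_one_self[of "1::real"] by simp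
  hence "2 * exp 1 \<le> exp 1 * exp (1::real)" by (intro mult_right_mono) auto
  hence "exp 1 + 1 \<le> exp (2::real)" using two by (simp add: exp_add[symmetric])
  hence "ln (exp 1 + 1) \<le> ln (exp (2::real))" by (subst ln_le_cancel_iff) (auto intro: add_pos_pos)
  thus ?thesis by simp
qed

section \<open>Subordinators and their potential measures\<close>

text \<open>
Additivity and nonnegativity make \<open>g\<close> monotone, so \<open>n g(t) = g(nt)\<close> lies between \<open>k g(1)\<close> and
\<open>(k+1) g(1)\<close> where \<open>k\<close> is the integer part of \<open>nt\<close>.  Dividing by \<open>n\<close> gives the claim in the limit.
\<close>

lemma additive_nonneg_linear:
  fixes g :: "real \<Rightarrow> real"
  assumes add: "\<And>s t. 0 \<le> s \<Longrightarrow> 0 \<le> t \<Longrightarrow> g (s + t) = g s + g t"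
    and nonneg: "\<And>t. 0 \<le> t \<Longrightarrow> 0 \<le> g t"
    and t: "0 \<le> t"
  shows "g t = t * g 1"
proof -
  have mono: "g s \<le> g r" if "0 \<le> s" "s \<le> r" for s r
    using add[of s "r - s"] nonneg[of "r - s"] that by simp
  have mult: "g (real n * s) = real n * g s" if "0 \<le> s" for n s
  proof (induction n)
    case 0
    show ?case using add[of 0 0] by simp
  next
    case (Suc n)
    have "g (real (Suc n) * s) = g (real n * s) + g s"
      using add[of "real n * s" s] that by (simp add: algebra_simps)
    with Suc show ?case by (simp add: algebra_simps)
  qed
  have bound: "real n * \<bar>g t - t * g 1\<bar> \<le> g 1" for n
  proof -
    define k where "k = nat \<lfloor>real n * t\<rfloor>"
    have k: "real k \<le> real n * t" "real n * t \<le> real (Suc k)"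
      using t unfolding k_def by (auto simp: of_nat_nat) linarith+
    have "real k * g 1 \<le> real n * g t" "real n * g t \<le> real (Suc k) * g 1"
      using mono[of "real k" "real n * t"] mono[of "real n * t" "real (Suc k)"] k
        mult[of t n] mult[of 1 k] mult[of 1 "Suc k"] t by auto
    moreover have "real k * g 1 \<le> real n * t * g 1" "real n * t * g 1 \<le> real (Suc k) * g 1"
      using k nonneg[of 1] by (auto intro: mult_right_mono)
    ultimately have "\<bar>real n * (g t - t * g 1)\<bar> \<le> g 1"
      by (simp add: algebra_simps abs_if)
    thus ?thesis by (simp add: abs_mult)
  qed
  show ?thesis
  proof (rule ccontr)
    assume "g t \<noteq> t * g 1"
    hence pos: "0 < \<bar>g t - t * g 1\<bar>" by simp
    then obtain n :: nat where "g 1 < real n * \<bar>g t - t * g 1\<bar>"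
      using reals_Archimedean3 by blast
    with bound[of n] show False by simp
  qed
qed

text \<open>
Independence and stationarity of the increments make minus the logarithm of the Laplace transform additive
in \<open>t\<close>; since the paths are nondecreasing it is also nonnegative, hence linear.  Its value at time 1 is
the Laplace exponent by definition.
\<close>

lemma subordinator_laplace:
  assumes S: "driftless_subordinator M S \<nu>" and u: "0 < u" and t: "0 \<le> t"
  shows "(\<integral>\<^sup>+\<omega>. ennreal (exp (- u * S t \<omega>)) \<partial>M) = ennreal (exp (- t * laplace_exponent \<nu> u))"
proof -
  interpret prob_space M using S by (simp add: driftless_subordinator_def)
  have meas[measurable]: "S s \<in> borel_measurable M" if "0 \<le> s" for s
    using S that by (simp add: driftless_subordinator_def)
  have paths: "AE \<omega> in M. S 0 \<omega> = 0 \<and> mono_on {0..} (\<lambda>t. S t \<omega>)"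
    using S unfolding driftless_subordinator_def by auto
  have incr: "distr M borel (\<lambda>\<omega>. S (s + r) \<omega> - S s \<omega>) = distr M borel (S r)" if "0 \<le> s" "0 \<le> r" for s r
    using S that unfolding driftless_subordinator_def by blast
  have S_nonneg: "AE \<omega> in M. 0 \<le> S s \<omega>" if "0 \<le> s" for s
    using paths by eventually_elim (use that in \<open>force dest: mono_onD[where r=0 and s=s]\<close>)
  define f where "f s = (\<integral>\<^sup>+\<omega>. ennreal (exp (- u * S s \<omega>)) \<partial>M)" for s
  have int: "integrable M (\<lambda>\<omega>. exp (- u * S s \<omega>))" if "0 \<le> s" for s
    by (rule integrable_const_bound[where B=1])
       (use S_nonneg[OF that] that u in \<open>auto elim!: eventually_mono\<close>)
  have f_exp: "f s = ennreal (expectation (\<lambda>\<omega>. exp (- u * S s \<omega>)))" if "0 \<le> s" for s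
    unfolding f_def by (rule nn_integral_eq_integral[OF int[OF that]]) simp
  have E_pos: "0 < expectation (\<lambda>\<omega>. exp (- u * S s \<omega>))" if "0 \<le> s" for s
  proof -
    have "expectation (\<lambda>\<omega>. exp (- u * S s \<omega>)) \<noteq> 0"
      using integral_nonneg_eq_0_iff_AE[OF int[OF that]] by auto
    moreover have "0 \<le> expectation (\<lambda>\<omega>. exp (- u * S s \<omega>))" by simp
    ultimately show ?thesis by linarith
  qed
  have E_le: "expectation (\<lambda>\<omega>. exp (- u * S s \<omega>)) \<le> 1" if "0 \<le> s" for s
  proof -
    have "expectation (\<lambda>\<omega>. exp (- u * S s \<omega>)) \<le> expectation (\<lambda>\<omega>. 1)"
      by (rule integral_mono_AE[OF int[OF that]])
         (use S_nonneg[OF that] u in \<open>auto elim!: eventually_mono\<close>)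
    thus ?thesis by (simp add: prob_space)
  qed
  have f_mult: "f (s + r) = f s * f r" if s: "0 \<le> s" and r: "0 \<le> r" for s r
  proof -
    define T where "T i = (if i = 0 then 0 else if i = 1 then s else s + r)" for i :: nat
    have "mono T" "0 \<le> T 0" using s r by (auto simp: T_def mono_def)
    hence "indep_vars (\<lambda>_. borel) (\<lambda>i \<omega>. S (T (Suc i)) \<omega> - S (T i) \<omega>) {..<2}"
      using S unfolding driftless_subordinator_def by blast
    hence ind: "indep_vars (\<lambda>_. borel)
        (\<lambda>i \<omega>. ennreal (exp (- u * (S (T (Suc i)) \<omega> - S (T i) \<omega>)))) {..<2}"
      by (rule indep_vars_compose2[where Y="\<lambda>_ z. ennreal (exp (- u * z))"]) simp
    have "f (s + r) = (\<integral>\<^sup>+\<omega>. (\<Prod>i<2::nat. ennreal (exp (- u * (S (T (Suc i)) \<omega> - S (T i) \<omega>)))) \<partial>M)"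
      unfolding f_def
    proof (rule nn_integral_cong_AE)
      show "AE \<omega> in M. ennreal (exp (- u * S (s + r) \<omega>)) =
          (\<Prod>i<2::nat. ennreal (exp (- u * (S (T (Suc i)) \<omega> - S (T i) \<omega>))))"
        using paths
      proof eventually_elim
        case (elim \<omega>)
        thus ?case
          by (simp add: T_def numeral_2_eq_2 ennreal_mult[symmetric] exp_add[symmetric] algebra_simps)
      qed
    qed
    also have "\<dots> = (\<Prod>i<2::nat. \<integral>\<^sup>+\<omega>. ennreal (exp (- u * (S (T (Suc i)) \<omega> - S (T i) \<omega>))) \<partial>M)"
      by (rule indep_vars_nn_integral[OF _ ind]) auto
    also have "\<dots> = (\<integral>\<^sup>+\<omega>. ennreal (exp (- u * (S s \<omega> - S 0 \<omega>))) \<partial>M) *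
        (\<integral>\<^sup>+\<omega>. ennreal (exp (- u * (S (s + r) \<omega> - S s \<omega>))) \<partial>M)"
      by (simp add: T_def numeral_2_eq_2)
    also have "(\<integral>\<^sup>+\<omega>. ennreal (exp (- u * (S s \<omega> - S 0 \<omega>))) \<partial>M) = f s"
      unfolding f_def by (rule nn_integral_cong_AE) (use paths in eventually_elim, auto)
    also have "(\<integral>\<^sup>+\<omega>. ennreal (exp (- u * (S (s + r) \<omega> - S s \<omega>))) \<partial>M) =
        (\<integral>\<^sup>+z. ennreal (exp (- u * z)) \<partial>distr M borel (\<lambda>\<omega>. S (s + r) \<omega> - S s \<omega>))"
      using s r by (subst nn_integral_distr) auto
    also have "\<dots> = f r"
      unfolding f_def incr[OF s r] using r by (subst nn_integral_distr) auto
    finally show ?thesis .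
  qed
  define g where "g s = - ln (expectation (\<lambda>\<omega>. exp (- u * S s \<omega>)))" for s
  have "g t = t * g 1"
  proof (rule additive_nonneg_linear[OF _ _ t])
    fix s r :: real assume s: "0 \<le> s" and r: "0 \<le> r"
    have "expectation (\<lambda>\<omega>. exp (- u * S (s + r) \<omega>)) =
        expectation (\<lambda>\<omega>. exp (- u * S s \<omega>)) * expectation (\<lambda>\<omega>. exp (- u * S r \<omega>))"
      using f_mult[OF s r] f_exp[of "s + r"] f_exp[OF s] f_exp[OF r] s r
        E_pos[OF s] E_pos[OF r] E_pos[of "s + r"]
      by (simp add: ennreal_mult[symmetric] del: mult_minus_left)
    thus "g (s + r) = g s + g r"
      using E_pos[OF s] E_pos[OF r] by (simp add: g_def ln_mult del: mult_minus_left)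
  next
    fix s :: real assume s: "0 \<le> s"
    show "0 \<le> g s" using E_pos[OF s] E_le[OF s] by (simp add: g_def del: mult_minus_left)
  qed
  moreover have "g 1 = laplace_exponent \<nu> u"
    using S u unfolding g_def driftless_subordinator_def by blast
  ultimately have "expectation (\<lambda>\<omega>. exp (- u * S t \<omega>)) = exp (- t * laplace_exponent \<nu> u)"
    using E_pos[OF t] unfolding g_def by (metis exp_ln minus_minus mult_minus_left)
  thus ?thesis using f_exp[OF t] by (simp add: f_def)
qed

text \<open>
The expected occupation measure \<open>U(B) = \<integral>\<^sub>0\<^sup>\<infinity> P(S\<^sub>t \<in> B) dt\<close>.  Written as a monadic bind, it inherits
Tonelli's theorem.
\<close>

definition potential_measure :: "'w measure \<Rightarrow> (real \<Rightarrow> 'w \<Rightarrow> real) \<Rightarrow> real measure" where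
  "potential_measure M S = restrict_space lborel {0<..} \<bind> (\<lambda>t. distr M borel (S t))"

text \<open>
On the half-lines \<open>(c,\<infinity>)\<close>, which generate the Borel sets, \<open>t \<mapsto> P(S\<^sub>t > c)\<close> is monotone.
\<close>

lemma subordinator_kernel_measurable:
  assumes S: "driftless_subordinator M S \<nu>"
  shows "(\<lambda>t. distr M borel (S t)) \<in> measurable (restrict_space lborel {0<..}) (prob_algebra borel)"
proof -
  interpret prob_space M using S by (simp add: driftless_subordinator_def)
  have meas[measurable]: "S s \<in> borel_measurable M" if "0 \<le> s" for s
    using S that by (simp add: driftless_subordinator_def)
  have paths: "AE \<omega> in M. mono_on {0..} (\<lambda>t. S t \<omega>)"
    using S unfolding driftless_subordinator_def by auto
  have sp: "space (restrict_space lborel {0<..}) = ({0<..} :: real set)"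
    by (simp add: space_restrict_space)
  show ?thesis
  proof (rule measurable_prob_algebra_generated[where \<Omega>=UNIV and G="range greaterThan"])
    show "sets (borel :: real measure) = sigma_sets UNIV (range greaterThan)"
      by (simp add: borel_Ioi)
    have "{a<..} \<inter> {b<..} = {max a b<..}" for a b :: real by auto
    thus "Int_stable (range greaterThan :: real set set)"
      by (auto simp: Int_stable_def)
    show "prob_space (distr M borel (S a))" if "a \<in> space (restrict_space lborel {0<..})" for a
      using that by (intro prob_space_distr) (simp add: sp)
    fix A :: "real set" assume "A \<in> range greaterThan"
    then obtain c where A: "A = {c<..}" by auto
    have "mono_on {0<..} (\<lambda>t. measure (distr M borel (S t)) A)"
    proof (rule mono_onI)
      fix r s :: real assume rs: "r \<in> {0<..}" "s \<in> {0<..}" "r \<le> s"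
      have "prob {\<omega> \<in> space M. c < S r \<omega>} \<le> prob {\<omega> \<in> space M. c < S s \<omega>}"
      proof (rule finite_measure_mono_AE)
        show "AE \<omega> in M. \<omega> \<in> {\<omega> \<in> space M. c < S r \<omega>} \<longrightarrow> \<omega> \<in> {\<omega> \<in> space M. c < S s \<omega>}"
          using paths
        proof eventually_elim
          case (elim \<omega>)
          have "S r \<omega> \<le> S s \<omega>" using mono_onD[OF elim, of r s] rs by simp
          thus ?case by auto
        qed
        have [measurable]: "S s \<in> borel_measurable M" using rs by (intro meas) auto
        show "{\<omega> \<in> space M. c < S s \<omega>} \<in> events" by measurable
      qed
      thus "measure (distr M borel (S r)) A \<le> measure (distr M borel (S s)) A"
        using rs by (simp add: measure_distr A vimage_def Int_def conj_commute)
    qed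
    hence "(\<lambda>t. measure (distr M borel (S t)) A) \<in> borel_measurable (restrict_space borel {0<..})"
      by (rule borel_measurable_mono_on_fnc)
    hence m: "(\<lambda>t. measure (distr M borel (S t)) A) \<in> borel_measurable (restrict_space lborel {0<..})"
      by (subst measurable_cong_sets[OF sets_restrict_space_cong[OF sets_lborel] refl])
    show "(\<lambda>a. emeasure (distr M borel (S a)) A) \<in> borel_measurable (restrict_space lborel {0<..})"
    proof (subst measurable_cong)
      fix t assume "t \<in> space (restrict_space lborel {0<..} :: real measure)"
      hence "0 \<le> t" by (simp add: sp)
      then interpret N: prob_space "distr M borel (S t)" by (intro prob_space_distr) simp
      show "emeasure (distr M borel (S t)) A = ennreal (measure (distr M borel (S t)) A)"
        by (rule N.emeasure_eq_measure)
    qed (use m in simp)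
  qed auto
qed

lemma sets_potential_measure:
  assumes "driftless_subordinator M S \<nu>"
  shows "sets (potential_measure M S) = sets borel"
  unfolding potential_measure_def
  by (rule sets_bind) (auto simp: space_restrict_space)

lemma nn_integral_potential_measure:
  assumes S: "driftless_subordinator M S \<nu>" and f: "f \<in> borel_measurable borel"
  shows "(\<integral>\<^sup>+s. f s \<partial>potential_measure M S) =
    (\<integral>\<^sup>+t\<in>{0<..}. (\<integral>\<^sup>+s. f s \<partial>distr M borel (S t)) \<partial>lborel)"
  unfolding potential_measure_def
  by (subst nn_integral_bind[OF f measurable_prob_algebraD[OF subordinator_kernel_measurable[OF S]]])
     (simp add: nn_integral_restrict_space)

text \<open>
By Tonelli's theorem this is \<open>\<integral>\<^sub>0\<^sup>\<infinity> exp(-t \<phi>(u)) dt\<close>.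
\<close>

lemma laplace_potential_measure:
  assumes S: "driftless_subordinator M S \<nu>" and u: "0 < u" and pos: "0 < laplace_exponent \<nu> u"
  shows "(\<integral>\<^sup>+s. ennreal (exp (- u * s)) \<partial>potential_measure M S) = ennreal (1 / laplace_exponent \<nu> u)"
proof -
  have meas: "S t \<in> borel_measurable M" if "0 \<le> t" for t
    using S that by (simp add: driftless_subordinator_def)
  define a where "a = laplace_exponent \<nu> u"
  have a: "0 < a" using pos by (simp add: a_def)
  have "(\<integral>\<^sup>+s. ennreal (exp (- u * s)) \<partial>potential_measure M S) =
      (\<integral>\<^sup>+t. ennreal (exp (- a * t)) * indicator {0<..} t \<partial>lborel)"
  proof (subst nn_integral_potential_measure[OF S], simp, rule nn_integral_cong)
    fix t :: real
    show "(\<integral>\<^sup>+s. ennreal (exp (- u * s)) \<partial>distr M borel (S t)) * indicator {0<..} t =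
        ennreal (exp (- a * t)) * indicator {0<..} t"
    proof (cases "0 < t")
      case True
      have "(\<integral>\<^sup>+s. ennreal (exp (- u * s)) \<partial>distr M borel (S t)) =
          (\<integral>\<^sup>+\<omega>. ennreal (exp (- u * S t \<omega>)) \<partial>M)"
        using True meas[of t] by (subst nn_integral_distr) auto
      also have "\<dots> = ennreal (exp (- a * t))"
        using subordinator_laplace[OF S u, of t] True by (simp add: a_def mult.commute)
      finally show ?thesis by simp
    qed simp
  qed
  also have "\<dots> = (\<integral>\<^sup>+t. ennreal (exp (- a * t)) * indicator {0..} t \<partial>lborel)"
    by (rule nn_integral_cong_AE) (use AE_lborel_singleton[of 0] in \<open>eventually_elim, auto split: split_indicator\<close>)
  also have "\<dots> = 0 - (- exp (- a * 0) / a)"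
  proof (rule nn_integral_FTC_atLeast)
    show "((\<lambda>t. - exp (- a * t) / a) \<longlongrightarrow> 0) at_top"
      using a by real_asymp
  qed (use a in \<open>auto intro!: derivative_eq_intros\<close>)
  finally show ?thesis by (simp add: a_def)
qed

section \<open>Levy tails and Laplace exponents\<close>

lemma powr_two_power: "(2 ^ k :: real) powr a = (2 powr a) ^ k"
  by (simp add: powr_realpow[symmetric] powr_powr mult.commute)

lemma dyadic_below:
  assumes "0 < s" "s \<le> (b::real)"
  obtains k :: nat where "b / 2 ^ Suc k < s" "s \<le> b / 2 ^ k"
proof -
  obtain n :: nat where "b / s < 2 ^ n" using real_arch_pow[of 2 "b / s"] by auto
  hence "b / 2 ^ n < s" using assms by (simp add: field_simps)
  moreover have "\<not> b / 2 ^ 0 < s" using assms by simp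
  ultimately obtain k where "k < n" "\<not> b / 2 ^ k < s" "b / 2 ^ Suc k < s"
    using ex_least_nat_less[of "\<lambda>k. b / 2 ^ k < s" n] by auto
  thus ?thesis using that[of k] by simp
qed

lemma dyadic_above:
  assumes "0 < a" "a < (s::real)"
  obtains k :: nat where "a * 2 ^ k < s" "s \<le> a * 2 ^ Suc k"
proof -
  obtain n :: nat where "s / a < 2 ^ n" using real_arch_pow[of 2 "s / a"] by auto
  hence "s \<le> a * 2 ^ n" using assms by (simp add: field_simps)
  moreover have "\<not> s \<le> a * 2 ^ 0" using assms by simp
  ultimately obtain k where "k < n" "\<not> s \<le> a * 2 ^ k" "s \<le> a * 2 ^ Suc k"
    using ex_least_nat_less[of "\<lambda>k. s \<le> a * 2 ^ k" n] by auto
  thus ?thesis using that[of k] by simp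
qed

lemma suminf_ennreal_geometric:
  assumes "0 \<le> c" "0 \<le> q" "q < (1::real)"
  shows "(\<Sum>k. ennreal (c * q ^ k)) = ennreal (c / (1 - q))"
  using assms sums_mult[OF geometric_sums[of q], of c]
  by (intro suminf_ennreal_eq) (auto simp: divide_inverse)

context
  fixes \<nu> :: "real measure"
  assumes levy: "levy_measure \<nu>"
begin

lemma sets_levy [measurable_cong, simp]: "sets \<nu> = sets borel"
  using levy by (simp add: levy_measure_def)

lemma AE_levy_pos: "AE s in \<nu>. 0 < s"
proof (rule AE_I)
  show "{s \<in> space \<nu>. \<not> 0 < s} \<subseteq> {..0}" by auto
  show "emeasure \<nu> {..0} = 0" using levy by (simp add: levy_measure_def)
qed simp

lemma nn_integral_levy_min: "(\<integral>\<^sup>+ s. ennreal (min 1 s) \<partial>\<nu>) < \<infinity>"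
  using levy by (simp add: levy_measure_def)

lemma levy_tail_finite: "0 < r \<Longrightarrow> emeasure \<nu> {r<..} < \<infinity>"
proof -
  assume r: "0 < r"
  have "emeasure \<nu> {r<..} = (\<integral>\<^sup>+ s. indicator {r<..} s \<partial>\<nu>)" by simp
  also have "\<dots> \<le> (\<integral>\<^sup>+ s. ennreal (1 / min 1 r) * ennreal (min 1 s) \<partial>\<nu>)"
  proof (rule nn_integral_mono)
    fix s :: real
    have "1 / min 1 r * min 1 s \<ge> 1" if "r < s" using r that by (auto simp: min_def field_simps)
    thus "indicator {r<..} s \<le> ennreal (1 / min 1 r) * ennreal (min 1 s)"
      using r by (auto split: split_indicator simp: ennreal_mult'[symmetric] simp del: times_divide_eq_left)
  qed
  also have "\<dots> = ennreal (1 / min 1 r) * (\<integral>\<^sup>+ s. ennreal (min 1 s) \<partial>\<nu>)"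
    by (rule nn_integral_cmult) measurable
  also have "\<dots> < \<infinity>" using nn_integral_levy_min by (auto simp: ennreal_mult_less_top)
  finally show ?thesis .
qed

lemma emeasure_levy_tail: "0 < r \<Longrightarrow> emeasure \<nu> {r<..} = ennreal (levy_tail \<nu> r)"
  unfolding levy_tail_def using levy_tail_finite[of r] by (intro emeasure_eq_ennreal_measure) auto

lemma one_minus_exp_le_min: "0 \<le> u \<Longrightarrow> 0 \<le> s \<Longrightarrow> 1 - exp (- u * s) \<le> min 1 (u * s)" for u s :: real
  using exp_ge_add_one_self[of "- u * s"] by auto

lemma nn_integral_laplace_exponent:
  assumes u: "0 \<le> u"
  shows "(\<integral>\<^sup>+ s. ennreal (1 - exp (- u * s)) \<partial>\<nu>) = ennreal (laplace_exponent \<nu> u)"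
proof -
  have "(\<integral>\<^sup>+ s. ennreal (1 - exp (- u * s)) \<partial>\<nu>) \<le> (\<integral>\<^sup>+ s. ennreal (max 1 u) * ennreal (min 1 s) \<partial>\<nu>)"
  proof (rule nn_integral_mono_AE)
    show "AE s in \<nu>. ennreal (1 - exp (- u * s)) \<le> ennreal (max 1 u) * ennreal (min 1 s)"
      using AE_levy_pos
    proof eventually_elim
      case (elim s)
      have "min 1 (u * s) \<le> max 1 u * min 1 s"
      proof (cases "s \<le> 1")
        case True
        have "u * s \<le> max 1 u * s" using elim by (intro mult_right_mono) auto
        thus ?thesis using True by (auto simp: min_def)
      qed auto
      hence "1 - exp (- u * s) \<le> max 1 u * min 1 s"
        using one_minus_exp_le_min[OF u, of s] elim by linarith
      hence "ennreal (1 - exp (- u * s)) \<le> ennreal (max 1 u * min 1 s)" by (rule ennreal_leI)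
      thus ?case by (simp add: ennreal_mult')
    qed
  qed
  also have "\<dots> = ennreal (max 1 u) * (\<integral>\<^sup>+ s. ennreal (min 1 s) \<partial>\<nu>)"
    by (rule nn_integral_cmult) measurable
  also have "\<dots> < \<infinity>" using nn_integral_levy_min by (auto simp: ennreal_mult_less_top)
  finally have fin: "(\<integral>\<^sup>+ s. ennreal (1 - exp (- u * s)) \<partial>\<nu>) < \<infinity>" .
  have nn: "AE s in \<nu>. 0 \<le> 1 - exp (- u * s)"
    using AE_levy_pos by eventually_elim (use u in auto)
  have "integrable \<nu> (\<lambda>s. 1 - exp (- u * s))"
    by (rule integrableI_nonneg[OF _ nn fin]) measurable
  thus ?thesis unfolding laplace_exponent_def by (intro nn_integral_eq_integral nn)
qed

lemma laplace_exponent_nonneg: "0 \<le> u \<Longrightarrow> 0 \<le> laplace_exponent \<nu> u"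
  unfolding laplace_exponent_def
  by (rule integral_nonneg_AE) (use AE_levy_pos in eventually_elim, auto)

lemma laplace_exponent_mono:
  assumes "0 \<le> u" "u \<le> v"
  shows "laplace_exponent \<nu> u \<le> laplace_exponent \<nu> v"
proof -
  have "(\<integral>\<^sup>+ s. ennreal (1 - exp (- u * s)) \<partial>\<nu>) \<le> (\<integral>\<^sup>+ s. ennreal (1 - exp (- v * s)) \<partial>\<nu>)"
    by (rule nn_integral_mono_AE)
       (use AE_levy_pos in eventually_elim, use assms in \<open>auto intro!: ennreal_leI mult_right_mono\<close>)
  thus ?thesis using assms laplace_exponent_nonneg[of v] by (simp only: nn_integral_laplace_exponent) (auto simp: ennreal_le_iff nn_integral_laplace_exponent)
qed

text \<open>
The functions \<open>u \<mapsto> 1 - exp(-us)\<close> are concave and vanish at 0; the inequality is preserved by integration.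
\<close>

lemma laplace_exponent_concave:
  assumes u: "0 \<le> u" and c: "0 \<le> c" "c \<le> 1"
  shows "c * laplace_exponent \<nu> u \<le> laplace_exponent \<nu> (c * u)"
proof -
  have conv: "c * (1 - exp (- u * s)) \<le> 1 - exp (- (c * u) * s)" for s
  proof -
    have "exp ((1 - c) *\<^sub>R 0 + c *\<^sub>R (- u * s)) \<le> (1 - c) * exp 0 + c * exp (- u * s)"
      using c by (intro convex_onD[OF exp_convex]) auto
    thus ?thesis by (simp add: algebra_simps)
  qed
  have "ennreal (c * laplace_exponent \<nu> u) = ennreal c * (\<integral>\<^sup>+ s. ennreal (1 - exp (- u * s)) \<partial>\<nu>)"
    using c u by (simp only: nn_integral_laplace_exponent) (simp add: ennreal_mult' laplace_exponent_nonneg)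
  also have "\<dots> = (\<integral>\<^sup>+ s. ennreal c * ennreal (1 - exp (- u * s)) \<partial>\<nu>)"
    by (rule nn_integral_cmult[symmetric]) measurable
  also have "\<dots> \<le> (\<integral>\<^sup>+ s. ennreal (1 - exp (- (c * u) * s)) \<partial>\<nu>)"
    by (rule nn_integral_mono) (use conv c in \<open>simp add: ennreal_mult'[symmetric] ennreal_leI del: mult_minus_left\<close>)
  also have "\<dots> = ennreal (laplace_exponent \<nu> (c * u))"
    using u c by (intro nn_integral_laplace_exponent) auto
  finally show ?thesis using laplace_exponent_nonneg[of "c * u"] u c by (simp add: ennreal_le_iff)
qed

text \<open>
Each jump larger than \<open>1/u\<close> contributes at least \<open>1 - 1/e\<close> to the integral defining the exponent.
\<close>

lemma laplace_exponent_ge_tail: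
  assumes u: "0 < u"
  shows "(1 - exp (- 1)) * levy_tail \<nu> (1 / u) \<le> laplace_exponent \<nu> u"
proof -
  have c: "0 \<le> (1 - exp (- 1) :: real)" by simp
  have "ennreal ((1 - exp (- 1)) * levy_tail \<nu> (1 / u)) = ennreal (1 - exp (- 1)) * emeasure \<nu> {1/u<..}"
    using u c by (simp add: emeasure_levy_tail ennreal_mult')
  also have "\<dots> = (\<integral>\<^sup>+ s. ennreal (1 - exp (- 1)) * indicator {1/u<..} s \<partial>\<nu>)"
    by (subst nn_integral_cmult_indicator) auto
  also have "\<dots> \<le> (\<integral>\<^sup>+ s. ennreal (1 - exp (- u * s)) \<partial>\<nu>)"
    by (rule nn_integral_mono) (use u in \<open>auto split: split_indicator intro!: ennreal_leI simp: field_simps\<close>)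
  also have "\<dots> = ennreal (laplace_exponent \<nu> u)"
    using u by (intro nn_integral_laplace_exponent) auto
  finally show ?thesis using laplace_exponent_nonneg[of u] u by (simp add: ennreal_le_iff)
qed

text \<open>
A jump of size \<open>s\<close> between \<open>b/2^(k+1)\<close> and \<open>b/2^k\<close> contributes at most \<open>s/b \<le> 1/2^k\<close>, and the tail at
\<open>b/2^(k+1)\<close> counts all of these jumps.
\<close>

lemma laplace_exponent_le_tails:
  assumes b: "0 < b"
  shows "ennreal (laplace_exponent \<nu> (1 / b)) \<le> (\<Sum>k. ennreal (levy_tail \<nu> (b / 2 ^ Suc k) / 2 ^ k))"
proof -
  have "ennreal (laplace_exponent \<nu> (1 / b)) = (\<integral>\<^sup>+ s. ennreal (1 - exp (- (1 / b) * s)) \<partial>\<nu>)"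
    using b by (intro nn_integral_laplace_exponent[symmetric]) auto
  also have "\<dots> \<le> (\<integral>\<^sup>+ s. (\<Sum>k. ennreal (1 / 2 ^ k) * indicator {b / 2 ^ Suc k<..} s) \<partial>\<nu>)"
  proof (rule nn_integral_mono_AE)
    show "AE s in \<nu>. ennreal (1 - exp (- (1 / b) * s)) \<le> (\<Sum>k. ennreal (1 / 2 ^ k) * indicator {b / 2 ^ Suc k<..} s)"
      using AE_levy_pos
    proof eventually_elim
      case (elim s)
      have le: "1 - exp (- (1 / b) * s) \<le> min 1 (s / b)"
        using one_minus_exp_le_min[of "1 / b" s] b elim by simp
      obtain k :: nat where k: "b / 2 ^ Suc k < s" "min 1 (s / b) \<le> 1 / 2 ^ k"
      proof (cases "s \<le> b")
        case True
        then obtain k :: nat where "b / 2 ^ Suc k < s" "s \<le> b / 2 ^ k"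
          using elim dyadic_below by metis
        moreover from this have "s / b \<le> 1 / 2 ^ k" using b by (simp add: field_simps)
        ultimately show ?thesis by (intro that[of k] min.coboundedI2)
      next
        case False
        thus ?thesis using b by (intro that[of 0]) auto
      qed
      have "ennreal (1 - exp (- (1 / b) * s)) \<le> ennreal (1 / 2 ^ k) * indicator {b / 2 ^ Suc k<..} s"
        using k(1) ennreal_leI[OF order_trans[OF le k(2)]] by simp
      also have "\<dots> \<le> (\<Sum>k. ennreal (1 / 2 ^ k) * indicator {b / 2 ^ Suc k<..} s)"
        by (rule sum_le_suminf[where I="{k}", simplified]) auto
      finally show ?case .
    qed
  qed
  also have "\<dots> = (\<Sum>k. \<integral>\<^sup>+ s. ennreal (1 / 2 ^ k) * indicator {b / 2 ^ Suc k<..} s \<partial>\<nu>)"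
    by (rule nn_integral_suminf) measurable
  also have "\<dots> = (\<Sum>k. ennreal (levy_tail \<nu> (b / 2 ^ Suc k) / 2 ^ k))"
    using b by (simp add: nn_integral_cmult_indicator emeasure_levy_tail ennreal_mult'[symmetric] del: power_Suc)
  finally show ?thesis .
qed

text \<open>
Dominated convergence: \<open>r\<close> times the indicator of \<open>(r,\<infinity>)\<close> is bounded by the integrable function \<open>min 1 s\<close>
and tends to 0 with \<open>r\<close>.
\<close>

lemma levy_tail_little_o: "(\<lambda>n. levy_tail \<nu> (1 / real (Suc n)) / real (Suc n)) \<longlonglongrightarrow> 0"
proof -
  have "(\<lambda>n. \<integral>\<^sup>+ s. ennreal (1 / real (Suc n)) * indicator {1 / real (Suc n)<..} s \<partial>\<nu>)
      \<longlonglongrightarrow> (\<integral>\<^sup>+ s. 0 \<partial>\<nu>)"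
  proof (rule nn_integral_dominated_convergence[where w="\<lambda>s. ennreal (min 1 s)"])
    show "AE s in \<nu>. ennreal (1 / real (Suc n)) * indicator {1 / real (Suc n)<..} s \<le> ennreal (min 1 s)" for n
      by (auto split: split_indicator intro!: ennreal_leI)
    show "AE s in \<nu>. (\<lambda>n. ennreal (1 / real (Suc n)) * indicator {1 / real (Suc n)<..} s) \<longlonglongrightarrow> 0"
    proof (rule AE_I2)
      fix s :: real
      have "(\<lambda>n. ennreal (1 / real (Suc n))) \<longlonglongrightarrow> ennreal 0"
        using LIMSEQ_inverse_real_of_nat by (intro tendsto_ennrealI) (simp add: inverse_eq_divide)
      hence lim: "(\<lambda>n. ennreal (1 / real (Suc n))) \<longlonglongrightarrow> 0" by simp
      show "(\<lambda>n. ennreal (1 / real (Suc n)) * indicator {1 / real (Suc n)<..} s) \<longlonglongrightarrow> 0"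
      proof (rule tendsto_sandwich[OF _ _ tendsto_const lim])
        show "\<forall>\<^sub>F n in sequentially. ennreal (1 / real (Suc n)) * indicator {1 / real (Suc n)<..} s
            \<le> ennreal (1 / real (Suc n))"
          by (intro always_eventually allI) (simp add: indicator_def)
      qed simp
    qed
  qed (use nn_integral_levy_min in auto)
  hence "(\<lambda>n. ennreal (levy_tail \<nu> (1 / real (Suc n)) / real (Suc n))) \<longlonglongrightarrow> ennreal 0"
    by (simp add: nn_integral_cmult_indicator emeasure_levy_tail ennreal_mult'[symmetric] del: of_nat_Suc)
  thus ?thesis by (subst (asm) tendsto_ennreal_iff) (auto simp: levy_tail_def)
qed

context
  fixes R1 :: ereal and \<beta> :: real
  assumes tail: "poly_tail \<nu> R1 \<beta> \<beta>"
begin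

lemma poly_tail_pos: "0 < \<beta>" "0 < R1"
  using tail by (auto simp: poly_tail_def)

text \<open>
The scaling condition is used against the value at one reference point \<open>l\<close>, which for \<open>R\<^sub>1 = \<infinity>\<close> may lie on
either side of \<open>r\<close>.
\<close>

lemma levy_tail_bounds:
  assumes l: "0 < l" "ereal l < R1"
  obtains K where "1 \<le> K"
    "\<And>r. 0 < r \<Longrightarrow> R1 = \<infinity> \<or> r \<le> l \<Longrightarrow> within_factor K (levy_tail \<nu> r) (r powr - \<beta>)"
proof -
  obtain c1 c2 where c: "0 < c1" "0 < c2" and
    cb: "\<And>r R. 0 < r \<Longrightarrow> r \<le> R \<Longrightarrow> ereal R < R1 \<Longrightarrow>
      c1 * (R / r) powr \<beta> \<le> levy_tail \<nu> r / levy_tail \<nu> R \<and>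
      levy_tail \<nu> r / levy_tail \<nu> R \<le> c2 * (R / r) powr \<beta>"
    using tail unfolding poly_tail_def by blast
  have wpos: "0 < levy_tail \<nu> r" if "0 < r" "ereal r < R1" for r
  proof -
    have "levy_tail \<nu> r \<noteq> 0" using cb[of r r] c that by auto
    thus ?thesis unfolding levy_tail_def using measure_nonneg[of \<nu> "{r<..}"] by linarith
  qed
  define W where "W = levy_tail \<nu> l"
  have W: "0 < W" using wpos[OF l] by (simp add: W_def)
  define a where "a = l powr \<beta>"
  have a: "0 < a" using l by (simp add: a_def)
  define K where "K = Max {1, c2 * W * a, 1 / (c1 * W * a), W * a / c1, c2 / (W * a)}"
  have K: "1 \<le> K" "c2 * W * a \<le> K" "1 / (c1 * W * a) \<le> K" "W * a / c1 \<le> K" "c2 / (W * a) \<le> K"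
    unfolding K_def by (rule Max_ge; simp)+
  have conv: "(l / r) powr \<beta> = a * r powr - \<beta>" "(r / l) powr \<beta> = 1 / (a * r powr - \<beta>)" if "0 < r" for r
    using that l by (simp_all add: a_def powr_divide powr_minus field_simps)
  show thesis
  proof (rule that[OF K(1)])
    fix r assume r: "0 < r" "R1 = \<infinity> \<or> r \<le> l"
    define z where "z = r powr - \<beta>"
    have z: "0 < z" using r by (simp add: z_def)
    have "z / K \<le> levy_tail \<nu> r \<and> levy_tail \<nu> r \<le> K * z"
    proof (cases "r \<le> l")
      case True
      have "c1 * (a * z) \<le> levy_tail \<nu> r / W" "levy_tail \<nu> r / W \<le> c2 * (a * z)"
        using cb[OF r(1) True l(2)] conv[OF r(1)] by (auto simp: W_def z_def)
      hence b: "(c1 * W * a) * z \<le> levy_tail \<nu> r" "levy_tail \<nu> r \<le> (c2 * W * a) * z"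
        using W by (simp_all add: field_simps)
      have "1 / K \<le> c1 * W * a" using K(1,3) c W a by (simp add: field_simps)
      hence "1 / K * z \<le> (c1 * W * a) * z" using z by (intro mult_right_mono) auto
      moreover have "(c2 * W * a) * z \<le> K * z" using z K(2) by (intro mult_right_mono) auto
      ultimately show ?thesis using b by simp
    next
      case False
      hence R: "R1 = \<infinity>" using r by auto
      have wr: "0 < levy_tail \<nu> r" using wpos r R by simp
      have "c1 * (1 / (a * z)) \<le> W / levy_tail \<nu> r" "W / levy_tail \<nu> r \<le> c2 * (1 / (a * z))"
        using cb[of l r] conv[OF r(1)] False l R by (auto simp: W_def z_def)
      hence b: "levy_tail \<nu> r \<le> (W * a / c1) * z" "(W * a / c2) * z \<le> levy_tail \<nu> r"
        using c wr a z by (simp_all add: field_simps)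
      have "1 / K \<le> W * a / c2" using K(1,5) c W a by (simp add: field_simps)
      hence "1 / K * z \<le> (W * a / c2) * z" using z by (intro mult_right_mono) auto
      moreover have "(W * a / c1) * z \<le> K * z" using z K(4) by (intro mult_right_mono) auto
      ultimately show ?thesis using b by simp
    qed
    thus "within_factor K (levy_tail \<nu> r) (r powr - \<beta>)" by (simp add: z_def)
  qed
qed

lemma exists_below_R1: obtains l where "0 < l" "l \<le> 1" "ereal l < R1"
proof (cases R1)
  case (real r)
  thus ?thesis using poly_tail_pos by (intro that[of "min 1 (r/2)"]) (auto simp: min_def)
qed (use that[of 1] poly_tail_pos in auto)

text \<open>
If \<open>\<beta> \<ge> 1\<close>, then \<open>r w(r) \<ge> r^(1-\<beta>)/K\<close> stays away from 0 as \<open>r\<close> tends to 0, contrary to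
\<open>levy_tail_little_o\<close>.
\<close>

lemma poly_tail_index_less_one: "\<beta> < 1"
proof (rule ccontr)
  assume "\<not> \<beta> < 1"
  obtain l where l: "0 < l" "l \<le> 1" "ereal l < R1" by (rule exists_below_R1)
  obtain K where K: "1 \<le> K" and
    b: "\<And>r. 0 < r \<Longrightarrow> R1 = \<infinity> \<or> r \<le> l \<Longrightarrow> within_factor K (levy_tail \<nu> r) (r powr - \<beta>)"
    using levy_tail_bounds[OF l(1,3)] by metis
  have "eventually (\<lambda>n. levy_tail \<nu> (1 / real (Suc n)) / real (Suc n) < 1 / K) sequentially"
    using levy_tail_little_o K by (intro order_tendstoD(2)) auto
  moreover have "eventually (\<lambda>n. 1 / real (Suc n) < l) sequentially"
    using LIMSEQ_inverse_real_of_nat l by (intro order_tendstoD(2)[of _ 0]) (auto simp: inverse_eq_divide)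
  ultimately obtain n where n: "levy_tail \<nu> (1 / real (Suc n)) / real (Suc n) < 1 / K" "1 / real (Suc n) < l"
    using eventually_happens'[OF sequentially_bot eventually_conj] by blast
  define N where "N = real (Suc n)"
  have N: "1 \<le> N" by (simp add: N_def)
  have "N powr 1 \<le> N powr \<beta>" using N \<open>\<not> \<beta> < 1\<close> by (intro powr_mono) auto
  hence "N \<le> (1 / N) powr - \<beta>" using N by (simp add: powr_minus powr_divide)
  moreover have "(1 / N) powr - \<beta> / K \<le> levy_tail \<nu> (1 / N)"
    using b[of "1 / N"] n(2) N by (simp add: N_def)
  ultimately have "N / K \<le> levy_tail \<nu> (1 / N)"
    using K by (smt (verit) divide_right_mono)
  hence "1 / K \<le> levy_tail \<nu> (1 / N) / N" using N by (simp add: field_simps)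
  thus False using n(1) by (simp add: N_def)
qed

text \<open>
Jumps larger than \<open>1/u\<close> give the lower bound.  In the upper bound the dyadic sum of tails is geometric with
ratio \<open>2^(\<beta>-1)\<close>, which is less than 1 because \<open>\<beta> < 1\<close>.  Both use the tail only below \<open>l\<close>; if \<open>R\<^sub>1\<close> is finite
the remaining arguments, \<open>l < 1/u \<le> M\<close>, form a compact range on which \<open>\<phi>\<close> is bounded above and below by
monotonicity and concavity.
\<close>

lemma laplace_exponent_bounds:
  assumes M: "0 < M"
  obtains K where "1 \<le> K"
    "\<And>u. 0 < u \<Longrightarrow> R1 = \<infinity> \<or> 1 / u \<le> M \<Longrightarrow>
      within_factor K (laplace_exponent \<nu> u) (u powr \<beta>)"
proof -
  obtain l where l: "0 < l" "l \<le> 1" "ereal l < R1" by (rule exists_below_R1)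
  obtain K where K: "1 \<le> K" and
    b: "\<And>r. 0 < r \<Longrightarrow> R1 = \<infinity> \<or> r \<le> l \<Longrightarrow> within_factor K (levy_tail \<nu> r) (r powr - \<beta>)"
    using levy_tail_bounds[OF l(1,3)] by metis
  define q where "q = (2::real) powr (\<beta> - 1)"
  have q: "0 < q" "q < 1"
    using poly_tail_index_less_one powr_less_mono[of "\<beta> - 1" 0 "2::real"] by (auto simp: q_def)
  define A where "A = K * 2 powr \<beta> / (1 - q)"
  have A: "0 < A" using K q by (simp add: A_def)
  define e where "e = (1 - exp (- 1) :: real)"
  have e: "0 < e" by (simp add: e_def)
  have upper: "laplace_exponent \<nu> u \<le> A * u powr \<beta>" if u: "0 < u" "R1 = \<infinity> \<or> 1 / u \<le> l" for u
  proof -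
    define c where "c = 1 / u"
    have c: "0 < c" "R1 = \<infinity> \<or> c \<le> l" "u = 1 / c" using u by (auto simp: c_def)
    have "ennreal (laplace_exponent \<nu> u) \<le> (\<Sum>k. ennreal (levy_tail \<nu> (c / 2 ^ Suc k) / 2 ^ k))"
      unfolding c(3) by (rule laplace_exponent_le_tails[OF c(1)])
    also have "\<dots> \<le> (\<Sum>k. ennreal (K * 2 powr \<beta> * c powr - \<beta> * q ^ k))"
    proof (rule suminf_le)
      fix k :: nat
      have le: "c / 2 ^ Suc k \<le> c" using c(1) by (simp add: field_simps del: power_Suc)
      have "levy_tail \<nu> (c / 2 ^ Suc k) \<le> K * (c / 2 ^ Suc k) powr - \<beta>"
        using b[of "c / 2 ^ Suc k"] c(1,2) le by auto
      also have "(c / 2 ^ Suc k) powr - \<beta> = c powr - \<beta> * 2 powr \<beta> * (2 powr \<beta>) ^ k"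
        using c(1) powr_two_power[of "Suc k" \<beta>] by (simp add: powr_divide powr_minus field_simps del: power_Suc) simp
      finally have "levy_tail \<nu> (c / 2 ^ Suc k) / 2 ^ k \<le> K * (c powr - \<beta> * 2 powr \<beta> * (2 powr \<beta>) ^ k) / 2 ^ k"
        by (intro divide_right_mono) auto
      also have "\<dots> = K * 2 powr \<beta> * c powr - \<beta> * q ^ k"
        by (simp add: q_def powr_diff power_divide)
      finally show "ennreal (levy_tail \<nu> (c / 2 ^ Suc k) / 2 ^ k) \<le> ennreal (K * 2 powr \<beta> * c powr - \<beta> * q ^ k)"
        by (rule ennreal_leI)
    qed auto
    also have "\<dots> = ennreal (K * 2 powr \<beta> * c powr - \<beta> / (1 - q))"
      using K q by (intro suminf_ennreal_geometric) auto
    also have "c powr - \<beta> = u powr \<beta>" using u by (simp add: c_def powr_minus powr_divide)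
    finally show ?thesis using K q by (simp add: A_def ennreal_le_iff)
  qed
  have lower: "e / K * u powr \<beta> \<le> laplace_exponent \<nu> u" if u: "0 < u" "R1 = \<infinity> \<or> 1 / u \<le> l" for u
  proof -
    have "u powr \<beta> / K \<le> levy_tail \<nu> (1 / u)"
      using b[of "1 / u"] u by (simp add: powr_minus powr_divide)
    hence "e * (u powr \<beta> / K) \<le> e * levy_tail \<nu> (1 / u)" using e by (intro mult_left_mono) auto
    also have "\<dots> \<le> laplace_exponent \<nu> u" unfolding e_def by (rule laplace_exponent_ge_tail[OF u(1)])
    finally show ?thesis by simp
  qed
  define F where "F = laplace_exponent \<nu> (1 / l)"
  have "e / K * (1 / l) powr \<beta> \<le> F" unfolding F_def using l by (intro lower) auto
  moreover have "0 < e / K * (1 / l) powr \<beta>" using l e K by simp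
  ultimately have F: "0 < F" by linarith
  \<comment> \<open>the factor by which concavity moves from \<open>\<phi>(1/l)\<close> to \<open>\<phi>(1/M)\<close>\<close>
  define m where "m = min 1 (l / M)"
  have m: "0 < m" "m \<le> 1" using l M by (auto simp: m_def)
  define K' where "K' = Max {1, A, K / e, (1 / l) powr \<beta> / (m * F), F * M powr \<beta>}"
  have K': "1 \<le> K'" "A \<le> K'" "K / e \<le> K'" "(1 / l) powr \<beta> / (m * F) \<le> K'" "F * M powr \<beta> \<le> K'"
    unfolding K'_def by (rule Max_ge; simp)+
  show thesis
  proof (rule that[OF K'(1)])
    fix u assume u: "0 < u" "R1 = \<infinity> \<or> 1 / u \<le> M"
    show "within_factor K' (laplace_exponent \<nu> u) (u powr \<beta>)"
    proof (cases "R1 = \<infinity> \<or> 1 / u \<le> l")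
      case True
      have "1 / K' \<le> e / K" using K' K e by (simp add: field_simps)
      hence "1 / K' * u powr \<beta> \<le> e / K * u powr \<beta>" by (rule mult_right_mono) auto
      moreover have "A * u powr \<beta> \<le> K' * u powr \<beta>" using K' by (intro mult_right_mono) auto
      ultimately show ?thesis using lower[OF u(1) True] upper[OF u(1) True] by simp
    next
      case False
      hence uM: "1 / u \<le> M" and ul: "u \<le> 1 / l" using u l by (auto simp: field_simps)
      have lM: "l \<le> M" "m = l / M" using False uM l M by (auto simp: m_def field_simps)
      have uM': "1 / M \<le> u" using uM u M by (simp add: field_simps)
      have "m * F \<le> laplace_exponent \<nu> (m * (1 / l))"
        unfolding F_def using l m by (intro laplace_exponent_concave) auto
      also have "m * (1 / l) = 1 / M" using l lM by simp
      also have "laplace_exponent \<nu> (1 / M) \<le> laplace_exponent \<nu> u"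
        using M uM' by (intro laplace_exponent_mono) auto
      finally have low: "m * F \<le> laplace_exponent \<nu> u" .
      have "u powr \<beta> \<le> (1 / l) powr \<beta>" using u ul poly_tail_pos by (intro powr_mono2) auto
      also have "\<dots> \<le> K' * (m * F)" using K'(4) m F by (simp add: field_simps)
      finally have "u powr \<beta> / K' \<le> m * F" using K'(1) by (simp add: field_simps)
      moreover have "laplace_exponent \<nu> u \<le> K' * u powr \<beta>"
      proof -
        have "laplace_exponent \<nu> u \<le> F" unfolding F_def using u ul by (intro laplace_exponent_mono) auto
        also have "\<dots> = F * M powr \<beta> * (1 / M) powr \<beta>" using M by (simp add: powr_divide)
        also have "\<dots> \<le> K' * u powr \<beta>"
          using K'(1,5) uM' M poly_tail_pos F by (intro mult_mono powr_mono2) auto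
        finally show ?thesis .
      qed
      ultimately show ?thesis using low by linarith
    qed
  qed
qed

end

end

section \<open>Mass of the potential measure at each scale\<close>

text \<open>
\<open>U\<close> charges the scales up to \<open>T\<close> like \<open>s^(\<beta>-1) ds\<close>.  The ratio \<open>\<kappa>\<close> of the blocks in the lower bound has to be
small: bounds for the mass of \<open>(0,r]\<close> with different constants from above and below leave mass for a block
only if the block is long enough.  The factor \<open>r/r0\<close> in the upper bound continues it linearly
beyond \<open>T\<close>, where nothing but the concavity of \<open>\<phi>\<close> is known.
\<close>

definition regular_potential :: "real measure \<Rightarrow> real \<Rightarrow> ereal \<Rightarrow> real \<Rightarrow> real \<Rightarrow> bool" where
  "regular_potential U \<beta> T \<kappa> K \<longleftrightarrow> sets U = sets borel \<and> 0 < \<beta> \<and> 0 < \<kappa> \<and> \<kappa> < 1 \<and> 1 \<le> K \<and>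
     (\<forall>r0 r. 0 < r0 \<and> ereal r0 \<le> T \<and> r0 \<le> r \<longrightarrow>
        emeasure U {0<..r} \<le> ennreal (K * r0 powr \<beta> * (r / r0))) \<and>
     (\<forall>r. 0 < r \<and> ereal r \<le> T \<longrightarrow> ennreal (r powr \<beta> / K) \<le> emeasure U {\<kappa> * r<..r})"

text \<open>
The upper bound is Markov's inequality, \<open>U(0,r] \<le> e / \<phi>(1/r)\<close>; beyond \<open>T\<close> concavity compares \<open>\<phi>(1/r)\<close> with
\<open>(r0/r) \<phi>(1/r0)\<close>.  For the lower bound put \<open>a = \<kappa>r\<close> and split the Laplace transform at \<open>u = 1/(Aa)\<close>, which is
of order \<open>(Aa)^\<beta>\<close>, into three parts.  Times up to \<open>a\<close> contribute at most \<open>e / \<phi>(1/a)\<close>, of order \<open>a^\<beta>\<close>; this is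
a fraction of the total if \<open>A\<close> is large.  Times after \<open>r\<close> contribute at most \<open>exp(-ur/2) / \<phi>(u/2)\<close>, and since
\<open>ur = 1/(A\<kappa>)\<close> this is small if \<open>\<kappa>\<close> is small in terms of \<open>A\<close>.  The rest is at most the mass of \<open>(a,r]\<close>.
\<close>

lemma potential_measure_regular:
  assumes \<beta>: "0 < \<beta>" and K: "1 \<le> K"
    and phi: "\<And>u. 0 < u \<Longrightarrow> ereal (1 / u) \<le> T \<Longrightarrow>
      within_factor K (laplace_exponent \<nu> u) (u powr \<beta>)"
  obtains \<kappa> K' where
    "\<And>(M :: 'w measure) S. driftless_subordinator M S \<nu> \<Longrightarrow> regular_potential (potential_measure M S) \<beta> T \<kappa> K'"
proof -
  define e where "e = exp (1::real)"
  have e: "1 \<le> e" by (simp add: e_def)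
  \<comment> \<open>chosen such that \<open>(Aa)^\<beta> / K\<close> is four times the error bound \<open>e K a^\<beta>\<close> of either outer part\<close>
  define A where "A = (4 * e * K\<^sup>2) powr (1 / \<beta>)"
  have base: "1 \<le> 4 * e * K\<^sup>2"
  proof -
    have "1 \<le> K * K" using mult_mono[OF K K] K by simp
    hence "1 \<le> e * (K * K)" using mult_mono[OF e, of 1 "K * K"] e by simp
    thus ?thesis by (simp add: power2_eq_square)
  qed
  have A\<beta>: "A powr \<beta> = 4 * e * K\<^sup>2" using base \<beta> by (simp add: A_def powr_powr)
  have A: "1 \<le> A" unfolding A_def using base \<beta> by (intro ge_one_powr_ge_zero) auto
  \<comment> \<open>chosen such that \<open>ur/2 = (2A)^\<beta>\<close>, by which \<open>exp(-ur/2)\<close> absorbs the factor \<open>(2A)^\<beta>\<close> of the late part\<close>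
  define \<kappa> where "\<kappa> = 1 / (2 * A * 2 powr \<beta> * A powr \<beta>)"
  have two: "1 \<le> (2::real) powr \<beta>" using \<beta> by (intro ge_one_powr_ge_zero) auto
  have A1: "1 \<le> A powr \<beta>" using A \<beta> by (intro ge_one_powr_ge_zero) auto
  have prod: "1 \<le> 2 powr \<beta> * A powr \<beta>" using mult_mono[OF two A1] by simp
  have \<kappa>A: "2 * A * \<kappa> \<le> 1" using A prod by (simp add: \<kappa>_def field_simps)
  have \<kappa>: "0 < \<kappa>" "\<kappa> < 1"
  proof -
    show "0 < \<kappa>" using A by (simp add: \<kappa>_def)
    thus "\<kappa> < 1" using \<kappa>A A by (smt (verit) mult_le_cancel_right2 mult.commute)
  qed
  define K' where "K' = max (e * K) (1 / \<kappa> powr \<beta>)"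
  have K': "1 \<le> K'" "e * K \<le> K'" "1 / \<kappa> powr \<beta> \<le> K'"
    using mult_mono[OF e K] e by (auto simp: K'_def)
  show thesis
  proof (rule that)
    fix M :: "'w measure" and S assume S: "driftless_subordinator M S \<nu>"
    define U where "U = potential_measure M S"
    have levy: "levy_measure \<nu>" using S by (simp add: driftless_subordinator_def)
    have sets_U[measurable_cong]: "sets U = sets borel"
      unfolding U_def by (rule sets_potential_measure[OF S])
    have lap: "(\<integral>\<^sup>+s. ennreal (exp (- u * s)) \<partial>U) = ennreal (1 / laplace_exponent \<nu> u)"
      if "0 < u" "0 < laplace_exponent \<nu> u" for u
      unfolding U_def by (rule laplace_potential_measure[OF S that])
    have inv_phi: "0 < laplace_exponent \<nu> (1 / r) \<and> r powr \<beta> / K \<le> 1 / laplace_exponent \<nu> (1 / r) \<and>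
        1 / laplace_exponent \<nu> (1 / r) \<le> K * r powr \<beta>" if r: "0 < r" "ereal r \<le> T" for r
    proof -
      have "(1 / r) powr \<beta> / K \<le> laplace_exponent \<nu> (1 / r)"
        "laplace_exponent \<nu> (1 / r) \<le> K * (1 / r) powr \<beta>"
        using phi[of "1 / r"] r by auto
      moreover have "(1 / r) powr \<beta> = 1 / r powr \<beta>" using r by (simp add: powr_divide)
      moreover have "0 < r powr \<beta>" using r by simp
      ultimately have *: "1 / r powr \<beta> / K \<le> laplace_exponent \<nu> (1 / r)"
        "laplace_exponent \<nu> (1 / r) \<le> K * (1 / r powr \<beta>)" "0 < r powr \<beta>" by auto
      have "0 < 1 / r powr \<beta> / K" using *(3) K by simp
      hence p: "0 < laplace_exponent \<nu> (1 / r)" using *(1) by linarith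
      show ?thesis using * p K by (auto simp: field_simps)
    qed
    show "regular_potential (potential_measure M S) \<beta> T \<kappa> K'"
      unfolding regular_potential_def U_def[symmetric]
    proof (intro conjI allI impI sets_U \<beta> \<kappa> K'(1))
      fix r0 r assume "0 < r0 \<and> ereal r0 \<le> T \<and> r0 \<le> r"
      hence r0: "0 < r0" "ereal r0 \<le> T" "r0 \<le> r" by auto
      have r: "0 < r" using r0 by simp
      note phi0 = inv_phi[OF r0(1,2)]
      have conc: "r0 / r * laplace_exponent \<nu> (1 / r0) \<le> laplace_exponent \<nu> (1 / r)"
        using laplace_exponent_concave[OF levy, of "1 / r0" "r0 / r"] r0 r by (auto simp: divide_simps)
      have pos: "0 < r0 / r * laplace_exponent \<nu> (1 / r0)" using r0 r phi0 by simp
      hence pr: "0 < laplace_exponent \<nu> (1 / r)" using conc by linarith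
      have "1 / laplace_exponent \<nu> (1 / r) \<le> 1 / (r0 / r * laplace_exponent \<nu> (1 / r0))"
        using conc pos by (intro frac_le) auto
      also have "\<dots> = (1 / laplace_exponent \<nu> (1 / r0)) * (r / r0)" using r0 r by simp
      also have "\<dots> \<le> K * r0 powr \<beta> * (r / r0)"
        using phi0 r0 r by (intro mult_right_mono) auto
      finally have bound: "e * (1 / laplace_exponent \<nu> (1 / r)) \<le> e * (K * r0 powr \<beta> * (r / r0))"
        using e by (intro mult_left_mono) auto
      have "emeasure U {0<..r} = (\<integral>\<^sup>+s. indicator {0<..r} s \<partial>U)" by simp
      also have "\<dots> \<le> (\<integral>\<^sup>+s. ennreal e * ennreal (exp (- (1 / r) * s)) \<partial>U)"
      proof (rule nn_integral_mono)
        fix s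
        have "1 \<le> e * exp (- (1 / r) * s)" if "s \<le> r"
        proof -
          have "(1 / r) * s \<le> 1" using that r by (simp add: field_simps)
          hence "exp 0 \<le> exp (1 + (- (1 / r) * s))" by (subst exp_le_cancel_iff) simp
          thus ?thesis unfolding e_def exp_add by simp
        qed
        thus "indicator {0<..r} s \<le> ennreal e * ennreal (exp (- (1 / r) * s))"
          using e by (auto split: split_indicator simp: ennreal_mult'[symmetric] simp del: mult_minus_left)
      qed
      also have "\<dots> = ennreal e * ennreal (1 / laplace_exponent \<nu> (1 / r))"
        using r pr lap[of "1 / r"]
        by (subst nn_integral_cmult) (simp_all add: measurable_cong_sets[OF sets_U refl])
      also have "\<dots> = ennreal (e * (1 / laplace_exponent \<nu> (1 / r)))"
        by (rule ennreal_mult[symmetric]) (use e pr in auto)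
      also have "\<dots> \<le> ennreal (K' * r0 powr \<beta> * (r / r0))"
      proof (rule ennreal_leI)
        have "e * (K * r0 powr \<beta> * (r / r0)) = (e * K) * (r0 powr \<beta> * (r / r0))" by simp
        also have "\<dots> \<le> K' * (r0 powr \<beta> * (r / r0))" using K' r r0 by (intro mult_right_mono) auto
        finally show "e * (1 / laplace_exponent \<nu> (1 / r)) \<le> K' * r0 powr \<beta> * (r / r0)"
          using bound by (simp add: mult.assoc)
      qed
      finally show "emeasure U {0<..r} \<le> ennreal (K' * r0 powr \<beta> * (r / r0))" .
    next
      fix r assume "0 < r \<and> ereal r \<le> T"
      hence r: "0 < r" "ereal r \<le> T" by auto
      define a where "a = \<kappa> * r"
      define u where "u = 1 / (A * a)"
      have a: "0 < a" using \<kappa> r by (simp add: a_def)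
      have Aa: "0 < A * a" "2 * (A * a) \<le> r" "a \<le> A * a"
      proof -
        show "0 < A * a" using A a by simp
        have "2 * A * \<kappa> * r \<le> 1 * r" using \<kappa>A r by (intro mult_right_mono) auto
        thus "2 * (A * a) \<le> r" by (simp add: a_def ac_simps)
        show "a \<le> A * a" using A a by simp
      qed
      have below: "ereal (A * a) \<le> T" "ereal (2 * (A * a)) \<le> T" "ereal a \<le> T"
        using Aa r order_trans[OF _ r(2)] by auto
      have u: "0 < u" "u \<le> 1 / a" using Aa A a by (auto simp: u_def field_simps)
      define R where "R = exp (- (u * r / 2))"
      have R: "0 < R" "R * (K * 2 powr \<beta> * A powr \<beta>) \<le> e * K"
      proof -
        show "0 < R" by (simp add: R_def)
        have ur: "u * r / 2 = 2 powr \<beta> * A powr \<beta>"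
          using A a r \<kappa> by (simp add: u_def a_def \<kappa>_def)
        have "u * r / 2 < exp (u * r / 2)" by (metis exp_gt_self)
        hence "R * (u * r / 2) \<le> 1" unfolding R_def exp_minus by (simp add: field_simps)
        hence "R * (2 powr \<beta> * A powr \<beta>) \<le> e" using e ur by simp
        hence "R * (2 powr \<beta> * A powr \<beta>) * K \<le> e * K" using K by (intro mult_right_mono) auto
        thus "R * (K * 2 powr \<beta> * A powr \<beta>) \<le> e * K" by (simp add: ac_simps)
      qed
      have inv_u: "1 / u = A * a" "1 / (u / 2) = 2 * (A * a)" "1 / (1 / a) = a" by (auto simp: u_def)
      have f1: "0 < laplace_exponent \<nu> u" "(A * a) powr \<beta> / K \<le> 1 / laplace_exponent \<nu> u"
        using inv_phi[OF Aa(1) below(1)] by (auto simp: u_def)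
      have f2: "0 < laplace_exponent \<nu> (1 / a)" "1 / laplace_exponent \<nu> (1 / a) \<le> K * a powr \<beta>"
        using inv_phi[OF a below(3)] by auto
      have f3: "0 < laplace_exponent \<nu> (u / 2)" "1 / laplace_exponent \<nu> (u / 2) \<le> K * (2 * (A * a)) powr \<beta>"
        using inv_phi[of "2 * (A * a)"] Aa below(2) by (auto simp: u_def mult.commute)
      have "ennreal (1 / laplace_exponent \<nu> u) = (\<integral>\<^sup>+s. ennreal (exp (- u * s)) \<partial>U)"
        using lap[OF u(1) f1(1)] by simp
      also have "\<dots> \<le> (\<integral>\<^sup>+s. ennreal e * ennreal (exp (- (1 / a) * s)) + indicator {a<..r} s +
          ennreal R * ennreal (exp (- (u / 2) * s)) \<partial>U)"
      proof (rule nn_integral_mono)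
        fix s
        consider "s \<le> a" | "a < s" "s \<le> r" | "r < s" by linarith
        thus "ennreal (exp (- u * s)) \<le> ennreal e * ennreal (exp (- (1 / a) * s)) + indicator {a<..r} s +
          ennreal R * ennreal (exp (- (u / 2) * s))"
        proof cases
          case 1
          have "s * (1 / a - u) \<le> 1"
          proof (cases "0 \<le> s")
            case True
            hence "s * (1 / a - u) \<le> s * (1 / a)" using u by (intro mult_left_mono) auto
            also have "\<dots> \<le> 1" using 1 a by simp
            finally show ?thesis .
          next
            case False
            hence "s * (1 / a - u) \<le> 0" using u by (intro mult_nonpos_nonneg) auto
            thus ?thesis by simp
          qed
          hence "exp (- u * s) \<le> exp (1 + (- (1 / a) * s))" by (subst exp_le_cancel_iff) (simp add: algebra_simps)
          also have "\<dots> = e * exp (- (1 / a) * s)" unfolding e_def exp_add by simp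
          finally have "ennreal (exp (- u * s)) \<le> ennreal (e * exp (- (1 / a) * s))" by (rule ennreal_leI)
          also have "\<dots> = ennreal e * ennreal (exp (- (1 / a) * s))" using e by (simp add: ennreal_mult')
          finally show ?thesis by (simp add: add_increasing2 del: mult_minus_left)
        next
          case 2
          have "0 \<le> u * s" using 2 a u by simp
          hence "exp (- u * s) \<le> 1" by simp
          hence "ennreal (exp (- u * s)) \<le> indicator {a<..r} s" using 2 by (simp del: mult_minus_left)
          thus ?thesis by (simp add: add_increasing add_increasing2 del: mult_minus_left)
        next
          case 3
          have "u * r \<le> u * s" using 3 u by (intro mult_left_mono) auto
          hence "exp (- u * s) \<le> exp (- (u * r / 2) + (- (u / 2) * s))"
            by (subst exp_le_cancel_iff) (simp add: algebra_simps)
          also have "\<dots> = R * exp (- (u / 2) * s)" unfolding R_def exp_add by simp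
          finally have "ennreal (exp (- u * s)) \<le> ennreal (R * exp (- (u / 2) * s))" by (rule ennreal_leI)
          also have "\<dots> = ennreal R * ennreal (exp (- (u / 2) * s))" using R by (simp add: ennreal_mult')
          finally show ?thesis by (simp add: add_increasing del: mult_minus_left)
        qed
      qed
      also have "\<dots> = ennreal e * ennreal (1 / laplace_exponent \<nu> (1 / a)) + emeasure U {a<..r} +
          ennreal R * ennreal (1 / laplace_exponent \<nu> (u / 2))"
      proof -
        define F where "F v s = ennreal (exp (- v * s))" for v s :: real
        have [measurable]: "F v \<in> borel_measurable U" for v
          unfolding F_def by (simp add: measurable_cong_sets[OF sets_U refl])
        have F: "(\<integral>\<^sup>+s. F (1 / a) s \<partial>U) = ennreal (1 / laplace_exponent \<nu> (1 / a))"
          "(\<integral>\<^sup>+s. F (u / 2) s \<partial>U) = ennreal (1 / laplace_exponent \<nu> (u / 2))"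
          unfolding F_def using a u f2(1) f3(1) by (intro lap; simp)+
        have [measurable]: "{a<..r} \<in> sets U" by (simp add: sets_U)
        show ?thesis unfolding F_def[symmetric] F[symmetric]
          by (simp add: nn_integral_add nn_integral_cmult)
      qed
      also have "\<dots> \<le> ennreal (e * K * a powr \<beta>) + emeasure U {a<..r} + ennreal (R * (K * (2 * (A * a)) powr \<beta>))"
        using f2 f3 R e
        by (intro add_mono order_refl) (auto simp: ennreal_mult'[symmetric] mult.assoc intro!: ennreal_leI mult_left_mono simp del: times_divide_eq_right)
      finally have main: "ennreal (1 / laplace_exponent \<nu> u) \<le> \<dots>" .
      show "ennreal (r powr \<beta> / K') \<le> emeasure U {\<kappa> * r<..r}"
        unfolding a_def[symmetric]
      proof (cases "emeasure U {a<..r}")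
        case (real x)
        have sum: "1 / laplace_exponent \<nu> u \<le> e * K * a powr \<beta> + x + R * (K * (2 * (A * a)) powr \<beta>)"
          using main real e K R by (simp add: ennreal_plus[symmetric] ennreal_le_iff del: ennreal_plus)
        have "(A * a) powr \<beta> / K = 4 * e * K * a powr \<beta>"
          using A a K by (simp add: powr_mult A\<beta> power2_eq_square)
        moreover have "R * (K * (2 * (A * a)) powr \<beta>) \<le> e * K * a powr \<beta>"
          using mult_right_mono[OF R(2), of "a powr \<beta>"] A a by (simp add: powr_mult ac_simps)
        ultimately have "4 * (e * K * a powr \<beta>) \<le> 2 * (e * K * a powr \<beta>) + x"
          using sum f1(2) by linarith
        moreover have "1 * a powr \<beta> \<le> (e * K) * a powr \<beta>"
          using mult_mono[OF e K] e by (intro mult_right_mono) auto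
        moreover have "0 \<le> a powr \<beta>" by simp
        ultimately have x: "a powr \<beta> \<le> x" by linarith
        have "r powr \<beta> / K' \<le> r powr \<beta> * \<kappa> powr \<beta>"
          using K' \<kappa> r by (simp add: field_simps)
        also have "\<dots> = a powr \<beta>" using \<kappa> r by (simp add: a_def powr_mult)
        finally show "ennreal (r powr \<beta> / K') \<le> emeasure U {a<..r}"
          using x real by (simp add: ennreal_le_iff)
      qed simp
    qed
  qed
qed

text \<open>
Only the masses of initial intervals are bounded above, so a function is majorized by a sum of multiples
of indicators of such intervals, which may overlap.
\<close>

lemma nn_integral_cover_le:
  fixes f :: "real \<Rightarrow> real" and c d r :: "nat \<Rightarrow> real"
  assumes sets_U [measurable_cong]: "sets U = sets borel"
    and cover: "\<And>s. s \<in> A \<Longrightarrow> 0 < s \<and> (\<exists>k. s \<le> r k \<and> f s \<le> c k)"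
    and d: "\<And>k. ennreal (c k) * emeasure U {0<..r k} \<le> ennreal (d k)"
  shows "(\<integral>\<^sup>+s\<in>A. ennreal (f s) \<partial>U) \<le> (\<Sum>k. ennreal (d k))"
proof -
  have "(\<integral>\<^sup>+s\<in>A. ennreal (f s) \<partial>U) \<le> (\<integral>\<^sup>+s. (\<Sum>k. ennreal (c k) * indicator {0<..r k} s) \<partial>U)"
  proof (rule nn_integral_mono)
    fix s
    show "ennreal (f s) * indicator A s \<le> (\<Sum>k. ennreal (c k) * indicator {0<..r k} s)"
    proof (cases "s \<in> A")
      case True
      then obtain k where k: "0 < s" "s \<le> r k" "f s \<le> c k" using cover by blast
      have "ennreal (f s) \<le> ennreal (c k) * indicator {0<..r k} s" using k by (simp add: ennreal_leI)
      also have "\<dots> \<le> (\<Sum>k. ennreal (c k) * indicator {0<..r k} s)"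
        by (rule sum_le_suminf[where I="{k}", simplified]) auto
      finally show ?thesis using True by simp
    qed simp
  qed
  also have "\<dots> = (\<Sum>k. \<integral>\<^sup>+s. ennreal (c k) * indicator {0<..r k} s \<partial>U)"
    by (rule nn_integral_suminf) (simp add: measurable_cong_sets[OF sets_U refl])
  also have "\<dots> = (\<Sum>k. ennreal (c k) * emeasure U {0<..r k})"
    by (simp add: nn_integral_cmult_indicator sets_U)
  also have "\<dots> \<le> (\<Sum>k. ennreal (d k))" by (intro suminf_le d) auto
  finally show ?thesis .
qed

context
  fixes U :: "real measure" and \<beta> \<kappa> K :: real and T :: ereal
  assumes regular: "regular_potential U \<beta> T \<kappa> K"
begin

lemma regular_potentialD:
  shows sets_pot [measurable_cong, simp]: "sets U = sets borel"
    and pot_beta: "0 < \<beta>" and pot_kappa: "0 < \<kappa>" "\<kappa> < 1" and pot_K: "1 \<le> K"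
    and pot_le_linear: "0 < r0 \<Longrightarrow> ereal r0 \<le> T \<Longrightarrow> r0 \<le> r \<Longrightarrow>
      emeasure U {0<..r} \<le> ennreal (K * r0 powr \<beta> * (r / r0))"
    and pot_le: "0 < r \<Longrightarrow> ereal r \<le> T \<Longrightarrow> emeasure U {0<..r} \<le> ennreal (K * r powr \<beta>)"
    and pot_ge: "0 < r \<Longrightarrow> ereal r \<le> T \<Longrightarrow> ennreal (r powr \<beta> / K) \<le> emeasure U {\<kappa> * r<..r}"
  using regular unfolding regular_potential_def by (blast, blast, blast, blast, blast, blast, force, blast)

lemma ennreal_mult_le:
  assumes "0 \<le> c" "x \<le> ennreal y"
  shows "ennreal c * x \<le> ennreal (c * y)"
  using mult_left_mono[OF assms(2), of "ennreal c"] assms(1) by (simp add: ennreal_mult')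

text \<open>
The dyadic interval below \<open>r/2^k\<close> contributes at most a multiple of \<open>2^(k(a-\<beta>))\<close>, a convergent
geometric series.
\<close>

lemma pot_power_near_zero:
  assumes a: "0 \<le> a" "a < \<beta>" and r: "0 < r" "ereal r \<le> T"
  shows "(\<integral>\<^sup>+s\<in>{0<..r}. ennreal (s powr - a) \<partial>U) \<le> ennreal (K * 2 powr a / (1 - 2 powr (a - \<beta>)) * r powr (\<beta> - a))"
proof -
  define q where "q = (2::real) powr (a - \<beta>)"
  have q: "0 \<le> q" "q < 1" using a powr_less_mono[of "a - \<beta>" 0 "2::real"] by (auto simp: q_def)
  have "(\<integral>\<^sup>+s\<in>{0<..r}. ennreal (s powr - a) \<partial>U) \<le> (\<Sum>k. ennreal (K * 2 powr a * r powr (\<beta> - a) * q ^ k))"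
  proof (rule nn_integral_cover_le[where c="\<lambda>k. (r / 2 ^ Suc k) powr - a" and r="\<lambda>k. r / 2 ^ k"])
    fix s assume "s \<in> {0<..r}"
    then obtain k where k: "r / 2 ^ Suc k < s" "s \<le> r / 2 ^ k" using dyadic_below[of s r] by auto
    have "s powr - a \<le> (r / 2 ^ Suc k) powr - a"
      using a r less_imp_le[OF k(1)] by (intro powr_mono2') (auto simp del: power_Suc)
    thus "0 < s \<and> (\<exists>k. s \<le> r / 2 ^ k \<and> s powr - a \<le> (r / 2 ^ Suc k) powr - a)"
      using k \<open>s \<in> {0<..r}\<close> by auto
  next
    fix k :: nat
    have "r / 2 ^ k \<le> r" using r by (simp add: field_simps)
    hence T: "ereal (r / 2 ^ k) \<le> T" using r ereal_le_below by blast
    have "ennreal ((r / 2 ^ Suc k) powr - a) * emeasure U {0<..r / 2 ^ k} \<le>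
        ennreal ((r / 2 ^ Suc k) powr - a * (K * (r / 2 ^ k) powr \<beta>))"
      using r T by (intro ennreal_mult_le pot_le) auto
    also have "(r / 2 ^ Suc k) powr - a * (K * (r / 2 ^ k) powr \<beta>) = K * 2 powr a * r powr (\<beta> - a) * q ^ k"
    proof -
      have "(r / 2 ^ Suc k) powr - a = r powr - a * (2 powr a * (2 powr a) ^ k)"
        using r powr_two_power[of "Suc k" a] by (simp add: powr_divide powr_minus divide_simps del: power_Suc) simp
      moreover have "(r / 2 ^ k) powr \<beta> = r powr \<beta> / (2 powr \<beta>) ^ k"
        using r powr_two_power[of k \<beta>] by (simp add: powr_divide)
      moreover have "q ^ k = (2 powr a) ^ k / (2 powr \<beta>) ^ k" by (simp add: q_def powr_diff power_divide)
      moreover have "r powr (\<beta> - a) = r powr \<beta> * r powr - a" by (simp add: powr_add[symmetric])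
      ultimately show ?thesis by simp
    qed
    finally show "ennreal ((r / 2 ^ Suc k) powr - a) * emeasure U {0<..r / 2 ^ k} \<le>
        ennreal (K * 2 powr a * r powr (\<beta> - a) * q ^ k)" .
  qed simp
  also have "\<dots> = ennreal (K * 2 powr a * r powr (\<beta> - a) / (1 - q))"
    using q pot_K by (intro suminf_ennreal_geometric) auto
  finally show ?thesis by (simp add: q_def)
qed

lemma pot_power_away_from_zero:
  assumes p: "\<beta> < p" and a: "0 < a" and b: "ereal b \<le> T"
  shows "(\<integral>\<^sup>+s\<in>{a<..b}. ennreal (s powr - p) \<partial>U) \<le> ennreal (K * 2 powr \<beta> / (1 - 2 powr (\<beta> - p)) * a powr (\<beta> - p))"
proof (cases "a < b")
  case True
  define q where "q = (2::real) powr (\<beta> - p)"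
  have q: "0 \<le> q" "q < 1" using p powr_less_mono[of "\<beta> - p" 0 "2::real"] by (auto simp: q_def)
  have "(\<integral>\<^sup>+s\<in>{a<..b}. ennreal (s powr - p) \<partial>U) \<le> (\<Sum>k. ennreal (K * 2 powr \<beta> * a powr (\<beta> - p) * q ^ k))"
  proof (rule nn_integral_cover_le[where c="\<lambda>k. (a * 2 ^ k) powr - p" and r="\<lambda>k. min (a * 2 ^ Suc k) b"])
    fix s assume s: "s \<in> {a<..b}"
    then obtain k where k: "a * 2 ^ k < s" "s \<le> a * 2 ^ Suc k" using dyadic_above[of a s] a by auto
    have "s powr - p \<le> (a * 2 ^ k) powr - p"
      using a p pot_beta less_imp_le[OF k(1)] by (intro powr_mono2') auto
    thus "0 < s \<and> (\<exists>k. s \<le> min (a * 2 ^ Suc k) b \<and> s powr - p \<le> (a * 2 ^ k) powr - p)"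
      using k s a by auto
  next
    fix k :: nat
    let ?m = "min (a * 2 ^ Suc k) b"
    have m: "0 < ?m" "ereal ?m \<le> T" using a b True order_trans[of "ereal ?m" "ereal b" T] by auto
    have "ennreal ((a * 2 ^ k) powr - p) * emeasure U {0<..?m} \<le>
        ennreal ((a * 2 ^ k) powr - p * (K * ?m powr \<beta>))"
      using m by (intro ennreal_mult_le pot_le) auto
    also have "\<dots> \<le> ennreal ((a * 2 ^ k) powr - p * (K * (a * 2 ^ Suc k) powr \<beta>))"
      using m pot_beta pot_K by (intro ennreal_leI mult_left_mono powr_mono2) auto
    also have "(a * 2 ^ k) powr - p * (K * (a * 2 ^ Suc k) powr \<beta>) = K * 2 powr \<beta> * a powr (\<beta> - p) * q ^ k"
    proof -
      have "(a * 2 ^ Suc k) powr \<beta> = a powr \<beta> * (2 powr \<beta> * (2 powr \<beta>) ^ k)"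
        using a powr_two_power[of "Suc k" \<beta>] by (simp add: powr_mult del: power_Suc) simp
      moreover have "(a * 2 ^ k) powr - p = a powr - p / (2 powr p) ^ k"
        using a powr_two_power[of k "- p"] by (simp add: powr_mult powr_minus power_inverse divide_inverse)
      moreover have "q ^ k = (2 powr \<beta>) ^ k / (2 powr p) ^ k" by (simp add: q_def powr_diff power_divide)
      moreover have "a powr (\<beta> - p) = a powr \<beta> * a powr - p" by (simp add: powr_add[symmetric])
      ultimately show ?thesis by simp
    qed
    finally show "ennreal ((a * 2 ^ k) powr - p) * emeasure U {0<..?m} \<le>
        ennreal (K * 2 powr \<beta> * a powr (\<beta> - p) * q ^ k)" .
  qed simp
  also have "\<dots> = ennreal (K * 2 powr \<beta> * a powr (\<beta> - p) / (1 - q))"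
    using q pot_K by (intro suminf_ennreal_geometric) auto
  finally show ?thesis by (simp add: q_def)
qed auto

text \<open>
After time \<open>T\<close> the mass of \<open>(0,r]\<close> is only bounded linearly in \<open>r\<close>; the power \<open>1+\<beta>\<close> still leaves the ratio
\<open>2^(-\<beta>)\<close> between successive dyadic contributions.
\<close>

lemma pot_power_tail:
  assumes r: "0 < r" "ereal r \<le> T"
  shows "(\<integral>\<^sup>+s\<in>{r<..}. ennreal (s powr - (1 + \<beta>)) \<partial>U) \<le> ennreal (2 * K / (1 - 2 powr - \<beta>) / r)"
proof -
  define q where "q = (2::real) powr - \<beta>"
  have q: "0 \<le> q" "q < 1" using pot_beta powr_less_mono[of "- \<beta>" 0 "2::real"] by (auto simp: q_def)
  have "(\<integral>\<^sup>+s\<in>{r<..}. ennreal (s powr - (1 + \<beta>)) \<partial>U) \<le> (\<Sum>k. ennreal (2 * K / r * q ^ k))"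
  proof (rule nn_integral_cover_le[where c="\<lambda>k. (r * 2 ^ k) powr - (1 + \<beta>)" and r="\<lambda>k. r * 2 ^ Suc k"])
    fix s assume s: "s \<in> {r<..}"
    then obtain k where k: "r * 2 ^ k < s" "s \<le> r * 2 ^ Suc k" using dyadic_above[of r s] r by auto
    have "s powr - (1 + \<beta>) \<le> (r * 2 ^ k) powr - (1 + \<beta>)"
      using r pot_beta less_imp_le[OF k(1)] by (intro powr_mono2') auto
    thus "0 < s \<and> (\<exists>k. s \<le> r * 2 ^ Suc k \<and> s powr - (1 + \<beta>) \<le> (r * 2 ^ k) powr - (1 + \<beta>))"
      using k s r by auto
  next
    fix k :: nat
    have "r \<le> r * 2 ^ Suc k" using r one_le_power[of "2::real" "Suc k"] by (simp del: power_Suc)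
    hence "ennreal ((r * 2 ^ k) powr - (1 + \<beta>)) * emeasure U {0<..r * 2 ^ Suc k} \<le>
        ennreal ((r * 2 ^ k) powr - (1 + \<beta>) * (K * r powr \<beta> * (r * 2 ^ Suc k / r)))"
      using r by (intro ennreal_mult_le pot_le_linear) auto
    also have "(r * 2 ^ k) powr - (1 + \<beta>) * (K * r powr \<beta> * (r * 2 ^ Suc k / r)) = 2 * K / r * q ^ k"
    proof -
      have "(r * 2 ^ k) powr - (1 + \<beta>) = (r * 2 ^ k) powr - 1 * (r * 2 ^ k) powr - \<beta>"
        by (subst powr_add[symmetric]) simp
      also have "(r * 2 ^ k) powr - \<beta> = q ^ k / r powr \<beta>"
        using r powr_two_power[of k "- \<beta>"] by (simp add: powr_mult powr_minus q_def power_inverse divide_inverse)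
      finally show ?thesis using r by (simp add: powr_minus_divide)
    qed
    finally show "ennreal ((r * 2 ^ k) powr - (1 + \<beta>)) * emeasure U {0<..r * 2 ^ Suc k} \<le>
        ennreal (2 * K / r * q ^ k)" .
  qed simp
  also have "\<dots> = ennreal (2 * K / r / (1 - q))"
    using q pot_K r by (intro suminf_ennreal_geometric) auto
  finally show ?thesis by (simp add: q_def mult.commute)
qed

text \<open>
At the critical power every dyadic interval contributes at most \<open>K 2^\<beta>\<close>, so the integral is bounded by the
number of these intervals.
\<close>

lemma pot_log_upper:
  assumes a: "0 < a" and ab: "a \<le> b" and b: "ereal b \<le> T"
  shows "(\<integral>\<^sup>+s\<in>{a<..b}. ennreal (s powr - \<beta>) \<partial>U) \<le> ennreal (3 * K * 2 powr \<beta> * ln (exp 1 + b / a))"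
proof -
  define N where "N = nat \<lceil>log 2 (b / a)\<rceil>"
  define d where "d = K * 2 powr \<beta>"
  have d: "0 \<le> d" using pot_K by (simp add: d_def)
  have ba: "1 \<le> b / a" using a ab by simp
  have "(\<integral>\<^sup>+s\<in>{a<..b}. ennreal (s powr - \<beta>) \<partial>U) \<le> (\<Sum>k. ennreal (if k < N then d else 0))"
  proof (rule nn_integral_cover_le[where c="\<lambda>k. if k < N then (a * 2 ^ k) powr - \<beta> else 0" and r="\<lambda>k. min (a * 2 ^ Suc k) b"])
    fix s assume s: "s \<in> {a<..b}"
    then obtain k where k: "a * 2 ^ k < s" "s \<le> a * 2 ^ Suc k" using dyadic_above[of a s] a by auto
    have "2 ^ k < b / a" using k(1) s a by (simp add: field_simps)
    hence "log 2 (2 ^ k) < log 2 (b / a)" using ba by (subst log_less_cancel_iff) auto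
    hence "real k < log 2 (b / a)" by (simp add: log_nat_power)
    hence "k < N" unfolding N_def by linarith
    moreover have "s powr - \<beta> \<le> (a * 2 ^ k) powr - \<beta>"
      using a pot_beta less_imp_le[OF k(1)] by (intro powr_mono2') auto
    ultimately show "0 < s \<and> (\<exists>k. s \<le> min (a * 2 ^ Suc k) b \<and> s powr - \<beta> \<le> (if k < N then (a * 2 ^ k) powr - \<beta> else 0))"
      using k s a by (auto intro!: exI[of _ k])
  next
    fix k :: nat
    let ?m = "min (a * 2 ^ Suc k) b"
    have m: "0 < ?m" "ereal ?m \<le> T" using a b ab order_trans[of "ereal ?m" "ereal b" T] by auto
    have "ennreal ((a * 2 ^ k) powr - \<beta>) * emeasure U {0<..?m} \<le>
        ennreal ((a * 2 ^ k) powr - \<beta> * (K * ?m powr \<beta>))"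
      using m by (intro ennreal_mult_le pot_le) auto
    also have "\<dots> \<le> ennreal ((a * 2 ^ k) powr - \<beta> * (K * (a * 2 ^ Suc k) powr \<beta>))"
      using m pot_beta pot_K by (intro ennreal_leI mult_left_mono powr_mono2) auto
    also have "(a * 2 ^ k) powr - \<beta> * (K * (a * 2 ^ Suc k) powr \<beta>) = d"
    proof -
      have "(a * 2 ^ Suc k) powr \<beta> = 2 powr \<beta> * (a * 2 ^ k) powr \<beta>"
        using a by (simp add: powr_mult)
      thus ?thesis using a by (simp add: d_def powr_minus)
    qed
    finally show "ennreal (if k < N then (a * 2 ^ k) powr - \<beta> else 0) * emeasure U {0<..?m} \<le> ennreal (if k < N then d else 0)"
      by auto
  qed simp
  also have "\<dots> = (\<Sum>k<N. ennreal d)" by (subst suminf_finite[of "{..<N}"]) auto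
  also have "\<dots> = ennreal (real N * d)" using d by (simp add: ennreal_mult' ennreal_of_nat_eq_real_of_nat)
  also have "\<dots> \<le> ennreal (3 * ln (exp 1 + b / a) * d)"
  proof (intro ennreal_leI mult_right_mono d)
    have l1: "1 \<le> ln (exp 1 + b / a)" using ba by (intro one_le_ln_exp_plus) auto
    have l2: "ln (b / a) \<le> ln (exp 1 + b / a)" using ba by (subst ln_le_cancel_iff) (auto intro: add_pos_nonneg)
    have "real N \<le> 1 + log 2 (b / a)"
    proof -
      have "0 \<le> log 2 (b / a)" using ba by simp
      thus ?thesis unfolding N_def by linarith
    qed
    also have "log 2 (b / a) \<le> 2 * ln (b / a)"
    proof -
      have "1 / ln 2 \<le> (2::real)" using ln2_ge_two_thirds by (simp add: field_simps)
      thus ?thesis using ba mult_right_mono[of "1 / ln 2" 2 "ln (b / a)"] by (simp add: log_def)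
    qed
    finally show "real N \<le> 3 * ln (exp 1 + b / a)" using l1 l2 by simp
  qed
  finally show ?thesis by (simp add: d_def ac_simps)
qed

text \<open>
Each block \<open>(\<kappa>^(n+1) b, \<kappa>^n b]\<close> contributes at least \<open>1/K\<close>, and the number of blocks between \<open>\<kappa>a\<close> and \<open>b\<close> is
of the order of the logarithm.
\<close>

lemma pot_log_lower:
  assumes a: "0 < a" and ab: "a \<le> b" and b: "ereal b \<le> T"
  shows "ennreal (ln (exp 1 + b / a) / (K * (2 + ln (1 / \<kappa>)))) \<le> (\<integral>\<^sup>+s\<in>{\<kappa> * a<..b}. ennreal (s powr - \<beta>) \<partial>U)"
proof -
  have b0: "0 < b" using a ab by simp
  have blocks: "ennreal (real n / K) \<le> (\<integral>\<^sup>+s\<in>{\<kappa> ^ n * b<..b}. ennreal (s powr - \<beta>) \<partial>U)" for n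
  proof (induction n)
    case (Suc n)
    define c where "c = \<kappa> ^ n * b"
    have c: "0 < c" "c \<le> b" "\<kappa> * c \<le> c"
      using pot_kappa b0 by (auto simp: c_def power_le_one)
    have cT: "ereal c \<le> T" using c b order_trans[of "ereal c" "ereal b" T] by simp
    have "ennreal (1 / K) = ennreal (c powr - \<beta> * (c powr \<beta> / K))" using c by (simp add: powr_minus)
    also have "\<dots> = ennreal (c powr - \<beta>) * ennreal (c powr \<beta> / K)"
      by (rule ennreal_mult) (use pot_K in auto)
    also have "\<dots> \<le> ennreal (c powr - \<beta>) * emeasure U {\<kappa> * c<..c}"
      using pot_ge[OF c(1) cT] by (intro mult_left_mono) auto
    also have "\<dots> = (\<integral>\<^sup>+s. ennreal (c powr - \<beta>) * indicator {\<kappa> * c<..c} s \<partial>U)"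
      by (simp add: nn_integral_cmult_indicator)
    also have "\<dots> \<le> (\<integral>\<^sup>+s\<in>{\<kappa> * c<..c}. ennreal (s powr - \<beta>) \<partial>U)"
    proof (rule nn_integral_mono)
      fix s
      have "0 < \<kappa> * c" using pot_kappa c by simp
      hence "c powr - \<beta> \<le> s powr - \<beta>" if "\<kappa> * c < s" "s \<le> c"
        using that pot_beta by (intro powr_mono2') auto
      thus "ennreal (c powr - \<beta>) * indicator {\<kappa> * c<..c} s \<le> ennreal (s powr - \<beta>) * indicator {\<kappa> * c<..c} s"
        by (auto split: split_indicator intro!: ennreal_leI)
    qed
    finally have new: "ennreal (1 / K) \<le> (\<integral>\<^sup>+s\<in>{\<kappa> * c<..c}. ennreal (s powr - \<beta>) \<partial>U)" .
    have "ennreal (real (Suc n) / K) = ennreal (real n / K) + ennreal (1 / K)"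
      using pot_K by (simp add: ennreal_plus[symmetric] add_divide_distrib del: ennreal_plus)
    also have "\<dots> \<le> (\<integral>\<^sup>+s\<in>{c<..b}. ennreal (s powr - \<beta>) \<partial>U) + (\<integral>\<^sup>+s\<in>{\<kappa> * c<..c}. ennreal (s powr - \<beta>) \<partial>U)"
      using Suc new unfolding c_def by (intro add_mono) auto
    also have "\<dots> = (\<integral>\<^sup>+s. ennreal (s powr - \<beta>) * indicator {c<..b} s + ennreal (s powr - \<beta>) * indicator {\<kappa> * c<..c} s \<partial>U)"
      by (rule nn_integral_add[symmetric]) (simp_all add: measurable_cong_sets[OF sets_pot refl])
    also have "\<dots> \<le> (\<integral>\<^sup>+s\<in>{\<kappa> * c<..b}. ennreal (s powr - \<beta>) \<partial>U)"
      using c le_less_trans[OF c(3)] by (intro nn_integral_mono) (auto split: split_indicator)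
    finally show ?case by (simp add: c_def ac_simps)
  qed simp
  define L where "L = ln (1 / \<kappa>)"
  have L: "0 < L" using pot_kappa by (simp add: L_def ln_div)
  have ba: "1 \<le> b / a" using a ab by simp
  \<comment> \<open>one block more than fit between \<open>a\<close> and \<open>b\<close>, which is why the integral starts at \<open>\<kappa>a\<close>\<close>
  define n where "n = Suc (nat \<lfloor>ln (b / a) / L\<rfloor>)"
  have n: "ln (b / a) / L \<le> real n" "real n \<le> 1 + ln (b / a) / L" "1 \<le> real n"
  proof -
    have "0 \<le> ln (b / a) / L" using L ba by simp
    thus "ln (b / a) / L \<le> real n" "real n \<le> 1 + ln (b / a) / L" "1 \<le> real n"
      unfolding n_def by linarith+
  qed
  have "\<kappa> * a \<le> \<kappa> ^ n * b"
  proof -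
    have "real (n - 1) * L \<le> ln (b / a)" using n(2) L by (simp add: n_def field_simps)
    hence "(1 / \<kappa>) ^ (n - 1) \<le> b / a"
      using pot_kappa ba by (subst ln_le_cancel_iff[symmetric]) (auto simp: L_def ln_realpow)
    hence "a \<le> \<kappa> ^ (n - 1) * b" using pot_kappa a by (simp add: field_simps)
    thus ?thesis using pot_kappa by (simp add: n_def)
  qed
  have "ln (exp 1 + b / a) / (K * (2 + L)) \<le> real n / K"
  proof -
    have "exp 1 + b / a \<le> (exp 1 + 1) * (b / a)"
      using mult_left_mono[OF ba, of "exp 1"] unfolding distrib_right by simp
    hence "ln (exp 1 + b / a) \<le> ln ((exp 1 + 1) * (b / a))"
      using ba a b0 by (subst ln_le_cancel_iff) (auto intro!: add_pos_nonneg divide_pos_pos mult_pos_pos)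
    also have "\<dots> = ln (exp 1 + 1) + ln (b / a)"
      using ba a add_pos_pos[of "exp 1" "1::real"] by (subst ln_mult) auto
    also have "\<dots> \<le> 2 + ln (b / a)" using ln_exp_plus_one_le by simp
    also have "\<dots> \<le> 2 * real n + L * real n" using n(1,3) L by (intro add_mono) (auto simp: field_simps)
    finally have "ln (exp 1 + b / a) / (2 + L) \<le> real n"
      using L by (subst pos_divide_le_eq) (auto simp: algebra_simps)
    hence "ln (exp 1 + b / a) / (2 + L) / K \<le> real n / K"
      using pot_K by (intro divide_right_mono) auto
    thus ?thesis by (simp add: mult.commute)
  qed
  hence "ennreal (ln (exp 1 + b / a) / (K * (2 + L))) \<le> ennreal (real n / K)" by (rule ennreal_leI)
  also note blocks[of n]
  also have "(\<integral>\<^sup>+s\<in>{\<kappa> ^ n * b<..b}. ennreal (s powr - \<beta>) \<partial>U) \<le> (\<integral>\<^sup>+s\<in>{\<kappa> * a<..b}. ennreal (s powr - \<beta>) \<partial>U)"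
    using \<open>\<kappa> * a \<le> \<kappa> ^ n * b\<close> by (intro nn_integral_mono) (auto split: split_indicator)
  finally show ?thesis by (simp add: L_def)
qed

end

section \<open>Integrals against a regular potential\<close>

text \<open>
The three summands are the constants of \<open>pot_power_near_zero\<close>, \<open>pot_log_upper\<close> and \<open>pot_power_tail\<close>.
\<close>

definition potential_const :: "real \<Rightarrow> real \<Rightarrow> real \<Rightarrow> real" where
  "potential_const K \<beta> g =
     K * 2 powr (g - 1) / (1 - 2 powr (g - 1 - \<beta>)) + 3 * K * 2 powr \<beta> + 2 * K / (1 - 2 powr - \<beta>)"

context
  fixes U :: "real measure" and \<beta> \<kappa> K :: real and T :: ereal
  assumes regular: "regular_potential U \<beta> T \<kappa> K"
begin

lemmas pot = regular_potentialD[OF regular]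

lemma measurable_pot: "f \<in> borel_measurable U \<longleftrightarrow> f \<in> borel_measurable borel"
  by (simp add: measurable_cong_sets[OF pot(1) refl])

lemma set_nn_integral_cmult_pot:
  fixes f :: "real \<Rightarrow> real"
  assumes "f \<in> borel_measurable borel" "A \<in> sets borel" "0 \<le> c"
  shows "(\<integral>\<^sup>+s\<in>A. ennreal (c * f s) \<partial>U) = ennreal c * (\<integral>\<^sup>+s\<in>A. ennreal (f s) \<partial>U)"
  using assms
  by (subst nn_integral_cmult[symmetric]) (auto simp: measurable_pot ennreal_mult' mult.assoc)

lemma set_nn_integral_le:
  assumes "\<And>s. s \<in> A \<Longrightarrow> f s \<le> (g s :: real)"
  shows "(\<integral>\<^sup>+s\<in>A. ennreal (f s) \<partial>U) \<le> (\<integral>\<^sup>+s\<in>A. ennreal (g s) \<partial>U)"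
  by (rule nn_integral_mono) (auto split: split_indicator intro!: ennreal_leI assms)

lemma set_nn_integral_power_le:
  assumes le: "\<And>s. s \<in> A \<Longrightarrow> f s \<le> c * s powr a" and A: "A \<in> sets borel" and c: "0 \<le> c"
    and I: "(\<integral>\<^sup>+s\<in>A. ennreal (s powr a) \<partial>U) \<le> ennreal b"
  shows "(\<integral>\<^sup>+s\<in>A. ennreal (f s) \<partial>U) \<le> ennreal (c * b)"
proof -
  have "(\<integral>\<^sup>+s\<in>A. ennreal (f s) \<partial>U) \<le> (\<integral>\<^sup>+s\<in>A. ennreal (c * s powr a) \<partial>U)"
    by (rule set_nn_integral_le[OF le])
  also have "\<dots> = ennreal c * (\<integral>\<^sup>+s\<in>A. ennreal (s powr a) \<partial>U)"
    by (rule set_nn_integral_cmult_pot) (use A c in auto)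
  also have "\<dots> \<le> ennreal (c * b)" by (rule ennreal_mult_le[OF regular c I])
  finally show ?thesis .
qed

text \<open>
Heat kernels are measurable only on \<open>(0,\<infinity>)\<close>, so subadditivity is stated for subsets of this half-line.
\<close>

lemma set_nn_integral_Un_le:
  fixes f :: "real \<Rightarrow> real"
  assumes f: "(\<lambda>s. ennreal (f s) * indicator {0<..} s) \<in> borel_measurable borel"
    and A: "A \<in> sets borel" "A \<subseteq> {0<..}" and B: "B \<in> sets borel" "B \<subseteq> {0<..}" and C: "C \<subseteq> A \<union> B"
  shows "(\<integral>\<^sup>+s\<in>C. ennreal (f s) \<partial>U) \<le> (\<integral>\<^sup>+s\<in>A. ennreal (f s) \<partial>U) + (\<integral>\<^sup>+s\<in>B. ennreal (f s) \<partial>U)"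
proof -
  have meas: "(\<lambda>s. ennreal (f s) * indicator X s) \<in> borel_measurable U" if X: "X \<in> sets borel" "X \<subseteq> {0<..}" for X
  proof -
    have "(\<lambda>s. ennreal (f s) * indicator X s) = (\<lambda>s. (ennreal (f s) * indicator {0<..} s) * indicator X s)"
      by (rule ext) (use X in \<open>auto split: split_indicator\<close>)
    thus ?thesis using f X by (simp add: measurable_pot)
  qed
  have "(\<integral>\<^sup>+s\<in>C. ennreal (f s) \<partial>U) \<le> (\<integral>\<^sup>+s. ennreal (f s) * indicator A s + ennreal (f s) * indicator B s \<partial>U)"
    using C by (intro nn_integral_mono) (auto split: split_indicator)
  also have "\<dots> = (\<integral>\<^sup>+s\<in>A. ennreal (f s) \<partial>U) + (\<integral>\<^sup>+s\<in>B. ennreal (f s) \<partial>U)"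
    by (rule nn_integral_add) (use meas A B in auto)
  finally show ?thesis .
qed

text \<open>
The shape of the integrand in the four time ranges.  On \<open>(0,\<sigma>]\<close> the power \<open>1-g\<close> is integrable at 0 because
\<open>g - 1 < \<beta>\<close>, and the integral is of the size of the contribution of times near \<open>\<sigma>\<close>; on \<open>(\<sigma>,\<tau>]\<close> the power is
critical and produces the logarithm; on \<open>(\<tau>,\<omega>]\<close> the majorant \<open>v\<close> is kept; after \<open>\<omega>\<close> the integral is
dominated by times near \<open>\<omega>\<close>.
\<close>

lemma potential_integral_upper:
  fixes p v :: "real \<Rightarrow> real"
  assumes g: "1 \<le> g" "g < 1 + \<beta>"
    and p: "(\<lambda>s. ennreal (p s) * indicator {0<..} s) \<in> borel_measurable borel"
    and nonneg: "0 \<le> J" "0 \<le> B" "0 \<le> E"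
    and order: "0 < \<sigma>" "\<sigma> \<le> \<tau>" "\<tau> \<le> \<omega>" "ereal \<omega> \<le> T"
    and u1: "\<And>s. 0 < s \<Longrightarrow> s \<le> \<sigma> \<Longrightarrow> p s \<le> J * \<sigma> powr (g - 1 - \<beta>) * s powr (1 - g) + B"
    and u2: "\<And>s. \<sigma> < s \<Longrightarrow> s \<le> \<tau> \<Longrightarrow> p s \<le> J * s powr - \<beta> + B"
    and u3: "\<And>s. \<tau> < s \<Longrightarrow> s \<le> \<omega> \<Longrightarrow> p s \<le> v s"
    and u4: "\<And>s. \<omega> < s \<Longrightarrow> p s \<le> E * \<omega> powr (1 + \<beta>) * s powr - (1 + \<beta>)"
  defines "C \<equiv> potential_const K \<beta> g"
  shows "(\<integral>\<^sup>+s\<in>{0<..}. ennreal (p s) \<partial>U) \<le>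
    ennreal (C * (J * ln (exp 1 + \<tau> / \<sigma>) + B * \<tau> powr \<beta> + E * \<omega> powr \<beta>)) + (\<integral>\<^sup>+s\<in>{\<tau><..\<omega>}. ennreal (v s) \<partial>U)"
proof -
  define C1 where "C1 = K * 2 powr (g - 1) / (1 - 2 powr (g - 1 - \<beta>))"
  define C2 where "C2 = 3 * K * 2 powr \<beta>"
  define C3 where "C3 = 2 * K / (1 - 2 powr - \<beta>)"
  note \<beta> = pot(2) and K = pot(5)
  have q: "2 powr (g - 1 - \<beta>) < (1::real)" "2 powr - \<beta> < (1::real)"
    using g \<beta> powr_less_mono[of "g - 1 - \<beta>" 0 "2::real"] powr_less_mono[of "- \<beta>" 0 "2::real"] by auto
  have C0: "0 \<le> C1" "K \<le> C2" "0 \<le> C3"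
  proof -
    show "0 \<le> C1" "0 \<le> C3" using K q by (auto simp: C1_def C3_def)
    have "1 \<le> (2::real) powr \<beta>" using \<beta> by (intro ge_one_powr_ge_zero) auto
    hence "K * 1 \<le> (3 * K) * 2 powr \<beta>" using K by (intro mult_mono) auto
    thus "K \<le> C2" by (simp add: C2_def)
  qed
  have pos: "0 < \<tau>" "0 < \<omega>" using order by auto
  have T: "ereal \<sigma> \<le> T" "ereal \<tau> \<le> T"
    using order ereal_le_below[OF _ order(4)] by auto
  have I1: "(\<integral>\<^sup>+s\<in>{0<..\<sigma>}. ennreal (J * \<sigma> powr (g - 1 - \<beta>) * s powr (1 - g)) \<partial>U) \<le> ennreal (C1 * J)"
  proof -
    have "(\<integral>\<^sup>+s\<in>{0<..\<sigma>}. ennreal (J * \<sigma> powr (g - 1 - \<beta>) * s powr (1 - g)) \<partial>U)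
        \<le> ennreal (J * \<sigma> powr (g - 1 - \<beta>) * (C1 * \<sigma> powr (\<beta> - (g - 1))))"
    proof (rule set_nn_integral_power_le[where a="1 - g"])
      show "(\<integral>\<^sup>+s\<in>{0<..\<sigma>}. ennreal (s powr (1 - g)) \<partial>U) \<le> ennreal (C1 * \<sigma> powr (\<beta> - (g - 1)))"
        using pot_power_near_zero[OF regular, of "g - 1" \<sigma>] g order T by (simp add: C1_def)
    qed (use nonneg in auto)
    also have "J * \<sigma> powr (g - 1 - \<beta>) * (C1 * \<sigma> powr (\<beta> - (g - 1))) = C1 * J * \<sigma> powr ((g - 1 - \<beta>) + (\<beta> - (g - 1)))"
      unfolding powr_add by simp
    finally show ?thesis using order by simp
  qed
  have I2: "(\<integral>\<^sup>+s\<in>{\<sigma><..\<tau>}. ennreal (J * s powr - \<beta>) \<partial>U) \<le> ennreal (J * (C2 * ln (exp 1 + \<tau> / \<sigma>)))"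
    by (rule set_nn_integral_power_le[where a="- \<beta>"])
       (use pot_log_upper[OF regular order(1,2) T(2)] nonneg in \<open>auto simp: C2_def\<close>)
  have IB: "(\<integral>\<^sup>+s\<in>{0<..\<tau>}. ennreal B \<partial>U) \<le> ennreal (B * (C2 * \<tau> powr \<beta>))"
  proof -
    have "(\<integral>\<^sup>+s\<in>{0<..\<tau>}. ennreal B \<partial>U) = ennreal B * emeasure U {0<..\<tau>}"
      by (simp add: nn_integral_cmult_indicator pot(1))
    also have "\<dots> \<le> ennreal (B * (K * \<tau> powr \<beta>))"
      by (rule ennreal_mult_le[OF regular nonneg(2) pot(7)]) (use pos T in auto)
    also have "\<dots> \<le> ennreal (B * (C2 * \<tau> powr \<beta>))"
      using C0 nonneg by (intro ennreal_leI mult_left_mono mult_right_mono) auto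
    finally show ?thesis .
  qed
  have near: "(\<integral>\<^sup>+s\<in>{0<..\<tau>}. ennreal (p s) \<partial>U) \<le> ennreal (C1 * J + J * (C2 * ln (exp 1 + \<tau> / \<sigma>)) + B * (C2 * \<tau> powr \<beta>))"
  proof -
    have "(\<integral>\<^sup>+s\<in>{0<..\<tau>}. ennreal (p s) \<partial>U) \<le> (\<integral>\<^sup>+s.
        ennreal (J * \<sigma> powr (g - 1 - \<beta>) * s powr (1 - g)) * indicator {0<..\<sigma>} s +
        ennreal (J * s powr - \<beta>) * indicator {\<sigma><..\<tau>} s + ennreal B * indicator {0<..\<tau>} s \<partial>U)"
    proof (rule nn_integral_mono)
      fix s
      consider "0 < s" "s \<le> \<sigma>" | "\<sigma> < s" "s \<le> \<tau>" | "\<not> (0 < s \<and> s \<le> \<tau>)" using order by linarith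
      thus "ennreal (p s) * indicator {0<..\<tau>} s \<le>
        ennreal (J * \<sigma> powr (g - 1 - \<beta>) * s powr (1 - g)) * indicator {0<..\<sigma>} s +
        ennreal (J * s powr - \<beta>) * indicator {\<sigma><..\<tau>} s + ennreal B * indicator {0<..\<tau>} s"
      proof cases
        case 1
        thus ?thesis using ennreal_leI[OF u1[OF 1]] order nonneg
          by (simp add: ennreal_plus)
      next
        case 2
        thus ?thesis using ennreal_leI[OF u2[OF 2]] order nonneg
          by (simp add: ennreal_plus)
      qed auto
    qed
    also have "\<dots> = (\<integral>\<^sup>+s\<in>{0<..\<sigma>}. ennreal (J * \<sigma> powr (g - 1 - \<beta>) * s powr (1 - g)) \<partial>U) +
        (\<integral>\<^sup>+s\<in>{\<sigma><..\<tau>}. ennreal (J * s powr - \<beta>) \<partial>U) + (\<integral>\<^sup>+s\<in>{0<..\<tau>}. ennreal B \<partial>U)"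
      by (subst nn_integral_add, simp_all add: measurable_pot)+
    also have "\<dots> \<le> ennreal (C1 * J) + ennreal (J * (C2 * ln (exp 1 + \<tau> / \<sigma>))) + ennreal (B * (C2 * \<tau> powr \<beta>))"
      by (intro add_mono I1 I2 IB)
    also have "\<dots> = ennreal (C1 * J + J * (C2 * ln (exp 1 + \<tau> / \<sigma>)) + B * (C2 * \<tau> powr \<beta>))"
    proof -
      have "0 \<le> ln (exp 1 + \<tau> / \<sigma>)" using order pos by (intro ln_ge_zero add_increasing2) auto
      thus ?thesis using C0 K nonneg by (simp add: ennreal_plus[symmetric] del: ennreal_plus)
    qed
    finally show ?thesis .
  qed
  have far: "(\<integral>\<^sup>+s\<in>{\<omega><..}. ennreal (p s) \<partial>U) \<le> ennreal (C3 * (E * \<omega> powr \<beta>))"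
  proof -
    have "(\<integral>\<^sup>+s\<in>{\<omega><..}. ennreal (p s) \<partial>U) \<le> ennreal (E * \<omega> powr (1 + \<beta>) * (C3 / \<omega>))"
    proof (rule set_nn_integral_power_le[where a="- (1 + \<beta>)"])
      show "p s \<le> E * \<omega> powr (1 + \<beta>) * s powr - (1 + \<beta>)" if "s \<in> {\<omega><..}" for s using u4 that by simp
      show "(\<integral>\<^sup>+s\<in>{\<omega><..}. ennreal (s powr - (1 + \<beta>)) \<partial>U) \<le> ennreal (C3 / \<omega>)"
        unfolding C3_def by (rule pot_power_tail[OF regular pos(2) order(4)])
    qed (use nonneg in auto)
    also have "E * \<omega> powr (1 + \<beta>) * (C3 / \<omega>) = C3 * (E * \<omega> powr \<beta>)" using pos by (simp add: powr_add)
    finally show ?thesis .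
  qed
  have mid: "(\<integral>\<^sup>+s\<in>{\<tau><..\<omega>}. ennreal (p s) \<partial>U) \<le> (\<integral>\<^sup>+s\<in>{\<tau><..\<omega>}. ennreal (v s) \<partial>U)"
    by (rule set_nn_integral_le) (use u3 in auto)
  have "(\<integral>\<^sup>+s\<in>{0<..}. ennreal (p s) \<partial>U) \<le> (\<integral>\<^sup>+s\<in>{0<..\<tau>}. ennreal (p s) \<partial>U) + (\<integral>\<^sup>+s\<in>{\<tau><..}. ennreal (p s) \<partial>U)"
    using pos by (intro set_nn_integral_Un_le[OF p]) auto
  also have "(\<integral>\<^sup>+s\<in>{\<tau><..}. ennreal (p s) \<partial>U) \<le> (\<integral>\<^sup>+s\<in>{\<tau><..\<omega>}. ennreal (p s) \<partial>U) + (\<integral>\<^sup>+s\<in>{\<omega><..}. ennreal (p s) \<partial>U)"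
    using pos by (intro set_nn_integral_Un_le[OF p]) auto
  also note near
  also note mid
  also note far
  finally have total: "(\<integral>\<^sup>+s\<in>{0<..}. ennreal (p s) \<partial>U) \<le>
      ennreal (C1 * J + J * (C2 * ln (exp 1 + \<tau> / \<sigma>)) + B * (C2 * \<tau> powr \<beta>)) +
      ((\<integral>\<^sup>+s\<in>{\<tau><..\<omega>}. ennreal (v s) \<partial>U) + ennreal (C3 * (E * \<omega> powr \<beta>)))"
    by (auto simp: add_left_mono add_right_mono)
  have "C1 * J + J * (C2 * ln (exp 1 + \<tau> / \<sigma>)) + B * (C2 * \<tau> powr \<beta>) + C3 * (E * \<omega> powr \<beta>)
      \<le> C * (J * ln (exp 1 + \<tau> / \<sigma>) + B * \<tau> powr \<beta> + E * \<omega> powr \<beta>)"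
  proof -
    define l where "l = ln (exp 1 + \<tau> / \<sigma>)"
    have l: "1 \<le> l" unfolding l_def using order pos by (intro one_le_ln_exp_plus) auto
    have "C1 * J * 1 \<le> C1 * J * l" using l C0 nonneg by (intro mult_left_mono) auto
    moreover have "0 \<le> C3 * (J * l)" "0 \<le> C1 * (B * \<tau> powr \<beta>)" "0 \<le> C3 * (B * \<tau> powr \<beta>)"
      "0 \<le> C1 * (E * \<omega> powr \<beta>)" "0 \<le> C2 * (E * \<omega> powr \<beta>)"
      using C0 K nonneg l by auto
    moreover have "C = C1 + C2 + C3" by (simp add: C_def C1_def C2_def C3_def potential_const_def)
    ultimately show ?thesis unfolding l_def[symmetric] by (simp add: algebra_simps)
  qed
  hence "ennreal (C1 * J + J * (C2 * ln (exp 1 + \<tau> / \<sigma>)) + B * (C2 * \<tau> powr \<beta>)) + ennreal (C3 * (E * \<omega> powr \<beta>))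
      \<le> ennreal (C * (J * ln (exp 1 + \<tau> / \<sigma>) + B * \<tau> powr \<beta> + E * \<omega> powr \<beta>))"
  proof -
    have "0 \<le> ln (exp 1 + \<tau> / \<sigma>)" using order pos by (intro ln_ge_zero add_increasing2) auto
    thus ?thesis using C0 K nonneg \<open>_ \<le> C * _\<close>
      by (subst ennreal_plus[symmetric]) (auto intro!: ennreal_leI simp del: ennreal_plus)
  qed
  from add_right_mono[OF this, of "(\<integral>\<^sup>+s\<in>{\<tau><..\<omega>}. ennreal (v s) \<partial>U)"]
  show ?thesis
    by (intro order_trans[OF total]) (simp only: ac_simps)
qed

lemma potential_integral_lower_log:
  fixes p :: "real \<Rightarrow> real"
  assumes order: "0 < \<sigma>" "\<sigma> \<le> \<tau>" "ereal \<tau> \<le> T" and J: "0 \<le> J"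
    and l: "\<And>s. \<kappa> * \<sigma> < s \<Longrightarrow> s \<le> \<tau> \<Longrightarrow> J * s powr - \<beta> \<le> p s"
  shows "ennreal (J * ln (exp 1 + \<tau> / \<sigma>) / (K * (2 + ln (1 / \<kappa>)))) \<le> (\<integral>\<^sup>+s\<in>{0<..}. ennreal (p s) \<partial>U)"
proof -
  have "ennreal (J * ln (exp 1 + \<tau> / \<sigma>) / (K * (2 + ln (1 / \<kappa>)))) =
      ennreal J * ennreal (ln (exp 1 + \<tau> / \<sigma>) / (K * (2 + ln (1 / \<kappa>))))"
    using J by (simp add: ennreal_mult'[symmetric])
  also have "\<dots> \<le> ennreal J * (\<integral>\<^sup>+s\<in>{\<kappa> * \<sigma><..\<tau>}. ennreal (s powr - \<beta>) \<partial>U)"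
    by (intro mult_left_mono pot_log_lower[OF regular] order) auto
  also have "\<dots> = (\<integral>\<^sup>+s\<in>{\<kappa> * \<sigma><..\<tau>}. ennreal (J * s powr - \<beta>) \<partial>U)"
    by (rule set_nn_integral_cmult_pot[symmetric]) (use J in auto)
  also have "\<dots> \<le> (\<integral>\<^sup>+s\<in>{\<kappa> * \<sigma><..\<tau>}. ennreal (p s) \<partial>U)"
    by (rule set_nn_integral_le) (use l in auto)
  also have "\<dots> \<le> (\<integral>\<^sup>+s\<in>{0<..}. ennreal (p s) \<partial>U)"
  proof (rule nn_integral_mono)
    fix s
    have "0 < \<kappa> * \<sigma>" using pot(3) order by simp
    thus "ennreal (p s) * indicator {\<kappa> * \<sigma><..\<tau>} s \<le> ennreal (p s) * indicator {0<..} s"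
      by (auto split: split_indicator)
  qed
  finally show ?thesis .
qed

lemma potential_integral_lower_volume:
  fixes p v :: "real \<Rightarrow> real"
  assumes order: "0 < \<tau>" and c: "0 \<le> c"
    and v: "(\<lambda>s. ennreal (v s) * indicator {\<kappa> * \<tau><..\<omega>} s) \<in> borel_measurable borel"
    and l: "\<And>s. \<kappa> * \<tau> < s \<Longrightarrow> s \<le> \<omega> \<Longrightarrow> c * v s \<le> p s"
  shows "ennreal c * (\<integral>\<^sup>+s\<in>{\<kappa> * \<tau><..\<omega>}. ennreal (v s) \<partial>U) \<le> (\<integral>\<^sup>+s\<in>{0<..}. ennreal (p s) \<partial>U)"
proof -
  have "ennreal c * (\<integral>\<^sup>+s\<in>{\<kappa> * \<tau><..\<omega>}. ennreal (v s) \<partial>U) =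
      (\<integral>\<^sup>+s. ennreal c * (ennreal (v s) * indicator {\<kappa> * \<tau><..\<omega>} s) \<partial>U)"
    by (rule nn_integral_cmult[symmetric]) (simp add: measurable_pot v)
  also have "\<dots> \<le> (\<integral>\<^sup>+s\<in>{0<..}. ennreal (p s) \<partial>U)"
  proof (rule nn_integral_mono)
    fix s
    have "0 < \<kappa> * \<tau>" using pot(3) order by simp
    thus "ennreal c * (ennreal (v s) * indicator {\<kappa> * \<tau><..\<omega>} s) \<le> ennreal (p s) * indicator {0<..} s"
      using l[of s] c by (auto split: split_indicator simp: ennreal_mult'[symmetric] intro!: ennreal_leI)
  qed
  finally show ?thesis .
qed

text \<open>
A single block, just below \<open>r\<close>, is enough.
\<close>

lemma potential_volume_ge:
  fixes v :: "real \<Rightarrow> real"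
  assumes order: "0 < \<tau>" "\<tau> \<le> r" "r \<le> \<omega>" "ereal \<omega> \<le> T" and v: "0 \<le> v r"
    and anti: "\<And>s. 0 < s \<Longrightarrow> s \<le> r \<Longrightarrow> v r \<le> v s"
  shows "ennreal (v r * r powr \<beta> / K) \<le> (\<integral>\<^sup>+s\<in>{\<kappa> * \<tau><..\<omega>}. ennreal (v s) \<partial>U)"
proof -
  have "ennreal (v r * r powr \<beta> / K) = ennreal (v r) * ennreal (r powr \<beta> / K)"
    using v by (simp add: ennreal_mult'[symmetric])
  also have "\<dots> \<le> ennreal (v r) * emeasure U {\<kappa> * r<..r}"
    using order ereal_le_below[OF order(3,4)] by (intro mult_left_mono pot(8)) auto
  also have "\<dots> = (\<integral>\<^sup>+s. ennreal (v r) * indicator {\<kappa> * r<..r} s \<partial>U)"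
    by (simp add: nn_integral_cmult_indicator pot(1))
  also have "\<dots> \<le> (\<integral>\<^sup>+s\<in>{\<kappa> * \<tau><..\<omega>}. ennreal (v s) \<partial>U)"
  proof (rule nn_integral_mono)
    fix s
    have "0 < \<kappa> * r" "\<kappa> * \<tau> \<le> \<kappa> * r" using pot(3) order by auto
    thus "ennreal (v r) * indicator {\<kappa> * r<..r} s \<le> ennreal (v s) * indicator {\<kappa> * \<tau><..\<omega>} s"
      using anti[of s] order by (auto split: split_indicator intro!: ennreal_leI)
  qed
  finally show ?thesis .
qed

text \<open>
To the right of \<open>\<tau>\<close> the function \<open>v\<close> decays faster than \<open>s^(-\<beta>)\<close>, so times near \<open>\<tau>\<close> dominate; between \<open>\<kappa>\<tau>\<close>
and \<open>\<tau>\<close> it exceeds \<open>v(\<tau>)\<close> by at most a factor depending on \<open>\<kappa>\<close>.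
\<close>

lemma potential_volume_le_left:
  fixes v :: "real \<Rightarrow> real"
  assumes p: "\<beta> < e1" "0 \<le> e2" and order: "0 < \<tau>" "\<tau> \<le> \<omega>" "ereal \<omega> \<le> T"
    and v: "0 \<le> v \<tau>" and Q: "0 \<le> Q"
    and up: "\<And>s. \<tau> \<le> s \<Longrightarrow> s \<le> \<omega> \<Longrightarrow> v s \<le> Q * v \<tau> * (\<tau> / s) powr e1"
    and down: "\<And>s. 0 < s \<Longrightarrow> s \<le> \<tau> \<Longrightarrow> v s \<le> Q * v \<tau> * (\<tau> / s) powr e2"
  shows "(\<integral>\<^sup>+s\<in>{\<kappa> * \<tau><..\<omega>}. ennreal (v s) \<partial>U) \<le>
    ennreal (Q * \<kappa> powr (\<beta> - e1 - e2) * (K * 2 powr \<beta> / (1 - 2 powr (\<beta> - e1))) * (v \<tau> * \<tau> powr \<beta>))"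
proof -
  note \<beta> = pot(2) and \<kappa> = pot(3,4)
  define C where "C = K * 2 powr \<beta> / (1 - 2 powr (\<beta> - e1))"
  have \<kappa>\<tau>: "0 < \<kappa> * \<tau>" using \<kappa> order by simp
  have "(\<integral>\<^sup>+s\<in>{\<kappa> * \<tau><..\<omega>}. ennreal (v s) \<partial>U) \<le>
      ennreal (Q * v \<tau> * \<kappa> powr - e2 * \<tau> powr e1 * (C * (\<kappa> * \<tau>) powr (\<beta> - e1)))"
  proof (rule set_nn_integral_power_le[where a="- e1"])
    show "(\<integral>\<^sup>+s\<in>{\<kappa> * \<tau><..\<omega>}. ennreal (s powr - e1) \<partial>U) \<le> ennreal (C * (\<kappa> * \<tau>) powr (\<beta> - e1))"
      unfolding C_def by (rule pot_power_away_from_zero[OF regular p(1) \<kappa>\<tau> order(3)])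
    fix s assume s: "s \<in> {\<kappa> * \<tau><..\<omega>}"
    hence s0: "0 < s" using \<kappa>\<tau> by auto
    have ratio: "(\<tau> / s) powr e1 = \<tau> powr e1 * s powr - e1"
      using s0 order by (simp add: powr_divide powr_minus_divide)
    have \<kappa>1: "1 \<le> \<kappa> powr - e2" using \<kappa> p(2) powr_mono2'[of "- e2" \<kappa> 1] by simp
    have Qv: "0 \<le> Q * v \<tau>" using Q v by simp
    have "v s \<le> Q * v \<tau> * (\<kappa> powr - e2 * (\<tau> / s) powr e1)"
    proof (cases "\<tau> \<le> s")
      case True
      have "v s \<le> Q * v \<tau> * (\<tau> / s) powr e1" using up True s by simp
      also have "\<dots> \<le> Q * v \<tau> * (\<kappa> powr - e2 * (\<tau> / s) powr e1)"
        using mult_right_mono[OF \<kappa>1, of "(\<tau> / s) powr e1"] Qv by (intro mult_left_mono) auto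
      finally show ?thesis .
    next
      case False
      have "\<tau> / s \<le> 1 / \<kappa>" using s s0 \<kappa> by (simp add: field_simps)
      hence "(\<tau> / s) powr e2 \<le> (1 / \<kappa>) powr e2" using order s0 p(2) by (intro powr_mono2) auto
      also have "\<dots> = \<kappa> powr - e2" using \<kappa> by (simp add: powr_divide powr_minus_divide)
      finally have "(\<tau> / s) powr e2 \<le> \<kappa> powr - e2" .
      moreover have "1 \<le> (\<tau> / s) powr e1" using False s0 p \<beta> by (intro ge_one_powr_ge_zero) auto
      ultimately have "(\<tau> / s) powr e2 * 1 \<le> \<kappa> powr - e2 * (\<tau> / s) powr e1"
        by (intro mult_mono) auto
      hence "Q * v \<tau> * (\<tau> / s) powr e2 \<le> Q * v \<tau> * (\<kappa> powr - e2 * (\<tau> / s) powr e1)"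
        using Qv by (intro mult_left_mono) auto
      thus ?thesis using down[of s] False s0 by simp
    qed
    thus "v s \<le> Q * v \<tau> * \<kappa> powr - e2 * \<tau> powr e1 * s powr - e1" by (simp add: ratio mult.assoc)
  qed (use Q v in auto)
  also have "Q * v \<tau> * \<kappa> powr - e2 * \<tau> powr e1 * (C * (\<kappa> * \<tau>) powr (\<beta> - e1)) =
      Q * \<kappa> powr (\<beta> - e1 - e2) * C * (v \<tau> * \<tau> powr \<beta>)"
  proof -
    have "\<kappa> powr (\<beta> - e1 - e2) = \<kappa> powr (\<beta> - e1) * \<kappa> powr - e2" by (simp add: powr_add[symmetric])
    moreover have "\<tau> powr \<beta> = \<tau> powr e1 * \<tau> powr (\<beta> - e1)" by (simp add: powr_add[symmetric])
    moreover have "(\<kappa> * \<tau>) powr (\<beta> - e1) = \<kappa> powr (\<beta> - e1) * \<tau> powr (\<beta> - e1)"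
      using \<kappa> order by (simp add: powr_mult)
    ultimately show ?thesis by simp
  qed
  finally show ?thesis by (simp add: C_def)
qed

text \<open>
To the left of \<open>\<omega>\<close> the function \<open>v\<close> grows more slowly than \<open>s^(-\<beta>)\<close>, so times near \<open>\<omega>\<close> dominate.
\<close>

lemma potential_volume_le_right:
  fixes v :: "real \<Rightarrow> real"
  assumes p: "0 \<le> e2" "e2 < \<beta>" and order: "0 < \<tau>" "\<tau> \<le> \<omega>" "ereal \<omega> \<le> T"
    and v: "0 \<le> v \<omega>" and Q: "0 \<le> Q"
    and down: "\<And>s. 0 < s \<Longrightarrow> s \<le> \<omega> \<Longrightarrow> v s \<le> Q * v \<omega> * (\<omega> / s) powr e2"
  shows "(\<integral>\<^sup>+s\<in>{\<kappa> * \<tau><..\<omega>}. ennreal (v s) \<partial>U) \<le>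
    ennreal (Q * (K * 2 powr e2 / (1 - 2 powr (e2 - \<beta>))) * (v \<omega> * \<omega> powr \<beta>))"
proof -
  define C where "C = K * 2 powr e2 / (1 - 2 powr (e2 - \<beta>))"
  have \<omega>: "0 < \<omega>" using order by simp
  have \<kappa>\<tau>: "0 < \<kappa> * \<tau>" using pot(3) order by simp
  have "(\<integral>\<^sup>+s\<in>{\<kappa> * \<tau><..\<omega>}. ennreal (v s) \<partial>U) \<le> (\<integral>\<^sup>+s\<in>{0<..\<omega>}. ennreal (v s) \<partial>U)"
    using \<kappa>\<tau> by (intro nn_integral_mono) (auto split: split_indicator)
  also have "\<dots> \<le> ennreal (Q * v \<omega> * \<omega> powr e2 * (C * \<omega> powr (\<beta> - e2)))"
  proof (rule set_nn_integral_power_le[where a="- e2"])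
    show "(\<integral>\<^sup>+s\<in>{0<..\<omega>}. ennreal (s powr - e2) \<partial>U) \<le> ennreal (C * \<omega> powr (\<beta> - e2))"
      unfolding C_def by (rule pot_power_near_zero[OF regular p \<omega> order(3)])
    fix s assume s: "s \<in> {0<..\<omega>}"
    have "(\<omega> / s) powr e2 = \<omega> powr e2 * s powr - e2"
      using s by (simp add: powr_divide powr_minus_divide)
    thus "v s \<le> Q * v \<omega> * \<omega> powr e2 * s powr - e2" using down[of s] s by (simp add: mult.assoc)
  qed (use Q v in auto)
  also have "Q * v \<omega> * \<omega> powr e2 * (C * \<omega> powr (\<beta> - e2)) = Q * C * (v \<omega> * \<omega> powr \<beta>)"
  proof -
    have "\<omega> powr \<beta> = \<omega> powr e2 * \<omega> powr (\<beta> - e2)" by (simp add: powr_add[symmetric])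
    thus ?thesis by simp
  qed
  finally show ?thesis by (simp add: C_def)
qed

text \<open>
Replacing \<open>\<tau>\<close> by \<open>\<kappa>\<tau>\<close> changes the logarithm at most by the factor \<open>1 + ln(1/\<kappa>)\<close>.
\<close>

lemma potential_volume_critical:
  fixes v :: "real \<Rightarrow> real"
  assumes order: "0 < \<tau>" "\<tau> \<le> \<omega>" "ereal \<omega> \<le> T" and Q: "0 < Q"
    and v: "\<And>s. 0 < s \<Longrightarrow> s \<le> \<omega> \<Longrightarrow> within_factor Q (v s) (s powr - \<beta>)"
  shows "(\<integral>\<^sup>+s\<in>{\<kappa> * \<tau><..\<omega>}. ennreal (v s) \<partial>U) \<le>
      ennreal (Q * (3 * K * 2 powr \<beta> * (1 + ln (1 / \<kappa>))) * ln (exp 1 + \<omega> / \<tau>))"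
    and "ennreal (1 / Q / (K * (2 + ln (1 / \<kappa>))) * ln (exp 1 + \<omega> / \<tau>)) \<le>
      (\<integral>\<^sup>+s\<in>{\<kappa> * \<tau><..\<omega>}. ennreal (v s) \<partial>U)"
proof -
  note \<kappa> = pot(3,4)
  have \<kappa>\<tau>: "0 < \<kappa> * \<tau>" "\<kappa> * \<tau> \<le> \<omega>"
    using \<kappa> order order_trans[OF mult_left_le_one_le[of \<tau> \<kappa>] order(2)] by auto
  define L where "L = ln (1 / \<kappa>)"
  have L: "0 \<le> L" using \<kappa> by (simp add: L_def ln_div)
  have "(\<integral>\<^sup>+s\<in>{\<kappa> * \<tau><..\<omega>}. ennreal (v s) \<partial>U) \<le>
      ennreal (Q * (3 * K * 2 powr \<beta> * ln (exp 1 + \<omega> / (\<kappa> * \<tau>))))"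
    by (rule set_nn_integral_power_le[where a="- \<beta>", OF _ _ _ pot_log_upper[OF regular \<kappa>\<tau> order(3)]])
       (use v \<kappa>\<tau> Q in auto)
  also have "\<dots> \<le> ennreal (Q * (3 * K * 2 powr \<beta> * ((1 + L) * ln (exp 1 + \<omega> / \<tau>))))"
  proof (intro ennreal_leI mult_left_mono)
    define x where "x = \<omega> / \<tau>"
    have x: "0 < x" using order by (simp add: x_def)
    have l: "1 \<le> ln (exp 1 + x)" using x by (intro one_le_ln_exp_plus) auto
    have "exp 1 + \<omega> / (\<kappa> * \<tau>) = exp 1 + 1 / \<kappa> * x" using \<kappa> order by (simp add: x_def)
    also have "\<dots> \<le> 1 / \<kappa> * (exp 1 + x)"
    proof -
      have "exp 1 * 1 \<le> exp 1 * (1 / \<kappa>)" using \<kappa> by (intro mult_left_mono) auto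
      thus ?thesis by (simp add: distrib_left)
    qed
    finally have "ln (exp 1 + \<omega> / (\<kappa> * \<tau>)) \<le> ln (1 / \<kappa> * (exp 1 + x))"
      using \<kappa> order x by (subst ln_le_cancel_iff) (auto intro!: add_pos_pos divide_pos_pos)
    also have "\<dots> = L + ln (exp 1 + x)" 
      using \<kappa> add_pos_pos[OF exp_gt_zero[of 1] x] by (subst ln_mult) (auto simp: L_def)
    also have "\<dots> \<le> (1 + L) * ln (exp 1 + x)" using mult_left_mono[OF l L] by (simp add: algebra_simps)
    finally show "ln (exp 1 + \<omega> / (\<kappa> * \<tau>)) \<le> (1 + L) * ln (exp 1 + \<omega> / \<tau>)" by (simp add: x_def)
  qed (use Q pot(5) in auto)
  finally show "(\<integral>\<^sup>+s\<in>{\<kappa> * \<tau><..\<omega>}. ennreal (v s) \<partial>U) \<le>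
      ennreal (Q * (3 * K * 2 powr \<beta> * (1 + ln (1 / \<kappa>))) * ln (exp 1 + \<omega> / \<tau>))"
    by (simp add: L_def mult.assoc)
  have "ennreal (1 / Q / (K * (2 + L)) * ln (exp 1 + \<omega> / \<tau>)) =
      ennreal (1 / Q) * ennreal (ln (exp 1 + \<omega> / \<tau>) / (K * (2 + L)))"
    using Q by (simp add: ennreal_mult'[symmetric])
  also have "\<dots> \<le> ennreal (1 / Q) * (\<integral>\<^sup>+s\<in>{\<kappa> * \<tau><..\<omega>}. ennreal (s powr - \<beta>) \<partial>U)"
    unfolding L_def by (intro mult_left_mono pot_log_lower[OF regular] order) auto
  also have "\<dots> = (\<integral>\<^sup>+s\<in>{\<kappa> * \<tau><..\<omega>}. ennreal (1 / Q * s powr - \<beta>) \<partial>U)"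
    by (rule set_nn_integral_cmult_pot[symmetric]) (use Q in auto)
  also have "\<dots> \<le> (\<integral>\<^sup>+s\<in>{\<kappa> * \<tau><..\<omega>}. ennreal (v s) \<partial>U)"
    by (rule set_nn_integral_le) (use v \<kappa>\<tau> in auto)
  finally show "ennreal (1 / Q / (K * (2 + ln (1 / \<kappa>))) * ln (exp 1 + \<omega> / \<tau>)) \<le>
      (\<integral>\<^sup>+s\<in>{\<kappa> * \<tau><..\<omega>}. ennreal (v s) \<partial>U)"
    by (simp add: L_def)
qed

end

section \<open>Scale functions and volumes\<close>

context
  fixes \<Phi> :: "real \<Rightarrow> real" and a b :: real
  assumes scaling: "weak_scaling \<Phi> a b"
    and mono: "strict_mono_on {0..} \<Phi>" and nonneg: "\<forall>r\<ge>0. 0 \<le> \<Phi> r"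
begin

lemma scale_index_pos: "0 < a" "0 < b"
  using scaling by (auto simp: weak_scaling_def)

lemma scale_pos: "0 < r \<Longrightarrow> 0 < \<Phi> r"
  using strict_mono_onD[OF mono, of 0 r] nonneg by fastforce

lemma scale_mono: "0 \<le> r \<Longrightarrow> r \<le> s \<Longrightarrow> \<Phi> r \<le> \<Phi> s"
  using strict_mono_on_leD[OF mono, of r s] by simp

lemma scale_less_iff: "0 \<le> r \<Longrightarrow> 0 \<le> s \<Longrightarrow> \<Phi> r < \<Phi> s \<longleftrightarrow> r < s"
  using strict_mono_on_less[OF mono, of r s] by simp

lemma scale_ratio:
  obtains C where "1 \<le> C" "\<And>r R. 0 < r \<Longrightarrow> r \<le> R \<Longrightarrow>
    between_powers C a b (R / r) (\<Phi> R / \<Phi> r)"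
proof -
  obtain c1 c2 where c: "0 < c1" "0 < c2" and cb: "\<And>r R. 0 < r \<Longrightarrow> r \<le> R \<Longrightarrow>
      c1 * (R / r) powr a \<le> \<Phi> R / \<Phi> r \<and> \<Phi> R / \<Phi> r \<le> c2 * (R / r) powr b"
    using scaling unfolding weak_scaling_def by blast
  define C where "C = max 1 (max c2 (1 / c1))"
  have C: "1 \<le> C" "c2 \<le> C" "1 / c1 \<le> C" by (auto simp: C_def)
  have c1: "1 / C \<le> c1" using C c by (simp add: field_simps)
  show thesis
  proof (rule that[OF C(1)], intro conjI)
    fix r R :: real assume r: "0 < r" "r \<le> R"
    have "(R / r) powr a / C \<le> c1 * (R / r) powr a"
      using mult_right_mono[OF c1, of "(R / r) powr a"] by simp
    thus "(R / r) powr a / C \<le> \<Phi> R / \<Phi> r" using cb[OF r] by linarith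
    have "c2 * (R / r) powr b \<le> C * (R / r) powr b" using C by (intro mult_right_mono) auto
    thus "\<Phi> R / \<Phi> r \<le> C * (R / r) powr b" using cb[OF r] by linarith
  qed
qed

lemma scale_unbounded:
  assumes "0 < s"
  shows "\<exists>r>0. s < \<Phi> r" and "\<exists>r>0. \<Phi> r \<le> s"
proof -
  obtain C where C: "1 \<le> C" and cb: "\<And>r R. 0 < r \<Longrightarrow> r \<le> R \<Longrightarrow>
      between_powers C a b (R / r) (\<Phi> R / \<Phi> r)"
    by (rule scale_ratio) blast
  note a = scale_index_pos(1)
  define F where "F = \<Phi> 1"
  have F: "0 < F" unfolding F_def by (rule scale_pos) simp
  show "\<exists>r>0. s < \<Phi> r"
  proof -
    define z where "z = (s + 1) * C / F"
    define r where "r = max 1 (z powr (1 / a))"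
    have "0 < z" using assms C F by (simp add: z_def)
    hence "z = (z powr (1 / a)) powr a" using a by (simp add: powr_powr)
    also have "\<dots> \<le> r powr a" using a by (intro powr_mono2) (auto simp: r_def)
    finally have "z / C \<le> r powr a / C" using C by (intro divide_right_mono) auto
    also have "\<dots> \<le> \<Phi> r / F" using cb[of 1 r] by (simp add: r_def F_def)
    finally have "(s + 1) / F \<le> \<Phi> r / F" using C by (simp add: z_def)
    hence "s + 1 \<le> \<Phi> r" using F by (simp add: divide_le_cancel)
    thus ?thesis by (intro exI[of _ r]) (auto simp: r_def)
  qed
  show "\<exists>r>0. \<Phi> r \<le> s"
  proof -
    define z where "z = s / (F * C)"
    define r where "r = min 1 (z powr (1 / a))"
    have z: "0 < z" using assms C F by (simp add: z_def)
    have r: "0 < r" "r \<le> 1" using z by (auto simp: r_def)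
    have "r powr a \<le> (z powr (1 / a)) powr a" using a r by (intro powr_mono2) (auto simp: r_def)
    also have "\<dots> = z" using a z by (simp add: powr_powr)
    finally have rz: "r powr a \<le> z" .
    have "(1 / r) powr a / C \<le> F / \<Phi> r" using cb[of r 1] r by (simp add: F_def)
    hence "\<Phi> r \<le> F * C * r powr a"
      using r C F scale_pos[OF r(1)] by (simp add: powr_divide field_simps)
    also have "\<dots> \<le> F * C * z" using rz C F by (intro mult_left_mono) auto
    also have "\<dots> = s" using C F by (simp add: z_def)
    finally show ?thesis using r by blast
  qed
qed

text \<open>
A scale function may jump, so that \<open>\<Phi>(\<Phi>\<^sup>-\<^sup>1(s))\<close> need not be \<open>s\<close>; the last two inequalities take the place of
this identity.
\<close>

lemma scale_inv_bounds:
  assumes s: "0 < s"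
  shows scale_inv_pos: "0 < scale_inv \<Phi> s"
    and scale_inv_below: "0 \<le> r \<Longrightarrow> r < scale_inv \<Phi> s \<Longrightarrow> \<Phi> r \<le> s"
    and scale_inv_above: "scale_inv \<Phi> s < r \<Longrightarrow> s < \<Phi> r"
proof -
  let ?X = "{r. 0 \<le> r \<and> s < \<Phi> r}"
  have bdd: "bdd_below ?X" by (rule bdd_belowI[of _ 0]) auto
  obtain R where R: "0 < R" "s < \<Phi> R" using scale_unbounded(1)[OF s] by auto
  hence ne: "?X \<noteq> {}" by (auto intro!: exI[of _ R])
  obtain q where q: "0 < q" "\<Phi> q \<le> s" using scale_unbounded(2)[OF s] by auto
  have "q \<le> Inf ?X"
  proof (rule cInf_greatest[OF ne])
    fix r assume "r \<in> ?X"
    thus "q \<le> r" using q scale_less_iff[of q r] by auto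
  qed
  thus "0 < scale_inv \<Phi> s" using q by (simp add: scale_inv_def)
  show "\<Phi> r \<le> s" if "0 \<le> r" "r < scale_inv \<Phi> s"
  proof (rule ccontr)
    assume "\<not> \<Phi> r \<le> s"
    hence "Inf ?X \<le> r" using that by (intro cInf_lower[OF _ bdd]) auto
    thus False using that by (simp add: scale_inv_def)
  qed
  show "s < \<Phi> r" if less: "scale_inv \<Phi> s < r"
  proof -
    obtain r' where "r' \<in> ?X" "r' < r" 
      using cInf_lessD[OF ne less[unfolded scale_inv_def]] by blast
    thus ?thesis using scale_mono[of r' r] by auto
  qed
qed

lemma scale_inv_mono:
  assumes "0 < s" "s \<le> t"
  shows "scale_inv \<Phi> s \<le> scale_inv \<Phi> t"
  unfolding scale_inv_def
proof (rule cInf_superset_mono)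
  show "{r. 0 \<le> r \<and> t < \<Phi> r} \<noteq> {}" using scale_unbounded(1)[of t] assms by force
qed (use assms in \<open>auto intro!: bdd_belowI[of _ 0]\<close>)

lemma scale_inv_scale:
  assumes "0 \<le> r"
  shows "scale_inv \<Phi> (\<Phi> r) = r"
proof -
  have "{q. 0 \<le> q \<and> \<Phi> r < \<Phi> q} = {r<..}" using assms by (auto simp: scale_less_iff)
  thus ?thesis by (simp add: scale_inv_def)
qed

text \<open>
The arguments \<open>\<Phi>\<^sup>-\<^sup>1(s)\<close> and \<open>\<Phi>\<^sup>-\<^sup>1(t)\<close> are moved by a factor 2, to the side on which \<open>\<Phi>\<close> is known to be below or
above \<open>s\<close> and \<open>t\<close>.
\<close>

lemma scale_inv_ratio:
  obtains C where "1 \<le> C" "\<And>s t. 0 < s \<Longrightarrow> s \<le> t \<Longrightarrow>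
    between_powers C (1 / b) (1 / a) (t / s) (scale_inv \<Phi> t / scale_inv \<Phi> s)"
proof -
  obtain C where C: "1 \<le> C" and cb: "\<And>r R. 0 < r \<Longrightarrow> r \<le> R \<Longrightarrow>
      between_powers C a b (R / r) (\<Phi> R / \<Phi> r)"
    by (rule scale_ratio) blast
  note ab = scale_index_pos
  define C' where "C' = max (4 * C powr (1 / b)) (4 * C powr (1 / a))"
  have C': "4 * C powr (1 / b) \<le> C'" "4 * C powr (1 / a) \<le> C'" by (auto simp: C'_def)
  have C1: "1 \<le> C powr (1 / b)" "1 \<le> C powr (1 / a)"
    using C ab by (auto intro!: ge_one_powr_ge_zero)
  show thesis
  proof (rule that[of C'])
    show "1 \<le> C'" using C' C1 by linarith
    fix s t :: real assume st: "0 < s" "s \<le> t"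
    define i j where "i = scale_inv \<Phi> s" and "j = scale_inv \<Phi> t"
    have ij: "0 < i" "i \<le> j" using scale_inv_pos[OF st(1)] scale_inv_mono[OF st] by (auto simp: i_def j_def)
    have t: "0 < t" using st by simp
    have lower: "(t / s) powr (1 / b) / C' \<le> j / i"
    proof -
      have s1: "\<Phi> (i / 2) \<le> s" using scale_inv_below[OF st(1), of "i / 2"] ij by (simp add: i_def)
      have t1: "t < \<Phi> (2 * j)" using scale_inv_above[OF t, of "2 * j"] ij by (simp add: j_def)
      have p: "0 < \<Phi> (i / 2)" using ij by (intro scale_pos) auto
      have "t / s \<le> \<Phi> (2 * j) / \<Phi> (i / 2)" using s1 t1 p t by (intro frac_le) auto
      also have "\<dots> \<le> C * (2 * j / (i / 2)) powr b" using cb[of "i / 2" "2 * j"] ij by auto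
      finally have "t / s \<le> C * (4 * (j / i)) powr b" using ij by (simp add: field_simps)
      hence "(t / s) powr (1 / b) \<le> (C * (4 * (j / i)) powr b) powr (1 / b)"
        using st ab by (intro powr_mono2) auto
      also have "\<dots> = C powr (1 / b) * (4 * (j / i))"
        using C ij ab by (simp add: powr_mult powr_powr)
      also have "\<dots> \<le> C' * (j / i)"
        using mult_right_mono[OF C'(1), of "j / i"] ij by (simp add: mult_ac)
      finally show ?thesis using \<open>1 \<le> C'\<close> by (simp add: field_simps)
    qed
    moreover have "j / i \<le> C' * (t / s) powr (1 / a)"
    proof (cases "2 * i \<le> j / 2")
      case True
      have s1: "s < \<Phi> (2 * i)" using scale_inv_above[OF st(1), of "2 * i"] ij by (simp add: i_def)
      have t1: "\<Phi> (j / 2) \<le> t" using scale_inv_below[OF t, of "j / 2"] ij by (simp add: j_def)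
      have "(j / 2 / (2 * i)) powr a / C \<le> \<Phi> (j / 2) / \<Phi> (2 * i)"
        using cb[of "2 * i" "j / 2"] True ij by auto
      also have "\<dots> \<le> t / s" using s1 t1 st scale_pos[of "j / 2"] ij by (intro frac_le) auto
      finally have "(j / i / 4) powr a \<le> C * (t / s)" using C by (simp add: field_simps)
      hence "((j / i / 4) powr a) powr (1 / a) \<le> (C * (t / s)) powr (1 / a)"
        using ab by (intro powr_mono2) auto
      also have "\<dots> = C powr (1 / a) * (t / s) powr (1 / a)" by (rule powr_mult)
      finally have "j / i \<le> 4 * C powr (1 / a) * (t / s) powr (1 / a)"
        using ij ab by (simp add: powr_powr)
      also have "\<dots> \<le> C' * (t / s) powr (1 / a)" by (rule mult_right_mono[OF C'(2)]) simp
      finally show ?thesis .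
    next
      case False
      hence "j / i \<le> 4" using ij by (simp add: field_simps)
      also have "\<dots> \<le> C'" using C' C1 by linarith
      also have "\<dots> \<le> C' * (t / s) powr (1 / a)"
        using ge_one_powr_ge_zero[of "t / s" "1 / a"] st ab \<open>1 \<le> C'\<close>
        by simp
      finally show ?thesis .
    qed
    ultimately show "between_powers C' (1 / b) (1 / a) (t / s) (scale_inv \<Phi> t / scale_inv \<Phi> s)"
      by (simp add: i_def j_def)
  qed
qed

end

text \<open>
The volume condition with a single constant, for all radii up to and including \<open>L\<close>.
\<close>

definition vol_scaled :: "'a::metric_space measure \<Rightarrow> real \<Rightarrow> real \<Rightarrow> real \<Rightarrow> ereal \<Rightarrow> bool" where
  "vol_scaled m C d1 d2 L \<longleftrightarrow> (\<forall>x r R. 0 < r \<and> r \<le> R \<and> ereal R \<le> L \<longrightarrow>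
     between_powers C d1 d2 (R / r) (vol m x R / vol m x r))"

lemma volume_scaling_vol_scaled:
  assumes vs: "volume_scaling m R_E d1 d2" and L: "L < \<infinity> \<or> R_E = \<infinity>"
  obtains C where "1 \<le> C" "vol_scaled m C d1 d2 L"
proof -
  have RE: "0 < R_E" using vs by (simp add: volume_scaling_def)
  obtain a where a: "1 \<le> a" and below: "\<And>R. ereal R \<le> L \<Longrightarrow> ereal R < ereal a * R_E"
  proof (cases R_E)
    case (real e)
    hence e: "0 < e" using RE by simp
    show thesis
    proof (cases L)
      case (real l)
      \<comment> \<open>\<open>l + 1\<close> instead of \<open>l\<close> because the volume condition excludes the end of the range\<close>
      define a where "a = max 1 ((l + 1) / e)"
      have le: "l + 1 \<le> a * e" using e by (simp add: a_def max_def field_simps)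
      show ?thesis
      proof (rule that[of a])
        fix R assume "ereal R \<le> L"
        hence "R < a * e" using le real by simp
        thus "ereal R < ereal a * R_E" using \<open>R_E = ereal e\<close> by simp
      qed (simp add: a_def)
    next
      case PInf
      thus ?thesis using L real by simp
    next
      case MInf
      thus ?thesis using that[of 1] by simp
    qed
  next
    case PInf
    thus ?thesis using that[of 1] by simp
  next
    case MInf
    thus ?thesis using RE by simp
  qed
  obtain C where C: "1 \<le> C" "\<And>x r R. 0 < r \<Longrightarrow> r \<le> R \<Longrightarrow> ereal R < ereal a * R_E \<Longrightarrow>
        inverse C * (R / r) powr d1 \<le> vol m x R / vol m x r \<and>
        vol m x R / vol m x r \<le> C * (R / r) powr d2"
    using vs a unfolding volume_scaling_def by meson
  show thesis
    by (rule that[OF C(1)]) (use C(2) below in \<open>auto simp: vol_scaled_def divide_inverse mult.commute\<close>)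
qed

lemma vol_mono:
  fixes m :: "'a::heine_borel measure"
  assumes m: "radon_full_support m" and sub: "ball x r \<subseteq> ball y R"
  shows "vol m x r \<le> vol m y R"
proof -
  have "emeasure m (ball y R) \<le> emeasure m (cball y R)"
    using m by (intro emeasure_mono) (auto simp: radon_full_support_def)
  also have "\<dots> < \<infinity>" using m by (auto simp: radon_full_support_def)
  finally have "ball y R \<in> fmeasurable m"
    using m by (auto simp: radon_full_support_def fmeasurable_def)
  thus ?thesis unfolding vol_def
    using m sub by (intro measure_mono_fmeasurable) (auto simp: radon_full_support_def)
qed

lemma vol_pos:
  assumes C: "1 \<le> C" and vs: "vol_scaled m C d1 d2 L" and r: "0 < r" "ereal r \<le> L"
  shows "0 < vol m x r"
proof -
  have "(r / r) powr d1 / C \<le> vol m x r / vol m x r" using vs r unfolding vol_scaled_def by blast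
  hence "1 / C \<le> vol m x r / vol m x r" using r by simp
  hence "vol m x r \<noteq> 0" using C by auto
  thus ?thesis using measure_nonneg[of m "ball x r"] unfolding vol_def by linarith
qed

text \<open>
A ball around a point of \<open>D\<close> and the ball with the same radius around a fixed \<open>x0\<close> contain each other after
enlarging the radius by the diameter.
\<close>

lemma vol_uniform_bounds:
  fixes m :: "'a::heine_borel measure"
  assumes m: "radon_full_support m" and vs: "volume_scaling m R_E d1 d2"
    and D: "bounded D" "x0 \<in> D" and r: "0 < r"
  obtains c where "0 < c" "\<And>x. x \<in> D \<Longrightarrow> 1 / c \<le> vol m x r \<and> vol m x r \<le> c"
proof -
  define R where "R = r + diameter D"
  have R: "0 < r" "r \<le> R" using r diameter_ge_0[OF D(1)] by (auto simp: R_def)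
  obtain C where C: "1 \<le> C" "vol_scaled m C d1 d2 (ereal R)"
    using volume_scaling_vol_scaled[OF vs, of "ereal R"] by auto
  have p0: "0 < vol m x0 r" using vol_pos[OF C R(1)] R by simp
  define u where "u = C * (R / r) powr d2 / vol m x0 r"
  define c where "c = max u (vol m x0 R)"
  have u: "0 < u" using C R p0 by (simp add: u_def)
  show thesis
  proof (rule that[of c])
    show c0: "0 < c" using u by (simp add: c_def)
    fix x assume x: "x \<in> D"
    have d: "dist x x0 \<le> diameter D" using diameter_bounded_bound[OF D(1) x D(2)] .
    have px: "0 < vol m x r" using vol_pos[OF C R(1)] R by simp
    have "vol m x0 r \<le> vol m x R"
    proof (rule vol_mono[OF m], rule subsetI)
      fix z assume "z \<in> ball x0 r"
      thus "z \<in> ball x R" using d dist_triangle[of x z x0] by (simp add: R_def)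
    qed
    also have "\<dots> \<le> C * (R / r) powr d2 * vol m x r"
    proof -
      have "vol m x R / vol m x r \<le> C * (R / r) powr d2" using C(2) R by (auto simp: vol_scaled_def)
      thus ?thesis using px by (simp add: pos_divide_le_eq)
    qed
    finally have "1 / u \<le> vol m x r" using C R p0 u by (simp add: u_def field_simps)
    moreover have "1 / c \<le> 1 / u" using u c0 by (intro divide_left_mono) (auto simp: c_def)
    moreover have "vol m x r \<le> vol m x0 R"
    proof (rule vol_mono[OF m], rule subsetI)
      fix z assume "z \<in> ball x r"
      thus "z \<in> ball x0 R" using d dist_triangle[of x0 z x] by (simp add: R_def dist_commute)
    qed
    ultimately show "1 / c \<le> vol m x r \<and> vol m x r \<le> c" by (auto simp: c_def)
  qed
qed

text \<open>
Equality of the exponents gives \<open>V(x,r)\<close> comparable with \<open>(r/R)^d V(x,R)\<close>.  It remains to choose a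
reference radius \<open>R\<close> at which the volume is known to be of order \<open>R^d\<close> independently of \<open>x\<close>: a fixed radius
if \<open>D\<close> is bounded, and a radius not smaller than the distance of \<open>x\<close> to a fixed point \<open>x0\<close> if the scaling is global.
\<close>

lemma vol_power_law:
  fixes m :: "'a::heine_borel measure"
  assumes m: "radon_full_support m" and vs: "volume_scaling m R_E d d"
    and D: "x0 \<in> D" and L: "0 < L" "bounded D \<and> L < \<infinity> \<or> R_E = \<infinity>"
  obtains c where "1 \<le> c" "\<And>x r. x \<in> D \<Longrightarrow> 0 < r \<Longrightarrow> ereal r \<le> L \<Longrightarrow>
    within_factor c (vol m x r) (r powr d)"
proof -
  have d: "0 < d" using vs by (simp add: volume_scaling_def)
  \<comment> \<open>a reference radius for each point, at which the volume is known up to constants\<close>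
  have "\<exists>c\<ge>1. \<forall>x r. x \<in> D \<and> 0 < r \<and> ereal r \<le> L \<longrightarrow>
      (\<exists>R\<ge>r. R powr d / c \<le> vol m x R \<and> vol m x R \<le> c * R powr d \<and>
        between_powers c d d (R / r) (vol m x R / vol m x r))"
  proof (cases "R_E = \<infinity>")
    case True
    obtain C where C: "1 \<le> C" "vol_scaled m C d d \<infinity>"
      using volume_scaling_vol_scaled[OF vs, of \<infinity>] True by auto
    have sc: "(R / r) powr d / C \<le> vol m x R / vol m x r" "vol m x R / vol m x r \<le> C * (R / r) powr d"
      "0 < vol m x r" if "0 < r" "r \<le> R" for x r R
      using C that vol_pos[OF C] by (auto simp: vol_scaled_def)
    define w where "w = vol m x0 1"
    have w: "0 < w" using sc(3)[of 1 1] by (simp add: w_def)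
    define c where "c = Max {C, C * 2 powr d * w, C\<^sup>2 * 2 powr d / w}"
    have c: "C \<le> c" "C * 2 powr d * w \<le> c" "C\<^sup>2 * 2 powr d / w \<le> c"
      unfolding c_def by (rule Max_ge; simp)+
    have c1: "1 \<le> c" using C c by simp
    show ?thesis
    proof (rule exI[of _ c], intro conjI c1 allI impI)
      fix x r assume "x \<in> D \<and> 0 < r \<and> ereal r \<le> L"
      hence r: "0 < r" by simp
      define R where "R = max r (max 1 (dist x x0))"
      have R: "r \<le> R" "1 \<le> R" "dist x x0 \<le> R" by (auto simp: R_def)
      have "vol m x R \<le> vol m x0 (2 * R)"
      proof (rule vol_mono[OF m], rule subsetI)
        fix z assume "z \<in> ball x R"
        thus "z \<in> ball x0 (2 * R)" using R dist_triangle[of x0 z x] by (simp add: dist_commute)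
      qed
      also have "\<dots> \<le> C * (2 * R) powr d * w"
        using sc(2)[of 1 "2 * R" x0] R w by (simp add: w_def field_simps)
      also have "\<dots> = C * 2 powr d * w * R powr d" using R by (simp add: powr_mult)
      also have "\<dots> \<le> c * R powr d" using c by (intro mult_right_mono) auto
      finally have up: "vol m x R \<le> c * R powr d" .
      have "R powr d * w / C \<le> vol m x0 R"
        using sc(1)[of 1 R x0] R w C by (simp add: w_def field_simps)
      also have "\<dots> \<le> vol m x (2 * R)"
      proof (rule vol_mono[OF m], rule subsetI)
        fix z assume "z \<in> ball x0 R"
        thus "z \<in> ball x (2 * R)" using R dist_triangle[of x z x0] by simp
      qed
      also have "\<dots> \<le> C * 2 powr d * vol m x R"
        using sc(2)[of R "2 * R" x] sc(3)[of R R x] R by (simp add: field_simps)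
      finally have "R powr d \<le> C\<^sup>2 * 2 powr d / w * vol m x R"
        using C w by (simp add: field_simps power2_eq_square)
      also have "\<dots> \<le> c * vol m x R" using c sc(3)[of R R x] R by (intro mult_right_mono) auto
      finally have low: "R powr d / c \<le> vol m x R" using c1 by (simp add: field_simps)
      have "(R / r) powr d / c \<le> (R / r) powr d / C" using c c1 C by (intro divide_left_mono) auto
      moreover have "C * (R / r) powr d \<le> c * (R / r) powr d" using c by (intro mult_right_mono) auto
      ultimately show "\<exists>R\<ge>r. R powr d / c \<le> vol m x R \<and> vol m x R \<le> c * R powr d \<and>
        between_powers c d d (R / r) (vol m x R / vol m x r)"
        using up low sc(1,2)[OF r R(1), of x] R(1) by (intro exI[of _ R]) auto
    qed
  next
    case False
    hence L': "bounded D" "L < \<infinity>" using L by auto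
    then obtain l where l: "L = ereal l" "0 < l" using L(1) by (cases L) auto
    obtain C where C: "1 \<le> C" "vol_scaled m C d d (ereal l)"
      using volume_scaling_vol_scaled[OF vs, of "ereal l"] by auto
    obtain b where b: "0 < b" "\<And>x. x \<in> D \<Longrightarrow> 1 / b \<le> vol m x l \<and> vol m x l \<le> b"
      using vol_uniform_bounds[OF m vs L'(1) D l(2)] by metis
    define c where "c = Max {C, b / l powr d, b * l powr d}"
    have c: "C \<le> c" "b / l powr d \<le> c" "b * l powr d \<le> c"
      unfolding c_def by (rule Max_ge; simp)+
    have c1: "1 \<le> c" using C c by simp
    show ?thesis
    proof (rule exI[of _ c], intro conjI c1 allI impI)
      fix x r assume "x \<in> D \<and> 0 < r \<and> ereal r \<le> L"
      hence x: "x \<in> D" and r: "0 < r" "r \<le> l" using l by auto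
      have "l powr d / c \<le> 1 / b" using c c1 b l by (simp add: field_simps)
      moreover have "b \<le> c * l powr d" using c l by (simp add: field_simps)
      moreover have "(l / r) powr d / c \<le> (l / r) powr d / C" using c c1 C by (intro divide_left_mono) auto
      moreover have "C * (l / r) powr d \<le> c * (l / r) powr d" using c by (intro mult_right_mono) auto
      moreover have "(l / r) powr d / C \<le> vol m x l / vol m x r" "vol m x l / vol m x r \<le> C * (l / r) powr d"
        using C(2) r by (auto simp: vol_scaled_def)
      ultimately show "\<exists>R\<ge>r. R powr d / c \<le> vol m x R \<and> vol m x R \<le> c * R powr d \<and>
        between_powers c d d (R / r) (vol m x R / vol m x r)"
        using b(2)[OF x] r by (intro exI[of _ l] conjI; linarith)
    qed
  qed
  then obtain c where c: "1 \<le> c" and ref: "\<And>x r. x \<in> D \<Longrightarrow> 0 < r \<Longrightarrow> ereal r \<le> L \<Longrightarrow>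
      (\<exists>R\<ge>r. R powr d / c \<le> vol m x R \<and> vol m x R \<le> c * R powr d \<and>
        between_powers c d d (R / r) (vol m x R / vol m x r))"
    by blast
  have c2: "1 \<le> c * c" using mult_mono[OF c c] c by simp
  show thesis
  proof (rule that[OF c2])
    fix x r assume xr: "x \<in> D" "0 < r" "ereal r \<le> L"
    obtain R where R: "r \<le> R" and e: "R powr d / c \<le> vol m x R" "vol m x R \<le> c * R powr d"
      "(R / r) powr d / c \<le> vol m x R / vol m x r" "vol m x R / vol m x r \<le> c * (R / r) powr d"
      using ref[OF xr] by blast
    have R0: "0 < R" using R xr by simp
    have pw: "(R / r) powr d = R powr d / r powr d" using xr R0 by (simp add: powr_divide)
    have pos: "0 < R powr d" "0 < r powr d" using R0 xr by auto
    have V: "0 < vol m x r"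
    proof -
      have "0 < (R / r) powr d / c" using c R0 xr by simp
      hence "vol m x r \<noteq> 0" using e(3) by auto
      thus ?thesis using measure_nonneg[of m "ball x r"] unfolding vol_def by linarith
    qed
    have "vol m x R \<le> c * (R powr d / r powr d) * vol m x r"
      using e(4) V unfolding pw by (simp add: pos_divide_le_eq)
    hence "R powr d / c \<le> c * (R powr d / r powr d) * vol m x r" using e(1) by linarith
    hence "r powr d / (c * c) \<le> vol m x r" using pos c by (simp add: field_simps)
    moreover have "R powr d / r powr d / c * vol m x r \<le> vol m x R"
      using e(3) V unfolding pw by (simp add: pos_le_divide_eq)
    hence "R powr d / r powr d / c * vol m x r \<le> c * R powr d" using e(2) by linarith
    hence "vol m x r \<le> c * c * r powr d" using pos c by (simp add: field_simps)
    ultimately show "r powr d / (c * c) \<le> vol m x r \<and> vol m x r \<le> c * c * r powr d" by simp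
  qed
qed

text \<open>
This is \<open>ln t \<le> t - 1\<close> at \<open>t = cz/k\<close>.
\<close>

lemma powr_times_exp_bounded:
  assumes "0 < k" "0 < (c::real)" "0 < z"
  shows "z powr k * exp (- c * z) \<le> exp (k * ln (k / c))"
proof -
  have "ln (c * z / k) \<le> c * z / k - 1" using assms by (intro ln_le_minus_one) auto
  moreover have "ln (c * z / k) = ln z - ln (k / c)" using assms by (simp add: ln_mult ln_div)
  ultimately have "k * (ln z - ln (k / c)) \<le> k * (c * z / k - 1)" using assms by (intro mult_left_mono) auto
  hence "k * ln z - c * z \<le> k * ln (k / c)" using assms by (simp add: algebra_simps)
  hence "exp (k * ln z - c * z) \<le> exp (k * ln (k / c))" by simp
  thus ?thesis using assms by (simp add: powr_def exp_add[symmetric] algebra_simps)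
qed

lemma ln_exp_plus_le_powr:
  fixes y z C b :: real
  assumes "0 \<le> z" "0 \<le> y" "0 \<le> C" "0 \<le> b" "y \<le> C * (exp 1 + z) powr b"
  shows "ln (exp 1 + y) \<le> (ln (exp 1 + C) + b) * ln (exp 1 + z)"
proof -
  have e: "1 < exp (1::real)" by simp
  have z: "1 \<le> exp 1 + z" using assms e by linarith
  have pos: "0 < exp 1 + C" "0 < exp 1 + z" using assms e by linarith+
  have z1: "1 \<le> ln (exp 1 + z)" using assms(1) by (rule one_le_ln_exp_plus)
  have p1: "1 \<le> (exp 1 + z) powr b" using z assms by (intro ge_one_powr_ge_zero) auto
  have "exp 1 * 1 \<le> exp 1 * (exp 1 + z) powr b" using p1 by (intro mult_left_mono) auto
  hence "exp 1 + y \<le> (exp 1 + C) * (exp 1 + z) powr b"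
    using assms(5) unfolding distrib_right by linarith
  hence "ln (exp 1 + y) \<le> ln ((exp 1 + C) * (exp 1 + z) powr b)"
    using assms pos by (subst ln_le_cancel_iff) (auto intro: add_pos_nonneg)
  also have "\<dots> = ln (exp 1 + C) + b * ln (exp 1 + z)"
    using pos by (subst ln_mult) (auto simp: ln_powr)
  also have "\<dots> \<le> (ln (exp 1 + C) + b) * ln (exp 1 + z)"
  proof -
    have "0 \<le> ln (exp 1 + C)" using assms e by (intro ln_ge_zero) linarith
    thus ?thesis using mult_left_mono[OF z1, of "ln (exp 1 + C)"] by (simp add: algebra_simps)
  qed
  finally show ?thesis .
qed

section \<open>The boundary function and the time scales of a pair of points\<close>

lemma boundary_function_bounds:
  assumes "boundary_function D \<Phi> \<gamma> h"
  shows "0 < s \<Longrightarrow> x \<in> D \<Longrightarrow> y \<in> D \<Longrightarrow> 0 \<le> h s x y \<and> h s x y \<le> 1"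
  using assms by (auto simp: boundary_function_def)

lemma boundary_function_anti:
  assumes "boundary_function D \<Phi> \<gamma> h" and "0 < s" "s \<le> t" "x \<in> D" "y \<in> D"
  shows "h t x y \<le> h s x y"
proof -
  have "antimono_on {0<..} (\<lambda>s. h s x y)"
    using assms unfolding boundary_function_def by blast
  from monotone_onD[OF this, of s t] show ?thesis using assms by simp
qed

lemma hk_bound_between:
  assumes "0 \<le> c" "0 \<le> s" "0 \<le> \<Psi> (dist x y)"
  shows "exp (- (c * (dist x y)\<^sup>2 / (scale_inv \<Phi> s)\<^sup>2)) / vol m x (scale_inv \<Phi> s) \<le> hk_bound m \<Phi> \<Psi> 1 c s x y"
    and "hk_bound m \<Phi> \<Psi> 1 c s x y \<le> 1 / vol m x (scale_inv \<Phi> s)"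
    and "0 \<le> hk_bound m \<Phi> \<Psi> 1 c s x y"
proof -
  define w where "w = 1 / vol m x (scale_inv \<Phi> s)"
  define e where "e = exp (- (c * (dist x y)\<^sup>2 / (scale_inv \<Phi> s)\<^sup>2))"
  have V: "0 \<le> vol m x (scale_inv \<Phi> s)" by (simp add: vol_def)
  hence w: "0 \<le> w" by (simp add: w_def)
  have e: "0 \<le> e" "e \<le> 1" using assms by (auto simp: e_def)
  have "0 \<le> s / (vol m x (dist x y) * \<Psi> (dist x y))" using assms by (simp add: vol_def)
  hence "w * e \<le> min w (s / (vol m x (dist x y) * \<Psi> (dist x y)) + w * e)" "0 \<le> w * e"
    using w e by (auto simp: mult_left_le)
  thus "e / vol m x (scale_inv \<Phi> s) \<le> hk_bound m \<Phi> \<Psi> 1 c s x y" "0 \<le> hk_bound m \<Phi> \<Psi> 1 c s x y"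
    "hk_bound m \<Phi> \<Psi> 1 c s x y \<le> 1 / vol m x (scale_inv \<Phi> s)"
    using V by (auto simp: hk_bound_def w_def e_def)
qed

text \<open>
The size \<open>1/V(x,\<Phi>\<^sup>-\<^sup>1(s))\<close> of the heat kernel on the diagonal, in the interior of \<open>D\<close>.
\<close>

definition vol_inv :: "'a::metric_space measure \<Rightarrow> (real \<Rightarrow> real) \<Rightarrow> 'a \<Rightarrow> real \<Rightarrow> real" where
  "vol_inv m \<Phi> x s = 1 / vol m x (scale_inv \<Phi> s)"

text \<open>
The two alternatives \<open>HK_B\<close> and \<open>HK_U\<close> are used only through the conditions \<open>heat_kernel_bounds\<close> and
\<open>large_time\<close>: two-sided estimates up to time \<open>\<Phi>(diam D)\<close>, and decay at the rate \<open>s^(-(1+\<beta>))\<close> afterwards.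
\<close>

locale critical_boundary =
  fixes m :: "'a::heine_borel measure" and D :: "'a set"
    and p h :: "real \<Rightarrow> 'a \<Rightarrow> 'a \<Rightarrow> real" and \<Phi> \<Psi> :: "real \<Rightarrow> real"
    and R_E :: ereal and d1 d2 \<alpha>1 \<alpha>2 \<alpha>3 \<alpha>4 \<beta> :: real
  assumes radon: "radon_full_support m"
    and volume: "volume_scaling m R_E d1 d2"
    and D_open: "open D" and D_proper: "D \<noteq> UNIV"
    and scales: "scale_functions \<Phi> \<Psi> \<alpha>1 \<alpha>2 \<alpha>3 \<alpha>4"
    and index_pos: "0 < \<beta>"
    and boundary: "boundary_function D \<Phi> (1 + \<beta>) h"
    and boundary_regular: "regular_boundary_function D \<Phi> h"
    and boundary_star: "H2_star D \<Phi> (1 + \<beta>) h"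
    and boundary_star_star: "H2_star_star D \<Phi> \<beta> h"
    and bounded_or_global: "bounded D \<or> R_E = \<infinity>"
    and heat_kernel_bounds: "two_sided_hk m D \<Phi> \<Psi> h p 1 {s. 0 < s \<and> ereal s \<le> scale_diam \<Phi> D}"
    and large_time: "bounded D \<Longrightarrow> \<exists>C. \<forall>s x y. x \<in> D \<longrightarrow> y \<in> D \<longrightarrow> \<Phi> (diameter D) < s \<longrightarrow>
      p s x y \<le> C * s powr - (1 + \<beta>) * h (\<Phi> (diameter D)) x y"
    and p_measurable: "x \<in> D \<Longrightarrow> y \<in> D \<Longrightarrow>
      (\<lambda>s. ennreal (p s x y) * indicator {0<..} s) \<in> borel_measurable borel"
begin

abbreviation T :: ereal where "T \<equiv> scale_diam \<Phi> D"

lemma \<Phi>_scaling: "weak_scaling \<Phi> \<alpha>1 \<alpha>2"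
  and \<Phi>_strict: "strict_mono_on {0..} \<Phi>"
  and \<Phi>_nonneg: "\<forall>r\<ge>0. 0 \<le> \<Phi> r"
  and \<Phi>_le_\<Psi>: "0 \<le> r \<Longrightarrow> \<Phi> r \<le> \<Psi> r"
  using scales unfolding scale_functions_def by auto

lemma \<Psi>_nonneg: "0 \<le> r \<Longrightarrow> 0 \<le> \<Psi> r"
  using \<Phi>_le_\<Psi> \<Phi>_nonneg order_trans by blast

lemmas \<Phi>_facts = \<Phi>_scaling \<Phi>_strict \<Phi>_nonneg
lemmas \<alpha>_pos = scale_index_pos[OF \<Phi>_facts]
lemmas \<Phi>_pos = scale_pos[OF \<Phi>_facts]
lemmas \<Phi>_mono = scale_mono[OF \<Phi>_facts]
lemmas \<Phi>_less_iff = scale_less_iff[OF \<Phi>_facts]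
lemmas inv_pos = scale_inv_pos[OF \<Phi>_facts]
lemmas inv_mono = scale_inv_mono[OF \<Phi>_facts]
lemmas inv_\<Phi> = scale_inv_scale[OF \<Phi>_facts]

text \<open>
On a bounded \<open>D\<close> (H2), (H2*) and regularity only concern times below \<open>4\<Phi>(diam D) + 1\<close>.  As the space need not
be connected, the distance to the complement may exceed the diameter; it is therefore capped.
\<close>

definition cutoff :: "'a \<Rightarrow> 'a \<Rightarrow> real" where
  "cutoff x y = (if bounded D then min (bdist_max D x y) (diameter D) else bdist_max D x y)"

abbreviation jump_time :: "'a \<Rightarrow> 'a \<Rightarrow> real" ("\<tau>") where "\<tau> x y \<equiv> \<Phi> (dist x y)"
definition boundary_time :: "'a \<Rightarrow> 'a \<Rightarrow> real" ("\<Delta>") where "\<Delta> x y = \<Phi> (cutoff x y)"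
definition lower_time :: "'a \<Rightarrow> 'a \<Rightarrow> real" ("\<sigma>") where "\<sigma> x y = min (\<tau> x y) (\<Delta> x y)"
definition upper_time :: "'a \<Rightarrow> 'a \<Rightarrow> real" ("\<omega>") where "\<omega> x y = max (\<tau> x y) (\<Delta> x y)"

lemma time_below:
  assumes "0 < s" "ereal s \<le> T"
  shows "ereal s < 4 * T + 1" "ereal s < 2 * T"
  using assms by (auto simp: scale_diam_def)

lemma bdist_pos: "x \<in> D \<Longrightarrow> 0 < bdist D x"
  unfolding bdist_def using D_open D_proper
  by (intro infdist_pos_not_in_closed) (auto simp: closed_Compl)

lemma bdist_min_max_pos:
  assumes "x \<in> D" "y \<in> D"
  shows "0 < bdist_min D x y" "0 < bdist_max D x y" "bdist_min D x y \<le> bdist_max D x y"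
    "bdist_max D x y - dist x y \<le> bdist_min D x y"
  using assms bdist_pos[of x] bdist_pos[of y] infdist_triangle_abs[of x "- D" y]
  unfolding bdist_min_def bdist_max_def bdist_def by (auto simp: max_def min_def)

lemma dist_le_diameter: "bounded D \<Longrightarrow> x \<in> D \<Longrightarrow> y \<in> D \<Longrightarrow> dist x y \<le> diameter D"
  by (rule diameter_bounded_bound)

lemma cutoff_bounds:
  assumes xy: "x \<in> D" "y \<in> D" "x \<noteq> y"
  shows "0 < cutoff x y" "cutoff x y \<le> bdist_max D x y" "cutoff x y < dist x y \<Longrightarrow> cutoff x y = bdist_max D x y"
    "cutoff x y - dist x y \<le> bdist_min D x y" "bounded D \<Longrightarrow> cutoff x y \<le> diameter D"
proof -
  note b = bdist_min_max_pos[OF xy(1,2)]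
  have "0 < diameter D" if "bounded D" using dist_le_diameter[OF that xy(1,2)] xy by (smt (verit) zero_less_dist_iff)
  thus "0 < cutoff x y" using b by (auto simp: cutoff_def)
  show le: "cutoff x y \<le> bdist_max D x y" by (auto simp: cutoff_def)
  show "cutoff x y = bdist_max D x y" if "cutoff x y < dist x y"
    using that dist_le_diameter[OF _ xy(1,2)] by (auto simp: cutoff_def min_def split: if_splits)
  show "cutoff x y - dist x y \<le> bdist_min D x y" using le b by linarith
  show "cutoff x y \<le> diameter D" if "bounded D" using that by (simp add: cutoff_def)
qed

lemma times:
  assumes xy: "x \<in> D" "y \<in> D" "x \<noteq> y"
  shows "0 < \<tau> x y" "0 < \<Delta> x y" "0 < \<sigma> x y" "\<sigma> x y \<le> \<tau> x y" "\<tau> x y \<le> \<omega> x y" "ereal (\<omega> x y) \<le> T"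
    "\<sigma> x y \<le> \<Delta> x y" "\<Delta> x y \<le> \<omega> x y" "0 < \<omega> x y" "\<Delta> x y \<le> \<Phi> (bdist_max D x y)"
    "\<Delta> x y < \<tau> x y \<Longrightarrow> \<Delta> x y = \<Phi> (bdist_max D x y)"
proof -
  note c = cutoff_bounds[OF xy]
  have d: "0 < dist x y" using xy by simp
  show "0 < \<tau> x y" "0 < \<Delta> x y" using d c by (auto simp: boundary_time_def intro: \<Phi>_pos)
  thus "0 < \<sigma> x y" "0 < \<omega> x y" by (auto simp: lower_time_def upper_time_def)
  show "\<sigma> x y \<le> \<tau> x y" "\<tau> x y \<le> \<omega> x y" "\<sigma> x y \<le> \<Delta> x y" "\<Delta> x y \<le> \<omega> x y"
    by (auto simp: lower_time_def upper_time_def)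
  show "ereal (\<omega> x y) \<le> T"
    using dist_le_diameter[OF _ xy(1,2)] c d
    by (auto simp: scale_diam_def upper_time_def boundary_time_def max_def intro!: \<Phi>_mono)
  show "\<Delta> x y \<le> \<Phi> (bdist_max D x y)" unfolding boundary_time_def using c by (intro \<Phi>_mono) auto
  show "\<Delta> x y = \<Phi> (bdist_max D x y)" if "\<Delta> x y < \<tau> x y"
    using that c d \<Phi>_less_iff[of "cutoff x y" "dist x y"] by (simp add: boundary_time_def)
qed

lemma below_upper_time: "x \<in> D \<Longrightarrow> y \<in> D \<Longrightarrow> x \<noteq> y \<Longrightarrow> s \<le> \<omega> x y \<Longrightarrow> ereal s \<le> T"
  using ereal_le_below[OF _ times(6)] .

lemma upper_time_eq:
  assumes "x \<in> D" "y \<in> D" "x \<noteq> y"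
  shows "\<omega> x y = \<Phi> (max (dist x y) (cutoff x y))"
  using \<Phi>_mono[of "dist x y" "cutoff x y"] \<Phi>_less_iff[of "cutoff x y" "dist x y"] cutoff_bounds[OF assms]
  by (auto simp: upper_time_def boundary_time_def max_def)

lemma times_le_T:
  assumes xy: "x \<in> D" "y \<in> D" "x \<noteq> y"
  shows "ereal (\<tau> x y) \<le> T" "ereal (\<sigma> x y) \<le> T" "ereal (\<Delta> x y) \<le> T"
  using times(4,5,8)[OF xy] below_upper_time[OF xy] by auto

lemmas h_bounds = boundary_function_bounds[OF boundary]
lemmas h_anti = boundary_function_anti[OF boundary]

lemma h_growth:
  obtains c where "1 \<le> c" "\<And>s t x y. 0 < s \<Longrightarrow> s \<le> t \<Longrightarrow> ereal t \<le> T \<Longrightarrow> x \<in> D \<Longrightarrow> y \<in> D \<Longrightarrow>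
    s powr (1 + \<beta>) * h s x y \<le> c * (t powr (1 + \<beta>) * h t x y)"
proof -
  obtain c where c: "\<And>s t x y. 0 < s \<Longrightarrow> s \<le> t \<Longrightarrow> ereal t < 4 * T + 1 \<Longrightarrow> x \<in> D \<Longrightarrow> y \<in> D \<Longrightarrow>
      s powr (1 + \<beta>) * h s x y \<le> c * t powr (1 + \<beta>) * h t x y"
    using boundary unfolding boundary_function_def by blast
  show thesis
  proof (rule that[of "max 1 c"])
    fix s t x y assume s: "0 < s" "s \<le> t" "ereal t \<le> T" and xy: "x \<in> D" "y \<in> D"
    have "s powr (1 + \<beta>) * h s x y \<le> c * (t powr (1 + \<beta>) * h t x y)"
      using c[OF s(1,2) _ xy] time_below(1)[of t] s by (simp add: mult.assoc)
    also have "\<dots> \<le> max 1 c * (t powr (1 + \<beta>) * h t x y)"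
      using h_bounds[of t x y] s xy by (intro mult_right_mono) auto
    finally show "s powr (1 + \<beta>) * h s x y \<le> max 1 c * (t powr (1 + \<beta>) * h t x y)" .
  qed simp
qed

lemma h_interior:
  obtains c where "1 \<le> c" "\<And>t x y. 0 < t \<Longrightarrow> ereal t \<le> T \<Longrightarrow> x \<in> D \<Longrightarrow> y \<in> D \<Longrightarrow>
    scale_inv \<Phi> t \<le> bdist_min D x y \<Longrightarrow> 1 \<le> c * h t x y"
proof -
  obtain c where c: "0 < c" "\<And>t x y. 0 < t \<Longrightarrow> ereal t < 4 * T + 1 \<Longrightarrow> x \<in> D \<Longrightarrow> y \<in> D \<Longrightarrow>
      scale_inv \<Phi> t \<le> bdist_min D x y \<Longrightarrow> c \<le> h t x y"
    using boundary_regular unfolding regular_boundary_function_def by blast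
  show thesis
  proof (rule that[of "max 1 (1 / c)"])
    fix t x y assume t: "0 < t" "ereal t \<le> T" and xy: "x \<in> D" "y \<in> D" and i: "scale_inv \<Phi> t \<le> bdist_min D x y"
    have "c \<le> h t x y" using c(2)[OF t(1) _ xy i] time_below(1)[OF t] by simp
    hence "1 \<le> 1 / c * h t x y" using c(1) by (simp add: field_simps)
    also have "\<dots> \<le> max 1 (1 / c) * h t x y" using h_bounds[of t x y] t xy by (intro mult_right_mono) auto
    finally show "1 \<le> max 1 (1 / c) * h t x y" .
  qed simp
qed

lemma h_decay:
  obtains c where "1 \<le> c" "\<And>s t x y. x \<in> D \<Longrightarrow> y \<in> D \<Longrightarrow> \<Phi> (bdist_max D x y) \<le> s \<Longrightarrow> s \<le> t \<Longrightarrow> ereal t \<le> T \<Longrightarrow>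
    t powr (1 + \<beta>) * h t x y \<le> c * (s powr (1 + \<beta>) * h s x y)"
proof -
  obtain c where c: "0 < c" "\<And>s t x y. x \<in> D \<Longrightarrow> y \<in> D \<Longrightarrow> \<Phi> (bdist_max D x y) \<le> s \<Longrightarrow> s \<le> t \<Longrightarrow>
      ereal t < 2 * T \<Longrightarrow> c * t powr (1 + \<beta>) * h t x y \<le> s powr (1 + \<beta>) * h s x y"
    using boundary_star unfolding H2_star_def by blast
  show thesis
  proof (rule that[of "max 1 (1 / c)"])
    fix s t x y assume xy: "x \<in> D" "y \<in> D" and s: "\<Phi> (bdist_max D x y) \<le> s" "s \<le> t" "ereal t \<le> T"
    have s0: "0 < s" using \<Phi>_pos[OF bdist_min_max_pos(2)[OF xy]] s by linarith
    have "c * (t powr (1 + \<beta>) * h t x y) \<le> s powr (1 + \<beta>) * h s x y"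
      using c(2)[OF xy s(1,2)] time_below(2)[of t] s s0 by (simp add: mult.assoc)
    hence "t powr (1 + \<beta>) * h t x y \<le> 1 / c * (s powr (1 + \<beta>) * h s x y)"
      using c(1) by (simp add: field_simps)
    also have "\<dots> \<le> max 1 (1 / c) * (s powr (1 + \<beta>) * h s x y)"
      using h_bounds[OF s0 xy] by (intro mult_right_mono) auto
    finally show "t powr (1 + \<beta>) * h t x y \<le> max 1 (1 / c) * (s powr (1 + \<beta>) * h s x y)" .
  qed simp
qed

text \<open>
The exponent of (H2**) is increased to at least 1, which keeps the inequality and makes \<open>s^(1-g)\<close>
nonincreasing.
\<close>

lemma h_intermediate:
  obtains c g where "1 \<le> c" "1 \<le> g" "g < 1 + \<beta>"
    "\<And>s t x y. x \<in> D \<Longrightarrow> y \<in> D \<Longrightarrow> \<Phi> (bdist_min D x y) \<le> s \<Longrightarrow> s \<le> t \<Longrightarrow> t < \<Phi> (bdist_max D x y) \<Longrightarrow>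
      s powr g * h s x y \<le> c * (t powr g * h t x y)"
proof -
  obtain c k where c: "0 < c" and k: "0 < k" "k < 1 + \<beta>" and
    ck: "\<And>s t x y. x \<in> D \<Longrightarrow> y \<in> D \<Longrightarrow> \<Phi> (bdist_min D x y) \<le> s \<Longrightarrow> s \<le> t \<Longrightarrow> t < \<Phi> (bdist_max D x y) \<Longrightarrow>
      s powr k * h s x y \<le> c * t powr k * h t x y"
    using boundary_star_star unfolding H2_star_star_def by blast
  define g where "g = max 1 k"
  show thesis
  proof (rule that[of "max 1 c" g])
    show "g < 1 + \<beta>" using k index_pos by (simp add: g_def)
    fix s t x y assume xy: "x \<in> D" "y \<in> D"
      and s: "\<Phi> (bdist_min D x y) \<le> s" "s \<le> t" "t < \<Phi> (bdist_max D x y)"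
    have s0: "0 < s" using \<Phi>_pos[OF bdist_min_max_pos(1)[OF xy]] s by linarith
    have t0: "0 < t" using s0 s by simp
    have split: "r powr g = r powr (g - k) * r powr k" for r :: real by (simp add: powr_add[symmetric])
    have "s powr g * h s x y = s powr (g - k) * (s powr k * h s x y)" by (simp add: split)
    also have "\<dots> \<le> t powr (g - k) * (c * t powr k * h t x y)"
    proof (rule mult_mono)
      show "s powr (g - k) \<le> t powr (g - k)" using s0 s by (intro powr_mono2) (auto simp: g_def)
      show "s powr k * h s x y \<le> c * t powr k * h t x y" by (rule ck[OF xy s])
    qed (use h_bounds[OF s0 xy] in auto)
    also have "\<dots> = c * (t powr g * h t x y)" by (simp add: split)
    also have "\<dots> \<le> max 1 c * (t powr g * h t x y)"
      using h_bounds[OF t0 xy] by (intro mult_right_mono) auto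
    finally show "s powr g * h s x y \<le> max 1 c * (t powr g * h t x y)" .
  qed (auto simp: g_def)
qed

lemma h_doubling:
  obtains c where "1 \<le> c" "\<And>s t x y. 0 < s \<Longrightarrow> s \<le> t \<Longrightarrow> t \<le> 2 * s \<Longrightarrow> ereal t \<le> T \<Longrightarrow> x \<in> D \<Longrightarrow> y \<in> D \<Longrightarrow>
    h s x y \<le> c * h t x y"
proof -
  obtain c where c: "1 \<le> c" and cb: "\<And>s t x y. 0 < s \<Longrightarrow> s \<le> t \<Longrightarrow> ereal t \<le> T \<Longrightarrow> x \<in> D \<Longrightarrow> y \<in> D \<Longrightarrow>
    s powr (1 + \<beta>) * h s x y \<le> c * (t powr (1 + \<beta>) * h t x y)" by (rule h_growth) blast
  have two: "1 \<le> 2 powr (1 + \<beta>)" using index_pos by (intro ge_one_powr_ge_zero) auto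
  show thesis
  proof (rule that[of "c * 2 powr (1 + \<beta>)"])
    show "1 \<le> c * 2 powr (1 + \<beta>)" using mult_mono[OF c two] c by simp
    fix s t x y assume s: "0 < s" "s \<le> t" "t \<le> 2 * s" "ereal t \<le> T" and xy: "x \<in> D" "y \<in> D"
    have "t powr (1 + \<beta>) \<le> (2 * s) powr (1 + \<beta>)" using s index_pos by (intro powr_mono2) auto
    also have "\<dots> = 2 powr (1 + \<beta>) * s powr (1 + \<beta>)" by (rule powr_mult)
    finally have tp: "t powr (1 + \<beta>) \<le> 2 powr (1 + \<beta>) * s powr (1 + \<beta>)" .
    have "s powr (1 + \<beta>) * h s x y \<le> c * (t powr (1 + \<beta>) * h t x y)" by (rule cb[OF s(1,2,4) xy])
    also have "\<dots> \<le> c * (2 powr (1 + \<beta>) * s powr (1 + \<beta>) * h t x y)"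
      using tp c h_bounds[of t x y] s xy by (intro mult_left_mono mult_right_mono) auto
    also have "\<dots> = s powr (1 + \<beta>) * (c * 2 powr (1 + \<beta>) * h t x y)" by simp
    finally show "h s x y \<le> c * 2 powr (1 + \<beta>) * h t x y"
      using s by (simp add: mult_le_cancel_left_pos)
  qed
qed

text \<open>
For \<open>s\<close> below \<open>\<Phi>(\<delta>\<^sub>\<and>)\<close> regularity bounds \<open>h\<close> from below at time \<open>\<Phi>(\<delta>\<^sub>\<and>)\<close>, or at \<open>\<sigma>\<close> if this is smaller; from there on
(H2**) applies.  It requires times strictly below \<open>\<Phi>(\<delta>\<^sub>\<or>)\<close>, hence the last step from \<open>\<sigma>/2\<close> to \<open>\<sigma>\<close> is made
with the doubling property.
\<close>

lemma h_small_times: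
  obtains Q g where "1 \<le> Q" "1 \<le> g" "g < 1 + \<beta>"
    "\<And>s x y. x \<in> D \<Longrightarrow> y \<in> D \<Longrightarrow> x \<noteq> y \<Longrightarrow> 0 < s \<Longrightarrow> s \<le> \<sigma> x y \<Longrightarrow>
      s powr g * h s x y \<le> Q * (\<tau> x y powr (1 + \<beta>) * h (\<tau> x y) x y * \<sigma> x y powr (g - 1 - \<beta>))"
proof -
  obtain c1 where c1: "1 \<le> c1" "\<And>s t x y. 0 < s \<Longrightarrow> s \<le> t \<Longrightarrow> ereal t \<le> T \<Longrightarrow> x \<in> D \<Longrightarrow> y \<in> D \<Longrightarrow>
    s powr (1 + \<beta>) * h s x y \<le> c1 * (t powr (1 + \<beta>) * h t x y)" by (rule h_growth) blast
  obtain c2 where c2: "1 \<le> c2" "\<And>t x y. 0 < t \<Longrightarrow> ereal t \<le> T \<Longrightarrow> x \<in> D \<Longrightarrow> y \<in> D \<Longrightarrow>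
    scale_inv \<Phi> t \<le> bdist_min D x y \<Longrightarrow> 1 \<le> c2 * h t x y" by (rule h_interior) blast
  obtain c3 g where c3: "1 \<le> c3" and g: "1 \<le> g" "g < 1 + \<beta>" and
    c3b: "\<And>s t x y. x \<in> D \<Longrightarrow> y \<in> D \<Longrightarrow> \<Phi> (bdist_min D x y) \<le> s \<Longrightarrow> s \<le> t \<Longrightarrow> t < \<Phi> (bdist_max D x y) \<Longrightarrow>
      s powr g * h s x y \<le> c3 * (t powr g * h t x y)" by (rule h_intermediate) blast
  obtain c4 where c4: "1 \<le> c4" "\<And>s t x y. 0 < s \<Longrightarrow> s \<le> t \<Longrightarrow> t \<le> 2 * s \<Longrightarrow> ereal t \<le> T \<Longrightarrow> x \<in> D \<Longrightarrow> y \<in> D \<Longrightarrow>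
    h s x y \<le> c4 * h t x y" by (rule h_doubling) blast
  have c34: "1 \<le> c3 * c4" "1 \<le> c2 * (c3 * c4)"
  proof -
    show *: "1 \<le> c3 * c4" using mult_mono[OF c3 c4(1)] c3 by simp
    show "1 \<le> c2 * (c3 * c4)" using mult_mono[OF c2(1) *] c2 by simp
  qed
  show thesis
  proof (rule that[of "c2 * (c3 * c4) * c1" g, OF _ g])
    show "1 \<le> c2 * (c3 * c4) * c1" using mult_mono[OF c34(2) c1(1)] c34 by simp
    fix s x y assume xy: "x \<in> D" "y \<in> D" "x \<noteq> y" and s: "0 < s" "s \<le> \<sigma> x y"
    define \<sigma>0 where "\<sigma>0 = \<sigma> x y"
    define D0 where "D0 = \<Phi> (bdist_min D x y)"
    note t = times[OF xy]
    have s0: "0 < \<sigma>0" "s \<le> \<sigma>0" "ereal \<sigma>0 \<le> T" using s times_le_T[OF xy] by (auto simp: \<sigma>0_def)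
    note b = bdist_min_max_pos[OF xy(1,2)]
    have D0: "0 < D0" using b by (auto simp: D0_def intro: \<Phi>_pos)
    have inv_D0: "scale_inv \<Phi> D0 = bdist_min D x y" unfolding D0_def using b by (intro inv_\<Phi>) auto
    have hs: "0 \<le> h \<sigma>0 x y" "h s x y \<le> 1" "0 \<le> h s x y"
      using h_bounds[OF s0(1) xy(1,2)] h_bounds[OF s(1) xy(1,2)] by auto
    \<comment> \<open>(H2**) between \<open>\<Phi>(\<delta>\<^sub>\<and>)\<close> and \<open>\<sigma>\<close>, with the doubling property for the last factor 2\<close>
    have mid: "r powr g * h r x y \<le> c3 * c4 * (\<sigma>0 powr g * h \<sigma>0 x y)" if r: "D0 \<le> r" "r \<le> \<sigma>0" for r
    proof -
      have r0: "0 < r" using r D0 by simp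
      have hr: "0 \<le> h r x y" using h_bounds[OF r0 xy(1,2)] by simp
      show ?thesis
      proof (cases "r \<le> \<sigma>0 / 2")
        case True
        have "\<sigma>0 / 2 < \<Phi> (bdist_max D x y)" using t s0 by (simp add: \<sigma>0_def)
        hence "r powr g * h r x y \<le> c3 * ((\<sigma>0 / 2) powr g * h (\<sigma>0 / 2) x y)"
          using c3b[OF xy(1,2) r(1)[unfolded D0_def] True] by simp
        also have "\<dots> \<le> c3 * (\<sigma>0 powr g * (c4 * h \<sigma>0 x y))"
          using c3 g s0 c4(2)[of "\<sigma>0 / 2" \<sigma>0 x y] xy h_bounds[of "\<sigma>0 / 2" x y]
          by (intro mult_left_mono mult_mono powr_mono2) auto
        finally show ?thesis by (simp add: ac_simps)
      next
        case False
        have "r powr g * h r x y \<le> \<sigma>0 powr g * (c4 * h \<sigma>0 x y)"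
          using r r0 g s0 c4(2)[of r \<sigma>0 x y] False xy hr by (intro mult_mono powr_mono2) auto
        also have "\<dots> \<le> c3 * (\<sigma>0 powr g * (c4 * h \<sigma>0 x y))"
          using mult_right_mono[OF c3, of "\<sigma>0 powr g * (c4 * h \<sigma>0 x y)"] hs c4 by simp
        finally show ?thesis by (simp add: ac_simps)
      qed
    qed
    have claim: "s powr g * h s x y \<le> c2 * (c3 * c4) * (\<sigma>0 powr g * h \<sigma>0 x y)"
    proof -
      have nn: "0 \<le> c3 * c4 * (\<sigma>0 powr g * h \<sigma>0 x y)" using hs c34 by simp
      consider "D0 \<le> s" | "s < D0" "D0 \<le> \<sigma>0" | "\<sigma>0 < D0" by linarith
      thus ?thesis
      proof cases
        case 1
        thus ?thesis using mid[OF 1 s0(2)] mult_right_mono[OF c2(1) nn] by (simp add: mult.assoc)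
      next
        case 2
        have "ereal D0 \<le> T" using 2 s0 ereal_le_below by blast
        hence "1 \<le> c2 * h D0 x y" using c2(2)[OF D0 _ xy(1,2)] inv_D0 by simp
        hence "h s x y \<le> c2 * h D0 x y" using hs by linarith
        hence "s powr g * h s x y \<le> D0 powr g * (c2 * h D0 x y)"
          using s 2 g hs by (intro mult_mono powr_mono2) auto
        also have "\<dots> = c2 * (D0 powr g * h D0 x y)" by simp
        also have "\<dots> \<le> c2 * (c3 * c4 * (\<sigma>0 powr g * h \<sigma>0 x y))"
          using mid[OF order_refl 2(2)] c2 by (intro mult_left_mono) auto
        finally show ?thesis by (simp add: mult.assoc)
      next
        case 3
        have "scale_inv \<Phi> \<sigma>0 \<le> bdist_min D x y" using inv_mono[of \<sigma>0 D0] 3 s0 inv_D0 by simp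
        hence "1 \<le> c2 * h \<sigma>0 x y" using c2(2)[OF s0(1,3) xy(1,2)] by simp
        hence "h s x y \<le> c2 * h \<sigma>0 x y" using hs by linarith
        hence "s powr g * h s x y \<le> \<sigma>0 powr g * (c2 * h \<sigma>0 x y)"
          using s s0 g hs by (intro mult_mono powr_mono2) auto
        also have "\<dots> \<le> c3 * c4 * (\<sigma>0 powr g * (c2 * h \<sigma>0 x y))"
          using mult_right_mono[OF c34(1), of "\<sigma>0 powr g * (c2 * h \<sigma>0 x y)"] hs c2 by simp
        finally show ?thesis by (simp add: ac_simps)
      qed
    qed
    also have "\<sigma>0 powr g * h \<sigma>0 x y = \<sigma>0 powr (g - 1 - \<beta>) * (\<sigma>0 powr (1 + \<beta>) * h \<sigma>0 x y)"
      by (simp add: powr_add[symmetric] mult.assoc[symmetric])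
    also have "c2 * (c3 * c4) * (\<sigma>0 powr (g - 1 - \<beta>) * (\<sigma>0 powr (1 + \<beta>) * h \<sigma>0 x y)) \<le>
        c2 * (c3 * c4) * (\<sigma>0 powr (g - 1 - \<beta>) * (c1 * (\<tau> x y powr (1 + \<beta>) * h (\<tau> x y) x y)))"
      using c1(2)[OF s0(1) _ times_le_T(1)[OF xy] xy(1,2)] t c34
      by (intro mult_left_mono) (auto simp: \<sigma>0_def)
    finally show "s powr g * h s x y \<le> c2 * (c3 * c4) * c1 *
        (\<tau> x y powr (1 + \<beta>) * h (\<tau> x y) x y * \<sigma> x y powr (g - 1 - \<beta>))"
      by (simp add: \<sigma>0_def ac_simps)
  qed
qed

text \<open>
From \<open>\<Delta>\<close> to \<open>\<tau>\<close> this is (H2*); one further block, from \<open>\<sigma>\<close> down to \<open>\<kappa>\<sigma>\<close>, costs only a constant because \<open>h\<close> is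
nonincreasing in time.
\<close>

lemma h_middle_times:
  assumes \<kappa>: "0 < \<kappa>" "\<kappa> < 1"
  obtains Q where "1 \<le> Q"
    "\<And>s x y. x \<in> D \<Longrightarrow> y \<in> D \<Longrightarrow> x \<noteq> y \<Longrightarrow> \<kappa> * \<sigma> x y < s \<Longrightarrow> s \<le> \<tau> x y \<Longrightarrow>
      \<tau> x y powr (1 + \<beta>) * h (\<tau> x y) x y \<le> Q * (s powr (1 + \<beta>) * h s x y)"
proof -
  obtain c where c: "1 \<le> c" "\<And>s t x y. x \<in> D \<Longrightarrow> y \<in> D \<Longrightarrow> \<Phi> (bdist_max D x y) \<le> s \<Longrightarrow> s \<le> t \<Longrightarrow> ereal t \<le> T \<Longrightarrow>
    t powr (1 + \<beta>) * h t x y \<le> c * (s powr (1 + \<beta>) * h s x y)" by (rule h_decay) blast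
  define k where "k = (1 / \<kappa>) powr (1 + \<beta>)"
  have k: "1 \<le> k" using \<kappa> index_pos by (auto simp: k_def intro!: ge_one_powr_ge_zero)
  show thesis
  proof (rule that[of "c * k"])
    show "1 \<le> c * k" using mult_mono[OF c(1) k] c by simp
    fix s x y assume xy: "x \<in> D" "y \<in> D" "x \<noteq> y" and s: "\<kappa> * \<sigma> x y < s" "s \<le> \<tau> x y"
    note t = times[OF xy]
    have s0: "0 < s" using s \<kappa> t(3) by (smt (verit) mult_pos_pos)
    have hs: "0 \<le> h s x y" using h_bounds[OF s0 xy(1,2)] by simp
    have from_\<sigma>: "\<tau> x y powr (1 + \<beta>) * h (\<tau> x y) x y \<le> c * (r powr (1 + \<beta>) * h r x y)"
      if r: "\<sigma> x y \<le> r" "r \<le> \<tau> x y" for r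
    proof (cases "\<Delta> x y < \<tau> x y")
      case True
      hence "\<sigma> x y = \<Phi> (bdist_max D x y)" using t(11) by (simp add: lower_time_def)
      thus ?thesis using c(2)[OF xy(1,2) _ r(2) times_le_T(1)[OF xy]] r by simp
    next
      case False
      hence "r = \<tau> x y" using r by (simp add: lower_time_def)
      thus ?thesis using mult_right_mono[OF c(1), of "r powr (1 + \<beta>) * h r x y"] h_bounds[of r x y] t xy by simp
    qed
    show "\<tau> x y powr (1 + \<beta>) * h (\<tau> x y) x y \<le> c * k * (s powr (1 + \<beta>) * h s x y)"
    proof (cases "\<sigma> x y \<le> s")
      case True
      have "\<tau> x y powr (1 + \<beta>) * h (\<tau> x y) x y \<le> c * (s powr (1 + \<beta>) * h s x y)" by (rule from_\<sigma>[OF True s(2)])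
      also have "\<dots> \<le> k * (c * (s powr (1 + \<beta>) * h s x y))"
        using mult_right_mono[OF k, of "c * (s powr (1 + \<beta>) * h s x y)"] c hs by simp
      finally show ?thesis by (simp add: ac_simps)
    next
      case False
      have "\<sigma> x y powr (1 + \<beta>) \<le> (1 / \<kappa> * s) powr (1 + \<beta>)"
        using s \<kappa> index_pos t(3) by (intro powr_mono2) (auto simp: field_simps)
      also have "\<dots> = k * s powr (1 + \<beta>)" unfolding k_def by (rule powr_mult)
      finally have \<sigma>s: "\<sigma> x y powr (1 + \<beta>) \<le> k * s powr (1 + \<beta>)" .
      have "h (\<sigma> x y) x y \<le> h s x y" using False s0 xy by (intro h_anti) auto
      hence "\<sigma> x y powr (1 + \<beta>) * h (\<sigma> x y) x y \<le> k * s powr (1 + \<beta>) * h s x y"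
        using \<sigma>s hs k h_bounds[OF t(3) xy(1,2)] by (intro mult_mono) auto
      hence "c * (\<sigma> x y powr (1 + \<beta>) * h (\<sigma> x y) x y) \<le> c * (k * s powr (1 + \<beta>) * h s x y)"
        using c by (intro mult_left_mono) auto
      thus ?thesis using from_\<sigma>[of "\<sigma> x y"] t(4) by (simp add: mult.assoc)
    qed
  qed
qed

text \<open>
Let \<open>\<tau> < \<Delta>\<close>.  If \<open>\<rho>\<close> is at most half the cutoff, both points have distance at least half the cutoff to the
boundary, so regularity bounds \<open>h\<close> below at a time comparable with \<open>\<Delta>\<close>.  Otherwise \<open>\<tau>\<close> itself is comparable
with \<open>\<Delta>\<close>.
\<close>

lemma h_upper_time:
  obtains Q where "1 \<le> Q"
    "\<And>x y. x \<in> D \<Longrightarrow> y \<in> D \<Longrightarrow> x \<noteq> y \<Longrightarrow> h (\<tau> x y) x y \<le> Q * h (\<omega> x y) x y"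
proof -
  obtain c1 where c1: "1 \<le> c1" "\<And>s t x y. 0 < s \<Longrightarrow> s \<le> t \<Longrightarrow> ereal t \<le> T \<Longrightarrow> x \<in> D \<Longrightarrow> y \<in> D \<Longrightarrow>
    s powr (1 + \<beta>) * h s x y \<le> c1 * (t powr (1 + \<beta>) * h t x y)" by (rule h_growth) blast
  obtain c2 where c2: "1 \<le> c2" "\<And>t x y. 0 < t \<Longrightarrow> ereal t \<le> T \<Longrightarrow> x \<in> D \<Longrightarrow> y \<in> D \<Longrightarrow>
    scale_inv \<Phi> t \<le> bdist_min D x y \<Longrightarrow> 1 \<le> c2 * h t x y" by (rule h_interior) blast
  obtain C where C: "1 \<le> C" "\<And>r R. 0 < r \<Longrightarrow> r \<le> R \<Longrightarrow>
    between_powers C \<alpha>1 \<alpha>2 (R / r) (\<Phi> R / \<Phi> r)" by (rule scale_ratio[OF \<Phi>_facts]) blast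
  define A where "A = C * 2 powr \<alpha>2"
  have A: "1 \<le> A" unfolding A_def
    using mult_mono[OF C(1), of 1 "2 powr \<alpha>2"] ge_one_powr_ge_zero[of 2 \<alpha>2] \<alpha>_pos C by simp
  define k where "k = A powr (1 + \<beta>)"
  have k: "1 \<le> k" unfolding k_def using A index_pos by (intro ge_one_powr_ge_zero) auto
  have c: "1 \<le> c1 * k" "1 \<le> c2 * (c1 * k)"
  proof -
    show *: "1 \<le> c1 * k" using mult_mono[OF c1(1) k] c1 by simp
    show "1 \<le> c2 * (c1 * k)" using mult_mono[OF c2(1) *] c2 by simp
  qed
  show thesis
  proof (rule that[OF c(2)])
    fix x y assume xy: "x \<in> D" "y \<in> D" "x \<noteq> y"
    note t = times[OF xy] and cb = cutoff_bounds[OF xy]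
    have h\<omega>: "0 \<le> h (\<omega> x y) x y" using h_bounds[OF t(9) xy(1,2)] by simp
    show "h (\<tau> x y) x y \<le> c2 * (c1 * k) * h (\<omega> x y) x y"
    proof (cases "\<tau> x y < \<Delta> x y")
      case False
      hence "\<omega> x y = \<tau> x y" by (simp add: upper_time_def)
      thus ?thesis using mult_right_mono[OF c(2) h\<omega>] by simp
    next
      case True
      hence \<omega>: "\<omega> x y = \<Delta> x y" by (simp add: upper_time_def)
      \<comment> \<open>half the cutoff and the cutoff give comparable times\<close>
      define M where "M = \<Phi> (cutoff x y / 2)"
      have M: "0 < M" using cb by (auto simp: M_def intro: \<Phi>_pos)
      have M\<Delta>: "M \<le> \<Delta> x y" unfolding M_def boundary_time_def using cb by (intro \<Phi>_mono) auto
      have "\<Delta> x y / M \<le> C * (cutoff x y / (cutoff x y / 2)) powr \<alpha>2"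
        using C(2)[of "cutoff x y / 2" "cutoff x y"] cb by (auto simp: M_def boundary_time_def)
      hence "\<Delta> x y \<le> A * M" using cb M by (simp add: A_def field_simps)
      hence "\<Delta> x y powr (1 + \<beta>) \<le> (A * M) powr (1 + \<beta>)" using t index_pos by (intro powr_mono2) auto
      also have "\<dots> = k * M powr (1 + \<beta>)" unfolding k_def by (rule powr_mult)
      finally have \<Delta>M: "\<Delta> x y powr (1 + \<beta>) \<le> k * M powr (1 + \<beta>)" .
      have comp: "h r x y \<le> c1 * k * h (\<omega> x y) x y" if r: "M \<le> r" "r \<le> \<Delta> x y" for r
      proof -
        have r0: "0 < r" using r M by simp
        have "r powr (1 + \<beta>) * h r x y \<le> c1 * (\<Delta> x y powr (1 + \<beta>) * h (\<Delta> x y) x y)"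
          by (rule c1(2)[OF r0 r(2) times_le_T(3)[OF xy] xy(1,2)])
        also have "\<dots> \<le> c1 * (k * r powr (1 + \<beta>) * h (\<Delta> x y) x y)"
        proof (intro mult_left_mono mult_right_mono)
          have "k * M powr (1 + \<beta>) \<le> k * r powr (1 + \<beta>)" using k r M index_pos by (intro mult_left_mono powr_mono2) auto
          thus "\<Delta> x y powr (1 + \<beta>) \<le> k * r powr (1 + \<beta>)" using \<Delta>M by linarith
        qed (use c1 h\<omega> \<omega> in auto)
        also have "\<dots> = r powr (1 + \<beta>) * (c1 * k * h (\<omega> x y) x y)" by (simp add: \<omega>)
        finally show ?thesis using r0 by (simp add: mult_le_cancel_left_pos)
      qed
      show ?thesis
      proof (cases "dist x y \<le> cutoff x y / 2")
        case True
        have "scale_inv \<Phi> M = cutoff x y / 2" unfolding M_def using cb by (intro inv_\<Phi>) auto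
        hence "scale_inv \<Phi> M \<le> bdist_min D x y" using cb True by linarith
        moreover have "ereal M \<le> T" using M\<Delta> times_le_T(3)[OF xy] ereal_le_below by blast
        ultimately have "1 \<le> c2 * h M x y" using c2(2)[OF M _ xy(1,2)] by simp
        also have "\<dots> \<le> c2 * (c1 * k * h (\<omega> x y) x y)" using comp[OF order_refl M\<Delta>] c2 by (intro mult_left_mono) auto
        finally show ?thesis using h_bounds[OF t(1) xy(1,2)] by (simp add: mult.assoc)
      next
        case False
        have "M \<le> \<tau> x y" unfolding M_def using False cb by (intro \<Phi>_mono) auto
        hence "h (\<tau> x y) x y \<le> c1 * k * h (\<omega> x y) x y" using comp[of "\<tau> x y"] \<open>\<tau> x y < \<Delta> x y\<close> by simp
        also have "\<dots> \<le> c2 * (c1 * k * h (\<omega> x y) x y)"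
          using mult_right_mono[OF c2(1), of "c1 * k * h (\<omega> x y) x y"] c h\<omega> by simp
        finally show ?thesis by (simp add: mult.assoc)
      qed
    qed
  qed
qed

text \<open>
This is (H2*), unless the cutoff is the diameter; then \<open>\<omega>\<close> is already the largest time considered.
\<close>

lemma h_large_times:
  obtains Q where "1 \<le> Q"
    "\<And>s x y. x \<in> D \<Longrightarrow> y \<in> D \<Longrightarrow> x \<noteq> y \<Longrightarrow> \<omega> x y \<le> s \<Longrightarrow> ereal s \<le> T \<Longrightarrow>
      s powr (1 + \<beta>) * h s x y \<le> Q * (\<omega> x y powr (1 + \<beta>) * h (\<tau> x y) x y)"
proof -
  obtain c where c: "1 \<le> c" "\<And>s t x y. x \<in> D \<Longrightarrow> y \<in> D \<Longrightarrow> \<Phi> (bdist_max D x y) \<le> s \<Longrightarrow> s \<le> t \<Longrightarrow> ereal t \<le> T \<Longrightarrow>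
    t powr (1 + \<beta>) * h t x y \<le> c * (s powr (1 + \<beta>) * h s x y)" by (rule h_decay) blast
  show thesis
  proof (rule that[OF c(1)])
    fix s x y assume xy: "x \<in> D" "y \<in> D" "x \<noteq> y" and s: "\<omega> x y \<le> s" "ereal s \<le> T"
    note t = times[OF xy] and cb = cutoff_bounds[OF xy]
    have h\<omega>: "h (\<omega> x y) x y \<le> h (\<tau> x y) x y" using t xy by (intro h_anti) auto
    have "s powr (1 + \<beta>) * h s x y \<le> c * (\<omega> x y powr (1 + \<beta>) * h (\<omega> x y) x y)"
    proof (cases "cutoff x y = bdist_max D x y")
      case True
      hence "\<Phi> (bdist_max D x y) \<le> \<omega> x y" using t(8) by (simp add: boundary_time_def)
      thus ?thesis by (rule c(2)[OF xy(1,2) _ s])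
    next
      case False
      hence "bounded D" "cutoff x y = diameter D" by (auto simp: cutoff_def min_def split: if_splits)
      hence "s = \<omega> x y" using s t(8) by (simp add: boundary_time_def scale_diam_def)
      thus ?thesis
        using mult_right_mono[OF c(1), of "\<omega> x y powr (1 + \<beta>) * h (\<omega> x y) x y"] h_bounds[OF t(9) xy(1,2)] by simp
    qed
    also have "\<dots> \<le> c * (\<omega> x y powr (1 + \<beta>) * h (\<tau> x y) x y)"
      using h\<omega> c by (intro mult_left_mono) auto
    finally show "s powr (1 + \<beta>) * h s x y \<le> c * (\<omega> x y powr (1 + \<beta>) * h (\<tau> x y) x y)" .
  qed
qed

section \<open>The heat kernel in the different time ranges\<close>

lemma vol_scaled_exists:
  assumes "bounded D \<Longrightarrow> L < \<infinity>"
  obtains C where "1 \<le> C" "vol_scaled m C d1 d2 L"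
  using volume_scaling_vol_scaled[OF volume, of L] assms bounded_or_global by blast

lemma d_pos: "0 < d1" "0 < d2" "d1 \<le> d2"
  using volume by (auto simp: volume_scaling_def)

lemma V_pos: "0 < r \<Longrightarrow> 0 < vol m x r"
proof -
  assume r: "0 < r"
  obtain C where "1 \<le> C" "vol_scaled m C d1 d2 (ereal r)"
    by (rule vol_scaled_exists[of "ereal r"]) auto
  thus ?thesis using vol_pos r by blast
qed

lemma V_mono: "r \<le> R \<Longrightarrow> vol m x r \<le> vol m x R"
  by (rule vol_mono[OF radon]) auto

abbreviation v :: "'a \<Rightarrow> real \<Rightarrow> real" where "v \<equiv> vol_inv m \<Phi>"

lemma v_pos: "0 < s \<Longrightarrow> 0 < v x s"
  unfolding vol_inv_def using V_pos[OF inv_pos, of s x] by simp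

lemma v_anti: "0 < s \<Longrightarrow> s \<le> t \<Longrightarrow> v x t \<le> v x s"
  unfolding vol_inv_def using V_pos[OF inv_pos, of s x] V_mono[OF inv_mono, of s t x] by (intro frac_le) auto

lemma v_at_jump_time: "v x (\<tau> x y) = 1 / vol m x (dist x y)"
  by (simp add: vol_inv_def inv_\<Phi>)

lemma v_measurable:
  assumes "0 < a"
  shows "(\<lambda>s. ennreal (v x s) * indicator {a<..b} s) \<in> borel_measurable borel"
proof -
  have "mono_on {a<..b} (\<lambda>s. - v x s)"
    by (rule mono_onI) (use assms in \<open>auto intro!: v_anti\<close>)
  hence "(\<lambda>s. - v x s) \<in> borel_measurable (restrict_space borel {a<..b})"
    by (rule borel_measurable_mono_on_fnc)
  hence "(\<lambda>s. ennreal (- (- v x s))) \<in> borel_measurable (restrict_space borel {a<..b})"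
    by measurable
  thus ?thesis by (simp add: borel_measurable_restrict_space_iff_ennreal)
qed

text \<open>
The volume exponents \<open>d\<^sub>1, d\<^sub>2\<close> and the scale exponents \<open>\<alpha>\<^sub>1, \<alpha>\<^sub>2\<close> combine to the exponents \<open>d\<^sub>1/\<alpha>\<^sub>2\<close> and \<open>d\<^sub>2/\<alpha>\<^sub>1\<close>, whose
position relative to \<open>\<beta>\<close> distinguishes the three regimes of \<open>g\<^sub>0\<close>.
\<close>

lemma v_ratio:
  obtains Q where "1 \<le> Q" "\<And>x s t. 0 < s \<Longrightarrow> s \<le> t \<Longrightarrow> ereal t \<le> T \<Longrightarrow>
    v x t \<le> Q * v x s * (s / t) powr (d1 / \<alpha>2) \<and> v x s \<le> Q * v x t * (t / s) powr (d2 / \<alpha>1)"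
proof -
  define L where "L = (if bounded D then ereal (diameter D) else \<infinity>)"
  obtain C where C: "1 \<le> C" "vol_scaled m C d1 d2 L" by (rule vol_scaled_exists[of L]) (auto simp: L_def)
  obtain B where B: "1 \<le> B" "\<And>s t. 0 < s \<Longrightarrow> s \<le> t \<Longrightarrow>
    between_powers B (1 / \<alpha>2) (1 / \<alpha>1) (t / s) (scale_inv \<Phi> t / scale_inv \<Phi> s)" by (rule scale_inv_ratio[OF \<Phi>_facts]) blast
  define Q where "Q = C * max (B powr d1) (B powr d2)"
  have B1: "1 \<le> B powr d1" "1 \<le> B powr d2" using B d_pos by (auto intro!: ge_one_powr_ge_zero)
  have Q: "1 \<le> Q" "C * B powr d1 \<le> Q" "C * B powr d2 \<le> Q"
    using mult_mono[OF C(1), of 1 "max (B powr d1) (B powr d2)"] C B1 by (auto simp: Q_def max_def)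
  show thesis
  proof (rule that[OF Q(1)])
    fix x s t assume s: "0 < s" "s \<le> t" "ereal t \<le> T"
    have t0: "0 < t" using s by simp
    define i j where "i = scale_inv \<Phi> s" and "j = scale_inv \<Phi> t"
    have ij: "0 < i" "i \<le> j" "0 < j" using inv_pos[OF s(1)] inv_mono[OF s(1,2)] inv_pos[OF t0] by (auto simp: i_def j_def)
    have j: "ereal j \<le> L"
    proof (cases "bounded D")
      case True
      hence "t \<le> \<Phi> (diameter D)" using s by (simp add: scale_diam_def)
      hence "j \<le> scale_inv \<Phi> (\<Phi> (diameter D))" unfolding j_def by (rule inv_mono[OF t0])
      also have "\<dots> = diameter D" by (rule inv_\<Phi>[OF diameter_ge_0[OF True]])
      finally show ?thesis using True by (simp add: L_def)
    qed (simp add: L_def)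
    have V: "0 < vol m x i" "0 < vol m x j" using V_pos ij by auto
    have vr: "(j / i) powr d1 / C \<le> vol m x j / vol m x i" "vol m x j / vol m x i \<le> C * (j / i) powr d2"
      using C(2) ij j unfolding vol_scaled_def by auto
    have br: "(t / s) powr (1 / \<alpha>2) / B \<le> j / i" "j / i \<le> B * (t / s) powr (1 / \<alpha>1)"
      using B(2)[OF s(1,2)] by (auto simp: i_def j_def)
    have ts: "0 < t / s" using s by simp
    have "v x t \<le> Q * v x s * (s / t) powr (d1 / \<alpha>2)"
    proof -
      have "((t / s) powr (1 / \<alpha>2) / B) powr d1 \<le> (j / i) powr d1"
        using br(1) B(1) d_pos ts by (intro powr_mono2) auto
      hence "((t / s) powr (1 / \<alpha>2) / B) powr d1 / C \<le> (j / i) powr d1 / C"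
        using C by (intro divide_right_mono) auto
      also have "((t / s) powr (1 / \<alpha>2) / B) powr d1 = (t / s) powr (d1 / \<alpha>2) / B powr d1"
        using B(1) by (simp add: powr_divide powr_powr powr_mult)
      finally have "(t / s) powr (d1 / \<alpha>2) / B powr d1 / C \<le> vol m x j / vol m x i"
        using vr by linarith
      hence "vol m x i * (t / s) powr (d1 / \<alpha>2) \<le> C * B powr d1 * vol m x j"
        using V C B(1) by (simp add: field_simps)
      also have "\<dots> \<le> Q * vol m x j" using Q V by (intro mult_right_mono) auto
      finally have "vol m x i \<le> Q * vol m x j / (t / s) powr (d1 / \<alpha>2)"
        using ts s by (simp add: pos_le_divide_eq)
      also have "\<dots> = Q * vol m x j * (s / t) powr (d1 / \<alpha>2)"
        using s t0 by (simp add: powr_divide)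
      finally show ?thesis using V by (simp add: vol_inv_def i_def[symmetric] j_def[symmetric] field_simps)
    qed
    moreover have "v x s \<le> Q * v x t * (t / s) powr (d2 / \<alpha>1)"
    proof -
      have "(j / i) powr d2 \<le> (B * (t / s) powr (1 / \<alpha>1)) powr d2"
        using br(2) ij d_pos by (intro powr_mono2) auto
      also have "\<dots> = B powr d2 * (t / s) powr (d2 / \<alpha>1)"
        using B(1) by (simp add: powr_mult powr_powr)
      finally have "C * (j / i) powr d2 \<le> C * (B powr d2 * (t / s) powr (d2 / \<alpha>1))"
        using C by (intro mult_left_mono) auto
      also have "\<dots> \<le> Q * (t / s) powr (d2 / \<alpha>1)"
        using mult_right_mono[OF Q(3), of "(t / s) powr (d2 / \<alpha>1)"] by (simp add: mult.assoc)
      finally have "vol m x j / vol m x i \<le> Q * (t / s) powr (d2 / \<alpha>1)" using vr by linarith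
      thus ?thesis using V by (simp add: vol_inv_def i_def[symmetric] j_def[symmetric] field_simps)
    qed
    ultimately show "v x t \<le> Q * v x s * (s / t) powr (d1 / \<alpha>2) \<and> v x s \<le> Q * v x t * (t / s) powr (d2 / \<alpha>1)" ..
  qed
qed

definition jump_rate :: "'a \<Rightarrow> 'a \<Rightarrow> real" where
  "jump_rate x y = 1 / (vol m x (dist x y) * \<Psi> (dist x y))"

text \<open>
Because \<open>\<Phi> \<le> \<Psi>\<close>, the jump term does not exceed the diagonal value of the kernel up to time \<open>\<tau>\<close>.
\<close>

lemma jump_rate_bounds:
  assumes "x \<noteq> y"
  shows "0 < jump_rate x y" "jump_rate x y * \<tau> x y \<le> v x (\<tau> x y)"
proof -
  have d: "0 < dist x y" using assms by simp
  have \<Psi>: "0 < \<Psi> (dist x y)" using \<Phi>_pos[OF d] \<Phi>_le_\<Psi>[of "dist x y"] by simp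
  note V = V_pos[OF d, of x]
  show "0 < jump_rate x y" using \<Psi> V by (simp add: jump_rate_def)
  have "\<tau> x y / \<Psi> (dist x y) \<le> 1" using \<Phi>_le_\<Psi>[of "dist x y"] \<Psi> by simp
  hence "\<tau> x y / \<Psi> (dist x y) / vol m x (dist x y) \<le> 1 / vol m x (dist x y)"
    using V by (intro divide_right_mono) auto
  thus "jump_rate x y * \<tau> x y \<le> v x (\<tau> x y)"
    by (simp add: jump_rate_def v_at_jump_time mult.commute)
qed

lemma hk_bound_eq:
  "hk_bound m \<Phi> \<Psi> 1 c s x y = min (v x s) (s * jump_rate x y + v x s * exp (- (c * (dist x y)\<^sup>2 / (scale_inv \<Phi> s)\<^sup>2)))"
  by (simp add: hk_bound_def vol_inv_def jump_rate_def)

lemma p_bounds: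
  obtains c1 c2 c3 c4 where "0 < c1" "0 < c2" "0 < c3" "0 < c4"
    "\<And>s x y. 0 < s \<Longrightarrow> ereal s \<le> T \<Longrightarrow> x \<in> D \<Longrightarrow> y \<in> D \<Longrightarrow>
      c1 * h s x y * hk_bound m \<Phi> \<Psi> 1 c2 s x y \<le> p s x y \<and> p s x y \<le> c3 * h s x y * hk_bound m \<Phi> \<Psi> 1 c4 s x y"
  using heat_kernel_bounds unfolding two_sided_hk_def by auto

lemma p_upper:
  obtains Q where "1 \<le> Q" "\<And>s x y. 0 < s \<Longrightarrow> ereal s \<le> T \<Longrightarrow> x \<in> D \<Longrightarrow> y \<in> D \<Longrightarrow> p s x y \<le> Q * (h s x y * v x s)"
proof -
  obtain c1 c2 c3 c4 where c: "0 < c3" "\<And>s x y. 0 < s \<Longrightarrow> ereal s \<le> T \<Longrightarrow> x \<in> D \<Longrightarrow> y \<in> D \<Longrightarrow>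
      c1 * h s x y * hk_bound m \<Phi> \<Psi> 1 c2 s x y \<le> p s x y \<and> p s x y \<le> c3 * h s x y * hk_bound m \<Phi> \<Psi> 1 c4 s x y"
    by (rule p_bounds) blast
  show thesis
  proof (rule that[of "max 1 c3"])
    fix s x y assume s: "0 < s" "ereal s \<le> T" and xy: "x \<in> D" "y \<in> D"
    note hs = h_bounds[OF s(1) xy]
    have "p s x y \<le> c3 * h s x y * hk_bound m \<Phi> \<Psi> 1 c4 s x y" using c(2)[OF s xy] by simp
    also have "\<dots> \<le> c3 * h s x y * v x s"
      using c hs by (intro mult_left_mono) (auto simp: hk_bound_eq)
    also have "\<dots> \<le> max 1 c3 * (h s x y * v x s)"
      using mult_right_mono[of c3 "max 1 c3" "h s x y * v x s"] hs v_pos[OF s(1), of x] by (simp add: mult.assoc)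
    finally show "p s x y \<le> max 1 c3 * (h s x y * v x s)" .
  qed simp
qed

text \<open>
As \<open>s\<close> decreases from \<open>\<tau>\<close>, both \<open>h\<close> and \<open>v\<close> grow at most like powers of \<open>\<tau>/s\<close>, whereas \<open>\<rho>/\<Phi>\<^sup>-\<^sup>1(s)\<close> is at least
a power of \<open>\<tau>/s\<close>; the Gaussian factor therefore compensates the growth.
\<close>

lemma p_upper_near:
  obtains Q where "1 \<le> Q" "\<And>s x y. x \<in> D \<Longrightarrow> y \<in> D \<Longrightarrow> x \<noteq> y \<Longrightarrow> 0 < s \<Longrightarrow> s \<le> \<tau> x y \<Longrightarrow>
    p s x y \<le> Q * (h s x y * s * jump_rate x y + h (\<tau> x y) x y * v x (\<tau> x y))"
proof -
  obtain c1 c2 c3 c4 where c: "0 < c3" "0 < c4" "\<And>s x y. 0 < s \<Longrightarrow> ereal s \<le> T \<Longrightarrow> x \<in> D \<Longrightarrow> y \<in> D \<Longrightarrow>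
      c1 * h s x y * hk_bound m \<Phi> \<Psi> 1 c2 s x y \<le> p s x y \<and> p s x y \<le> c3 * h s x y * hk_bound m \<Phi> \<Psi> 1 c4 s x y"
    by (rule p_bounds) blast
  obtain cg where cg: "1 \<le> cg" "\<And>s t x y. 0 < s \<Longrightarrow> s \<le> t \<Longrightarrow> ereal t \<le> T \<Longrightarrow> x \<in> D \<Longrightarrow> y \<in> D \<Longrightarrow>
    s powr (1 + \<beta>) * h s x y \<le> cg * (t powr (1 + \<beta>) * h t x y)" by (rule h_growth) blast
  obtain Qv where Qv: "1 \<le> Qv" "\<And>x s t. 0 < s \<Longrightarrow> s \<le> t \<Longrightarrow> ereal t \<le> T \<Longrightarrow>
    v x t \<le> Qv * v x s * (s / t) powr (d1 / \<alpha>2) \<and> v x s \<le> Qv * v x t * (t / s) powr (d2 / \<alpha>1)"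
    by (rule v_ratio) blast
  obtain B where B: "1 \<le> B" "\<And>s t. 0 < s \<Longrightarrow> s \<le> t \<Longrightarrow>
    between_powers B (1 / \<alpha>2) (1 / \<alpha>1) (t / s) (scale_inv \<Phi> t / scale_inv \<Phi> s)" by (rule scale_inv_ratio[OF \<Phi>_facts]) blast
  define e2 where "e2 = d2 / \<alpha>1"
  define c where "c = c4 / B\<^sup>2"
  \<comment> \<open>with \<open>w = (\<tau>/s)^(2/\<alpha>2)\<close>, the power \<open>w^k\<close> is the total growth \<open>(\<tau>/s)^(1+\<beta>+e2)\<close> of \<open>h\<close> and \<open>v\<close>\<close>
  define k where "k = (1 + \<beta> + e2) * \<alpha>2 / 2"
  have e2: "0 < e2" using d_pos \<alpha>_pos by (simp add: e2_def)
  have pos: "0 < c" "0 < k" using c B(1) index_pos e2 \<alpha>_pos by (auto simp: c_def k_def)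
  define M where "M = exp (k * ln (k / c))"
  define Q where "Q = max 1 (c3 * max 1 (cg * Qv * M))"
  have Q: "1 \<le> Q" "c3 \<le> Q" "c3 * (cg * Qv * M) \<le> Q"
  proof -
    have "c3 * 1 \<le> c3 * max 1 (cg * Qv * M)" "c3 * (cg * Qv * M) \<le> c3 * max 1 (cg * Qv * M)"
      using c by (intro mult_left_mono; simp)+
    thus "1 \<le> Q" "c3 \<le> Q" "c3 * (cg * Qv * M) \<le> Q" by (auto simp: Q_def)
  qed
  show thesis
  proof (rule that[OF Q(1)])
    fix s x y assume xy: "x \<in> D" "y \<in> D" "x \<noteq> y" and s: "0 < s" "s \<le> \<tau> x y"
    note \<tau>T = times_le_T(1)[OF xy]
    have sT: "ereal s \<le> T" using s \<tau>T ereal_le_below by blast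
    have \<tau>0: "0 < \<tau> x y" using s by simp
    note hs = h_bounds[OF s(1) xy(1,2)] and h\<tau> = h_bounds[OF \<tau>0 xy(1,2)]
    define z where "z = \<tau> x y / s"
    have z: "1 \<le> z" using s by (simp add: z_def)
    define E where "E = exp (- (c4 * (dist x y)\<^sup>2 / (scale_inv \<Phi> s)\<^sup>2))"
    have hz: "h s x y \<le> cg * z powr (1 + \<beta>) * h (\<tau> x y) x y"
    proof -
      have "s powr (1 + \<beta>) * h s x y \<le> cg * (\<tau> x y powr (1 + \<beta>) * h (\<tau> x y) x y)"
        by (rule cg(2)[OF s \<tau>T xy(1,2)])
      also have "\<tau> x y powr (1 + \<beta>) = s powr (1 + \<beta>) * z powr (1 + \<beta>)" using s \<tau>0 by (simp add: z_def powr_divide)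
      finally have "s powr (1 + \<beta>) * h s x y \<le> s powr (1 + \<beta>) * (cg * z powr (1 + \<beta>) * h (\<tau> x y) x y)"
        by (simp add: ac_simps)
      thus ?thesis using s by (simp add: mult_le_cancel_left_pos)
    qed
    have vz: "v x s \<le> Qv * v x (\<tau> x y) * z powr e2"
      using Qv(2)[OF s \<tau>T] by (simp add: z_def e2_def)
    have Ez: "z powr (1 + \<beta>) * z powr e2 * E \<le> M"
    proof -
      define w where "w = z powr (2 / \<alpha>2)"
      have w: "0 < w" using z by (simp add: w_def)
      have i: "0 < scale_inv \<Phi> s" by (rule inv_pos[OF s(1)])
      have "z powr (1 / \<alpha>2) / B \<le> dist x y / scale_inv \<Phi> s"
        using B(2)[OF s] by (simp add: z_def inv_\<Phi>)
      hence "(z powr (1 / \<alpha>2) / B)\<^sup>2 \<le> (dist x y / scale_inv \<Phi> s)\<^sup>2"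
        using B(1) by (intro power_mono) auto
      moreover have "(z powr (1 / \<alpha>2))\<^sup>2 = w"
        using z by (simp add: w_def power2_eq_square powr_add[symmetric])
      ultimately have "w / B\<^sup>2 \<le> (dist x y)\<^sup>2 / (scale_inv \<Phi> s)\<^sup>2" by (simp add: power_divide)
      hence "c4 * (w / B\<^sup>2) \<le> c4 * ((dist x y)\<^sup>2 / (scale_inv \<Phi> s)\<^sup>2)" using c by (intro mult_left_mono) auto
      hence "E \<le> exp (- c * w)" by (simp add: E_def c_def)
      moreover have "2 / \<alpha>2 * k = 1 + \<beta> + e2" using \<alpha>_pos by (simp add: k_def field_simps)
      hence "z powr (1 + \<beta>) * z powr e2 = w powr k"
        unfolding w_def powr_powr powr_add[symmetric] by simp
      ultimately have "z powr (1 + \<beta>) * z powr e2 * E \<le> w powr k * exp (- c * w)"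
        by (simp add: mult_left_mono)
      also have "\<dots> \<le> M" unfolding M_def by (rule powr_times_exp_bounded[OF pos(2,1) w])
      finally show ?thesis .
    qed
    have E0: "0 \<le> E" by (simp add: E_def)
    note vs = v_pos[OF s(1), of x] and v\<tau> = v_pos[OF \<tau>0, of x]
    have gauss: "h s x y * (v x s * E) \<le> cg * Qv * M * (h (\<tau> x y) x y * v x (\<tau> x y))"
    proof -
      have "v x s * E \<le> Qv * v x (\<tau> x y) * z powr e2 * E" using vz E0 by (rule mult_right_mono)
      hence "h s x y * (v x s * E) \<le> (cg * z powr (1 + \<beta>) * h (\<tau> x y) x y) * (Qv * v x (\<tau> x y) * z powr e2 * E)"
        by (intro mult_mono[OF hz]) (use hs h\<tau> cg(1) vs E0 in auto)
      also have "\<dots> = cg * Qv * (h (\<tau> x y) x y * v x (\<tau> x y)) * (z powr (1 + \<beta>) * z powr e2 * E)" by simp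
      also have "\<dots> \<le> cg * Qv * (h (\<tau> x y) x y * v x (\<tau> x y)) * M"
        using Ez cg(1) Qv(1) h\<tau> v\<tau> by (intro mult_left_mono) auto
      finally show ?thesis by (simp add: ac_simps)
    qed
    have "p s x y \<le> c3 * h s x y * hk_bound m \<Phi> \<Psi> 1 c4 s x y" using c(3)[OF s(1) sT xy(1,2)] by simp
    also have "\<dots> \<le> c3 * h s x y * (s * jump_rate x y + v x s * E)"
      using c hs by (intro mult_left_mono) (auto simp: hk_bound_eq E_def)
    also have "\<dots> = c3 * (h s x y * s * jump_rate x y) + c3 * (h s x y * (v x s * E))" by (simp add: algebra_simps)
    also have "\<dots> \<le> Q * (h s x y * s * jump_rate x y) + Q * (h (\<tau> x y) x y * v x (\<tau> x y))"
    proof (rule add_mono)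
      show "c3 * (h s x y * s * jump_rate x y) \<le> Q * (h s x y * s * jump_rate x y)"
        using Q hs s jump_rate_bounds(1)[OF xy(3)] by (intro mult_right_mono) auto
      have "c3 * (h s x y * (v x s * E)) \<le> c3 * (cg * Qv * M * (h (\<tau> x y) x y * v x (\<tau> x y)))"
        using gauss c by (intro mult_left_mono) auto
      also have "\<dots> \<le> Q * (h (\<tau> x y) x y * v x (\<tau> x y))"
        using mult_right_mono[OF Q(3), of "h (\<tau> x y) x y * v x (\<tau> x y)"] h\<tau> v\<tau> by (simp add: mult.assoc)
      finally show "c3 * (h s x y * (v x s * E)) \<le> Q * (h (\<tau> x y) x y * v x (\<tau> x y))" .
    qed
    finally show "p s x y \<le> Q * (h s x y * s * jump_rate x y + h (\<tau> x y) x y * v x (\<tau> x y))"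
      by (simp add: distrib_left)
  qed
qed

lemma p_lower_near:
  obtains Q where "1 \<le> Q" "\<And>s x y. x \<in> D \<Longrightarrow> y \<in> D \<Longrightarrow> x \<noteq> y \<Longrightarrow> 0 < s \<Longrightarrow> s \<le> \<tau> x y \<Longrightarrow>
    h s x y * s * jump_rate x y \<le> Q * p s x y"
proof -
  obtain c1 c2 c3 c4 where c: "0 < c1" "\<And>s x y. 0 < s \<Longrightarrow> ereal s \<le> T \<Longrightarrow> x \<in> D \<Longrightarrow> y \<in> D \<Longrightarrow>
      c1 * h s x y * hk_bound m \<Phi> \<Psi> 1 c2 s x y \<le> p s x y \<and> p s x y \<le> c3 * h s x y * hk_bound m \<Phi> \<Psi> 1 c4 s x y"
    by (rule p_bounds) blast
  show thesis
  proof (rule that[of "max 1 (1 / c1)"])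
    fix s x y assume xy: "x \<in> D" "y \<in> D" "x \<noteq> y" and s: "0 < s" "s \<le> \<tau> x y"
    have sT: "ereal s \<le> T" using s times_le_T(1)[OF xy] ereal_le_below by blast
    note hs = h_bounds[OF s(1) xy(1,2)] and jr = jump_rate_bounds[OF xy(3)]
    have "s * jump_rate x y \<le> \<tau> x y * jump_rate x y" using s jr by (intro mult_right_mono) auto
    also have "\<dots> \<le> v x (\<tau> x y)" using jr by (simp add: mult.commute)
    also have "\<dots> \<le> v x s" by (rule v_anti[OF s])
    finally have "s * jump_rate x y \<le> hk_bound m \<Phi> \<Psi> 1 c2 s x y"
      using v_pos[OF s(1), of x] by (simp add: hk_bound_eq)
    hence "c1 * h s x y * (s * jump_rate x y) \<le> c1 * h s x y * hk_bound m \<Phi> \<Psi> 1 c2 s x y"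
      using c hs by (intro mult_left_mono) auto
    hence le: "c1 * h s x y * (s * jump_rate x y) \<le> p s x y" using c(2)[OF s(1) sT xy(1,2)] by linarith
    moreover have "0 \<le> c1 * h s x y * (s * jump_rate x y)" using c hs s jr by simp
    ultimately have p0: "0 \<le> p s x y" by linarith
    have "h s x y * s * jump_rate x y \<le> 1 / c1 * p s x y" using le c by (simp add: field_simps)
    also have "\<dots> \<le> max 1 (1 / c1) * p s x y" using p0 by (intro mult_right_mono) auto
    finally show "h s x y * s * jump_rate x y \<le> max 1 (1 / c1) * p s x y" .
  qed simp
qed

text \<open>
For \<open>s \<ge> \<kappa>\<tau>\<close> the quotient \<open>\<rho>/\<Phi>\<^sup>-\<^sup>1(s)\<close> is bounded, and so the Gaussian factor is bounded below.
\<close>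

lemma p_lower:
  assumes \<kappa>: "0 < \<kappa>" "\<kappa> < 1"
  obtains Q where "1 \<le> Q" "\<And>s x y. x \<in> D \<Longrightarrow> y \<in> D \<Longrightarrow> x \<noteq> y \<Longrightarrow> \<kappa> * \<tau> x y < s \<Longrightarrow> ereal s \<le> T \<Longrightarrow>
    h s x y * v x s \<le> Q * p s x y"
proof -
  obtain c1 c2 c3 c4 where c: "0 < c1" "0 < c2" "\<And>s x y. 0 < s \<Longrightarrow> ereal s \<le> T \<Longrightarrow> x \<in> D \<Longrightarrow> y \<in> D \<Longrightarrow>
      c1 * h s x y * hk_bound m \<Phi> \<Psi> 1 c2 s x y \<le> p s x y \<and> p s x y \<le> c3 * h s x y * hk_bound m \<Phi> \<Psi> 1 c4 s x y"
    by (rule p_bounds) blast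
  obtain C where C: "1 \<le> C" "\<And>s t. 0 < s \<Longrightarrow> s \<le> t \<Longrightarrow>
    between_powers C (1 / \<alpha>2) (1 / \<alpha>1) (t / s) (scale_inv \<Phi> t / scale_inv \<Phi> s)" by (rule scale_inv_ratio[OF \<Phi>_facts]) blast
  define B where "B = C * (1 / \<kappa>) powr (1 / \<alpha>1)"
  have B: "1 \<le> B" unfolding B_def
    using mult_mono[OF C(1), of 1 "(1 / \<kappa>) powr (1 / \<alpha>1)"] ge_one_powr_ge_zero[of "1 / \<kappa>" "1 / \<alpha>1"] \<kappa> \<alpha>_pos C by simp
  define E where "E = exp (- (c2 * B\<^sup>2))"
  have E: "0 < E" by (simp add: E_def)
  show thesis
  proof (rule that[of "max 1 (1 / (c1 * E))"])
    fix s x y assume xy: "x \<in> D" "y \<in> D" "x \<noteq> y" and s: "\<kappa> * \<tau> x y < s" "ereal s \<le> T"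
    note t = times[OF xy]
    have s0: "0 < s" using s \<kappa> t(1) by (smt (verit) mult_pos_pos)
    note hs = h_bounds[OF s0 xy(1,2)] and jr = jump_rate_bounds[OF xy(3)]
    have i: "0 < scale_inv \<Phi> s" by (rule inv_pos[OF s0])
    have ratio: "dist x y / scale_inv \<Phi> s \<le> B"
    proof (cases "s \<le> \<tau> x y")
      case True
      have "dist x y / scale_inv \<Phi> s \<le> C * (\<tau> x y / s) powr (1 / \<alpha>1)"
        using C(2)[OF s0 True] by (simp add: inv_\<Phi>)
      also have "\<dots> \<le> B" unfolding B_def
        using C s s0 \<kappa> t(1) \<alpha>_pos by (intro mult_left_mono powr_mono2) (auto simp: field_simps)
      finally show ?thesis .
    next
      case False
      have "dist x y \<le> scale_inv \<Phi> s" using inv_mono[OF t(1), of s] False by (simp add: inv_\<Phi>)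
      hence "dist x y / scale_inv \<Phi> s \<le> 1" using i by simp
      thus ?thesis using B by linarith
    qed
    have "E \<le> exp (- (c2 * (dist x y)\<^sup>2 / (scale_inv \<Phi> s)\<^sup>2))"
    proof -
      have "(dist x y / scale_inv \<Phi> s)\<^sup>2 \<le> B\<^sup>2" using ratio i by (intro power_mono) auto
      hence "c2 * (dist x y / scale_inv \<Phi> s)\<^sup>2 \<le> c2 * B\<^sup>2" using c by (intro mult_left_mono) auto
      thus ?thesis by (simp add: E_def power_divide)
    qed
    hence "v x s * E \<le> v x s * exp (- (c2 * (dist x y)\<^sup>2 / (scale_inv \<Phi> s)\<^sup>2))"
      using v_pos[OF s0, of x] by (intro mult_left_mono) auto
    hence "v x s * E \<le> hk_bound m \<Phi> \<Psi> 1 c2 s x y"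
      using hk_bound_between(1)[of c2 s \<Psi> x y \<Phi> m] c(2) s0 \<Psi>_nonneg[of "dist x y"] by (simp add: vol_inv_def)
    hence "c1 * h s x y * (v x s * E) \<le> c1 * h s x y * hk_bound m \<Phi> \<Psi> 1 c2 s x y"
      using c hs by (intro mult_left_mono) auto
    hence le: "c1 * h s x y * (v x s * E) \<le> p s x y" using c(3)[OF s0 s(2) xy(1,2)] by linarith
    moreover have "0 \<le> c1 * h s x y * (v x s * E)" using c hs v_pos[OF s0, of x] E by simp
    ultimately have p0: "0 \<le> p s x y" by linarith
    have "h s x y * v x s \<le> 1 / (c1 * E) * p s x y" using le c E by (simp add: field_simps)
    also have "\<dots> \<le> max 1 (1 / (c1 * E)) * p s x y" using p0 by (intro mult_right_mono) auto
    finally show "h s x y * v x s \<le> max 1 (1 / (c1 * E)) * p s x y" .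
  qed simp
qed

text \<open>
Up to time \<open>\<Phi>(diam D)\<close> this combines \<open>h_large_times\<close> with the monotonicity of \<open>v\<close>.  Afterwards the large-time
decay applies; the factor \<open>v(\<omega>)\<close> can be inserted since on a bounded domain it is bounded below.
\<close>

lemma p_far:
  obtains Q where "1 \<le> Q" "\<And>s x y. x \<in> D \<Longrightarrow> y \<in> D \<Longrightarrow> x \<noteq> y \<Longrightarrow> \<omega> x y < s \<Longrightarrow>
    p s x y \<le> Q * (h (\<tau> x y) x y * v x (\<omega> x y)) * \<omega> x y powr (1 + \<beta>) * s powr - (1 + \<beta>)"
proof -
  obtain Qu where Qu: "1 \<le> Qu" "\<And>s x y. 0 < s \<Longrightarrow> ereal s \<le> T \<Longrightarrow> x \<in> D \<Longrightarrow> y \<in> D \<Longrightarrow> p s x y \<le> Qu * (h s x y * v x s)"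
    by (rule p_upper) blast
  obtain Ql where Ql: "1 \<le> Ql" "\<And>s x y. x \<in> D \<Longrightarrow> y \<in> D \<Longrightarrow> x \<noteq> y \<Longrightarrow> \<omega> x y \<le> s \<Longrightarrow> ereal s \<le> T \<Longrightarrow>
      s powr (1 + \<beta>) * h s x y \<le> Ql * (\<omega> x y powr (1 + \<beta>) * h (\<tau> x y) x y)" by (rule h_large_times) blast
  have below: "p s x y \<le> Qu * Ql * (h (\<tau> x y) x y * v x (\<omega> x y)) * \<omega> x y powr (1 + \<beta>) * s powr - (1 + \<beta>)"
    if xy: "x \<in> D" "y \<in> D" "x \<noteq> y" and s: "\<omega> x y < s" "ereal s \<le> T" for s x y
  proof -
    note t = times[OF xy]
    have s0: "0 < s" using s t(9) by simp
    note hs = h_bounds[OF s0 xy(1,2)]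
    have "h s x y = s powr - (1 + \<beta>) * (s powr (1 + \<beta>) * h s x y)" using s0 by (simp add: powr_add[symmetric] mult.assoc[symmetric])
    also have "\<dots> \<le> s powr - (1 + \<beta>) * (Ql * (\<omega> x y powr (1 + \<beta>) * h (\<tau> x y) x y))"
      using Ql(2)[OF xy _ s(2)] s by (intro mult_left_mono) auto
    finally have hb: "h s x y \<le> s powr - (1 + \<beta>) * (Ql * (\<omega> x y powr (1 + \<beta>) * h (\<tau> x y) x y))" .
    have "h s x y * v x s \<le> s powr - (1 + \<beta>) * (Ql * (\<omega> x y powr (1 + \<beta>) * h (\<tau> x y) x y)) * v x (\<omega> x y)"
      using hb hs v_anti[OF t(9), of s x] s v_pos[OF s0, of x] by (intro mult_mono) auto
    hence "Qu * (h s x y * v x s) \<le> Qu * (s powr - (1 + \<beta>) * (Ql * (\<omega> x y powr (1 + \<beta>) * h (\<tau> x y) x y)) * v x (\<omega> x y))"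
      using Qu(1) by (intro mult_left_mono) auto
    with Qu(2)[OF s0 s(2) xy(1,2)]
    have "p s x y \<le> Qu * (s powr - (1 + \<beta>) * (Ql * (\<omega> x y powr (1 + \<beta>) * h (\<tau> x y) x y)) * v x (\<omega> x y))" by linarith
    thus ?thesis by (simp add: ac_simps)
  qed
  have nonneg: "0 \<le> h (\<tau> x y) x y * v x (\<omega> x y) * \<omega> x y powr (1 + \<beta>) * s powr - (1 + \<beta>)"
    if xy: "x \<in> D" "y \<in> D" "x \<noteq> y" for s x y
    using h_bounds[OF times(1)[OF xy] xy(1,2)] v_pos[OF times(9)[OF xy], of x] by simp
  have one: "1 \<le> Qu * Ql" using mult_mono[OF Qu(1) Ql(1)] Qu by simp
  show thesis
  proof (cases "bounded D")
    case False
    hence "T = \<infinity>" by (simp add: scale_diam_def)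
    thus thesis using below by (intro that[OF one]) auto
  next
    case True
    show thesis
    proof (cases "\<exists>x y. x \<in> D \<and> y \<in> D \<and> x \<noteq> y")
      case False
      thus thesis by (intro that[of 1]) auto
    next
      case ex: True
      then obtain x0 y0 where x0: "x0 \<in> D" "y0 \<in> D" "x0 \<noteq> y0" by blast
      have diam: "0 < diameter D" using dist_le_diameter[OF True x0(1,2)] x0(3) by (smt (verit) zero_less_dist_iff)
      define T0 where "T0 = \<Phi> (diameter D)"
      have T0: "0 < T0" "T = ereal T0" using diam True by (auto simp: T0_def scale_diam_def intro: \<Phi>_pos)
      obtain C where C: "\<And>s x y. x \<in> D \<Longrightarrow> y \<in> D \<Longrightarrow> T0 < s \<Longrightarrow> p s x y \<le> C * s powr - (1 + \<beta>) * h T0 x y"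
        using large_time[OF True] unfolding T0_def by blast
      obtain b where b: "0 < b" "\<And>x. x \<in> D \<Longrightarrow> 1 / b \<le> vol m x (diameter D) \<and> vol m x (diameter D) \<le> b"
        using vol_uniform_bounds[OF radon volume True x0(1) diam] by metis
      define Q where "Q = max (Qu * Ql) (\<bar>C\<bar> * (Ql * (T0 powr - (1 + \<beta>) * b)))"
      show thesis
      proof (rule that[of Q])
        show "1 \<le> Q" using one by (simp add: Q_def)
        fix s x y assume xy: "x \<in> D" "y \<in> D" "x \<noteq> y" and s: "\<omega> x y < s"
        note t = times[OF xy]
        define N where "N = h (\<tau> x y) x y * v x (\<omega> x y) * \<omega> x y powr (1 + \<beta>) * s powr - (1 + \<beta>)"
        have N: "0 \<le> N" using nonneg[OF xy, of s] by (simp add: N_def)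
        have "p s x y \<le> Q * N"
        proof (cases "s \<le> T0")
          case True
          have "p s x y \<le> Qu * Ql * N" using below[OF xy s] True T0 by (simp add: N_def mult.assoc)
          also have "\<dots> \<le> Q * N" using N by (intro mult_right_mono) (auto simp: Q_def)
          finally show ?thesis .
        next
          case False
          have \<omega>T: "\<omega> x y \<le> T0" using t(6) T0 by simp
          have hT: "0 \<le> h T0 x y" using h_bounds[OF T0(1) xy(1,2)] by simp
          have "h T0 x y = T0 powr - (1 + \<beta>) * (T0 powr (1 + \<beta>) * h T0 x y)"
            using T0 by (simp add: powr_add[symmetric] mult.assoc[symmetric])
          also have "\<dots> \<le> T0 powr - (1 + \<beta>) * (Ql * (\<omega> x y powr (1 + \<beta>) * h (\<tau> x y) x y))"
            using Ql(2)[OF xy \<omega>T] T0 by (intro mult_left_mono) auto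
          finally have hb: "h T0 x y \<le> T0 powr - (1 + \<beta>) * (Ql * (\<omega> x y powr (1 + \<beta>) * h (\<tau> x y) x y))" .
          have "scale_inv \<Phi> (\<omega> x y) \<le> diameter D"
            using inv_mono[OF t(9) \<omega>T] inv_\<Phi>[of "diameter D"] diam by (simp add: T0_def)
          hence "vol m x (scale_inv \<Phi> (\<omega> x y)) \<le> b" using V_mono[of _ "diameter D" x] b(2)[OF xy(1)] by fastforce
          hence vb: "1 \<le> b * v x (\<omega> x y)"
            using V_pos[OF inv_pos[OF t(9)], of x] by (simp add: vol_inv_def)
          define Z where "Z = \<bar>C\<bar> * s powr - (1 + \<beta>) * (T0 powr - (1 + \<beta>) * (Ql * (\<omega> x y powr (1 + \<beta>) * h (\<tau> x y) x y)))"
          have Z: "0 \<le> Z" using Ql(1) h_bounds[OF t(1) xy(1,2)] by (simp add: Z_def)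
          have "p s x y \<le> C * s powr - (1 + \<beta>) * h T0 x y" using C[OF xy(1,2)] False by simp
          also have "\<dots> \<le> \<bar>C\<bar> * s powr - (1 + \<beta>) * h T0 x y" using hT by (intro mult_right_mono) auto
          also have "\<dots> \<le> Z" unfolding Z_def using hb by (intro mult_left_mono) auto
          also have "\<dots> \<le> Z * (b * v x (\<omega> x y))" using mult_left_mono[OF vb Z] by simp
          also have "\<dots> = \<bar>C\<bar> * (Ql * (T0 powr - (1 + \<beta>) * b)) * N" by (simp add: N_def Z_def ac_simps)
          also have "\<dots> \<le> Q * N" using N by (intro mult_right_mono) (auto simp: Q_def)
          finally show ?thesis .
        qed
        thus "p s x y \<le> Q * (h (\<tau> x y) x y * v x (\<omega> x y)) * \<omega> x y powr (1 + \<beta>) * s powr - (1 + \<beta>)"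
          by (simp add: N_def mult.assoc)
      qed
    qed
  qed
qed

section \<open>The Green integral\<close>

abbreviation green_integral :: "real measure \<Rightarrow> 'a \<Rightarrow> 'a \<Rightarrow> ennreal" where
  "green_integral U x y \<equiv> \<integral>\<^sup>+s\<in>{0<..}. ennreal (p s x y) \<partial>U"

abbreviation volume_integral :: "real \<Rightarrow> real measure \<Rightarrow> 'a \<Rightarrow> 'a \<Rightarrow> ennreal" where
  "volume_integral \<kappa> U x y \<equiv> \<integral>\<^sup>+s\<in>{\<kappa> * \<tau> x y<..\<omega> x y}. ennreal (v x s) \<partial>U"

abbreviation log_ratio :: "'a \<Rightarrow> 'a \<Rightarrow> real" where
  "log_ratio x y \<equiv> ln (exp 1 + \<tau> x y / \<Phi> (bdist_max D x y))"

abbreviation jump_part :: "'a \<Rightarrow> 'a \<Rightarrow> real" where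
  "jump_part x y \<equiv> jump_rate x y * \<tau> x y powr (1 + \<beta>) * log_ratio x y"

text \<open>
The logarithm of the theorem has \<open>\<delta>\<^sub>\<or>\<close> in the place of the capped distance.  The two differ only if
\<open>\<tau> \<le> \<Delta>\<close>, when both logarithms lie between 1 and 2.
\<close>

lemma log_ratio_bounds:
  assumes xy: "x \<in> D" "y \<in> D" "x \<noteq> y"
  shows "1 \<le> log_ratio x y" "log_ratio x y \<le> ln (exp 1 + \<tau> x y / \<sigma> x y)"
    "ln (exp 1 + \<tau> x y / \<sigma> x y) \<le> 2 * log_ratio x y"
    "dist x y \<le> bdist_max D x y \<Longrightarrow> log_ratio x y \<le> 2"
proof -
  note t = times[OF xy]
  have b: "0 < \<Phi> (bdist_max D x y)" using \<Phi>_pos bdist_min_max_pos(2)[OF xy(1,2)] by simp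
  have q: "0 < \<tau> x y / \<Phi> (bdist_max D x y)" using t b by simp
  note two = ln_exp_plus_one_le
  show one: "1 \<le> log_ratio x y"
    using q by (intro one_le_ln_exp_plus) auto
  have "\<tau> x y / \<Phi> (bdist_max D x y) \<le> \<tau> x y / \<sigma> x y"
    using t b by (intro divide_left_mono) auto
  thus "log_ratio x y \<le> ln (exp 1 + \<tau> x y / \<sigma> x y)"
    using q by (intro ln_exp_plus_mono) auto
  show "ln (exp 1 + \<tau> x y / \<sigma> x y) \<le> 2 * log_ratio x y"
  proof (cases "\<Delta> x y < \<tau> x y")
    case True
    hence "\<sigma> x y = \<Phi> (bdist_max D x y)" using t(11) by (simp add: lower_time_def)
    thus ?thesis using one by simp
  next
    case False
    hence "\<sigma> x y = \<tau> x y" by (simp add: lower_time_def)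
    thus ?thesis using two one t by simp
  qed
  show "log_ratio x y \<le> 2" if "dist x y \<le> bdist_max D x y"
  proof -
    have "\<tau> x y \<le> \<Phi> (bdist_max D x y)" using that by (intro \<Phi>_mono) auto
    hence "\<tau> x y / \<Phi> (bdist_max D x y) \<le> 1" using b by simp
    hence "log_ratio x y \<le> ln (exp 1 + 1)" using q by (intro ln_exp_plus_mono) auto
    thus ?thesis using two by linarith
  qed
qed

text \<open>
The four time ranges of \<open>potential_integral_upper\<close>.  The majorants of the jump term on \<open>(0,\<sigma>]\<close> and on \<open>(\<sigma>,\<tau>]\<close>
come from \<open>h_small_times\<close> and from (H2) respectively.
\<close>

lemma green_upper:
  obtains C where "1 \<le> C"
    "\<And>U x y. regular_potential U \<beta> T \<kappa> K \<Longrightarrow> x \<in> D \<Longrightarrow> y \<in> D \<Longrightarrow> x \<noteq> y \<Longrightarrow>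
      green_integral U x y \<le>
      ennreal (C * h (\<tau> x y) x y * (jump_part x y +
        v x (\<tau> x y) * \<tau> x y powr \<beta> + v x (\<omega> x y) * \<omega> x y powr \<beta>)) +
      ennreal (C * h (\<tau> x y) x y) * volume_integral \<kappa> U x y"
proof -
  obtain Q1 g where Q1: "1 \<le> Q1" and g: "1 \<le> g" "g < 1 + \<beta>" and
    Q1b: "\<And>s x y. x \<in> D \<Longrightarrow> y \<in> D \<Longrightarrow> x \<noteq> y \<Longrightarrow> 0 < s \<Longrightarrow> s \<le> \<sigma> x y \<Longrightarrow>
      s powr g * h s x y \<le> Q1 * (\<tau> x y powr (1 + \<beta>) * h (\<tau> x y) x y * \<sigma> x y powr (g - 1 - \<beta>))"
    by (rule h_small_times) blast
  obtain Q2 where Q2: "1 \<le> Q2" "\<And>s t x y. 0 < s \<Longrightarrow> s \<le> t \<Longrightarrow> ereal t \<le> T \<Longrightarrow> x \<in> D \<Longrightarrow> y \<in> D \<Longrightarrow>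
    s powr (1 + \<beta>) * h s x y \<le> Q2 * (t powr (1 + \<beta>) * h t x y)" by (rule h_growth) blast
  obtain Qn where Qn: "1 \<le> Qn" "\<And>s x y. x \<in> D \<Longrightarrow> y \<in> D \<Longrightarrow> x \<noteq> y \<Longrightarrow> 0 < s \<Longrightarrow> s \<le> \<tau> x y \<Longrightarrow>
    p s x y \<le> Qn * (h s x y * s * jump_rate x y + h (\<tau> x y) x y * v x (\<tau> x y))" by (rule p_upper_near) blast
  obtain Qu where Qu: "1 \<le> Qu" "\<And>s x y. 0 < s \<Longrightarrow> ereal s \<le> T \<Longrightarrow> x \<in> D \<Longrightarrow> y \<in> D \<Longrightarrow> p s x y \<le> Qu * (h s x y * v x s)"
    by (rule p_upper) blast
  obtain Qf where Qf: "1 \<le> Qf" "\<And>s x y. x \<in> D \<Longrightarrow> y \<in> D \<Longrightarrow> x \<noteq> y \<Longrightarrow> \<omega> x y < s \<Longrightarrow>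
    p s x y \<le> Qf * (h (\<tau> x y) x y * v x (\<omega> x y)) * \<omega> x y powr (1 + \<beta>) * s powr - (1 + \<beta>)" by (rule p_far) blast
  define Qh where "Qh = max Q1 Q2"
  have Qh: "1 \<le> Qh" "Q1 \<le> Qh" "Q2 \<le> Qh" using Q1 by (auto simp: Qh_def)
  define C0 where "C0 = max 1 (potential_const K \<beta> g)"
  define Qm where "Qm = max (2 * Qn * Qh) (max Qn Qf)"
  have Qm: "2 * Qn * Qh \<le> Qm" "Qn \<le> Qm" "Qf \<le> Qm" by (auto simp: Qm_def)
  define C where "C = max (C0 * Qm) Qu"
  have C: "C0 * Qm \<le> C" "Qu \<le> C" by (auto simp: C_def)
  show thesis
  proof (rule that[of C])
    show "1 \<le> C" using C Qu by linarith
    fix U x y assume U: "regular_potential U \<beta> T \<kappa> K" and xy: "x \<in> D" "y \<in> D" "x \<noteq> y"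
    note t = times[OF xy] and \<kappa> = regular_potentialD(3,4)[OF U]
    define H where "H = h (\<tau> x y) x y"
    have H: "0 \<le> H" using h_bounds[OF t(1) xy(1,2)] by (simp add: H_def)
    note jr = jump_rate_bounds(1)[OF xy(3)] and v\<tau> = v_pos[OF t(1), of x] and v\<omega> = v_pos[OF t(9), of x]
    define J where "J = Qn * Qh * (H * (jump_rate x y * \<tau> x y powr (1 + \<beta>)))"
    define B where "B = Qn * (H * v x (\<tau> x y))"
    define E where "E = Qf * (H * v x (\<omega> x y))"
    have nn: "0 \<le> J" "0 \<le> B" "0 \<le> E" using Qn(1) Qh(1) Qf(1) H jr v\<tau> v\<omega> by (auto simp: J_def B_def E_def)
    have "green_integral U x y \<le>
      ennreal (potential_const K \<beta> g *
        (J * ln (exp 1 + \<tau> x y / \<sigma> x y) + B * \<tau> x y powr \<beta> + E * \<omega> x y powr \<beta>)) +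
      (\<integral>\<^sup>+s\<in>{\<tau> x y<..\<omega> x y}. ennreal (Qu * H * v x s) \<partial>U)"
    proof (rule potential_integral_upper[OF U g p_measurable[OF xy(1,2)] nn t(3,4,5,6)])
      fix s assume s: "0 < s" "s \<le> \<sigma> x y"
      have "h s x y * s = s powr (1 - g) * (s powr g * h s x y)"
        using s by (simp add: mult.assoc[symmetric] powr_add[symmetric])
      also have "\<dots> \<le> s powr (1 - g) * (Q1 * (\<tau> x y powr (1 + \<beta>) * H * \<sigma> x y powr (g - 1 - \<beta>)))"
        using Q1b[OF xy s] by (intro mult_left_mono) (auto simp: H_def)
      also have "\<dots> = Q1 * (s powr (1 - g) * (\<tau> x y powr (1 + \<beta>) * H * \<sigma> x y powr (g - 1 - \<beta>)))" by simp
      also have "\<dots> \<le> Qh * (s powr (1 - g) * (\<tau> x y powr (1 + \<beta>) * H * \<sigma> x y powr (g - 1 - \<beta>)))"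
        using Qh H by (intro mult_right_mono) auto
      finally have hs: "h s x y * s * jump_rate x y \<le>
          Qh * (s powr (1 - g) * (\<tau> x y powr (1 + \<beta>) * H * \<sigma> x y powr (g - 1 - \<beta>))) * jump_rate x y"
        using jr by (intro mult_right_mono) auto
      have "p s x y \<le> Qn * (h s x y * s * jump_rate x y + H * v x (\<tau> x y))"
        using Qn(2)[OF xy s(1)] s t(4) by (simp add: H_def)
      also have "\<dots> \<le> Qn * (Qh * (s powr (1 - g) * (\<tau> x y powr (1 + \<beta>) * H * \<sigma> x y powr (g - 1 - \<beta>))) * jump_rate x y + H * v x (\<tau> x y))"
        using hs Qn(1) by (intro mult_left_mono add_right_mono) auto
      also have "\<dots> = J * \<sigma> x y powr (g - 1 - \<beta>) * s powr (1 - g) + B"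
        by (simp add: J_def B_def algebra_simps)
      finally show "p s x y \<le> J * \<sigma> x y powr (g - 1 - \<beta>) * s powr (1 - g) + B" .
    next
      fix s assume s: "\<sigma> x y < s" "s \<le> \<tau> x y"
      have s0: "0 < s" using s t(3) by simp
      have "h s x y * s = s powr - \<beta> * (s powr (1 + \<beta>) * h s x y)"
        using s0 by (simp add: mult.assoc[symmetric] powr_add[symmetric])
      also have "\<dots> \<le> s powr - \<beta> * (Q2 * (\<tau> x y powr (1 + \<beta>) * H))"
        using Q2(2)[OF s0 s(2) times_le_T(1)[OF xy] xy(1,2)] by (intro mult_left_mono) (auto simp: H_def)
      also have "\<dots> = Q2 * (s powr - \<beta> * (\<tau> x y powr (1 + \<beta>) * H))" by simp
      also have "\<dots> \<le> Qh * (s powr - \<beta> * (\<tau> x y powr (1 + \<beta>) * H))"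
        using Qh H by (intro mult_right_mono) auto
      finally have hs: "h s x y * s * jump_rate x y \<le> Qh * (s powr - \<beta> * (\<tau> x y powr (1 + \<beta>) * H)) * jump_rate x y"
        using jr by (intro mult_right_mono) auto
      have "p s x y \<le> Qn * (h s x y * s * jump_rate x y + H * v x (\<tau> x y))"
        using Qn(2)[OF xy s0 s(2)] by (simp add: H_def)
      also have "\<dots> \<le> Qn * (Qh * (s powr - \<beta> * (\<tau> x y powr (1 + \<beta>) * H)) * jump_rate x y + H * v x (\<tau> x y))"
        using hs Qn(1) by (intro mult_left_mono add_right_mono) auto
      also have "\<dots> = J * s powr - \<beta> + B" by (simp add: J_def B_def algebra_simps)
      finally show "p s x y \<le> J * s powr - \<beta> + B" .
    next
      fix s assume s: "\<tau> x y < s" "s \<le> \<omega> x y"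
      have s0: "0 < s" using s t(1) by simp
      note sT = below_upper_time[OF xy s(2)]
      have "p s x y \<le> Qu * (h s x y * v x s)" by (rule Qu(2)[OF s0 sT xy(1,2)])
      also have "\<dots> \<le> Qu * (H * v x s)"
        using h_anti[OF t(1) _ xy(1,2), of s] s Qu(1) v_pos[OF s0, of x]
        by (intro mult_left_mono mult_right_mono) (auto simp: H_def)
      finally show "p s x y \<le> Qu * H * v x s" by (simp add: mult.assoc)
    next
      fix s assume "\<omega> x y < s"
      thus "p s x y \<le> E * \<omega> x y powr (1 + \<beta>) * s powr - (1 + \<beta>)"
        using Qf(2)[OF xy] by (simp add: E_def H_def)
    qed
    also have "\<dots> \<le> ennreal (C * H * (jump_part x y +
        v x (\<tau> x y) * \<tau> x y powr \<beta> + v x (\<omega> x y) * \<omega> x y powr \<beta>)) +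
      ennreal (C * H) * volume_integral \<kappa> U x y"
    proof (rule add_mono)
      define N where "N = H * (jump_part x y +
        v x (\<tau> x y) * \<tau> x y powr \<beta> + v x (\<omega> x y) * \<omega> x y powr \<beta>)"
      note lr = log_ratio_bounds[OF xy]
      have lr0: "0 \<le> log_ratio x y" "0 \<le> ln (exp 1 + \<tau> x y / \<sigma> x y)" using lr by linarith+
      \<comment> \<open>the factor 2 comes from replacing \<open>\<sigma>\<close> by \<open>\<Phi>(\<delta>\<^sub>\<or>)\<close> in the logarithm\<close>
      have parts: "J * ln (exp 1 + \<tau> x y / \<sigma> x y) \<le> Qm * (H * (jump_part x y))"
        "B * \<tau> x y powr \<beta> \<le> Qm * (H * (v x (\<tau> x y) * \<tau> x y powr \<beta>))"
        "E * \<omega> x y powr \<beta> \<le> Qm * (H * (v x (\<omega> x y) * \<omega> x y powr \<beta>))"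
      proof -
        have "J * ln (exp 1 + \<tau> x y / \<sigma> x y) \<le> J * (2 * log_ratio x y)" using lr nn by (intro mult_left_mono) auto
        also have "\<dots> = 2 * Qn * Qh * (H * (jump_part x y))" by (simp add: J_def)
        also have "\<dots> \<le> Qm * (H * (jump_part x y))"
          using H jr lr0 by (intro mult_right_mono Qm) auto
        finally show "J * ln (exp 1 + \<tau> x y / \<sigma> x y) \<le> Qm * (H * (jump_part x y))" .
        show "B * \<tau> x y powr \<beta> \<le> Qm * (H * (v x (\<tau> x y) * \<tau> x y powr \<beta>))"
          unfolding B_def mult.assoc using H v\<tau> by (intro mult_right_mono Qm) auto
        show "E * \<omega> x y powr \<beta> \<le> Qm * (H * (v x (\<omega> x y) * \<omega> x y powr \<beta>))"
          unfolding E_def mult.assoc using H v\<omega> by (intro mult_right_mono Qm) auto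
      qed
      hence sum: "J * ln (exp 1 + \<tau> x y / \<sigma> x y) + B * \<tau> x y powr \<beta> + E * \<omega> x y powr \<beta> \<le> Qm * N"
        by (simp add: N_def algebra_simps)
      have N: "0 \<le> N" using H jr lr0 v\<tau> v\<omega> by (auto simp: N_def intro!: mult_nonneg_nonneg add_nonneg_nonneg)
      have "potential_const K \<beta> g *
        (J * ln (exp 1 + \<tau> x y / \<sigma> x y) + B * \<tau> x y powr \<beta> + E * \<omega> x y powr \<beta>) \<le> C0 * (Qm * N)"
        using sum nn lr0 by (intro mult_mono) (auto simp: C0_def intro!: add_nonneg_nonneg)
      also have "\<dots> \<le> C * N" using mult_right_mono[OF C(1) N] by (simp add: mult.assoc)
      finally show "ennreal (potential_const K \<beta> g *
        (J * ln (exp 1 + \<tau> x y / \<sigma> x y) + B * \<tau> x y powr \<beta> + E * \<omega> x y powr \<beta>)) \<le>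
        ennreal (C * H * (jump_part x y +
          v x (\<tau> x y) * \<tau> x y powr \<beta> + v x (\<omega> x y) * \<omega> x y powr \<beta>))"
        by (intro ennreal_leI) (simp add: N_def mult.assoc)
    next
      have \<kappa>\<tau>: "0 < \<kappa> * \<tau> x y" "\<kappa> * \<tau> x y \<le> \<tau> x y" using \<kappa> t(1) by (auto simp: mult_left_le_one_le)
      have meas: "(\<lambda>s. ennreal (v x s) * indicator {\<kappa> * \<tau> x y<..\<omega> x y} s) \<in> borel_measurable U"
        using v_measurable[OF \<kappa>\<tau>(1)] by (simp add: measurable_pot[OF U])
      have "(\<integral>\<^sup>+s\<in>{\<tau> x y<..\<omega> x y}. ennreal (Qu * H * v x s) \<partial>U) \<le>
          (\<integral>\<^sup>+s. ennreal (C * H) * (ennreal (v x s) * indicator {\<kappa> * \<tau> x y<..\<omega> x y} s) \<partial>U)"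
      proof (rule nn_integral_mono)
        fix s
        show "ennreal (Qu * H * v x s) * indicator {\<tau> x y<..\<omega> x y} s \<le>
            ennreal (C * H) * (ennreal (v x s) * indicator {\<kappa> * \<tau> x y<..\<omega> x y} s)"
        proof (cases "\<tau> x y < s \<and> s \<le> \<omega> x y")
          case True
          hence s0: "0 < s" using t(1) by simp
          have "Qu * H * v x s \<le> C * H * v x s" using C(2) H v_pos[OF s0, of x] by (intro mult_right_mono) auto
          moreover have "0 \<le> C * H" using C(2) Qu(1) H by simp
          ultimately show ?thesis using True \<kappa>\<tau> by (simp add: ennreal_mult'[symmetric] ennreal_leI)
        qed auto
      qed
      also have "\<dots> = ennreal (C * H) * volume_integral \<kappa> U x y"
        by (rule nn_integral_cmult[OF meas])
      finally show "(\<integral>\<^sup>+s\<in>{\<tau> x y<..\<omega> x y}. ennreal (Qu * H * v x s) \<partial>U) \<le> \<dots>" .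
    qed
    finally show "green_integral U x y \<le>
      ennreal (C * h (\<tau> x y) x y * (jump_part x y +
        v x (\<tau> x y) * \<tau> x y powr \<beta> + v x (\<omega> x y) * \<omega> x y powr \<beta>)) +
      ennreal (C * h (\<tau> x y) x y) * volume_integral \<kappa> U x y"
      by (simp add: H_def)
  qed
qed

text \<open>
Two separate bounds: the jump term between \<open>\<kappa>\<sigma>\<close> and \<open>\<tau>\<close> gives the logarithm, and the diagonal size of the kernel
between \<open>\<kappa>\<tau>\<close> and \<open>\<omega>\<close> gives the volume integral.
\<close>

lemma green_lower:
  assumes \<kappa>: "0 < \<kappa>" "\<kappa> < 1"
  obtains C where "1 \<le> C"
    "\<And>U x y. regular_potential U \<beta> T \<kappa> K \<Longrightarrow> x \<in> D \<Longrightarrow> y \<in> D \<Longrightarrow> x \<noteq> y \<Longrightarrow>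
      ennreal (h (\<tau> x y) x y * (jump_part x y) / C) \<le>
        green_integral U x y"
    "\<And>U x y. regular_potential U \<beta> T \<kappa> K \<Longrightarrow> x \<in> D \<Longrightarrow> y \<in> D \<Longrightarrow> x \<noteq> y \<Longrightarrow>
      ennreal (h (\<tau> x y) x y / C) * volume_integral \<kappa> U x y \<le>
        green_integral U x y"
proof -
  obtain Qm where Qm: "1 \<le> Qm"
    "\<And>s x y. x \<in> D \<Longrightarrow> y \<in> D \<Longrightarrow> x \<noteq> y \<Longrightarrow> \<kappa> * \<sigma> x y < s \<Longrightarrow> s \<le> \<tau> x y \<Longrightarrow>
      \<tau> x y powr (1 + \<beta>) * h (\<tau> x y) x y \<le> Qm * (s powr (1 + \<beta>) * h s x y)" by (rule h_middle_times[OF \<kappa>]) blast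
  obtain Qn where Qn: "1 \<le> Qn" "\<And>s x y. x \<in> D \<Longrightarrow> y \<in> D \<Longrightarrow> x \<noteq> y \<Longrightarrow> 0 < s \<Longrightarrow> s \<le> \<tau> x y \<Longrightarrow>
    h s x y * s * jump_rate x y \<le> Qn * p s x y" by (rule p_lower_near) blast
  obtain Ql where Ql: "1 \<le> Ql" "\<And>s x y. x \<in> D \<Longrightarrow> y \<in> D \<Longrightarrow> x \<noteq> y \<Longrightarrow> \<kappa> * \<tau> x y < s \<Longrightarrow> ereal s \<le> T \<Longrightarrow>
    h s x y * v x s \<le> Ql * p s x y" by (rule p_lower[OF \<kappa>]) blast
  obtain Qu where Qu: "1 \<le> Qu"
    "\<And>x y. x \<in> D \<Longrightarrow> y \<in> D \<Longrightarrow> x \<noteq> y \<Longrightarrow> h (\<tau> x y) x y \<le> Qu * h (\<omega> x y) x y" by (rule h_upper_time) blast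
  define A where "A = K * (2 + ln (1 / \<kappa>))"
  define C where "C = max 1 (max (Qm * Qn * A) (Qu * Ql))"
  have C: "1 \<le> C" "Qm * Qn * A \<le> C" "Qu * Ql \<le> C" by (auto simp: C_def)
  show thesis
  proof (rule that[OF C(1)])
    fix U x y assume U: "regular_potential U \<beta> T \<kappa> K" and xy: "x \<in> D" "y \<in> D" "x \<noteq> y"
    note t = times[OF xy]
    have K: "1 \<le> K" using regular_potentialD(5)[OF U] .
    have "0 \<le> ln (1 / \<kappa>)" using \<kappa> by (intro ln_ge_zero) auto
    hence A: "0 < A" unfolding A_def using K by (intro mult_pos_pos) linarith+
    define H where "H = h (\<tau> x y) x y"
    have H: "0 \<le> H" using h_bounds[OF t(1) xy(1,2)] by (simp add: H_def)
    note jr = jump_rate_bounds(1)[OF xy(3)] and lr = log_ratio_bounds[OF xy]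
    define J where "J = H * (jump_rate x y * \<tau> x y powr (1 + \<beta>)) / (Qm * Qn)"
    have J: "0 \<le> J" using H jr Qm(1) Qn(1) by (simp add: J_def)
    have "ennreal (J * ln (exp 1 + \<tau> x y / \<sigma> x y) / (K * (2 + ln (1 / \<kappa>)))) \<le> green_integral U x y"
    proof (rule potential_integral_lower_log[OF U t(3,4) times_le_T(1)[OF xy] J])
      fix s assume s: "\<kappa> * \<sigma> x y < s" "s \<le> \<tau> x y"
      have "0 < \<kappa> * \<sigma> x y" using \<kappa> t(3) by simp
      hence s0: "0 < s" using s by linarith
      have "H * (jump_rate x y * \<tau> x y powr (1 + \<beta>)) * s powr - \<beta> = (\<tau> x y powr (1 + \<beta>) * H) * (jump_rate x y * s powr - \<beta>)" by simp
      also have "\<dots> \<le> Qm * (s powr (1 + \<beta>) * h s x y) * (jump_rate x y * s powr - \<beta>)"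
        using Qm(2)[OF xy s] jr by (intro mult_right_mono) (auto simp: H_def)
      also have "\<dots> = Qm * (h s x y * (s powr (1 + \<beta>) * s powr - \<beta>) * jump_rate x y)" by simp
      also have "s powr (1 + \<beta>) * s powr - \<beta> = s" using s0 by (simp add: powr_add[symmetric])
      also have "Qm * (h s x y * s * jump_rate x y) \<le> Qm * (Qn * p s x y)"
        using Qn(2)[OF xy s0 s(2)] Qm(1) by (intro mult_left_mono) auto
      finally have "H * (jump_rate x y * \<tau> x y powr (1 + \<beta>)) * s powr - \<beta> \<le> Qm * Qn * p s x y" by (simp add: mult.assoc)
      thus "J * s powr - \<beta> \<le> p s x y"
        using Qm(1) Qn(1) by (simp add: J_def pos_divide_le_eq mult.commute)
    qed
    moreover have "H * (jump_part x y) / C \<le>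
        J * ln (exp 1 + \<tau> x y / \<sigma> x y) / (K * (2 + ln (1 / \<kappa>)))"
    proof -
      define N where "N = H * (jump_rate x y * \<tau> x y powr (1 + \<beta>))"
      have N: "0 \<le> N" using H jr by (simp add: N_def)
      have lr0: "0 \<le> log_ratio x y" using lr by linarith
      have "N * log_ratio x y / C \<le> N * log_ratio x y / (Qm * Qn * A)"
        using C A Qm(1) Qn(1) N lr0 by (intro divide_left_mono) auto
      also have "\<dots> \<le> N * ln (exp 1 + \<tau> x y / \<sigma> x y) / (Qm * Qn * A)"
        using lr N A Qm(1) Qn(1) by (intro divide_right_mono mult_left_mono) auto
      finally show ?thesis by (simp add: N_def J_def A_def mult.assoc)
    qed
    ultimately show "ennreal (h (\<tau> x y) x y * (jump_part x y) / C) \<le>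
        green_integral U x y"
      unfolding H_def using ennreal_leI order_trans by blast
  next
    fix U x y assume U: "regular_potential U \<beta> T \<kappa> K" and xy: "x \<in> D" "y \<in> D" "x \<noteq> y"
    note t = times[OF xy]
    define H where "H = h (\<tau> x y) x y"
    have H: "0 \<le> H" using h_bounds[OF t(1) xy(1,2)] by (simp add: H_def)
    have \<kappa>\<tau>: "0 < \<kappa> * \<tau> x y" using \<kappa> t(1) by simp
    have "ennreal (H / C) * volume_integral \<kappa> U x y \<le> green_integral U x y"
    proof (rule potential_integral_lower_volume[OF U t(1) _ v_measurable[OF \<kappa>\<tau>]])
      show "0 \<le> H / C" using H C by simp
      fix s assume s: "\<kappa> * \<tau> x y < s" "s \<le> \<omega> x y"
      have s0: "0 < s" using s \<kappa>\<tau> by linarith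
      note sT = below_upper_time[OF xy s(2)]
      have "h (\<omega> x y) x y \<le> h s x y" by (rule h_anti[OF s0 s(2) xy(1,2)])
      hence "Qu * h (\<omega> x y) x y \<le> Qu * h s x y" using Qu(1) by (intro mult_left_mono) auto
      hence "H \<le> Qu * h s x y" using Qu(2)[OF xy] by (simp add: H_def)
      hence "H * v x s \<le> Qu * h s x y * v x s" using v_pos[OF s0, of x] by (intro mult_right_mono) auto
      also have "\<dots> \<le> Qu * (Ql * p s x y)"
        using Ql(2)[OF xy s(1) sT] Qu(1) unfolding mult.assoc by (intro mult_left_mono) auto
      finally have le: "H * v x s \<le> Qu * Ql * p s x y" by (simp add: mult.assoc)
      have "0 \<le> Ql * p s x y" using Ql(2)[OF xy s(1) sT] h_bounds[OF s0 xy(1,2)] v_pos[OF s0, of x]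
        by (smt (verit) mult_nonneg_nonneg)
      hence "0 \<le> p s x y" using Ql(1) by (simp add: zero_le_mult_iff)
      hence "Qu * Ql * p s x y \<le> C * p s x y" using C by (intro mult_right_mono) auto
      thus "H / C * v x s \<le> p s x y" using le C(1) by (simp add: pos_divide_le_eq mult.commute)
    qed
    thus "ennreal (h (\<tau> x y) x y / C) * volume_integral \<kappa> U x y \<le>
        green_integral U x y"
      by (simp add: H_def)
  qed
qed

end

section \<open>The volume integral and the function \<open>g\<^sub>0\<close>\<close>

text \<open>
The bounds for \<open>\<phi>\<close> have to reach beyond \<open>\<Phi>(diam D)\<close>, because \<open>g\<^sub>0\<close> involves the uncapped distance \<open>\<delta>\<^sub>\<or>\<close>.
\<close>

locale critical_green = critical_boundary m D p h \<Phi> \<Psi> R_E d1 d2 \<alpha>1 \<alpha>2 \<alpha>3 \<alpha>4 \<beta>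
  for m :: "'a::heine_borel measure" and D :: "'a set" and p h :: "real \<Rightarrow> 'a \<Rightarrow> 'a \<Rightarrow> real"
    and \<Phi> \<Psi> :: "real \<Rightarrow> real" and R_E :: ereal and d1 d2 \<alpha>1 \<alpha>2 \<alpha>3 \<alpha>4 \<beta> :: real +
  fixes \<nu> :: "real measure"
  assumes index_less_one: "\<beta> < 1"
    and laplace_bounds: "0 < l \<Longrightarrow> \<exists>K\<ge>1. \<forall>u>0. (bounded D \<longrightarrow> 1 / u \<le> l) \<longrightarrow>
      within_factor K (laplace_exponent \<nu> u) (u powr \<beta>)"
    and regimes: "\<alpha>2 * \<beta> < d1 \<or> (d1 = d2 \<and> d2 = \<alpha>1 * \<beta> \<and> \<alpha>1 * \<beta> = \<alpha>2 * \<beta>) \<or> d2 < \<alpha>1 * \<beta>"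
begin

abbreviation g :: "'a \<Rightarrow> 'a \<Rightarrow> real" where
  "g x y \<equiv> g0 m D \<Phi> \<nu> d1 d2 \<alpha>1 \<alpha>2 \<beta> \<beta> x y"

abbreviation reach :: "'a \<Rightarrow> 'a \<Rightarrow> real" where
  "reach x y \<equiv> max (dist x y) (bdist_max D x y)"

text \<open>
A point of \<open>D\<close> is at most one diameter farther from the complement than a fixed point \<open>x0\<close>.
\<close>

lemma reach_bounded:
  assumes "bounded D"
  obtains l where "0 < l" "diameter D \<le> l" "\<And>x y. x \<in> D \<Longrightarrow> y \<in> D \<Longrightarrow> reach x y \<le> l"
proof (cases "D = {}")
  case True
  thus thesis using that[of "max 1 (diameter D)"] by auto
next
  case False
  then obtain x0 where x0: "x0 \<in> D" by blast
  define l where "l = max 1 (bdist D x0 + diameter D)"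
  have b0: "0 \<le> bdist D x0" using bdist_pos[OF x0] by simp
  have bd: "bdist D z \<le> bdist D x0 + diameter D" if "z \<in> D" for z
    using infdist_triangle_abs[of z "- D" x0] dist_le_diameter[OF assms that x0] by (simp add: bdist_def)
  show thesis
  proof (rule that[of l])
    fix x y assume xy: "x \<in> D" "y \<in> D"
    show "reach x y \<le> l"
      using bd[OF xy(1)] bd[OF xy(2)] dist_le_diameter[OF assms xy] b0 by (auto simp: l_def bdist_max_def)
  qed (use b0 in \<open>auto simp: l_def\<close>)
qed

lemma psi_bounds:
  obtains K where "1 \<le> K" "\<And>x y r. x \<in> D \<Longrightarrow> y \<in> D \<Longrightarrow> 0 < r \<Longrightarrow> r \<le> reach x y \<Longrightarrow>
    within_factor K (psi \<nu> \<Phi> r) (\<Phi> r powr \<beta>)"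
proof -
  obtain l where l: "0 < l" "\<And>x y. bounded D \<Longrightarrow> x \<in> D \<Longrightarrow> y \<in> D \<Longrightarrow> reach x y \<le> l"
  proof (cases "bounded D")
    case True
    thus thesis using reach_bounded that by metis
  qed (use that[of 1] in auto)
  obtain K where K: "1 \<le> K" "\<And>u. 0 < u \<Longrightarrow> (bounded D \<Longrightarrow> 1 / u \<le> \<Phi> l) \<Longrightarrow>
      within_factor K (laplace_exponent \<nu> u) (u powr \<beta>)"
    using laplace_bounds[OF \<Phi>_pos[OF l(1)]] by blast
  show thesis
  proof (rule that[OF K(1)])
    fix x y r assume xy: "x \<in> D" "y \<in> D" and r: "0 < r" "r \<le> reach x y"
    define t where "t = \<Phi> r"
    have t: "0 < t" unfolding t_def by (rule \<Phi>_pos[OF r(1)])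
    have tl: "t \<le> \<Phi> l" if "bounded D"
      unfolding t_def using r l(2)[OF that xy] by (intro \<Phi>_mono) auto
    have pw: "(1 / t) powr \<beta> = 1 / t powr \<beta>" using t by (simp add: powr_divide)
    have b: "1 / t powr \<beta> / K \<le> laplace_exponent \<nu> (1 / t)" "laplace_exponent \<nu> (1 / t) \<le> K * (1 / t powr \<beta>)"
      using K(2)[of "1 / t"] t tl by (auto simp: pw)
    have "0 < 1 / t powr \<beta> / K" using t K(1) by simp
    hence pos: "0 < laplace_exponent \<nu> (1 / t)" using b(1) by linarith
    have "0 < t powr \<beta>" using t by simp
    thus "within_factor K (psi \<nu> \<Phi> r) (\<Phi> r powr \<beta>)"
      using b pos K(1) by (simp add: psi_def t_def[symmetric] field_simps)
  qed
qed

text \<open>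
With equal exponents both \<open>\<Phi>\<^sup>-\<^sup>1\<close> and the volume are power functions up to constants, and
\<open>d/\<alpha> = \<beta>\<close>.
\<close>

lemma v_critical:
  assumes crit: "d1 = d2" "d2 = \<alpha>1 * \<beta>" "\<alpha>1 * \<beta> = \<alpha>2 * \<beta>" and ne: "x0 \<in> D"
  obtains Q where "0 < Q" "\<And>x s. x \<in> D \<Longrightarrow> 0 < s \<Longrightarrow> ereal s \<le> T \<Longrightarrow>
    within_factor Q (v x s) (s powr - \<beta>)"
proof -
  define d where "d = d2"
  have \<alpha>: "\<alpha>1 = \<alpha>2" using crit index_pos by simp
  have d: "0 < d" "1 / \<alpha>1 * d = \<beta>" using d_pos \<alpha>_pos crit by (auto simp: d_def)
  define L where "L = (if bounded D then ereal (max 1 (diameter D)) else \<infinity>)"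
  have L: "0 < L" "bounded D \<and> L < \<infinity> \<or> R_E = \<infinity>"
    using bounded_or_global by (auto simp: L_def max_def)
  obtain c where c: "1 \<le> c" "\<And>x r. x \<in> D \<Longrightarrow> 0 < r \<Longrightarrow> ereal r \<le> L \<Longrightarrow>
    within_factor c (vol m x r) (r powr d)"
    using vol_power_law[OF radon _ ne L] volume crit(1) by (metis d_def)
  obtain B where B: "1 \<le> B" "\<And>s t. 0 < s \<Longrightarrow> s \<le> t \<Longrightarrow>
    between_powers B (1 / \<alpha>2) (1 / \<alpha>1) (t / s) (scale_inv \<Phi> t / scale_inv \<Phi> s)" by (rule scale_inv_ratio[OF \<Phi>_facts]) blast
  define i1 where "i1 = scale_inv \<Phi> 1"
  have i1: "0 < i1" unfolding i1_def by (rule inv_pos) simp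
  define w where "w = i1 powr d"
  define b where "b = B powr d"
  have wb: "0 < w" "0 < b" using i1 B(1) by (auto simp: w_def b_def)
  define Q where "Q = max (c * b * w) (c * b / w)"
  have Q: "c * b * w \<le> Q" "c * b / w \<le> Q" by (auto simp: Q_def)
  have Q0: "0 < Q" using Q(1) c(1) wb by (smt (verit) mult_pos_pos)
  show thesis
  proof (rule that[OF Q0])
    fix x s assume x: "x \<in> D" and s: "0 < s" "ereal s \<le> T"
    define i where "i = scale_inv \<Phi> s"
    have i: "0 < i" unfolding i_def by (rule inv_pos[OF s(1)])
    have iL: "ereal i \<le> L"
    proof (cases "bounded D")
      case True
      hence "s \<le> \<Phi> (diameter D)" using s by (simp add: scale_diam_def)
      hence "i \<le> diameter D" using inv_mono[OF s(1)] inv_\<Phi>[OF diameter_ge_0[OF True]] by (metis i_def)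
      thus ?thesis using True by (simp add: L_def le_max_iff_disj)
    qed (simp add: L_def)
    have i_bounds: "s powr (1 / \<alpha>1) * i1 / B \<le> i \<and> i \<le> B * (s powr (1 / \<alpha>1) * i1)"
    proof (cases "1 \<le> s")
      case True
      have "s powr (1 / \<alpha>1) / B \<le> i / i1" "i / i1 \<le> B * s powr (1 / \<alpha>1)"
        using B(2)[of 1 s] True by (auto simp: i_def i1_def \<alpha>)
      thus ?thesis using i1 by (simp add: field_simps)
    next
      case False
      have "(1 / s) powr (1 / \<alpha>1) / B \<le> i1 / i" "i1 / i \<le> B * (1 / s) powr (1 / \<alpha>1)"
        using B(2)[of s 1] s False by (auto simp: i_def i1_def \<alpha>)
      moreover have "(1 / s) powr (1 / \<alpha>1) = 1 / s powr (1 / \<alpha>1)" using s by (simp add: powr_divide)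
      moreover have "0 < s powr (1 / \<alpha>1)" using s by simp
      ultimately show ?thesis using i i1 B(1) by (simp add: field_simps)
    qed
    have pw: "(s powr (1 / \<alpha>1) * i1) powr d = s powr \<beta> * w"
      using d by (simp add: powr_mult powr_powr w_def)
    have id: "s powr \<beta> * w / b \<le> i powr d" "i powr d \<le> b * (s powr \<beta> * w)"
    proof -
      have "(s powr (1 / \<alpha>1) * i1 / B) powr d \<le> i powr d"
        using i_bounds i1 B(1) d by (intro powr_mono2) auto
      thus "s powr \<beta> * w / b \<le> i powr d" unfolding powr_divide pw b_def .
      have "i powr d \<le> (B * (s powr (1 / \<alpha>1) * i1)) powr d"
        using i_bounds i d by (intro powr_mono2) auto
      also have "\<dots> = b * (s powr \<beta> * w)" unfolding powr_mult[of B] pw b_def by simp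
      finally show "i powr d \<le> b * (s powr \<beta> * w)" .
    qed
    have V: "i powr d / c \<le> vol m x i" "vol m x i \<le> c * i powr d" using c(2)[OF x i iL] by auto
    have sb: "0 < s powr \<beta>" using s by simp
    have "vol m x i \<le> c * (b * (s powr \<beta> * w))" using V(2) id(2) c(1) by (smt (verit) mult_left_mono)
    also have "\<dots> \<le> Q * s powr \<beta>" using mult_right_mono[OF Q(1), of "s powr \<beta>"] by (simp add: ac_simps)
    finally have up: "vol m x i \<le> Q * s powr \<beta>" .
    have "s powr \<beta> * w / b / c \<le> vol m x i"
      using V(1) divide_right_mono[OF id(1), of c] c(1) by linarith
    hence "s powr \<beta> \<le> c * b / w * vol m x i" using wb c(1) by (simp add: field_simps)
    also have "\<dots> \<le> Q * vol m x i" using V_pos[OF i, of x] by (intro mult_right_mono Q) auto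
    finally have low: "s powr \<beta> \<le> Q * vol m x i" .
    define S where "S = s powr \<beta>"
    have "1 / S / Q \<le> 1 / vol m x i \<and> 1 / vol m x i \<le> Q * (1 / S)"
      using up low Q0 sb V_pos[OF i, of x] by (simp add: S_def[symmetric] field_simps)
    thus "within_factor Q (v x s) (s powr - \<beta>)"
      by (simp add: vol_inv_def i_def S_def powr_minus_divide)
  qed
qed

text \<open>
The uncapped distances are bounded on a bounded domain, so capping them at the diameter costs a constant.
\<close>

lemma reach_cutoff:
  obtains q where "1 \<le> q" "\<And>x y. x \<in> D \<Longrightarrow> y \<in> D \<Longrightarrow> x \<noteq> y \<Longrightarrow> reach x y \<le> q * max (dist x y) (cutoff x y)"
proof (cases "bounded D")
  case False
  thus thesis by (intro that[of 1]) (auto simp: cutoff_def)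
next
  case True
  obtain l where l: "0 < l" "diameter D \<le> l" "\<And>x y. x \<in> D \<Longrightarrow> y \<in> D \<Longrightarrow> reach x y \<le> l"
    using reach_bounded[OF True] by metis
  define q where "q = max 1 (l / diameter D)"
  show thesis
  proof (rule that[of q])
    fix x y assume xy: "x \<in> D" "y \<in> D" "x \<noteq> y"
    note cb = cutoff_bounds[OF xy]
    show "reach x y \<le> q * max (dist x y) (cutoff x y)"
    proof (cases "cutoff x y = bdist_max D x y")
      case True
      have "1 * reach x y \<le> q * reach x y" by (intro mult_right_mono) (auto simp: q_def intro: max.coboundedI1)
      thus ?thesis using True by simp
    next
      case False
      hence c: "cutoff x y = diameter D" using True by (auto simp: cutoff_def min_def split: if_splits)
      hence diam: "0 < diameter D" using cb(1) by simp
      have "reach x y \<le> l / diameter D * diameter D" using l(3)[OF xy(1,2)] diam by simp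
      also have "\<dots> \<le> q * max (dist x y) (cutoff x y)"
        using diam l(1) c by (intro mult_mono) (auto simp: q_def)
      finally show ?thesis .
    qed
  qed (simp add: q_def)
qed

text \<open>
Here \<open>v\<close> decays faster than \<open>s^(-\<beta>)\<close>, so times near \<open>\<tau>\<close> dominate.  Their contribution \<open>v(\<tau>) \<tau>^\<beta>\<close> is comparable with
\<open>\<psi>(\<rho>)/V(x,\<rho>)\<close>.
\<close>

lemma volume_integral_left:
  assumes large: "\<alpha>2 * \<beta> < d1" and \<kappa>: "0 < \<kappa>" "\<kappa> < 1" and K: "1 \<le> K"
  obtains C where "1 \<le> C"
    "\<And>U x y. regular_potential U \<beta> T \<kappa> K \<Longrightarrow> x \<in> D \<Longrightarrow> y \<in> D \<Longrightarrow> x \<noteq> y \<Longrightarrow>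
      0 \<le> g x y \<and> volume_integral \<kappa> U x y \<le> ennreal (C * g x y) \<and>
      ennreal (g x y / C) \<le> volume_integral \<kappa> U x y"
    "\<And>x y. x \<in> D \<Longrightarrow> y \<in> D \<Longrightarrow> x \<noteq> y \<Longrightarrow> bdist_max D x y \<le> dist x y \<Longrightarrow>
      g x y \<le> C * (v x (\<tau> x y) * \<tau> x y powr \<beta>)"
proof -
  obtain P where P: "1 \<le> P" "\<And>x y r. x \<in> D \<Longrightarrow> y \<in> D \<Longrightarrow> 0 < r \<Longrightarrow> r \<le> reach x y \<Longrightarrow>
    within_factor P (psi \<nu> \<Phi> r) (\<Phi> r powr \<beta>)" by (rule psi_bounds) blast
  obtain Qv where Qv: "1 \<le> Qv" "\<And>x s t. 0 < s \<Longrightarrow> s \<le> t \<Longrightarrow> ereal t \<le> T \<Longrightarrow>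
    v x t \<le> Qv * v x s * (s / t) powr (d1 / \<alpha>2) \<and> v x s \<le> Qv * v x t * (t / s) powr (d2 / \<alpha>1)"
    by (rule v_ratio) blast
  note ab = \<alpha>_pos
  have min_\<beta>: "min \<beta> 1 = \<beta>" using index_less_one by simp
  define e1 e2 where "e1 = d1 / \<alpha>2" and "e2 = d2 / \<alpha>1"
  have e: "\<beta> < e1" "0 \<le> e2" using large ab d_pos by (auto simp: e1_def e2_def field_simps)
  define A where "A = Qv * \<kappa> powr (\<beta> - e1 - e2) * (K * 2 powr \<beta> / (1 - 2 powr (\<beta> - e1)))"
  have A: "0 \<le> A" unfolding A_def using Qv(1) K e powr_less_mono[of "\<beta> - e1" 0 "2::real"]
    by (intro mult_nonneg_nonneg divide_nonneg_nonneg) auto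
  define C where "C = Max {1, A * P, P * K, P}"
  have C: "1 \<le> C" "A * P \<le> C" "P * K \<le> C" "P \<le> C"
    unfolding C_def by (rule Max_ge; simp)+
  have PK: "0 < P * K" using P(1) K by (intro mult_pos_pos) auto
  have geq: "v x (\<tau> x y) * \<tau> x y powr \<beta> / P \<le> g x y \<and> g x y \<le> P * (v x (\<tau> x y) * \<tau> x y powr \<beta>)"
    if xy: "x \<in> D" "y \<in> D" "x \<noteq> y" for x y
  proof -
    have "g x y = psi \<nu> \<Phi> (dist x y) * v x (\<tau> x y)"
      using large by (simp add: g0_def min_\<beta> v_at_jump_time)
    moreover have "\<tau> x y powr \<beta> / P \<le> psi \<nu> \<Phi> (dist x y)" "psi \<nu> \<Phi> (dist x y) \<le> P * \<tau> x y powr \<beta>"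
      using P(2)[OF xy(1,2), of "dist x y"] xy by auto
    moreover have "0 < v x (\<tau> x y)" using v_pos times(1)[OF xy] by simp
    ultimately show ?thesis
      using mult_right_mono[of "\<tau> x y powr \<beta> / P" "psi \<nu> \<Phi> (dist x y)" "v x (\<tau> x y)"]
        mult_right_mono[of "psi \<nu> \<Phi> (dist x y)" "P * \<tau> x y powr \<beta>" "v x (\<tau> x y)"]
      by (simp add: ac_simps)
  qed
  have B_nonneg: "0 \<le> v x (\<tau> x y) * \<tau> x y powr \<beta>" if "x \<in> D" "y \<in> D" "x \<noteq> y" for x y
    using v_pos[OF times(1)[OF that], of x] by simp
  show thesis
  proof (rule that[OF C(1)])
    fix U x y assume U: "regular_potential U \<beta> T \<kappa> K" and xy: "x \<in> D" "y \<in> D" "x \<noteq> y"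
    note t = times[OF xy]
    define W where "W = volume_integral \<kappa> U x y"
    define B where "B = v x (\<tau> x y) * \<tau> x y powr \<beta>"
    have B0: "0 \<le> B" using B_nonneg[OF xy] by (simp add: B_def)
    have gB: "B \<le> P * g x y" "g x y \<le> P * B" using geq[OF xy] P(1) by (auto simp: B_def field_simps)
    have g0: "0 \<le> g x y" using gB(1) B0 P(1) by (smt (verit) mult_pos_neg)
    have "W \<le> ennreal (A * B)" unfolding W_def A_def B_def
    proof (rule potential_volume_le_left[OF U e t(1,5,6)])
      show "0 \<le> v x (\<tau> x y)" using v_pos[OF t(1), of x] by simp
      show "v x s \<le> Qv * v x (\<tau> x y) * (\<tau> x y / s) powr e1" if "\<tau> x y \<le> s" "s \<le> \<omega> x y" for s
        using Qv(2)[OF t(1) that(1) below_upper_time[OF xy that(2)]] by (simp add: e1_def)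
      show "v x s \<le> Qv * v x (\<tau> x y) * (\<tau> x y / s) powr e2" if "0 < s" "s \<le> \<tau> x y" for s
        using Qv(2)[OF that times_le_T(1)[OF xy]] by (simp add: e2_def)
    qed (use Qv(1) in simp)
    also have "A * B \<le> C * g x y"
    proof -
      have "A * B \<le> A * (P * g x y)" using gB A by (intro mult_left_mono) auto
      also have "\<dots> \<le> C * g x y" using mult_right_mono[OF C(2) g0] by (simp add: mult.assoc)
      finally show ?thesis .
    qed
    finally have up: "W \<le> ennreal (C * g x y)" by (simp add: ennreal_leI)
    have "g x y / C \<le> P * B / (P * K)" using gB C PK P(1) g0 by (intro frac_le) auto
    also have "\<dots> = v x (\<tau> x y) * \<tau> x y powr \<beta> / K" using P(1) by (simp add: B_def)
    finally have "ennreal (g x y / C) \<le> ennreal (v x (\<tau> x y) * \<tau> x y powr \<beta> / K)" by (rule ennreal_leI)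
    also have "\<dots> \<le> W" unfolding W_def
      using v_pos[OF t(1), of x] by (intro potential_volume_ge[OF U t(1) order_refl t(5,6)]) (auto intro: v_anti)
    finally show "0 \<le> g x y \<and> volume_integral \<kappa> U x y \<le> ennreal (C * g x y) \<and>
      ennreal (g x y / C) \<le> volume_integral \<kappa> U x y"
      using g0 up by (simp add: W_def)
  next
    fix x y assume xy: "x \<in> D" "y \<in> D" "x \<noteq> y"
    show "g x y \<le> C * (v x (\<tau> x y) * \<tau> x y powr \<beta>)"
      using geq[OF xy] mult_right_mono[OF C(4) B_nonneg[OF xy]] by linarith
  qed
qed

text \<open>
All scales between \<open>\<tau>\<close> and \<open>\<omega>\<close> contribute equally, so that the integral is comparable with \<open>ln(e + \<omega>/\<tau>)\<close>.  As \<open>\<Phi>\<close> is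
bounded above and below by powers, this is comparable with \<open>ln(e + \<delta>\<^sub>\<or>/\<rho>)\<close>.
\<close>

lemma volume_integral_critical:
  assumes crit: "d1 = d2" "d2 = \<alpha>1 * \<beta>" "\<alpha>1 * \<beta> = \<alpha>2 * \<beta>" and \<kappa>: "0 < \<kappa>" "\<kappa> < 1" and K: "1 \<le> K"
  obtains C where "1 \<le> C"
    "\<And>U x y. regular_potential U \<beta> T \<kappa> K \<Longrightarrow> x \<in> D \<Longrightarrow> y \<in> D \<Longrightarrow> x \<noteq> y \<Longrightarrow>
      0 \<le> g x y \<and> volume_integral \<kappa> U x y \<le> ennreal (C * g x y) \<and>
      ennreal (g x y / C) \<le> volume_integral \<kappa> U x y"
    "\<And>x y. x \<in> D \<Longrightarrow> y \<in> D \<Longrightarrow> x \<noteq> y \<Longrightarrow> bdist_max D x y \<le> dist x y \<Longrightarrow>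
      g x y \<le> C * (v x (\<tau> x y) * \<tau> x y powr \<beta>)"
proof -
  obtain q where q: "1 \<le> q" "\<And>x y. x \<in> D \<Longrightarrow> y \<in> D \<Longrightarrow> x \<noteq> y \<Longrightarrow> reach x y \<le> q * max (dist x y) (cutoff x y)"
    by (rule reach_cutoff) blast
  note ab = \<alpha>_pos
  have min_\<beta>: "min \<beta> 1 = \<beta>" using index_less_one by simp
  show thesis
  proof (cases "D = {}")
    case True
    thus thesis by (intro that[of 1]) auto
  next
    case False
    then obtain x0 where x0: "x0 \<in> D" by blast
    obtain Q where Q: "0 < Q" "\<And>x s. x \<in> D \<Longrightarrow> 0 < s \<Longrightarrow> ereal s \<le> T \<Longrightarrow>
      within_factor Q (v x s) (s powr - \<beta>)" using v_critical[OF crit x0] by metis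
    obtain c where c: "1 \<le> c" "\<And>r R. 0 < r \<Longrightarrow> r \<le> R \<Longrightarrow>
      between_powers c \<alpha>1 \<alpha>2 (R / r) (\<Phi> R / \<Phi> r)" by (rule scale_ratio[OF \<Phi>_facts]) blast
    define L where "L x y = ln (exp 1 + \<omega> x y / \<tau> x y)" for x y
    define M1 where "M1 = ln (exp 1 + c) + \<alpha>2"
    define M2 where "M2 = ln (exp 1 + q * c powr (1 / \<alpha>1)) + 1 / \<alpha>1"
    have M: "0 \<le> M1" "0 \<le> M2"
      unfolding M1_def M2_def using c(1) q(1) ab by (intro add_nonneg_nonneg ln_ge_zero; auto intro: add_increasing2)+
    have geq: "g x y = ln (exp 1 + bdist_max D x y / dist x y)" for x y
      unfolding g0_def min_\<beta> using crit by auto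
    have cmp: "L x y \<le> M1 * g x y \<and> g x y \<le> M2 * L x y \<and> 0 \<le> g x y" if xy: "x \<in> D" "y \<in> D" "x \<noteq> y" for x y
    proof -
      note t = times[OF xy] and cb = cutoff_bounds[OF xy]
      define R where "R = max (dist x y) (cutoff x y)"
      have d: "0 < dist x y" "dist x y \<le> R" using xy by (auto simp: R_def)
      have Rd0: "0 \<le> R / dist x y" using d by (intro divide_nonneg_pos) linarith+
      have \<omega>: "\<omega> x y = \<Phi> R" using upper_time_eq[OF xy] by (simp add: R_def)
      define z where "z = bdist_max D x y / dist x y"
      have z: "0 \<le> z" using bdist_min_max_pos[OF xy(1,2)] d by (simp add: z_def)
      have rat: "(R / dist x y) powr \<alpha>1 / c \<le> \<omega> x y / \<tau> x y" "\<omega> x y / \<tau> x y \<le> c * (R / dist x y) powr \<alpha>2"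
        using c(2)[OF d] by (auto simp: \<omega>)
      have "R / dist x y \<le> exp 1 + z"
      proof -
        have "R \<le> dist x y + bdist_max D x y" using cb(2) bdist_min_max_pos[OF xy(1,2)] by (auto simp: R_def)
        hence "R / dist x y \<le> (dist x y + bdist_max D x y) / dist x y" using d by (intro divide_right_mono) auto
        also have "\<dots> = 1 + z" using d by (simp add: z_def add_divide_distrib)
        finally have "R / dist x y \<le> 1 + z" .
        moreover have "1 \<le> exp (1::real)" by simp
        ultimately show ?thesis by linarith
      qed
      hence "(R / dist x y) powr \<alpha>2 \<le> (exp 1 + z) powr \<alpha>2" using Rd0 ab by (intro powr_mono2) auto
      hence "c * (R / dist x y) powr \<alpha>2 \<le> c * (exp 1 + z) powr \<alpha>2" using c(1) by (intro mult_left_mono) auto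
      hence "\<omega> x y / \<tau> x y \<le> c * (exp 1 + z) powr \<alpha>2" using rat(2) by linarith
      hence up: "L x y \<le> M1 * g x y"
        unfolding L_def M1_def geq z_def[symmetric] using z c(1) ab t
        by (intro ln_exp_plus_le_powr) auto
      define w where "w = \<omega> x y / \<tau> x y"
      have w: "0 < w" using t by (simp add: w_def)
      have "(R / dist x y) powr \<alpha>1 \<le> c * w" using rat(1) c(1) by (simp add: w_def field_simps)
      hence "((R / dist x y) powr \<alpha>1) powr (1 / \<alpha>1) \<le> (c * w) powr (1 / \<alpha>1)" using ab by (intro powr_mono2) auto
      hence "R / dist x y \<le> c powr (1 / \<alpha>1) * w powr (1 / \<alpha>1)"
        using ab Rd0 d by (simp add: powr_powr powr_mult abs_of_pos[OF less_le_trans[OF d(1,2)]])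
      also have "\<dots> \<le> c powr (1 / \<alpha>1) * (exp 1 + w) powr (1 / \<alpha>1)"
        using ab w by (intro mult_left_mono powr_mono2) auto
      finally have Rd: "R / dist x y \<le> c powr (1 / \<alpha>1) * (exp 1 + w) powr (1 / \<alpha>1)" .
      have "z \<le> q * R / dist x y"
        unfolding z_def using q(2)[OF xy] d by (intro divide_right_mono) (auto simp: R_def)
      also have "\<dots> = q * (R / dist x y)" by simp
      also have "\<dots> \<le> q * (c powr (1 / \<alpha>1) * (exp 1 + w) powr (1 / \<alpha>1))" using Rd q(1) by (intro mult_left_mono) auto
      finally have "z \<le> q * c powr (1 / \<alpha>1) * (exp 1 + w) powr (1 / \<alpha>1)" by (simp add: mult.assoc)
      hence low: "g x y \<le> M2 * L x y"
        unfolding L_def M2_def geq z_def[symmetric] w_def[symmetric] using z q(1) ab w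
        by (intro ln_exp_plus_le_powr) auto
      have "0 \<le> g x y" unfolding geq z_def[symmetric] using z by (intro ln_ge_zero) (auto intro: add_increasing2)
      thus ?thesis using up low by simp
    qed
    define A where "A = Q * (3 * K * 2 powr \<beta> * (1 + ln (1 / \<kappa>)))"
    define E where "E = 1 / Q / (K * (2 + ln (1 / \<kappa>)))"
    have l\<kappa>: "0 \<le> ln (1 / \<kappa>)" using \<kappa> by (simp add: ln_div)
    have A: "0 \<le> A" using Q(1) K l\<kappa> by (simp add: A_def)
    have E: "0 < E" using Q(1) K l\<kappa> by (auto simp: E_def intro!: divide_pos_pos mult_pos_pos)
    define C where "C = Max {1, A * M1, M2 / E, 2 * Q}"
    have C: "1 \<le> C" "A * M1 \<le> C" "M2 / E \<le> C" "2 * Q \<le> C"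
      unfolding C_def by (rule Max_ge; simp)+
    show thesis
    proof (rule that[OF C(1)])
      fix U x y assume U: "regular_potential U \<beta> T \<kappa> K" and xy: "x \<in> D" "y \<in> D" "x \<noteq> y"
      note t = times[OF xy]
      define W where "W = volume_integral \<kappa> U x y"
      have vb: "within_factor Q (v x s) (s powr - \<beta>)" if "0 < s" "s \<le> \<omega> x y" for s
        by (rule Q(2)[OF xy(1) that(1) below_upper_time[OF xy that(2)]])
      note W = potential_volume_critical[where v="v x", OF U t(1,5,6) Q(1) vb]
      have "W \<le> ennreal (A * L x y)" using W(1) by (simp add: W_def A_def L_def)
      also have "A * L x y \<le> C * g x y"
      proof -
        have "A * L x y \<le> A * (M1 * g x y)" using cmp[OF xy] A by (intro mult_left_mono) auto
        also have "\<dots> \<le> C * g x y" using mult_right_mono[OF C(2), of "g x y"] cmp[OF xy] by (simp add: mult.assoc)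
        finally show ?thesis .
      qed
      finally have up: "W \<le> ennreal (C * g x y)" by (simp add: ennreal_leI)
      have "g x y / C \<le> E * L x y"
      proof -
        have "L x y * M2 \<le> L x y * (C * E)"
        proof (rule mult_left_mono)
          show "M2 \<le> C * E" using C(3) E by (simp add: field_simps)
          show "0 \<le> L x y" unfolding L_def using t by (intro ln_ge_zero) (auto intro: add_increasing2)
        qed
        hence "g x y \<le> E * L x y * C" using cmp[OF xy] by (simp add: ac_simps)
        thus ?thesis using C(1) by (simp add: pos_divide_le_eq)
      qed
      hence "ennreal (g x y / C) \<le> ennreal (E * L x y)" by (rule ennreal_leI)
      also have "\<dots> \<le> W" using W(2) by (simp add: W_def E_def L_def)
      finally show "0 \<le> g x y \<and> volume_integral \<kappa> U x y \<le> ennreal (C * g x y) \<and>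
        ennreal (g x y / C) \<le> volume_integral \<kappa> U x y"
        using cmp[OF xy] up by (simp add: W_def)
    next
      fix x y assume xy: "x \<in> D" "y \<in> D" "x \<noteq> y" and far: "bdist_max D x y \<le> dist x y"
      note t = times[OF xy]
      have "g x y \<le> 2"
      proof -
        have "bdist_max D x y / dist x y \<le> 1" using far xy by simp
        hence "g x y \<le> ln (exp 1 + 1)"
          unfolding geq using bdist_min_max_pos(2)[OF xy(1,2)] by (intro ln_exp_plus_mono) auto
        also have "\<dots> \<le> 2" by (rule ln_exp_plus_one_le)
        finally show ?thesis .
      qed
      moreover have "1 \<le> Q * (v x (\<tau> x y) * \<tau> x y powr \<beta>)"
      proof -
        have "\<tau> x y powr - \<beta> / Q \<le> v x (\<tau> x y)" using Q(2)[OF xy(1) t(1) times_le_T(1)[OF xy]] by simp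
        hence "\<tau> x y powr - \<beta> \<le> v x (\<tau> x y) * Q" using Q(1) by (simp add: pos_divide_le_eq)
        hence "\<tau> x y powr - \<beta> * \<tau> x y powr \<beta> \<le> v x (\<tau> x y) * Q * \<tau> x y powr \<beta>" by (rule mult_right_mono) simp
        moreover have "\<tau> x y powr - \<beta> * \<tau> x y powr \<beta> = 1" using t by (simp add: powr_add[symmetric])
        ultimately show ?thesis by (simp add: ac_simps)
      qed
      moreover have "2 * Q * (v x (\<tau> x y) * \<tau> x y powr \<beta>) \<le> C * (v x (\<tau> x y) * \<tau> x y powr \<beta>)"
        using C(4) v_pos[OF t(1), of x] by (intro mult_right_mono) auto
      ultimately show "g x y \<le> C * (v x (\<tau> x y) * \<tau> x y powr \<beta>)" by linarith
    qed
  qed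
qed

text \<open>
Here \<open>v\<close> decays more slowly than \<open>s^(-\<beta>)\<close>, so times near \<open>\<omega>\<close> dominate.  Their contribution \<open>v(\<omega>) \<omega>^\<beta>\<close> is comparable
with \<open>\<psi>/V\<close> at the radius \<open>\<rho> \<or> \<delta>\<^sub>\<or>\<close>, by \<open>reach_cutoff\<close> also if \<open>\<omega>\<close> is computed with the capped distance.
\<close>

lemma volume_integral_right:
  assumes small: "\<not> \<alpha>2 * \<beta> < d1" "\<not> (d1 = d2 \<and> d2 = \<alpha>1 * \<beta> \<and> \<alpha>1 * \<beta> = \<alpha>2 * \<beta>)" "d2 < \<alpha>1 * \<beta>" and \<kappa>: "0 < \<kappa>" "\<kappa> < 1" and K: "1 \<le> K"
  obtains C where "1 \<le> C"
    "\<And>U x y. regular_potential U \<beta> T \<kappa> K \<Longrightarrow> x \<in> D \<Longrightarrow> y \<in> D \<Longrightarrow> x \<noteq> y \<Longrightarrow>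
      0 \<le> g x y \<and> volume_integral \<kappa> U x y \<le> ennreal (C * g x y) \<and>
      ennreal (g x y / C) \<le> volume_integral \<kappa> U x y"
    "\<And>x y. x \<in> D \<Longrightarrow> y \<in> D \<Longrightarrow> x \<noteq> y \<Longrightarrow> bdist_max D x y \<le> dist x y \<Longrightarrow>
      g x y \<le> C * (v x (\<tau> x y) * \<tau> x y powr \<beta>)"
proof -
  obtain P where P: "1 \<le> P" "\<And>x y r. x \<in> D \<Longrightarrow> y \<in> D \<Longrightarrow> 0 < r \<Longrightarrow> r \<le> reach x y \<Longrightarrow>
    within_factor P (psi \<nu> \<Phi> r) (\<Phi> r powr \<beta>)" by (rule psi_bounds) blast
  obtain Qv where Qv: "1 \<le> Qv" "\<And>x s t. 0 < s \<Longrightarrow> s \<le> t \<Longrightarrow> ereal t \<le> T \<Longrightarrow>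
    v x t \<le> Qv * v x s * (s / t) powr (d1 / \<alpha>2) \<and> v x s \<le> Qv * v x t * (t / s) powr (d2 / \<alpha>1)"
    by (rule v_ratio) blast
  obtain q where q: "1 \<le> q" "\<And>x y. x \<in> D \<Longrightarrow> y \<in> D \<Longrightarrow> x \<noteq> y \<Longrightarrow> reach x y \<le> q * max (dist x y) (cutoff x y)"
    by (rule reach_cutoff) blast
  note ab = \<alpha>_pos
  have min_\<beta>: "min \<beta> 1 = \<beta>" using index_less_one by simp
  define e2 where "e2 = d2 / \<alpha>1"
  have e: "0 \<le> e2" "e2 < \<beta>" using small ab d_pos by (auto simp: e2_def field_simps)
  obtain c where c: "1 \<le> c" "\<And>r R. 0 < r \<Longrightarrow> r \<le> R \<Longrightarrow>
    between_powers c \<alpha>1 \<alpha>2 (R / r) (\<Phi> R / \<Phi> r)" by (rule scale_ratio[OF \<Phi>_facts]) blast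
  obtain CV where CV: "1 \<le> CV" "\<And>x y. x \<in> D \<Longrightarrow> y \<in> D \<Longrightarrow> x \<noteq> y \<Longrightarrow>
    vol m x (reach x y) \<le> CV * vol m x (max (dist x y) (cutoff x y))"
  proof -
    obtain L where L: "bounded D \<Longrightarrow> L < \<infinity>" "\<And>x y. x \<in> D \<Longrightarrow> y \<in> D \<Longrightarrow> ereal (reach x y) \<le> L"
    proof (cases "bounded D")
      case True
      obtain l where "\<And>x y. x \<in> D \<Longrightarrow> y \<in> D \<Longrightarrow> reach x y \<le> l" using reach_bounded[OF True] by metis
      thus thesis by (intro that[of "ereal l"]) auto
    qed (use that[of \<infinity>] in auto)
    obtain C where C: "1 \<le> C" "vol_scaled m C d1 d2 L" by (rule vol_scaled_exists[OF L(1)])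
    have q2: "1 \<le> q powr d2" using q(1) d_pos by (intro ge_one_powr_ge_zero) auto
    show thesis
    proof (rule that[of "C * q powr d2"])
      show "1 \<le> C * q powr d2" using mult_mono[OF C(1) q2] C(1) by simp
      fix x y assume xy: "x \<in> D" "y \<in> D" "x \<noteq> y"
      define R where "R = max (dist x y) (cutoff x y)"
      have R: "0 < R" "R \<le> reach x y" using xy cutoff_bounds[OF xy] by (auto simp: R_def less_max_iff_disj)
      have "vol m x (reach x y) / vol m x R \<le> C * (reach x y / R) powr d2"
        using C(2) R L(2)[OF xy(1,2)] unfolding vol_scaled_def by blast
      also have "\<dots> \<le> C * q powr d2"
        using q(2)[OF xy] R C(1) d_pos by (intro mult_left_mono powr_mono2) (auto simp: R_def field_simps)
      finally show "vol m x (reach x y) \<le> C * q powr d2 * vol m x (max (dist x y) (cutoff x y))"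
        using V_pos[OF R(1), of x] by (simp add: R_def pos_divide_le_eq)
    qed
  qed
  define A where "A = Qv * (K * 2 powr e2 / (1 - 2 powr (e2 - \<beta>)))"
  have A: "0 \<le> A" unfolding A_def using Qv(1) K e powr_less_mono[of "e2 - \<beta>" 0 "2::real"]
    by (intro mult_nonneg_nonneg divide_nonneg_nonneg) auto
  define k where "k = (c * q powr \<alpha>2) powr \<beta>"
  have k: "1 \<le> k"
  proof -
    have "1 \<le> q powr \<alpha>2" using q(1) ab by (intro ge_one_powr_ge_zero) auto
    hence "1 \<le> c * q powr \<alpha>2" using mult_mono[OF c(1), of 1 "q powr \<alpha>2"] c(1) by simp
    thus ?thesis unfolding k_def using index_pos by (intro ge_one_powr_ge_zero) auto
  qed
  have geq: "v x (\<omega> x y) * \<omega> x y powr \<beta> \<le> CV * P * g x y \<and>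
      g x y \<le> P * k * (v x (\<omega> x y) * \<omega> x y powr \<beta>) \<and> 0 \<le> g x y \<and>
      (bdist_max D x y \<le> dist x y \<longrightarrow> g x y \<le> P * (v x (\<tau> x y) * \<tau> x y powr \<beta>))"
    if xy: "x \<in> D" "y \<in> D" "x \<noteq> y" for x y
  proof -
    note t = times[OF xy] and cb = cutoff_bounds[OF xy]
    define R where "R = max (dist x y) (cutoff x y)"
    define R' where "R' = reach x y"
    have R: "0 < R" "R \<le> R'" using xy cb by (auto simp: R_def R'_def less_max_iff_disj)
    have \<omega>: "\<omega> x y = \<Phi> R" using upper_time_eq[OF xy] by (simp add: R_def)
    have v\<omega>: "v x (\<Phi> R) = 1 / vol m x R" using R by (simp add: vol_inv_def inv_\<Phi>)
    have geq: "g x y = psi \<nu> \<Phi> R' / vol m x R'" using small by (auto simp: g0_def min_\<beta> R'_def)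
    have ps: "\<Phi> R' powr \<beta> / P \<le> psi \<nu> \<Phi> R'" "psi \<nu> \<Phi> R' \<le> P * \<Phi> R' powr \<beta>"
      using P(2)[OF xy(1,2), of R'] R by (auto simp: R'_def)
    have V: "0 < vol m x R" "0 < vol m x R'" "vol m x R \<le> vol m x R'" "vol m x R' \<le> CV * vol m x R"
      using V_pos R V_mono CV(2)[OF xy] by (auto simp: R_def R'_def)
    have \<Phi>R: "0 < \<Phi> R" "\<Phi> R \<le> \<Phi> R'" using R by (auto intro: \<Phi>_pos \<Phi>_mono)
    have "\<Phi> R' / \<Phi> R \<le> c * (R' / R) powr \<alpha>2" using c(2)[OF R] by simp
    also have "\<dots> \<le> c * q powr \<alpha>2"
      using q(2)[OF xy] R c(1) ab by (intro mult_left_mono powr_mono2) (auto simp: R_def R'_def field_simps)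
    finally have "\<Phi> R' \<le> c * q powr \<alpha>2 * \<Phi> R" using \<Phi>R by (simp add: pos_divide_le_eq)
    hence "\<Phi> R' powr \<beta> \<le> (c * q powr \<alpha>2 * \<Phi> R) powr \<beta>" using \<Phi>R index_pos by (intro powr_mono2) auto
    also have "\<dots> = k * \<Phi> R powr \<beta>" unfolding k_def by (rule powr_mult)
    finally have \<Phi>k: "\<Phi> R' powr \<beta> \<le> k * \<Phi> R powr \<beta>" .
    have ps0: "0 \<le> psi \<nu> \<Phi> R'" using ps(1) P(1) by (smt (verit) divide_nonneg_nonneg powr_ge_zero)
    have "g x y \<le> P * (k * \<Phi> R powr \<beta>) / vol m x R"
      unfolding geq
    proof (rule frac_le)
      show "0 \<le> P * (k * \<Phi> R powr \<beta>)" using P(1) k by simp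
      show "psi \<nu> \<Phi> R' \<le> P * (k * \<Phi> R powr \<beta>)"
        using ps(2) mult_left_mono[OF \<Phi>k, of P] P(1) by linarith
    qed (use V in auto)
    hence up: "g x y \<le> P * k * (v x (\<omega> x y) * \<omega> x y powr \<beta>)" by (simp add: v\<omega> \<omega>)
    have "\<Phi> R powr \<beta> / vol m x R \<le> (P * psi \<nu> \<Phi> R') * (CV / vol m x R')"
    proof -
      have "\<Phi> R powr \<beta> \<le> \<Phi> R' powr \<beta>" using \<Phi>R index_pos by (intro powr_mono2) auto
      also have "\<dots> \<le> P * psi \<nu> \<Phi> R'" using ps(1) P(1) by (simp add: field_simps)
      finally have 1: "\<Phi> R powr \<beta> \<le> P * psi \<nu> \<Phi> R'" .
      have 2: "1 / vol m x R \<le> CV / vol m x R'" using V by (simp add: field_simps)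
      have "\<Phi> R powr \<beta> * (1 / vol m x R) \<le> (P * psi \<nu> \<Phi> R') * (CV / vol m x R')"
        by (rule mult_mono[OF 1 2]) (use P(1) ps0 V in auto)
      thus ?thesis by simp
    qed
    hence low: "v x (\<omega> x y) * \<omega> x y powr \<beta> \<le> CV * P * g x y" by (simp add: v\<omega> \<omega> geq ac_simps)
    have nn: "0 \<le> g x y" unfolding geq using ps0 V by simp
    have "g x y \<le> P * (v x (\<tau> x y) * \<tau> x y powr \<beta>)" if "bdist_max D x y \<le> dist x y"
    proof -
      have "R' = dist x y" using that by (simp add: R'_def)
      hence "g x y = psi \<nu> \<Phi> R' * v x (\<tau> x y)" by (simp add: geq v_at_jump_time)
      also have "\<dots> \<le> P * \<Phi> R' powr \<beta> * v x (\<tau> x y)" using ps(2) v_pos[OF t(1), of x] by (intro mult_right_mono) auto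
      finally show ?thesis using \<open>R' = dist x y\<close> by (simp add: ac_simps)
    qed
    thus ?thesis using up low nn by blast
  qed
  define C where "C = Max {1, A * (CV * P), P * k * K, P}"
  have C: "1 \<le> C" "A * (CV * P) \<le> C" "P * k * K \<le> C" "P \<le> C"
    unfolding C_def by (rule Max_ge; simp)+
  show thesis
  proof (rule that[OF C(1)])
    fix U x y assume U: "regular_potential U \<beta> T \<kappa> K" and xy: "x \<in> D" "y \<in> D" "x \<noteq> y"
    note t = times[OF xy]
    define W where "W = volume_integral \<kappa> U x y"
    define B where "B = v x (\<omega> x y) * \<omega> x y powr \<beta>"
    have gB: "B \<le> CV * P * g x y" "g x y \<le> P * k * B" "0 \<le> g x y" using geq[OF xy] by (auto simp: B_def)
    have "W \<le> ennreal (A * B)" unfolding W_def A_def B_def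
    proof (rule potential_volume_le_right[OF U e t(1,5,6)])
      show "0 \<le> v x (\<omega> x y)" using v_pos[OF t(9), of x] by simp
      show "v x s \<le> Qv * v x (\<omega> x y) * (\<omega> x y / s) powr e2" if "0 < s" "s \<le> \<omega> x y" for s
        using Qv(2)[OF that t(6)] by (simp add: e2_def)
    qed (use Qv(1) in simp)
    also have "A * B \<le> C * g x y"
    proof -
      have "A * B \<le> A * (CV * P * g x y)" using gB A by (intro mult_left_mono) auto
      also have "\<dots> \<le> C * g x y" using mult_right_mono[OF C(2) gB(3)] by (simp add: mult.assoc)
      finally show ?thesis .
    qed
    finally have up: "W \<le> ennreal (C * g x y)" by (simp add: ennreal_leI)
    have Pk: "0 < P * k" using P(1) k by simp
    have "g x y / C \<le> P * k * B / (P * k * K)" using gB C Pk K by (intro frac_le) auto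
    also have "\<dots> = v x (\<omega> x y) * \<omega> x y powr \<beta> / K" using P(1) k by (simp add: B_def)
    finally have "ennreal (g x y / C) \<le> ennreal (v x (\<omega> x y) * \<omega> x y powr \<beta> / K)" by (rule ennreal_leI)
    also have "\<dots> \<le> W" unfolding W_def
      using v_pos[OF t(9), of x] by (intro potential_volume_ge[OF U t(1,5) order_refl t(6)]) (auto intro: v_anti)
    finally show "0 \<le> g x y \<and> volume_integral \<kappa> U x y \<le> ennreal (C * g x y) \<and>
      ennreal (g x y / C) \<le> volume_integral \<kappa> U x y"
      using gB up by (simp add: W_def)
  next
    fix x y assume xy: "x \<in> D" "y \<in> D" "x \<noteq> y" and far: "bdist_max D x y \<le> dist x y"
    have "0 \<le> v x (\<tau> x y) * \<tau> x y powr \<beta>" using v_pos[OF times(1)[OF xy], of x] by simp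
    from mult_right_mono[OF C(4) this] show "g x y \<le> C * (v x (\<tau> x y) * \<tau> x y powr \<beta>)"
      using geq[OF xy] far by linarith
  qed
qed

text \<open>
The last estimate, for points closer to the boundary than to each other, serves the case of comparable
\<open>\<Phi>\<close> and \<open>\<Psi>\<close>.
\<close>

lemma volume_integral_g0:
  assumes \<kappa>: "0 < \<kappa>" "\<kappa> < 1" and K: "1 \<le> K"
  obtains C where "1 \<le> C"
    "\<And>U x y. regular_potential U \<beta> T \<kappa> K \<Longrightarrow> x \<in> D \<Longrightarrow> y \<in> D \<Longrightarrow> x \<noteq> y \<Longrightarrow>
      0 \<le> g x y \<and> volume_integral \<kappa> U x y \<le> ennreal (C * g x y) \<and>
      ennreal (g x y / C) \<le> volume_integral \<kappa> U x y"
    "\<And>x y. x \<in> D \<Longrightarrow> y \<in> D \<Longrightarrow> x \<noteq> y \<Longrightarrow> bdist_max D x y \<le> dist x y \<Longrightarrow>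
      g x y \<le> C * (v x (\<tau> x y) * \<tau> x y powr \<beta>)"
proof -
  consider (large) "\<alpha>2 * \<beta> < d1" | (crit) "d1 = d2" "d2 = \<alpha>1 * \<beta>" "\<alpha>1 * \<beta> = \<alpha>2 * \<beta>"
    | (small) "\<not> \<alpha>2 * \<beta> < d1" "\<not> (d1 = d2 \<and> d2 = \<alpha>1 * \<beta> \<and> \<alpha>1 * \<beta> = \<alpha>2 * \<beta>)" "d2 < \<alpha>1 * \<beta>"
    using regimes by blast
  thus thesis
  proof cases
    case large
    show thesis by (rule volume_integral_left[OF large \<kappa> K]) (rule that; blast)
  next
    case crit
    show thesis by (rule volume_integral_critical[OF crit \<kappa> K]) (rule that; blast)
  next
    case small
    show thesis by (rule volume_integral_right[OF small \<kappa> K]) (rule that; blast)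
  qed
qed

section \<open>Two-sided estimates of the Green function\<close>

text \<open>
The terms \<open>v(\<tau>) \<tau>^\<beta>\<close> and \<open>v(\<omega>) \<omega>^\<beta>\<close> of the upper bound are each at most a multiple of one block of the volume
integral, hence of \<open>g\<^sub>0\<close>.  The two lower bounds are combined by using the larger one.
\<close>

lemma green_estimate:
  assumes \<kappa>: "0 < \<kappa>" "\<kappa> < 1" and K: "1 \<le> K"
  obtains C where "1 \<le> C"
    "\<And>U x y. regular_potential U \<beta> T \<kappa> K \<Longrightarrow> x \<in> D \<Longrightarrow> y \<in> D \<Longrightarrow> x \<noteq> y \<Longrightarrow>
      0 \<le> g x y \<and> v x (\<tau> x y) * \<tau> x y powr \<beta> \<le> C * g x y \<and>
      (bdist_max D x y \<le> dist x y \<longrightarrow> g x y \<le> C * (v x (\<tau> x y) * \<tau> x y powr \<beta>)) \<and>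
      ennreal (h (\<tau> x y) x y * (jump_part x y + g x y) / C) \<le>
        green_integral U x y \<and>
      green_integral U x y \<le>
        ennreal (C * (h (\<tau> x y) x y * (jump_part x y + g x y)))"
proof -
  obtain C1 where C1: "1 \<le> C1"
    "\<And>U x y. regular_potential U \<beta> T \<kappa> K \<Longrightarrow> x \<in> D \<Longrightarrow> y \<in> D \<Longrightarrow> x \<noteq> y \<Longrightarrow>
      green_integral U x y \<le>
      ennreal (C1 * h (\<tau> x y) x y * (jump_part x y +
        v x (\<tau> x y) * \<tau> x y powr \<beta> + v x (\<omega> x y) * \<omega> x y powr \<beta>)) +
      ennreal (C1 * h (\<tau> x y) x y) * volume_integral \<kappa> U x y"
    by (rule green_upper) blast
  obtain C2 where C2: "1 \<le> C2"
    "\<And>U x y. regular_potential U \<beta> T \<kappa> K \<Longrightarrow> x \<in> D \<Longrightarrow> y \<in> D \<Longrightarrow> x \<noteq> y \<Longrightarrow>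
      ennreal (h (\<tau> x y) x y * (jump_part x y) / C2) \<le>
        green_integral U x y"
    "\<And>U x y. regular_potential U \<beta> T \<kappa> K \<Longrightarrow> x \<in> D \<Longrightarrow> y \<in> D \<Longrightarrow> x \<noteq> y \<Longrightarrow>
      ennreal (h (\<tau> x y) x y / C2) * volume_integral \<kappa> U x y \<le>
        green_integral U x y"
    by (rule green_lower[OF \<kappa>]) blast
  obtain C3 where C3: "1 \<le> C3"
    "\<And>U x y. regular_potential U \<beta> T \<kappa> K \<Longrightarrow> x \<in> D \<Longrightarrow> y \<in> D \<Longrightarrow> x \<noteq> y \<Longrightarrow>
      0 \<le> g x y \<and> volume_integral \<kappa> U x y \<le> ennreal (C3 * g x y) \<and>
      ennreal (g x y / C3) \<le> volume_integral \<kappa> U x y"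
    "\<And>x y. x \<in> D \<Longrightarrow> y \<in> D \<Longrightarrow> x \<noteq> y \<Longrightarrow> bdist_max D x y \<le> dist x y \<Longrightarrow>
      g x y \<le> C3 * (v x (\<tau> x y) * \<tau> x y powr \<beta>)"
    by (rule volume_integral_g0[OF \<kappa> K]) blast
  define C where "C = Max {C1 * (2 * K * C3 + C3 + 1), 2 * C2 * C3, K * C3, C3}"
  have C: "C1 * (2 * K * C3 + C3 + 1) \<le> C" "2 * C2 * C3 \<le> C" "K * C3 \<le> C" "C3 \<le> C"
    unfolding C_def by (rule Max_ge; simp)+
  have Cge1: "1 \<le> C" using C(4) C3(1) by linarith
  show thesis
  proof (rule that[OF Cge1])
    fix U x y assume U: "regular_potential U \<beta> T \<kappa> K" and xy: "x \<in> D" "y \<in> D" "x \<noteq> y"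
    note t = times[OF xy]
    define W where "W = volume_integral \<kappa> U x y"
    define F where "F = green_integral U x y"
    define H where "H = h (\<tau> x y) x y"
    define L where "L = jump_part x y"
    define B1 where "B1 = v x (\<tau> x y) * \<tau> x y powr \<beta>"
    define B2 where "B2 = v x (\<omega> x y) * \<omega> x y powr \<beta>"
    have H: "0 \<le> H" using h_bounds[OF t(1) xy(1,2)] by (simp add: H_def)
    have L: "0 \<le> L" using jump_rate_bounds(1)[OF xy(3)] log_ratio_bounds(1)[OF xy] by (simp add: L_def)
    note gW = C3(2)[OF U xy, folded W_def]
    have g: "0 \<le> g x y" using gW by simp
    have B_le: "v x r * r powr \<beta> \<le> K * C3 * g x y" if r: "\<tau> x y \<le> r" "r \<le> \<omega> x y" for r
    proof -
      have r0: "0 < r" using r t(1) by simp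
      have "ennreal (v x r * r powr \<beta> / K) \<le> W" unfolding W_def
        using v_pos[OF r0, of x] by (intro potential_volume_ge[OF U t(1) r t(6)]) (auto intro: v_anti)
      also have "\<dots> \<le> ennreal (C3 * g x y)" using gW by simp
      finally have "v x r * r powr \<beta> / K \<le> C3 * g x y" using C3(1) g by (simp add: ennreal_le_iff)
      thus ?thesis using K by (simp add: pos_divide_le_eq ac_simps)
    qed
    have B1: "B1 \<le> K * C3 * g x y" "0 \<le> B1"
      using B_le[of "\<tau> x y"] t(5) v_pos[OF t(1), of x] by (auto simp: B1_def)
    have B2: "B2 \<le> K * C3 * g x y" "0 \<le> B2"
      using B_le[of "\<omega> x y"] t(5) v_pos[OF t(9), of x] by (auto simp: B2_def)
    have upper: "F \<le> ennreal (C * (H * (L + g x y)))"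
    proof -
      have "F \<le> ennreal (C1 * H * (L + B1 + B2)) + ennreal (C1 * H) * W"
        using C1(2)[OF U xy] by (simp add: F_def H_def L_def B1_def B2_def W_def)
      also have "\<dots> \<le> ennreal (C1 * H * (L + B1 + B2)) + ennreal (C1 * H) * ennreal (C3 * g x y)"
        using gW by (intro add_left_mono mult_left_mono) auto
      also have "\<dots> = ennreal (C1 * H * (L + B1 + B2) + C1 * H * (C3 * g x y))"
        using C1(1) C3(1) H L B1 B2 g by (simp add: ennreal_mult'[symmetric] ennreal_plus[symmetric] del: ennreal_plus)
      also have "\<dots> \<le> ennreal (C * (H * (L + g x y)))"
      proof (rule ennreal_leI)
        have CH: "0 \<le> C1 * H" using C1(1) H by simp
        have "L + B1 + B2 + C3 * g x y \<le> (2 * K * C3 + C3 + 1) * (L + g x y)"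
        proof -
          have "0 \<le> (2 * K * C3 + C3) * L" using K C3(1) L by simp
          moreover have "L + B1 + B2 + C3 * g x y \<le> L + (2 * K * C3 + C3) * g x y" using B1 B2 by (simp add: algebra_simps)
          ultimately show ?thesis using g by (simp add: algebra_simps)
        qed
        hence "C1 * H * (L + B1 + B2 + C3 * g x y) \<le> C1 * H * ((2 * K * C3 + C3 + 1) * (L + g x y))"
          using CH by (intro mult_left_mono) auto
        also have "\<dots> = C1 * (2 * K * C3 + C3 + 1) * (H * (L + g x y))" by simp
        also have "\<dots> \<le> C * (H * (L + g x y))" using C(1) H L g by (intro mult_right_mono) auto
        finally show "C1 * H * (L + B1 + B2) + C1 * H * (C3 * g x y) \<le> C * (H * (L + g x y))"
          by (simp add: distrib_left)
      qed
      finally show ?thesis .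
    qed
    have lower: "ennreal (H * (L + g x y) / C) \<le> F"
    proof (cases "L \<le> g x y")
      case True
      have "H * (L + g x y) / C \<le> H * (2 * g x y) / (2 * C2 * C3)"
        using True C C2(1) C3(1) H L g by (intro frac_le mult_left_mono) auto
      also have "\<dots> = H / C2 * (g x y / C3)" by simp
      finally have "ennreal (H * (L + g x y) / C) \<le> ennreal (H / C2 * (g x y / C3))" by (rule ennreal_leI)
      also have "\<dots> = ennreal (H / C2) * ennreal (g x y / C3)"
        by (rule ennreal_mult) (use H g C2(1) C3(1) in auto)
      also have "\<dots> \<le> ennreal (H / C2) * W" using gW by (intro mult_left_mono) auto
      also have "\<dots> \<le> F" using C2(3)[OF U xy] by (simp add: F_def H_def W_def)
      finally show ?thesis .
    next
      case False
      have "C2 * 2 \<le> C2 * 2 * C3" using mult_left_mono[OF C3(1), of "C2 * 2"] C2(1) by simp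
      hence C22: "C2 * 2 \<le> C" using C(2) by linarith
      have "H * (L + g x y) / C \<le> H * (2 * L) / (C2 * 2)"
        using False C22 C2(1) H L g by (intro frac_le mult_left_mono) auto
      hence "ennreal (H * (L + g x y) / C) \<le> ennreal (H * L / C2)" by (intro ennreal_leI) simp
      also have "\<dots> \<le> F" using C2(2)[OF U xy] by (simp add: F_def H_def L_def)
      finally show ?thesis .
    qed
    have "B1 \<le> C * g x y" using B1(1) mult_right_mono[OF C(3) g] by linarith
    moreover have "g x y \<le> C * B1" if "bdist_max D x y \<le> dist x y"
      using C3(3)[OF xy that] mult_right_mono[OF C(4) B1(2)] by (simp add: B1_def)
    ultimately show "0 \<le> g x y \<and> v x (\<tau> x y) * \<tau> x y powr \<beta> \<le> C * g x y \<and>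
      (bdist_max D x y \<le> dist x y \<longrightarrow> g x y \<le> C * (v x (\<tau> x y) * \<tau> x y powr \<beta>)) \<and>
      ennreal (h (\<tau> x y) x y * (jump_part x y + g x y) / C) \<le>
        green_integral U x y \<and>
      green_integral U x y \<le>
        ennreal (C * (h (\<tau> x y) x y * (jump_part x y + g x y)))"
      using g upper lower by (auto simp: B1_def F_def H_def L_def)
  qed
qed

text \<open>
With \<open>B = v(\<tau>) \<tau>^\<beta>\<close> the assumption makes \<open>jump_part\<close> comparable with \<open>B\<close> times the logarithm, and \<open>B\<close> is at most a
multiple of \<open>g\<^sub>0\<close>.  Conversely, either the logarithm is at most 2, or \<open>\<delta>\<^sub>\<or> \<le> \<rho>\<close> and \<open>g\<^sub>0\<close> is at most a multiple of \<open>B\<close>.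
\<close>

lemma comparable_scales:
  assumes ab: "0 < a" "0 < b" and \<Psi>: "\<And>r. 0 < r \<Longrightarrow> a * \<Phi> r \<le> \<Psi> r \<and> \<Psi> r \<le> b * \<Phi> r"
    and xy: "x \<in> D" "y \<in> D" "x \<noteq> y" and C: "1 \<le> C"
    and gB: "0 \<le> g x y" "v x (\<tau> x y) * \<tau> x y powr \<beta> \<le> C * g x y"
    and Bg: "bdist_max D x y \<le> dist x y \<Longrightarrow> g x y \<le> C * (v x (\<tau> x y) * \<tau> x y powr \<beta>)"
  shows "jump_part x y + g x y \<le> (C / a + 1) * (g x y * log_ratio x y)"
    and "g x y * log_ratio x y \<le> max 2 (C * b) * (jump_part x y + g x y)"
proof -
  note t = times[OF xy] and lr = log_ratio_bounds[OF xy]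
  define B where "B = v x (\<tau> x y) * \<tau> x y powr \<beta>"
  define l where "l = log_ratio x y"
  define J where "J = jump_rate x y * \<tau> x y powr (1 + \<beta>)"
  have B: "0 \<le> B" using v_pos[OF t(1), of x] by (simp add: B_def)
  have l: "1 \<le> l" using lr by (simp add: l_def)
  have d: "0 < dist x y" using xy by simp
  have ps: "a * \<tau> x y \<le> \<Psi> (dist x y)" "\<Psi> (dist x y) \<le> b * \<tau> x y" using \<Psi>[OF d] by auto
  have ps0: "0 < \<Psi> (dist x y)" using ps(1) ab t(1) by (smt (verit) mult_pos_pos)
  have J: "J = \<tau> x y / \<Psi> (dist x y) * B"
    using t(1) by (simp add: J_def B_def jump_rate_def v_at_jump_time powr_add)
  have ratio: "\<tau> x y / \<Psi> (dist x y) \<le> 1 / a" "1 / b \<le> \<tau> x y / \<Psi> (dist x y)"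
    using ps ps0 ab by (auto simp: field_simps)
  have JB: "J \<le> 1 / a * B" "1 / b * B \<le> J"
    unfolding J by (rule mult_right_mono[OF ratio(1) B] mult_right_mono[OF ratio(2) B])+
  have J0: "0 \<le> J" using JB(2) B ab by (smt (verit) divide_nonneg_nonneg mult_nonneg_nonneg)
  have gl: "g x y \<le> g x y * l" using mult_left_mono[OF l gB(1)] by simp
  have "J * l \<le> C / a * (g x y * l)"
  proof -
    have "J \<le> 1 / a * (C * g x y)" using JB(1) gB(2) ab mult_left_mono[of B "C * g x y" "1 / a"] by (simp add: B_def)
    hence "J * l \<le> 1 / a * (C * g x y) * l" using l by (intro mult_right_mono) auto
    thus ?thesis by simp
  qed
  hence "J * l + g x y \<le> C / a * (g x y * l) + 1 * (g x y * l)" using gl by simp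
  thus "jump_part x y + g x y \<le> (C / a + 1) * (g x y * log_ratio x y)"
    unfolding distrib_right J_def l_def .
  have N: "0 \<le> J * l + g x y" using J0 l gB(1) by simp
  have "g x y * l \<le> max 2 (C * b) * (J * l + g x y)"
  proof (cases "bdist_max D x y \<le> dist x y")
    case True
    have "B \<le> b * J" using JB(2) ab by (simp add: field_simps)
    hence "C * B \<le> C * (b * J)" using C by (intro mult_left_mono) auto
    hence "g x y \<le> C * (b * J)" using Bg[OF True] unfolding B_def by linarith
    hence "g x y * l \<le> C * (b * J) * l" using l by (intro mult_right_mono) auto
    also have "\<dots> \<le> C * b * (J * l + g x y)" using C ab gB(1) by (simp add: algebra_simps)
    also have "\<dots> \<le> max 2 (C * b) * (J * l + g x y)" using N by (intro mult_right_mono) auto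
    finally show ?thesis .
  next
    case False
    hence "l \<le> 2" using lr(4) by (simp add: l_def)
    hence "g x y * l \<le> g x y * 2" using gB(1) by (intro mult_left_mono) auto
    also have "\<dots> \<le> 2 * (J * l + g x y)" using J0 l by simp
    also have "\<dots> \<le> max 2 (C * b) * (J * l + g x y)" using N by (intro mult_right_mono) auto
    finally show ?thesis .
  qed
  thus "g x y * log_ratio x y \<le> max 2 (C * b) * (jump_part x y + g x y)"
    by (simp add: J_def l_def)
qed

end

section \<open>Large times on bounded domains\<close>

lemma two_sided_hk_subset:
  assumes "two_sided_hk m D \<Phi> \<Psi> h p C0 I" "J \<subseteq> I"
  shows "two_sided_hk m D \<Phi> \<Psi> h p C0 J"
  using assms unfolding two_sided_hk_def by (meson subsetD)

lemma strictly_positive_scale_diam: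
  assumes "strict_mono_on {0..} \<Phi>" "\<forall>r\<ge>0. 0 \<le> \<Phi> r" "bounded D" "x0 \<in> D" "y0 \<in> D" "x0 \<noteq> y0"
  shows "0 < diameter D" "(0::real) < \<Phi> (diameter D)"
proof -
  show d: "0 < diameter D"
    using diameter_bounded_bound[OF assms(3-5)] assms(6) by (smt (verit) zero_less_dist_iff)
  have "\<Phi> 0 < \<Phi> (diameter D)" using strict_mono_onD[OF assms(1), of 0 "diameter D"] d by simp
  thus "0 < \<Phi> (diameter D)" using assms(2) by (meson dual_order.refl order.strict_trans1)
qed

lemma exp_le_powr:
  assumes "0 < a" "0 < (b::real)"
  obtains M where "0 < M" "\<And>s. 0 < s \<Longrightarrow> exp (- b * s) \<le> M * s powr - a"
proof (rule that[of "exp (a * ln (a / b))"])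
  fix s :: real assume s: "0 < s"
  have "s powr a * exp (- b * s) \<le> exp (a * ln (a / b))" by (rule powr_times_exp_bounded[OF assms s])
  thus "exp (- b * s) \<le> exp (a * ln (a / b)) * s powr - a"
    using s by (simp add: powr_minus_divide field_simps)
qed simp

text \<open>
The estimates are given with the explicit kernel up to time 1 and with the exponential afterwards; they are
transferred to the time \<open>\<Phi>(diam D)\<close> in place of 1.  For times between the two, \<open>hk_bound\<close> lies between positive
constants that depend on the domain and \<open>h(s)\<close> is comparable with \<open>h(1)\<close>, so that both forms of the estimate
say that the kernel is comparable with \<open>h(1)\<close>.
\<close>

lemma HK_B_to_diameter:
  fixes m :: "'a::heine_borel measure"
  assumes m: "radon_full_support m" and vs: "volume_scaling m R_E d1 d2"
    and sc: "scale_functions \<Phi> \<Psi> \<alpha>1 \<alpha>2 \<alpha>3 \<alpha>4"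
    and bf: "boundary_function D \<Phi> \<gamma> h" and hk: "HK_B m D \<Phi> \<Psi> h p 1"
    and x0: "x0 \<in> D" "y0 \<in> D" "x0 \<noteq> y0" and a: "0 < a"
  shows "two_sided_hk m D \<Phi> \<Psi> h p 1 {s. 0 < s \<and> ereal s \<le> scale_diam \<Phi> D}"
    and "\<exists>C. \<forall>s x y. x \<in> D \<longrightarrow> y \<in> D \<longrightarrow> \<Phi> (diameter D) < s \<longrightarrow>
      p s x y \<le> C * s powr - a * h (\<Phi> (diameter D)) x y"
proof -
  have D: "bounded D" using hk by (simp add: HK_B_def)
  have \<Phi>: "weak_scaling \<Phi> \<alpha>1 \<alpha>2" "strict_mono_on {0..} \<Phi>" "\<forall>r\<ge>0. 0 \<le> \<Phi> r"
    and \<Phi>\<Psi>: "\<And>r. 0 \<le> r \<Longrightarrow> \<Phi> r \<le> \<Psi> r"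
    using sc by (auto simp: scale_functions_def)
  note inv_pos = scale_inv_pos[OF \<Phi>] and inv_mono = scale_inv_mono[OF \<Phi>]
  define T0 where "T0 = \<Phi> (diameter D)"
  have diam: "0 < diameter D" and T0: "0 < T0"
    using strictly_positive_scale_diam[OF \<Phi>(2,3) D x0] by (auto simp: T0_def)
  have T: "scale_diam \<Phi> D = ereal T0" using D by (simp add: scale_diam_def T0_def)
  note hb = boundary_function_bounds[OF bf] and h_anti = boundary_function_anti[OF bf]
  have \<Psi>: "0 \<le> \<Psi> (dist x y)" for x y :: 'a
    using \<Phi>\<Psi>[of "dist x y"] \<Phi>(3) by (meson order_trans zero_le_dist)
  obtain cg where cg: "0 < cg" "\<And>s t x y. 0 < s \<Longrightarrow> s \<le> t \<Longrightarrow> ereal t < 4 * scale_diam \<Phi> D + 1 \<Longrightarrow>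
      x \<in> D \<Longrightarrow> y \<in> D \<Longrightarrow> s powr \<gamma> * h s x y \<le> cg * t powr \<gamma> * h t x y"
    using bf unfolding boundary_function_def by blast
  have \<gamma>: "0 \<le> \<gamma>" using bf by (simp add: boundary_function_def)
  have "two_sided_hk m D \<Phi> \<Psi> h p 1 {0<..1}" using hk by (simp add: HK_B_def)
  then obtain c1 c2 c3 c4 where c: "0 < c1" "0 < c2" "0 < c3" "0 < c4" and
    cb: "\<forall>t\<in>{0<..1}. \<forall>x\<in>D. \<forall>y\<in>D. c1 * h t x y * hk_bound m \<Phi> \<Psi> 1 c2 t x y \<le> p t x y \<and>
        p t x y \<le> c3 * h t x y * hk_bound m \<Phi> \<Psi> 1 c4 t x y"
    unfolding two_sided_hk_def by metis
  obtain l e1 e2 where l: "0 < l" and e: "0 < e1" "0 < e2" and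
    eb': "\<forall>t\<ge>1. \<forall>x\<in>D. \<forall>y\<in>D. e1 * (exp (- l * t) * h 1 x y) \<le> p t x y \<and>
        p t x y \<le> e2 * (exp (- l * t) * h 1 x y)"
    using hk unfolding HK_B_def by metis
  have eb: "e1 * (exp (- l * t) * h 1 x y) \<le> p t x y \<and> p t x y \<le> e2 * (exp (- l * t) * h 1 x y)"
    if "1 \<le> t" "x \<in> D" "y \<in> D" for t x y
    using eb' that by blast
  define i1 where "i1 = scale_inv \<Phi> 1"
  define iT where "iT = scale_inv \<Phi> T0"
  have i: "0 < i1" "0 < iT" unfolding i1_def iT_def by (rule inv_pos; use T0 in simp)+
  obtain b1 where b1: "0 < b1" "\<And>x. x \<in> D \<Longrightarrow> 1 / b1 \<le> vol m x i1 \<and> vol m x i1 \<le> b1"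
    using vol_uniform_bounds[OF m vs D x0(1) i(1)] by metis
  obtain bT where bT: "0 < bT" "\<And>x. x \<in> D \<Longrightarrow> 1 / bT \<le> vol m x iT \<and> vol m x iT \<le> bT"
    using vol_uniform_bounds[OF m vs D x0(1) i(2)] by metis
  have Vm: "vol m x r \<le> vol m x R" if "r \<le> R" for x r R using that by (intro vol_mono[OF m]) auto
  \<comment> \<open>between time 1 and the diameter scale everything is comparable with its value at time 1\<close>
  define k where "k = max 1 (cg * T0 powr \<gamma>)"
  have k: "1 \<le> k" by (simp add: k_def)
  have h1: "h 1 x y \<le> k * h s x y" if s: "0 < s" "s \<le> max 1 T0" and xy: "x \<in> D" "y \<in> D" for s x y
  proof (cases "s \<le> 1")
    case True
    have "h 1 x y \<le> h s x y" using s True xy by (intro h_anti) auto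
    also have "\<dots> \<le> k * h s x y" using mult_right_mono[OF k, of "h s x y"] hb[OF s(1) xy] by simp
    finally show ?thesis .
  next
    case False
    hence sT: "1 \<le> s" "s \<le> T0" using s by auto
    have lt: "ereal s < 4 * scale_diam \<Phi> D + 1" using sT T0 by (simp add: T)
    have "h 1 x y \<le> cg * s powr \<gamma> * h s x y" using cg(2)[OF _ sT(1) lt xy] by simp
    also have "\<dots> \<le> k * h s x y"
    proof (rule mult_right_mono)
      have "cg * s powr \<gamma> \<le> cg * T0 powr \<gamma>" using sT cg(1) \<gamma> by (intro mult_left_mono powr_mono2) auto
      thus "cg * s powr \<gamma> \<le> k" by (simp add: k_def)
    qed (use hb[OF s(1) xy] in simp)
    finally show ?thesis .
  qed
  define E where "E = exp (- (c4 * (diameter D)\<^sup>2 / i1\<^sup>2)) / bT"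
  have E: "0 < E" using bT(1) by (simp add: E_def)
  have hk_mid: "hk_bound m \<Phi> \<Psi> 1 c' s x y \<le> b1 \<and> (c' = c4 \<longrightarrow> E \<le> hk_bound m \<Phi> \<Psi> 1 c' s x y) \<and> 0 \<le> hk_bound m \<Phi> \<Psi> 1 c' s x y"
    if s: "1 \<le> s" "s \<le> T0" and xy: "x \<in> D" "y \<in> D" and c': "0 < c'" for s x y c'
  proof -
    have inv_le: "i1 \<le> scale_inv \<Phi> s" "scale_inv \<Phi> s \<le> iT"
      using inv_mono[of 1 s] inv_mono[of s T0] s by (auto simp: i1_def iT_def)
    have V: "1 / b1 \<le> vol m x (scale_inv \<Phi> s)" "vol m x (scale_inv \<Phi> s) \<le> bT"
      using Vm[OF inv_le(1), of x] Vm[OF inv_le(2), of x] b1(2)[OF xy(1)] bT(2)[OF xy(1)] by linarith+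
    have V0: "0 < vol m x (scale_inv \<Phi> s)" using V(1) b1(1) by (smt (verit) zero_less_divide_1_iff)
    have w: "1 / vol m x (scale_inv \<Phi> s) \<le> b1" using V V0 b1(1) by (simp add: field_simps)
    note hkb = hk_bound_between[where c=c' and s=s and \<Psi>=\<Psi> and x=x and y=y and \<Phi>=\<Phi> and m=m, OF less_imp_le[OF c'] _ \<Psi>]
    have "E \<le> hk_bound m \<Phi> \<Psi> 1 c' s x y" if "c' = c4"
    proof -
      have "(dist x y)\<^sup>2 / (scale_inv \<Phi> s)\<^sup>2 \<le> (diameter D)\<^sup>2 / i1\<^sup>2"
        using diameter_bounded_bound[OF D xy] inv_le i by (intro frac_le power_mono) auto
      hence "c4 * ((dist x y)\<^sup>2 / (scale_inv \<Phi> s)\<^sup>2) \<le> c4 * ((diameter D)\<^sup>2 / i1\<^sup>2)"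
        using c by (intro mult_left_mono) auto
      hence "E \<le> exp (- (c4 * (dist x y)\<^sup>2 / (scale_inv \<Phi> s)\<^sup>2)) / vol m x (scale_inv \<Phi> s)"
        unfolding E_def using V V0 by (intro frac_le) auto
      thus ?thesis using hkb(1) s that by simp
    qed
    thus ?thesis using hkb(2,3) w s by auto
  qed
  define C1 where "C1 = min c1 (e1 * exp (- l * T0) / b1)"
  define C3 where "C3 = max c3 (e2 * k / E)"
  have pos: "0 < C1" "0 < C3" using c e b1(1) by (auto simp: C1_def C3_def)
  show "two_sided_hk m D \<Phi> \<Psi> h p 1 {s. 0 < s \<and> ereal s \<le> scale_diam \<Phi> D}"
    unfolding two_sided_hk_def
  proof (rule conjI, simp, rule exI[of _ C1], rule conjI[OF pos(1)], rule exI[of _ c2], rule conjI[OF c(2)],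
      rule exI[of _ C3], rule conjI[OF pos(2)], rule exI[of _ c4], rule conjI[OF c(4)], intro ballI)
    fix s x y assume "s \<in> {s. 0 < s \<and> ereal s \<le> scale_diam \<Phi> D}" and xy: "x \<in> D" "y \<in> D"
    hence s: "0 < s" "s \<le> T0" by (auto simp: T)
    note hs = hb[OF s(1) xy]
    define A B where "A = hk_bound m \<Phi> \<Psi> 1 c2 s x y" and "B = hk_bound m \<Phi> \<Psi> 1 c4 s x y"
    have "C1 * h s x y * A \<le> p s x y \<and> p s x y \<le> C3 * h s x y * B"
    proof (cases "s \<le> 1")
      case True
      have nn: "0 \<le> A" "0 \<le> B"
        unfolding A_def B_def using c s \<Psi> by (intro hk_bound_between(3); simp)+
      have "C1 * h s x y * A \<le> c1 * h s x y * A" using hs nn by (intro mult_right_mono) (auto simp: C1_def)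
      moreover have "c3 * h s x y * B \<le> C3 * h s x y * B" using hs nn by (intro mult_right_mono) (auto simp: C3_def)
      ultimately show ?thesis using cb[rule_format, of s x y] s True xy by (auto simp: A_def B_def)
    next
      case False
      hence s1: "1 \<le> s" by simp
      have A: "A \<le> b1" "0 \<le> A" and B: "E \<le> B" "0 \<le> B"
        using hk_mid[OF s1 s(2) xy c(2)] hk_mid[OF s1 s(2) xy c(4)] by (auto simp: A_def B_def)
      have "C1 * h s x y * A \<le> e1 * exp (- l * T0) / b1 * h s x y * b1"
        using A hs e b1(1) by (intro mult_mono) (auto simp: C1_def)
      also have "\<dots> = e1 * (exp (- l * T0) * h s x y)" using b1(1) by simp
      also have "\<dots> \<le> e1 * (exp (- l * s) * h 1 x y)"
        using h_anti[OF _ s1 xy] s l e hs by (intro mult_left_mono mult_mono) auto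
      also have "\<dots> \<le> p s x y" using eb[OF s1 xy] by simp
      finally have low: "C1 * h s x y * A \<le> p s x y" .
      have "p s x y \<le> e2 * (exp (- l * s) * h 1 x y)" using eb[OF s1 xy] by simp
      also have "\<dots> \<le> e2 * (1 * (k * h s x y))"
        using h1[OF s(1) _ xy] s e l s1 hb[of 1 x y] xy by (intro mult_left_mono mult_mono) auto
      also have "\<dots> = e2 * k / E * h s x y * E" using E by simp
      also have "\<dots> \<le> C3 * h s x y * B"
        using B hs e k E c by (intro mult_mono) (auto simp: C3_def)
      finally show ?thesis using low by simp
    qed
    thus "C1 * h s x y * hk_bound m \<Phi> \<Psi> 1 c2 s x y \<le> p s x y \<and> p s x y \<le> C3 * h s x y * hk_bound m \<Phi> \<Psi> 1 c4 s x y"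
      by (simp add: A_def B_def)
  qed
  obtain M where M: "0 < M" "\<And>s. 0 < s \<Longrightarrow> exp (- l * s) \<le> M * s powr - a" by (rule exp_le_powr[OF a l]) blast
  have "p s x y \<le> max (e2 * k * M) (c3 * bT) * s powr - a * h T0 x y"
    if xy: "x \<in> D" "y \<in> D" and s: "T0 < s" for s x y
  proof -
    have s0: "0 < s" using s T0 by simp
    note hT = hb[OF T0 xy]
    have nn: "0 \<le> s powr - a * h T0 x y" using hT by simp
    show ?thesis
    proof (cases "1 \<le> s")
      case True
      have "p s x y \<le> e2 * (exp (- l * s) * h 1 x y)" using eb[OF True xy] by simp
      also have "\<dots> \<le> e2 * (M * s powr - a * (k * h T0 x y))"
        using h1[OF T0 _ xy] M(2)[OF s0] hb[of 1 x y] xy e M(1) by (intro mult_left_mono mult_mono) auto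
      also have "\<dots> = e2 * k * M * (s powr - a * h T0 x y)" by simp
      also have "\<dots> \<le> max (e2 * k * M) (c3 * bT) * (s powr - a * h T0 x y)" using nn by (intro mult_right_mono) auto
      finally show ?thesis by (simp add: mult.assoc)
    next
      case False
      have inv_le: "iT \<le> scale_inv \<Phi> s" using inv_mono[OF T0, of s] s by (simp add: iT_def)
      have V: "1 / bT \<le> vol m x (scale_inv \<Phi> s)" using Vm[OF inv_le, of x] bT(2)[OF xy(1)] by linarith
      have "0 < vol m x (scale_inv \<Phi> s)" using V bT(1) by (smt (verit) zero_less_divide_1_iff)
      hence "1 / vol m x (scale_inv \<Phi> s) \<le> bT" using V bT(1) by (simp add: field_simps)
      hence hkb: "hk_bound m \<Phi> \<Psi> 1 c4 s x y \<le> bT" by (simp add: hk_bound_def)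
      have "p s x y \<le> c3 * h s x y * hk_bound m \<Phi> \<Psi> 1 c4 s x y" using cb[rule_format, of s x y] False s0 xy by simp
      also have "\<dots> \<le> c3 * h s x y * bT" using hkb c hb[OF s0 xy] by (intro mult_left_mono) auto
      also have "\<dots> \<le> c3 * h T0 x y * bT"
        using h_anti[OF T0 _ xy, of s] s c bT(1) by (intro mult_right_mono mult_left_mono) auto
      also have "\<dots> = c3 * bT * (1 * h T0 x y)" by simp
      also have "\<dots> \<le> c3 * bT * (s powr - a * h T0 x y)"
      proof (intro mult_left_mono mult_right_mono)
        show "1 \<le> s powr - a" using False s0 a powr_mono2'[of "- a" s 1] by simp
      qed (use hT c bT(1) in auto)
      also have "\<dots> \<le> max (e2 * k * M) (c3 * bT) * (s powr - a * h T0 x y)" using nn by (intro mult_right_mono) auto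
      finally show ?thesis by (simp add: mult.assoc)
    qed
  qed
  thus "\<exists>C. \<forall>s x y. x \<in> D \<longrightarrow> y \<in> D \<longrightarrow> \<Phi> (diameter D) < s \<longrightarrow>
      p s x y \<le> C * s powr - a * h (\<Phi> (diameter D)) x y"
    unfolding T0_def by blast
qed

text \<open>
Sections of a jointly measurable function; the restriction of the domain is preserved by the maps that fix the
remaining coordinates.
\<close>

lemma heat_kernel_section_measurable:
  assumes kernel: "heat_kernel m D Y P p"
  shows "x \<in> D \<Longrightarrow> y \<in> D \<Longrightarrow> (\<lambda>s. p s x y) \<in> borel_measurable (restrict_space borel {0<..})"
    and "0 < s \<Longrightarrow> x \<in> D \<Longrightarrow> (\<lambda>z. p s x z) \<in> borel_measurable (restrict_space borel D)"
    and "0 < s \<Longrightarrow> y \<in> D \<Longrightarrow> (\<lambda>z. p s z y) \<in> borel_measurable (restrict_space borel D)"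
proof -
  have joint: "(\<lambda>(t, x, y). p t x y) \<in>
      borel_measurable (restrict_space (borel \<Otimes>\<^sub>M borel \<Otimes>\<^sub>M borel) ({0<..} \<times> D \<times> D))"
    using kernel by (simp add: heat_kernel_def)
  have slice: "(\<lambda>z. (\<lambda>(t, x, y). p t x y) (f z)) \<in> borel_measurable (restrict_space borel A)"
    if "f \<in> borel \<rightarrow>\<^sub>M borel \<Otimes>\<^sub>M borel \<Otimes>\<^sub>M borel" "\<And>z. z \<in> A \<Longrightarrow> f z \<in> {0<..} \<times> D \<times> D" for f and A :: "'c::topological_space set"
    by (rule measurable_compose[OF measurable_restrict_space3[OF that(1)] joint]) (use that(2) in auto)
  show "(\<lambda>s. p s x y) \<in> borel_measurable (restrict_space borel {0<..})" if "x \<in> D" "y \<in> D"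
    using slice[of "\<lambda>s. (s, x, y)" "{0<..}"] that by simp
  show "(\<lambda>z. p s x z) \<in> borel_measurable (restrict_space borel D)" if "0 < s" "x \<in> D"
    using slice[of "\<lambda>z. (s, x, z)" D] that by simp
  show "(\<lambda>z. p s z y) \<in> borel_measurable (restrict_space borel D)" if "0 < s" "y \<in> D"
    using slice[of "\<lambda>z. (s, z, y)" D] that by simp
qed

text \<open>
Let \<open>T0 = \<Phi>(diam D)\<close>.  The Gaussian factor is bounded below at time \<open>T0\<close>, so \<open>p(T0,x,y)\<close> is at least a multiple
of \<open>h(T0)\<close>, uniformly on \<open>D\<close>.  At \<open>t1 = \<Phi>(R)\<close> the kernel is at most \<open>C h(T0) / V(x,R)\<close>, which for large \<open>R\<close> is at
most half of \<open>p(T0,x,y)\<close>.  By the Chapman-Kolmogorov equation the inequality \<open>p(t1) \<le> p(T0)/2\<close> persists when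
both times are increased by the same amount.  So the kernel is halved in every time step
\<open>t1 - T0\<close>, and exponential decay follows.
\<close>

lemma HK_U_large_time:
  fixes m :: "'a::heine_borel measure"
  assumes m: "radon_full_support m" and vs: "volume_scaling m R_E d1 d2"
    and sc: "scale_functions \<Phi> \<Psi> \<alpha>1 \<alpha>2 \<alpha>3 \<alpha>4"
    and bf: "boundary_function D \<Phi> \<gamma> h" and hk: "HK_U m R_E D \<Phi> \<Psi> h p 1"
    and kernel: "heat_kernel m D Y P p" and D_open: "open D"
    and D: "bounded D" and x0: "x0 \<in> D" "y0 \<in> D" "x0 \<noteq> y0" and a: "0 < a"
  shows "\<exists>C. \<forall>s x y. x \<in> D \<longrightarrow> y \<in> D \<longrightarrow> \<Phi> (diameter D) < s \<longrightarrow>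
      p s x y \<le> C * s powr - a * h (\<Phi> (diameter D)) x y"
proof -
  have \<Phi>: "weak_scaling \<Phi> \<alpha>1 \<alpha>2" "strict_mono_on {0..} \<Phi>" "\<forall>r\<ge>0. 0 \<le> \<Phi> r"
    and \<Phi>\<Psi>: "\<And>r. 0 \<le> r \<Longrightarrow> \<Phi> r \<le> \<Psi> r"
    using sc by (auto simp: scale_functions_def)
  have RE: "R_E = \<infinity>" using hk by (simp add: HK_U_def)
  define d where "d = diameter D"
  define T0 where "T0 = \<Phi> d"
  have d0: "0 < d" and T0: "0 < T0"
    using strictly_positive_scale_diam[OF \<Phi>(2,3) D x0] by (auto simp: T0_def d_def)
  note hb = boundary_function_bounds[OF bf] and h_anti = boundary_function_anti[OF bf]
  have \<Psi>: "0 \<le> \<Psi> (dist x y)" for x y :: 'a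
    using \<Phi>\<Psi>[of "dist x y"] \<Phi>(3) by (meson order_trans zero_le_dist)
  have p_nonneg: "0 \<le> p s x y" if "0 < s" "x \<in> D" "y \<in> D" for s x y
    using kernel that by (simp add: heat_kernel_def)
  have CK: "ennreal (p (s + t) x y) = (\<integral>\<^sup>+ z\<in>D. ennreal (p s x z * p t z y) \<partial>m)"
    if "0 < s" "0 < t" "x \<in> D" "y \<in> D" for s t x y
    using kernel that by (simp add: heat_kernel_def)
  have "two_sided_hk m D \<Phi> \<Psi> h p 1 {0<..}" using hk by (simp add: HK_U_def)
  then obtain c1 c2 c3 c4 where c: "0 < c1" "0 < c2" "0 < c3" and
    cb': "\<forall>t\<in>{0<..}. \<forall>x\<in>D. \<forall>y\<in>D. c1 * h t x y * hk_bound m \<Phi> \<Psi> 1 c2 t x y \<le> p t x y \<and>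
        p t x y \<le> c3 * h t x y * hk_bound m \<Phi> \<Psi> 1 c4 t x y"
    unfolding two_sided_hk_def by metis
  have cb: "c1 * h t x y * hk_bound m \<Phi> \<Psi> 1 c2 t x y \<le> p t x y \<and>
        p t x y \<le> c3 * h t x y * hk_bound m \<Phi> \<Psi> 1 c4 t x y" if "0 < t" "x \<in> D" "y \<in> D" for t x y
    using cb' that by simp
  obtain b where b: "0 < b" "\<And>x. x \<in> D \<Longrightarrow> 1 / b \<le> vol m x d \<and> vol m x d \<le> b"
    using vol_uniform_bounds[OF m vs D x0(1) d0] by metis
  obtain C where C: "1 \<le> C" "vol_scaled m C d1 d2 \<infinity>"
    using volume_scaling_vol_scaled[OF vs, of \<infinity>] RE by auto
  have dpos: "0 < d1" using vs by (simp add: volume_scaling_def)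
  have V: "0 < vol m x d" if "x \<in> D" for x
    using b that by (smt (verit) zero_less_divide_1_iff)
  have low: "c1 * exp (- c2) / b * h T0 x y \<le> p T0 x y" if xy: "x \<in> D" "y \<in> D" for x y
  proof -
    have inv: "scale_inv \<Phi> T0 = d" unfolding T0_def using d0 by (intro scale_inv_scale[OF \<Phi>]) auto
    have "(dist x y)\<^sup>2 \<le> d\<^sup>2" unfolding d_def using diameter_bounded_bound[OF D xy] by (intro power_mono) auto
    hence "(dist x y)\<^sup>2 / d\<^sup>2 \<le> 1" using d0 by simp
    hence "c2 * ((dist x y)\<^sup>2 / d\<^sup>2) \<le> c2 * 1" using c by (intro mult_left_mono) auto
    hence "exp (- c2) / b \<le> exp (- (c2 * (dist x y)\<^sup>2 / d\<^sup>2)) / vol m x d"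
      using b(2)[OF xy(1)] V[OF xy(1)] by (intro frac_le) auto
    also have "\<dots> \<le> hk_bound m \<Phi> \<Psi> 1 c2 T0 x y"
      using hk_bound_between(1)[of c2 T0 \<Psi> x y \<Phi> m] c T0 \<Psi> by (simp add: inv)
    finally have "1 / b * exp (- c2) \<le> hk_bound m \<Phi> \<Psi> 1 c2 T0 x y" by simp
    hence "c1 * h T0 x y * (1 / b * exp (- c2)) \<le> c1 * h T0 x y * hk_bound m \<Phi> \<Psi> 1 c2 T0 x y"
      using c hb[OF T0 xy] by (intro mult_left_mono) auto
    thus ?thesis using cb[OF T0 xy] by (simp add: ac_simps)
  qed
  have up: "p s x y \<le> c3 * h T0 x y / vol m x (scale_inv \<Phi> s)" if xy: "x \<in> D" "y \<in> D" and s: "T0 \<le> s" for s x y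
  proof -
    have s0: "0 < s" using s T0 by simp
    have "p s x y \<le> c3 * h s x y * hk_bound m \<Phi> \<Psi> 1 c4 s x y" using cb[OF s0 xy] by simp
    also have "\<dots> \<le> c3 * h s x y * (1 / vol m x (scale_inv \<Phi> s))"
      using c hb[OF s0 xy] by (intro mult_left_mono) (auto simp: hk_bound_def)
    also have "\<dots> \<le> c3 * h T0 x y * (1 / vol m x (scale_inv \<Phi> s))"
      using h_anti[OF T0 s xy] c by (intro mult_right_mono mult_left_mono) (auto simp: vol_def)
    finally show ?thesis by simp
  qed
  \<comment> \<open>at a radius this large the volume has grown enough to halve the kernel\<close>
  define Z where "Z = 2 * c3 * b * C * b / (c1 * exp (- c2))"
  have Z: "0 < Z" using c b(1) C(1) by (simp add: Z_def)
  define q where "q = Z powr (1 / d1)"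
  define R where "R = d * max 2 q"
  have R: "d < R" "2 \<le> R / d" "q \<le> R / d" using d0 by (auto simp: R_def)
  define t1 where "t1 = \<Phi> R"
  have t1: "T0 < t1" unfolding t1_def T0_def using scale_less_iff[OF \<Phi>, of d R] R d0 by simp
  have halve: "p t1 x y \<le> 1 / 2 * p T0 x y" if xy: "x \<in> D" "y \<in> D" for x y
  proof -
    have inv: "scale_inv \<Phi> t1 = R" unfolding t1_def using R d0 by (intro scale_inv_scale[OF \<Phi>]) auto
    have "Z = q powr d1" using Z dpos by (simp add: q_def powr_powr)
    also have "\<dots> \<le> (R / d) powr d1" using R dpos by (intro powr_mono2) (auto simp: q_def)
    finally have ZR: "Z \<le> (R / d) powr d1" .
    have "(R / d) powr d1 / C \<le> vol m x R / vol m x d"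
      using C(2) R d0 by (auto simp: vol_scaled_def)
    hence "Z / C \<le> vol m x R / vol m x d" using ZR C(1) divide_right_mono[OF ZR, of C] by linarith
    hence "Z / C * vol m x d \<le> vol m x R" using V[OF xy(1)] by (simp add: pos_le_divide_eq)
    moreover have "Z / C * (1 / b) \<le> Z / C * vol m x d"
      using b(2)[OF xy(1)] Z C(1) by (intro mult_left_mono) auto
    ultimately have VR: "Z / (C * b) \<le> vol m x R" by simp
    have "p t1 x y \<le> c3 * h T0 x y / vol m x R" using up[OF xy less_imp_le[OF t1]] by (simp add: inv)
    also have "\<dots> \<le> c3 * h T0 x y / (Z / (C * b))"
      using VR Z C(1) b(1) c hb[OF T0 xy] by (intro divide_left_mono mult_pos_pos) (auto intro: less_le_trans[OF _ VR])
    also have "\<dots> = 1 / 2 * (c1 * exp (- c2) / b * h T0 x y)"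
      using c b(1) C(1) by (simp add: Z_def field_simps)
    also have "\<dots> \<le> 1 / 2 * p T0 x y" using low[OF xy] by simp
    finally show ?thesis .
  qed
  define \<delta> where "\<delta> = t1 - T0"
  have \<delta>: "0 < \<delta>" using t1 by (simp add: \<delta>_def)
  \<comment> \<open>convolution of \<open>halve\<close> with the kernel at time \<open>u - T0\<close>\<close>
  have step: "p (u + \<delta>) x y \<le> 1 / 2 * p u x y" if u: "T0 \<le> u" and xy: "x \<in> D" "y \<in> D" for u x y
  proof (cases "u = T0")
    case True
    thus ?thesis using halve[OF xy] by (simp add: \<delta>_def)
  next
    case False
    hence s: "0 < u - T0" using u by simp
    have u0: "0 < u" using u T0 by simp
    have "ennreal (2 * p (u + \<delta>) x y) = 2 * ennreal (p (t1 + (u - T0)) x y)"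
      using p_nonneg[OF _ xy, of "u + \<delta>"] u0 \<delta> by (simp add: ennreal_mult' \<delta>_def algebra_simps)
    also have "\<dots> = 2 * (\<integral>\<^sup>+ z\<in>D. ennreal (p t1 x z * p (u - T0) z y) \<partial>m)"
      using CK[OF _ s xy, of t1] t1 T0 by simp
    also have "\<dots> \<le> (\<integral>\<^sup>+ z\<in>D. ennreal (p T0 x z * p (u - T0) z y) \<partial>m)"
    proof -
      define f where "f z = ennreal (p T0 x z * p (u - T0) z y) * indicator D z" for z
      have f: "f \<in> borel_measurable m"
      proof -
        have "(\<lambda>z. ennreal (p T0 x z * p (u - T0) z y)) \<in> borel_measurable (restrict_space borel D)"
          using heat_kernel_section_measurable(2)[OF kernel T0 xy(1)]
            heat_kernel_section_measurable(3)[OF kernel s xy(2)] by measurable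
        hence "f \<in> borel_measurable borel"
          unfolding f_def using D_open by (subst borel_measurable_restrict_space_iff_ennreal[symmetric]) auto
        thus ?thesis using m by (simp add: radon_full_support_def cong: measurable_cong_sets)
      qed
      have "(\<integral>\<^sup>+ z\<in>D. ennreal (p t1 x z * p (u - T0) z y) \<partial>m) \<le> (\<integral>\<^sup>+ z. ennreal (1 / 2) * f z \<partial>m)"
      proof (rule nn_integral_mono)
        fix z
        show "ennreal (p t1 x z * p (u - T0) z y) * indicator D z \<le> ennreal (1 / 2) * f z"
        proof (cases "z \<in> D")
          case True
          have "p t1 x z * p (u - T0) z y \<le> 1 / 2 * p T0 x z * p (u - T0) z y"
            using halve[OF xy(1) True] p_nonneg[OF s True xy(2)] by (intro mult_right_mono) auto
          hence "ennreal (p t1 x z * p (u - T0) z y) \<le> ennreal (1 / 2 * (p T0 x z * p (u - T0) z y))"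
            by (intro ennreal_leI) simp
          also have "\<dots> = ennreal (1 / 2) * ennreal (p T0 x z * p (u - T0) z y)"
            by (rule ennreal_mult) (use p_nonneg[OF T0 xy(1) True] p_nonneg[OF s True xy(2)] in auto)
          finally show ?thesis using True by (simp add: f_def)
        qed simp
      qed
      also have "\<dots> = ennreal (1 / 2) * (\<integral>\<^sup>+ z. f z \<partial>m)" by (rule nn_integral_cmult[OF f])
      finally have "ennreal 2 * (\<integral>\<^sup>+ z\<in>D. ennreal (p t1 x z * p (u - T0) z y) \<partial>m) \<le>
          ennreal 2 * (ennreal (1 / 2) * (\<integral>\<^sup>+ z. f z \<partial>m))" by (rule mult_left_mono) simp
      also have "\<dots> = (\<integral>\<^sup>+ z. f z \<partial>m)"
      proof -
        have "ennreal 2 * ennreal (1 / 2) = 1" by (subst ennreal_mult[symmetric]) auto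
        thus ?thesis by (simp only: mult.assoc[symmetric] mult_1)
      qed
      finally show ?thesis by (simp add: f_def)
    qed
    also have "\<dots> = ennreal (p (T0 + (u - T0)) x y)" using CK[OF T0 s xy] by simp
    finally have "ennreal (2 * p (u + \<delta>) x y) \<le> ennreal (p u x y)" by simp
    hence "2 * p (u + \<delta>) x y \<le> p u x y" using p_nonneg[OF u0 xy] by (simp add: ennreal_le_iff)
    thus ?thesis by simp
  qed
  have iter: "p (u + real n * \<delta>) x y \<le> (1 / 2) ^ n * p u x y" if u: "T0 \<le> u" and xy: "x \<in> D" "y \<in> D" for u n x y
  proof (induction n)
    case (Suc n)
    have eq: "u + real (Suc n) * \<delta> = (u + real n * \<delta>) + \<delta>" by (simp add: algebra_simps)
    have "T0 \<le> u + real n * \<delta>" using u \<delta> by (simp add: add_increasing2)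
    hence "p (u + real (Suc n) * \<delta>) x y \<le> 1 / 2 * p (u + real n * \<delta>) x y"
      unfolding eq by (rule step[OF _ xy])
    also have "\<dots> \<le> 1 / 2 * ((1 / 2) ^ n * p u x y)" using Suc by simp
    finally show ?case by simp
  qed simp
  \<comment> \<open>the rate at which \<open>n\<close> halvings in time \<open>n \<delta>\<close> amount to exponential decay\<close>
  define l where "l = ln 2 / \<delta>"
  have l: "0 < l" using \<delta> by (simp add: l_def)
  obtain M where M: "0 < M" "\<And>s. 0 < s \<Longrightarrow> exp (- l * s) \<le> M * s powr - a" by (rule exp_le_powr[OF a l]) blast
  define A where "A = 2 * exp (l * T0) * M * (c3 * b)"
  have "p s x y \<le> A * s powr - a * h T0 x y" if xy: "x \<in> D" "y \<in> D" and s: "T0 < s" for s x y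
  proof -
    have s0: "0 < s" using s T0 by simp
    define n where "n = nat \<lfloor>(s - T0) / \<delta>\<rfloor>"
    define u where "u = s - real n * \<delta>"
    have nb: "real n \<le> (s - T0) / \<delta>" "(s - T0) / \<delta> \<le> real n + 1"
    proof -
      have "0 \<le> (s - T0) / \<delta>" using s \<delta> by simp
      thus "real n \<le> (s - T0) / \<delta>" "(s - T0) / \<delta> \<le> real n + 1" unfolding n_def by linarith+
    qed
    have "real n * \<delta> \<le> s - T0" using nb(1) \<delta> by (simp add: pos_le_divide_eq)
    hence u: "T0 \<le> u" by (simp add: u_def)
    have "p s x y \<le> (1 / 2) ^ n * p u x y" using iter[OF u xy, of n] by (simp add: u_def)
    also have "\<dots> \<le> (2 * exp (l * T0) * exp (- l * s)) * (c3 * b * h T0 x y)"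
    proof (rule mult_mono)
      have "exp (- (real n * ln 2)) \<le> exp (ln 2 + l * T0 + - l * s)"
      proof (subst exp_le_cancel_iff)
        have "l * (s - T0) \<le> ln 2 * (real n + 1)"
          using mult_left_mono[OF nb(2), of "ln 2"] by (simp add: l_def)
        thus "- (real n * ln 2) \<le> ln 2 + l * T0 + - l * s" by (simp add: algebra_simps)
      qed
      moreover have "exp (- (real n * ln 2)) = (1 / 2) ^ n"
        by (simp add: exp_minus exp_of_nat_mult power_one_over inverse_eq_divide)
      ultimately show "(1 / 2) ^ n \<le> 2 * exp (l * T0) * exp (- l * s)" unfolding exp_add by simp
      have "p u x y \<le> c3 * h T0 x y / vol m x (scale_inv \<Phi> u)" by (rule up[OF xy u])
      also have "\<dots> \<le> c3 * h T0 x y / (1 / b)"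
      proof (rule divide_left_mono)
        have "scale_inv \<Phi> T0 = d" unfolding T0_def using d0 by (intro scale_inv_scale[OF \<Phi>]) auto
        hence "d \<le> scale_inv \<Phi> u" using scale_inv_mono[OF \<Phi> T0 u] by simp
        hence "vol m x d \<le> vol m x (scale_inv \<Phi> u)" by (intro vol_mono[OF m]) auto
        thus "1 / b \<le> vol m x (scale_inv \<Phi> u)" using b(2)[OF xy(1)] by linarith
        thus "0 < vol m x (scale_inv \<Phi> u) * (1 / b)" using b(1) by (smt (verit) mult_pos_pos zero_less_divide_1_iff)
      qed (use c hb[OF T0 xy] in auto)
      finally show "p u x y \<le> c3 * b * h T0 x y" by (simp add: ac_simps)
      show "0 \<le> p u x y" using p_nonneg[OF _ xy, of u] u T0 by simp
    qed simp
    also have "\<dots> \<le> (2 * exp (l * T0) * (M * s powr - a)) * (c3 * b * h T0 x y)"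
      using M(2)[OF s0] c b(1) hb[OF T0 xy] by (intro mult_right_mono mult_left_mono) auto
    finally show ?thesis by (simp add: A_def ac_simps)
  qed
  thus ?thesis unfolding T0_def d_def by blast
qed

section \<open>The Green function of the subordinate process\<close>

lemma green_function_eq_potential:
  assumes S: "driftless_subordinator (P (Some x)) S \<nu>"
    and meas: "(\<lambda>s. ennreal (p s x y) * indicator {0<..} s) \<in> borel_measurable borel"
  shows "green_function P S p x y = (\<integral>\<^sup>+s\<in>{0<..}. ennreal (p s x y) \<partial>potential_measure (P (Some x)) S)"
  unfolding green_function_def subordinate_kernel_def
  by (rule nn_integral_potential_measure[OF S meas, symmetric])

theorem theorem5p11:
  fixes m :: "'a::{heine_borel, second_countable_topology} measure"
    and D :: "'a set"
    and Y :: "ennreal \<Rightarrow> 'w \<Rightarrow> 'a option"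
    and P :: "'a option \<Rightarrow> 'w measure"
    and S :: "real \<Rightarrow> 'w \<Rightarrow> real"
    and \<nu> :: "real measure"
    and p h :: "real \<Rightarrow> 'a \<Rightarrow> 'a \<Rightarrow> real"
    and \<Phi> \<Psi> :: "real \<Rightarrow> real"
    and R1 R_E :: ereal
    and d1 d2 \<alpha>1 \<alpha>2 \<alpha>3 \<alpha>4 \<beta>1 \<beta>2 \<gamma> \<gamma>s C0 :: real
  assumes "radon_full_support m"
    and "volume_scaling m R_E d1 d2"
    and "open D" and "D \<noteq> UNIV"
    and "hunt_process D Y P"
    and "heat_kernel m D Y P p"
    and "independent_subordinator D Y P S \<nu>"
    and "scale_functions \<Phi> \<Psi> \<alpha>1 \<alpha>2 \<alpha>3 \<alpha>4"
    and "boundary_function D \<Phi> \<gamma> h"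
    and "(poly_tail \<nu> R1 \<beta>1 \<beta>2 \<and> HK_B m D \<Phi> \<Psi> h p C0 \<and> ereal (\<Phi> (diameter D)) < R1 / 8) \<or>
         (poly_tail \<nu> \<infinity> \<beta>1 \<beta>2 \<and> HK_U m R_E D \<Phi> \<Psi> h p C0)"
    and "C0 = 1" and "\<beta>1 = \<beta>2"
    and "regular_boundary_function D \<Phi> h"
    and "H2_star D \<Phi> \<gamma>s h" and "\<gamma>s = \<gamma>" and "\<gamma> = \<beta>1 + 1"
    and "H2_star_star D \<Phi> \<beta>1 h"
    and "d1 > \<alpha>2 * min \<beta>2 1 \<or>
         (d1 = d2 \<and> d2 = \<alpha>1 * \<beta>1 \<and> \<alpha>1 * \<beta>1 = \<alpha>2 * \<beta>2) \<or>
         d2 < \<alpha>1 * \<beta>1"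
  shows "(\<exists>c1>0. \<exists>c2>0. \<forall>x\<in>D. \<forall>y\<in>D. x \<noteq> y \<longrightarrow>
            (let \<rho> = dist x y;
                 rhs = h (\<Phi> \<rho>) x y *
                   (\<Phi> \<rho> / \<Psi> \<rho> * (\<Phi> \<rho> powr (\<gamma> - 1) / vol m x \<rho>)
                      * ln (exp 1 + \<Phi> \<rho> / \<Phi> (bdist_max D x y))
                    + g0 m D \<Phi> \<nu> d1 d2 \<alpha>1 \<alpha>2 \<beta>1 \<beta>2 x y)
             in ennreal (c1 * rhs) \<le> green_function P S p x y \<and>
                green_function P S p x y \<le> ennreal (c2 * rhs)))
       \<and> ((\<exists>a>0. \<exists>b>0. \<forall>r>0. a * \<Phi> r \<le> \<Psi> r \<and> \<Psi> r \<le> b * \<Phi> r) \<longrightarrow>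
          (\<exists>c1>0. \<exists>c2>0. \<forall>x\<in>D. \<forall>y\<in>D. x \<noteq> y \<longrightarrow>
            (let \<rho> = dist x y;
                 rhs = h (\<Phi> \<rho>) x y * g0 m D \<Phi> \<nu> d1 d2 \<alpha>1 \<alpha>2 \<beta>1 \<beta>2 x y
                   * ln (exp 1 + \<Phi> \<rho> / \<Phi> (bdist_max D x y))
             in ennreal (c1 * rhs) \<le> green_function P S p x y \<and>
                green_function P S p x y \<le> ennreal (c2 * rhs))))"
proof (cases "\<exists>x0 y0. x0 \<in> D \<and> y0 \<in> D \<and> x0 \<noteq> y0")
  \<comment> \<open>from two points on, a bounded \<open>D\<close> has positive diameter\<close>
  case False
  hence "\<not> (x \<in> D \<and> y \<in> D \<and> x \<noteq> y)" for x y by blast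
  thus ?thesis by (intro conjI impI exI[of _ 1]) (auto simp: Let_def)
next
  case True
  then obtain x0 y0 where x0: "x0 \<in> D" "y0 \<in> D" "x0 \<noteq> y0" by blast
  define \<beta> where "\<beta> = \<beta>1"
  have \<beta>2: "\<beta>2 = \<beta>" and \<gamma>: "\<gamma> = 1 + \<beta>" "\<gamma> - 1 = \<beta>" using assms(12,16) by (auto simp: \<beta>_def)
  note kernel = assms(6) and sc = assms(8)
  have bf: "boundary_function D \<Phi> (1 + \<beta>) h" using assms(9) \<gamma> by simp
  have S: "driftless_subordinator (P (Some x)) S \<nu>" if "x \<in> D" for x
    using assms(7) that by (simp add: independent_subordinator_def)
  have levy: "levy_measure \<nu>" using S[OF x0(1)] by (simp add: driftless_subordinator_def)
  have cases: "(poly_tail \<nu> R1 \<beta> \<beta> \<and> HK_B m D \<Phi> \<Psi> h p 1) \<or> (poly_tail \<nu> \<infinity> \<beta> \<beta> \<and> HK_U m R_E D \<Phi> \<Psi> h p 1)"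
    using assms(10,11) \<beta>2 by (auto simp: \<beta>_def)
  obtain R where tail: "poly_tail \<nu> R \<beta> \<beta>" and R: "R = \<infinity> \<or> bounded D"
    using cases by (auto simp: HK_B_def)
  have \<beta>: "0 < \<beta>" "\<beta> < 1"
    using poly_tail_pos(1)[OF levy tail] poly_tail_index_less_one[OF levy tail] by auto
  have laplace: "\<exists>K\<ge>1. \<forall>u>0. (bounded D \<longrightarrow> 1 / u \<le> l) \<longrightarrow>
      within_factor K (laplace_exponent \<nu> u) (u powr \<beta>)" if l: "0 < l" for l
  proof -
    obtain K where "1 \<le> K" "\<And>u. 0 < u \<Longrightarrow> R = \<infinity> \<or> 1 / u \<le> l \<Longrightarrow>
        within_factor K (laplace_exponent \<nu> u) (u powr \<beta>)"
      using laplace_exponent_bounds[OF levy tail l] by metis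
    thus ?thesis using R by blast
  qed
  have hk: "two_sided_hk m D \<Phi> \<Psi> h p 1 {s. 0 < s \<and> ereal s \<le> scale_diam \<Phi> D}"
    using cases
  proof
    assume "poly_tail \<nu> \<infinity> \<beta> \<beta> \<and> HK_U m R_E D \<Phi> \<Psi> h p 1"
    hence "two_sided_hk m D \<Phi> \<Psi> h p 1 {0<..}" by (simp add: HK_U_def)
    thus ?thesis by (rule two_sided_hk_subset) auto
  qed (use HK_B_to_diameter(1)[OF assms(1,2) sc bf _ x0, of p 1] in auto)
  have large: "\<exists>C. \<forall>s x y. x \<in> D \<longrightarrow> y \<in> D \<longrightarrow> \<Phi> (diameter D) < s \<longrightarrow>
      p s x y \<le> C * s powr - (1 + \<beta>) * h (\<Phi> (diameter D)) x y" if "bounded D"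
    using cases
  proof
    assume "poly_tail \<nu> R1 \<beta> \<beta> \<and> HK_B m D \<Phi> \<Psi> h p 1"
    thus ?thesis using \<beta> by (intro HK_B_to_diameter(2)[OF assms(1,2) sc bf _ x0]) auto
  next
    assume "poly_tail \<nu> \<infinity> \<beta> \<beta> \<and> HK_U m R_E D \<Phi> \<Psi> h p 1"
    thus ?thesis using \<beta> by (intro HK_U_large_time[OF assms(1,2) sc bf _ kernel assms(3) that x0]) auto
  qed
  have meas: "(\<lambda>s. ennreal (p s x y) * indicator {0<..} s) \<in> borel_measurable borel" if "x \<in> D" "y \<in> D" for x y
  proof -
    have "(\<lambda>s. ennreal (p s x y)) \<in> borel_measurable (restrict_space borel {0<..})"
      using heat_kernel_section_measurable(1)[OF kernel that] by measurable
    thus ?thesis by (simp add: borel_measurable_restrict_space_iff_ennreal)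
  qed
  have global: "bounded D \<or> R_E = \<infinity>" using cases by (auto simp: HK_B_def HK_U_def)
  interpret critical_green m D p h \<Phi> \<Psi> R_E d1 d2 \<alpha>1 \<alpha>2 \<alpha>3 \<alpha>4 \<beta> \<nu>
  proof unfold_locales
    show "H2_star D \<Phi> (1 + \<beta>) h" using assms(14,15) \<gamma> by simp
    show "H2_star_star D \<Phi> \<beta> h" using assms(17) by (simp add: \<beta>_def)
    show "\<alpha>2 * \<beta> < d1 \<or> (d1 = d2 \<and> d2 = \<alpha>1 * \<beta> \<and> \<alpha>1 * \<beta> = \<alpha>2 * \<beta>) \<or> d2 < \<alpha>1 * \<beta>"
      using assms(18) \<beta>(2) by (auto simp: \<beta>2 \<beta>_def[symmetric] min_def)
  qed (use assms(1-4,8,13) \<beta> bf hk large meas global laplace in auto)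
  \<comment> \<open>for an unbounded \<open>D\<close> the diameter has the default value 0, hence the maximum with 1\<close>
  obtain K0 where K0: "1 \<le> K0" "\<And>u. 0 < u \<Longrightarrow> ereal (1 / u) \<le> scale_diam \<Phi> D \<Longrightarrow>
      within_factor K0 (laplace_exponent \<nu> u) (u powr \<beta>)"
  proof -
    have l: "0 < max 1 (\<Phi> (diameter D))" by simp
    obtain K where "1 \<le> K" "\<forall>u>0. (bounded D \<longrightarrow> 1 / u \<le> max 1 (\<Phi> (diameter D))) \<longrightarrow>
        within_factor K (laplace_exponent \<nu> u) (u powr \<beta>)"
      using laplace[OF l] by blast
    thus thesis by (intro that[of K]) (auto simp: scale_diam_def)
  qed
  obtain \<kappa> K where reg: "\<And>(M :: 'w measure) S. driftless_subordinator M S \<nu> \<Longrightarrow>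
      regular_potential (potential_measure M S) \<beta> (scale_diam \<Phi> D) \<kappa> K"
    using potential_measure_regular[OF \<beta>(1) K0] by metis
  note regD = regular_potentialD[OF reg[OF S[OF x0(1)]]]
  obtain C where C: "1 \<le> C" and est: "\<And>U x y. regular_potential U \<beta> (scale_diam \<Phi> D) \<kappa> K \<Longrightarrow> x \<in> D \<Longrightarrow> y \<in> D \<Longrightarrow> x \<noteq> y \<Longrightarrow>
      0 \<le> g x y \<and> v x (\<Phi> (dist x y)) * \<Phi> (dist x y) powr \<beta> \<le> C * g x y \<and>
      (bdist_max D x y \<le> dist x y \<longrightarrow> g x y \<le> C * (v x (\<Phi> (dist x y)) * \<Phi> (dist x y) powr \<beta>)) \<and>
      ennreal (h (\<Phi> (dist x y)) x y * (jump_part x y + g x y) / C) \<le>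
        green_integral U x y \<and>
      green_integral U x y \<le>
        ennreal (C * (h (\<Phi> (dist x y)) x y * (jump_part x y + g x y)))"
    by (rule green_estimate[OF regD(3,4,5)]) blast
  define N where "N x y = jump_part x y + g x y" for x y
  define H where "H x y = h (\<Phi> (dist x y)) x y" for x y
  define G where "G x y = green_function P S p x y" for x y
  have G: "ennreal (H x y * N x y / C) \<le> G x y" "G x y \<le> ennreal (C * (H x y * N x y))"
    if "x \<in> D" "y \<in> D" "x \<noteq> y" for x y
    using est[OF reg[OF S[OF that(1)]] that] green_function_eq_potential[where P=P and S=S and p=p and x=x and y=y, OF S[OF that(1)] meas[OF that(1,2)]]
    by (auto simp: N_def H_def G_def)
  have H: "0 \<le> H x y" if "x \<in> D" "y \<in> D" "x \<noteq> y" for x y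
    using h_bounds[OF times(1)[OF that] that(1,2)] by (simp add: H_def)
  have jump: "jump_rate x y * \<Phi> (dist x y) powr (1 + \<beta>) =
      \<Phi> (dist x y) / \<Psi> (dist x y) * (\<Phi> (dist x y) powr (\<gamma> - 1) / vol m x (dist x y))"
    if "x \<in> D" "y \<in> D" "x \<noteq> y" for x y
    using times(1)[OF that] by (simp add: jump_rate_def \<gamma>(2) powr_add)
  have first: "\<exists>c1>0. \<exists>c2>0. \<forall>x\<in>D. \<forall>y\<in>D. x \<noteq> y \<longrightarrow>
      ennreal (c1 * (H x y * N x y)) \<le> G x y \<and> G x y \<le> ennreal (c2 * (H x y * N x y))"
  proof (rule exI[of _ "1 / C"], rule conjI)
    show "\<exists>c2>0. \<forall>x\<in>D. \<forall>y\<in>D. x \<noteq> y \<longrightarrow>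
        ennreal (1 / C * (H x y * N x y)) \<le> G x y \<and> G x y \<le> ennreal (c2 * (H x y * N x y))"
      using G C by (intro exI[of _ C]) auto
  qed (use C in simp)
  have second: "\<exists>c1>0. \<exists>c2>0. \<forall>x\<in>D. \<forall>y\<in>D. x \<noteq> y \<longrightarrow>
      ennreal (c1 * (H x y * g x y * log_ratio x y)) \<le> G x y \<and> G x y \<le> ennreal (c2 * (H x y * g x y * log_ratio x y))"
    if comparable: "\<exists>a>0. \<exists>b>0. \<forall>r>0. a * \<Phi> r \<le> \<Psi> r \<and> \<Psi> r \<le> b * \<Phi> r"
  proof -
    obtain a b where ab: "0 < a" "0 < b" "\<And>r. 0 < r \<Longrightarrow> a * \<Phi> r \<le> \<Psi> r \<and> \<Psi> r \<le> b * \<Phi> r"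
      using comparable by blast
    define A where "A = C / a + 1"
    define B where "B = max 2 (C * b)"
    have AB: "0 < A" "0 < B" using C ab by (auto simp: A_def B_def add_pos_pos)
    show ?thesis
    proof (rule exI[of _ "1 / (C * B)"], intro conjI, use C AB in simp, rule exI[of _ "C * A"], intro conjI, use C AB in simp, intro ballI impI)
      fix x y assume xy: "x \<in> D" "y \<in> D" "x \<noteq> y"
      note e = est[OF reg[OF S[OF xy(1)]] xy]
      have cmp: "N x y \<le> A * (g x y * log_ratio x y)" "g x y * log_ratio x y \<le> B * N x y"
        unfolding N_def A_def B_def using e by (auto intro!: comparable_scales[OF ab xy C])
      have "C * (H x y * N x y) \<le> C * (H x y * (A * (g x y * log_ratio x y)))"
        using cmp(1) H[OF xy] C by (intro mult_left_mono) auto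
      hence "G x y \<le> ennreal (C * A * (H x y * g x y * log_ratio x y))"
        using G(2)[OF xy] by (auto simp: ac_simps intro: order_trans ennreal_leI)
      moreover have "1 / (C * B) * (H x y * g x y * log_ratio x y) \<le> H x y * N x y / C"
      proof -
        have "H x y * (g x y * log_ratio x y) \<le> H x y * (B * N x y)"
          using cmp(2) H[OF xy] by (intro mult_left_mono) auto
        hence "H x y * (g x y * log_ratio x y) / (C * B) \<le> H x y * (B * N x y) / (C * B)"
          using C AB by (intro divide_right_mono) auto
        thus ?thesis using AB by (simp add: mult.assoc)
      qed
      ultimately show "ennreal (1 / (C * B) * (H x y * g x y * log_ratio x y)) \<le> G x y \<and>
          G x y \<le> ennreal (C * A * (H x y * g x y * log_ratio x y))"
        using G(1)[OF xy] by (meson ennreal_leI order_trans)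
    qed
  qed
  show ?thesis
  proof (intro conjI impI)
    show "\<exists>c1>0. \<exists>c2>0. \<forall>x\<in>D. \<forall>y\<in>D. x \<noteq> y \<longrightarrow>
            (let \<rho> = dist x y;
                 rhs = h (\<Phi> \<rho>) x y *
                   (\<Phi> \<rho> / \<Psi> \<rho> * (\<Phi> \<rho> powr (\<gamma> - 1) / vol m x \<rho>)
                      * ln (exp 1 + \<Phi> \<rho> / \<Phi> (bdist_max D x y))
                    + g0 m D \<Phi> \<nu> d1 d2 \<alpha>1 \<alpha>2 \<beta>1 \<beta>2 x y)
             in ennreal (c1 * rhs) \<le> green_function P S p x y \<and>
                green_function P S p x y \<le> ennreal (c2 * rhs))"
      using first unfolding Let_def by (simp add: H_def N_def G_def jump \<beta>2 \<beta>_def[symmetric])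
    assume "\<exists>a>0. \<exists>b>0. \<forall>r>0. a * \<Phi> r \<le> \<Psi> r \<and> \<Psi> r \<le> b * \<Phi> r"
    from second[OF this] show "\<exists>c1>0. \<exists>c2>0. \<forall>x\<in>D. \<forall>y\<in>D. x \<noteq> y \<longrightarrow>
            (let \<rho> = dist x y;
                 rhs = h (\<Phi> \<rho>) x y * g0 m D \<Phi> \<nu> d1 d2 \<alpha>1 \<alpha>2 \<beta>1 \<beta>2 x y
                   * ln (exp 1 + \<Phi> \<rho> / \<Phi> (bdist_max D x y))
             in ennreal (c1 * rhs) \<le> green_function P S p x y \<and>
                green_function P S p x y \<le> ennreal (c2 * rhs))"
      unfolding Let_def by (simp add: H_def G_def \<beta>2 \<beta>_def[symmetric])
  qed
qed

end
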